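(* Fix a smooth 3-dimensional manifold $N$ and consider (1) an open map $\iota\colon N\to\mathbb R^3_{\boldsymbol\mu}$ which is a local diffeomorphism, so that $\mu_1,\mu_2,\mu_3$ are local coordinates on $N$; (2) smooth functions $p\colon N\to(-1,1)$ and $W\colon N\to(0,+\infty)$ solving $$W_{11}+W_{22}+W_{33}+2(pW)_{23}=0,$$ such that the closed differential form $$\beta=(W_3+(pW)_2)\,d\mu_1\wedge d\mu_2-(W_2+(pW)_3)\,d\mu_1\wedge d\mu_3+W_1\,d\mu_2\wedge d\mu_3\in\Lambda^2(N,\mathbb R)$$ represents a class in $H^2(N,2\pi\mathbb Z)$; (3) a connection form $\eta$ with curvature $d\eta=\beta$ in the principal $S^1$-bundle $\pi\colon M\to N$ determined by $[\beta]$. Then the total space $M$ admits a nondegenerate generalized Kähler structure $(M,g,I,J)$ with $$g=Wh+W^{-1}\eta^2,\qquad h=(1-p^2)d\mu_1^2+d\mu_2^2+d\mu_3^2-2p\,d\mu_2d\mu_3,$$ and $I$, $J$ the unique almost complex structures such that the complex-valued 2-forms $$\Omega_I:=(-d\mu_1+\sqrt{-1}d\mu_2)\wedge(\eta+\sqrt{-1}W(d\mu_3-p\,d\mu_2)),$$ $$\Omega_J:=(-d\mu_1+\sqrt{-1}d\mu_3)\wedge(\eta+\sqrt{-1}W(-d\mu_2+p\,d\mu_3))$$ are holomorphic (of type $(2,0)$) with respect to $I$ and $J$ respectively. Conversely, any nondegenerate 4-dimensional generalized Kähler manifold $(M,g,I,J)$ with a free isometric tri-Hamiltonian $S^1$ action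 arises via this construction.
   Context: $\mathbb R^3_{\boldsymbol\mu}$ is $\mathbb R^3$ with distinguished coordinates $(\mu_1,\mu_2,\mu_3)$. Functions and forms on $\mathbb R^3_{\boldsymbol\mu}$ are pulled back to $N$ by $\iota$ (and to $M$ by $\pi$) without notation; a subscript $i$ on a function denotes $\partial/\partial\mu_i$. Generalized Kähler (GK) structure: $(M,g,I,J)$ with $g$ a Riemannian metric and $I,J$ integrable $g$-compatible almost complex structures such that, with $\omega_I=g(I\cdot,\cdot)$, $\omega_J=g(J\cdot,\cdot)$, $d^c_I=\sqrt{-1}(\bar\partial_I-\partial_I)$, $d^c_J=\sqrt{-1}(\bar\partial_J-\partial_J)$, one has $d^c_I\omega_I=-d^c_J\omega_J$ and $H:=-d^c_I\omega_I$ is closed. Its Poisson tensor is $\sigma=\tfrac12g^{-1}[I,J]$; the structure is nondegenerate if $\sigma$ is everywhere nondegenerate. In that case $\Omega:=\sigma^{-1}=2[I,J]^{-1}g$, i.e. $\Omega(u,v)=g((\tfrac12[I,J])^{-1}u,v)$, is symplectic, and $I\Omega:=\Omega(I\cdot,\cdot)$, $J\Omega:=\Omega(J\cdot,\cdot)$ are closed; $\Omega_I=\Omega-\sqrt{-1}I\Omega$, $\Omega_J=\Omega-\sqrt{-1}J\Omega$. The $S^1$ action (generated by a vector field $X$) is assumed to preserve $g,I,J$. It is tri-Hamiltonian if there are functions $\mu_1,\mu_2,\mu_3$ on $M$ with $d\mu_1=i_X\Omega$, $d\mu_2=i_XI\Omega$, $d\mu_3=i_XJ\Omega$. A connection form is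 an $S^1$-invariant 1-form $\eta$ with $\eta(X)=1$. *)

theory Defs
  imports "HOL-Analysis.Analysis"
begin

section \<open>Smooth manifolds\<close>

primrec Ck_on :: "nat \<Rightarrow> 'a::euclidean_space set \<Rightarrow> ('a \<Rightarrow> 'b::real_normed_vector) \<Rightarrow> bool"
where
  "Ck_on 0 S f \<longleftrightarrow> continuous_on S f"
| "Ck_on (Suc n) S f \<longleftrightarrow> (\<forall>x\<in>S. f differentiable (at x)) \<and>
     (\<forall>v. Ck_on n S (\<lambda>x. frechet_derivative f (at x) v))"

text \<open>Smoothness of a function on an open set \<open>S\<close>.\<close>

definition smooth_on :: "'a::euclidean_space set \<Rightarrow> ('a \<Rightarrow> 'b::real_normed_vector) \<Rightarrow> bool" where
  "smooth_on S f \<longleftrightarrow> (\<forall>n. Ck_on n S f)"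

text \<open>Points live in a carrier set (the topological space of an abstract topology), so that
  manifolds can be quantified existentially. The dimension is that of the model space \<open>'e\<close>;
  a chart is a domain together with a coordinate map. The atlas need not be maximal.\<close>

record ('a, 'e) manifold =
  mtop :: "'a topology"
  atlas :: "('a set \<times> ('a \<Rightarrow> 'e)) set"

definition points :: "('a, 'e) manifold \<Rightarrow> 'a set" where
  "points M = topspace (mtop M)"

definition smooth_manifold :: "('a, 'e::euclidean_space) manifold \<Rightarrow> bool" where
  "smooth_manifold M \<longleftrightarrow>
     Hausdorff_space (mtop M) \<and> second_countable (mtop M) \<and>
     \<Union> (fst ` atlas M) = points M \<and>
     (\<forall>(U, \<phi>)\<in>atlas M. openin (mtop M) U \<and> open (\<phi> ` U) \<and>
        homeomorphic_map (subtopology (mtop M) U) (top_of_set (\<phi> ` U)) \<phi>) \<and>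
     (\<forall>(U, \<phi>)\<in>atlas M. \<forall>(V, \<psi>)\<in>atlas M.
        smooth_on (\<phi> ` (U \<inter> V)) (\<psi> \<circ> inv_into U \<phi>))"

definition euclid :: "('e::euclidean_space, 'e) manifold" where
  "euclid = \<lparr>mtop = euclidean, atlas = {(UNIV, id)}\<rparr>"

definition open_sub :: "('a, 'e) manifold \<Rightarrow> 'a set \<Rightarrow> ('a, 'e) manifold" where
  "open_sub M U = \<lparr>mtop = subtopology (mtop M) U, atlas = (\<lambda>(V, \<phi>). (V \<inter> U, \<phi>)) ` atlas M\<rparr>"

definition prod_manifold ::
  "('a, 'e) manifold \<Rightarrow> ('b, 'f) manifold \<Rightarrow> ('a \<times> 'b, 'e \<times> 'f) manifold" where
  "prod_manifold M N = \<lparr>mtop = prod_topology (mtop M) (mtop N),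
     atlas = (\<lambda>((U, \<phi>), (V, \<psi>)). (U \<times> V, map_prod \<phi> \<psi>)) ` (atlas M \<times> atlas N)\<rparr>"

text \<open>The circle \<open>S\<^sup>1\<close> as the unit complex numbers, with the angular coordinates in
  \<open>(a, a + 2\<pi>)\<close> as charts.\<close>

definition circle :: "(complex, real) manifold" where
  "circle = \<lparr>mtop = top_of_set (sphere 0 1),
     atlas = range (\<lambda>a. (cis ` {a<..<a + 2 * pi}, inv_into {a<..<a + 2 * pi} cis))\<rparr>"

definition smooth_map ::
  "('a, 'e::euclidean_space) manifold \<Rightarrow> ('b, 'f::euclidean_space) manifold \<Rightarrow> ('a \<Rightarrow> 'b) \<Rightarrow> bool"
where
  "smooth_map M N f \<longleftrightarrow> continuous_map (mtop M) (mtop N) f \<and>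
     (\<forall>(U, \<phi>)\<in>atlas M. \<forall>(V, \<psi>)\<in>atlas N.
        smooth_on (\<phi> ` (U \<inter> f -` V)) (\<psi> \<circ> f \<circ> inv_into U \<phi>))"

definition diffeo ::
  "('a, 'e::euclidean_space) manifold \<Rightarrow> ('b, 'f::euclidean_space) manifold \<Rightarrow> ('a \<Rightarrow> 'b) \<Rightarrow> bool"
where
  "diffeo M N f \<longleftrightarrow> bij_betw f (points M) (points N) \<and>
     smooth_map M N f \<and> smooth_map N M (inv_into (points M) f)"

definition local_diffeo ::
  "('a, 'e::euclidean_space) manifold \<Rightarrow> ('b, 'f::euclidean_space) manifold \<Rightarrow> ('a \<Rightarrow> 'b) \<Rightarrow> bool"
where
  "local_diffeo M N f \<longleftrightarrow> (\<forall>x\<in>points M. \<exists>U. openin (mtop M) U \<and> x \<in> U \<and>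
     openin (mtop N) (f ` U) \<and> diffeo (open_sub M U) (open_sub N (f ` U)) f)"


section \<open>Tangent vectors and tensor fields\<close>

text \<open>Each point gets a preferred chart from the atlas, and the tangent space at \<open>x\<close> is the model
  space \<open>'e\<close>, its elements being read as components in the preferred chart at \<open>x\<close>.\<close>

definition chart_at :: "('a, 'e) manifold \<Rightarrow> 'a \<Rightarrow> 'a set \<times> ('a \<Rightarrow> 'e)" where
  "chart_at M x = (SOME c. c \<in> atlas M \<and> x \<in> fst c)"

definition tan_map ::
  "('a, 'e::euclidean_space) manifold \<Rightarrow> ('b, 'f::euclidean_space) manifold \<Rightarrow> ('a \<Rightarrow> 'b) \<Rightarrow>
   'a \<Rightarrow> 'e \<Rightarrow> 'f" where
  "tan_map M N f x =
     (case chart_at M x of (U, \<phi>) \<Rightarrow> case chart_at N (f x) of (V, \<psi>) \<Rightarrow>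
        frechet_derivative (\<psi> \<circ> f \<circ> inv_into U \<phi>) (at (\<phi> x)))"

text \<open>A covariant \<open>k\<close>-tensor takes its \<open>k\<close> tangent vectors as a list; its values on lists of other
  lengths and at points outside the manifold are irrelevant.\<close>

type_synonym ('a, 'e, 'v) tensor = "'a \<Rightarrow> 'e list \<Rightarrow> 'v"

definition pullback ::
  "('a, 'e::euclidean_space) manifold \<Rightarrow> ('b, 'f::euclidean_space) manifold \<Rightarrow> ('a \<Rightarrow> 'b) \<Rightarrow>
   ('b, 'f, 'v) tensor \<Rightarrow> ('a, 'e, 'v) tensor" where
  "pullback M N f \<alpha> x vs = \<alpha> (f x) (map (tan_map M N f x) vs)"

definition coord_rep ::
  "('a, 'e::euclidean_space) manifold \<Rightarrow> 'a set \<times> ('a \<Rightarrow> 'e) \<Rightarrow> ('a, 'e, 'v) tensor \<Rightarrow>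
   ('e, 'e, 'v) tensor" where
  "coord_rep M c \<alpha> = pullback euclid M (inv_into (fst c) (snd c)) \<alpha>"

definition smooth_tensor_on ::
  "('a, 'e::euclidean_space) manifold \<Rightarrow> 'a set \<Rightarrow> nat \<Rightarrow> ('a, 'e, 'v::real_normed_vector) tensor \<Rightarrow>
   bool" where
  "smooth_tensor_on M U k \<alpha> \<longleftrightarrow>
     (\<forall>x\<in>U. \<forall>vs. length vs = k \<longrightarrow> (\<forall>i<k. linear (\<lambda>v. \<alpha> x (vs[i := v])))) \<and>
     (\<forall>(V, \<phi>)\<in>atlas M. \<forall>vs. length vs = k \<longrightarrow>
        smooth_on (\<phi> ` (V \<inter> U)) (\<lambda>y. coord_rep M (V, \<phi>) \<alpha> y vs))"

definition smooth_form_on ::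
  "('a, 'e::euclidean_space) manifold \<Rightarrow> 'a set \<Rightarrow> nat \<Rightarrow> ('a, 'e, 'v::real_normed_vector) tensor \<Rightarrow>
   bool" where
  "smooth_form_on M U k \<alpha> \<longleftrightarrow> smooth_tensor_on M U k \<alpha> \<and>
     (\<forall>x\<in>U. \<forall>vs. length vs = k \<longrightarrow> \<not> distinct vs \<longrightarrow> \<alpha> x vs = 0)"

definition tensor_eq_on ::
  "'a set \<Rightarrow> nat \<Rightarrow> ('a, 'e, 'v) tensor \<Rightarrow> ('a, 'e, 'v) tensor \<Rightarrow> bool" where
  "tensor_eq_on U k \<alpha> \<beta> \<longleftrightarrow> (\<forall>x\<in>U. \<forall>vs. length vs = k \<longrightarrow> \<alpha> x vs = \<beta> x vs)"

text \<open>The exterior derivative, without normalising factor: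
  \<open>d\<alpha>(v\<^sub>0,\<dots>,v\<^sub>k) = \<Sum>\<^sub>i (-1)\<^sup>i \<partial>\<^sub>v\<^sub>i \<alpha>(v\<^sub>0,\<dots>,omit v\<^sub>i,\<dots>,v\<^sub>k)\<close> for constant vector fields in
  coordinates. In the preferred chart at \<open>x\<close> tangent vectors at \<open>x\<close> are their own components.\<close>

definition flat_d :: "('e::euclidean_space, 'e, 'v::real_normed_vector) tensor \<Rightarrow> ('e, 'e, 'v) tensor"
where
  "flat_d \<omega> y vs = (\<Sum>i<length vs. (-1) ^ i *\<^sub>R
     frechet_derivative (\<lambda>z. \<omega> z (take i vs @ drop (Suc i) vs)) (at y) (vs ! i))"

definition ext_d ::
  "('a, 'e::euclidean_space) manifold \<Rightarrow> ('a, 'e, 'v::real_normed_vector) tensor \<Rightarrow>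
   ('a, 'e, 'v) tensor" where
  "ext_d M \<alpha> x vs = flat_d (coord_rep M (chart_at M x) \<alpha>) (snd (chart_at M x) x) vs"

definition fun_d ::
  "('a, 'e::euclidean_space) manifold \<Rightarrow> ('a \<Rightarrow> 'v::real_normed_vector) \<Rightarrow> ('a, 'e, 'v) tensor" where
  "fun_d M f = ext_d M (\<lambda>x _. f x)"

text \<open>The wedge product of two 1-forms.\<close>

definition wedge ::
  "('a, 'e, 'v::real_normed_field) tensor \<Rightarrow> ('a, 'e, 'v) tensor \<Rightarrow> ('a, 'e, 'v) tensor" where
  "wedge \<alpha> \<beta> x vs = \<alpha> x [vs ! 0] * \<beta> x [vs ! 1] - \<alpha> x [vs ! 1] * \<beta> x [vs ! 0]"

definition riemannian_metric ::
  "('a, 'e::euclidean_space) manifold \<Rightarrow> ('a, 'e, real) tensor \<Rightarrow> bool" where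
  "riemannian_metric M g \<longleftrightarrow> smooth_tensor_on M (points M) 2 g \<and>
     (\<forall>x\<in>points M. (\<forall>u v. g x [u, v] = g x [v, u]) \<and> (\<forall>v. v \<noteq> 0 \<longrightarrow> g x [v, v] > 0))"


section \<open>Almost complex structures\<close>

type_synonym ('a, 'e) endo = "'a \<Rightarrow> 'e \<Rightarrow> 'e"

definition coord_endo ::
  "('a, 'e::euclidean_space) manifold \<Rightarrow> 'a set \<times> ('a \<Rightarrow> 'e) \<Rightarrow> ('a, 'e) endo \<Rightarrow> ('e, 'e) endo" where
  "coord_endo M c A y v =
     (let x = inv_into (fst c) (snd c) y in
      tan_map M euclid (snd c) x (A x (tan_map euclid M (inv_into (fst c) (snd c)) y v)))"

definition almost_complex_structure ::
  "('a, 'e::euclidean_space) manifold \<Rightarrow> ('a, 'e) endo \<Rightarrow> bool" where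
  "almost_complex_structure M I \<longleftrightarrow>
     (\<forall>x\<in>points M. linear (I x) \<and> (\<forall>v. I x (I x v) = - v)) \<and>
     (\<forall>(U, \<phi>)\<in>atlas M. \<forall>v. smooth_on (\<phi> ` U) (\<lambda>y. coord_endo M (U, \<phi>) I y v))"

definition flat_bracket :: "('e::euclidean_space \<Rightarrow> 'e) \<Rightarrow> ('e \<Rightarrow> 'e) \<Rightarrow> 'e \<Rightarrow> 'e" where
  "flat_bracket X Y y =
     frechet_derivative Y (at y) (X y) - frechet_derivative X (at y) (Y y)"

text \<open>The Nijenhuis tensor \<open>N(u,v) = [Iu,Iv] - I[Iu,v] - I[u,Iv] - [u,v]\<close>, with \<open>u\<close>, \<open>v\<close> extended to
  constant vector fields in the preferred chart; it is a tensor, so the extension does not matter.\<close>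

definition nijenhuis ::
  "('a, 'e::euclidean_space) manifold \<Rightarrow> ('a, 'e) endo \<Rightarrow> 'a \<Rightarrow> 'e \<Rightarrow> 'e \<Rightarrow> 'e" where
  "nijenhuis M I x u v =
     (let y = snd (chart_at M x) x;
          A = coord_endo M (chart_at M x) I;
          U = (\<lambda>_. u); V = (\<lambda>_. v); IU = (\<lambda>z. A z u); IV = (\<lambda>z. A z v)
      in flat_bracket IU IV y - A y (flat_bracket IU V y) - A y (flat_bracket U IV y)
         - flat_bracket U V y)"

definition integrable_acs ::
  "('a, 'e::euclidean_space) manifold \<Rightarrow> ('a, 'e) endo \<Rightarrow> bool" where
  "integrable_acs M I \<longleftrightarrow> almost_complex_structure M I \<and>
     (\<forall>x\<in>points M. \<forall>u v. nijenhuis M I x u v = 0)"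

definition complexify :: "('a, 'e, real) tensor \<Rightarrow> ('a, 'e, complex) tensor" where
  "complexify \<alpha> x vs = complex_of_real (\<alpha> x vs)"

text \<open>The \<open>(p,q)\<close>-part of a complex-valued \<open>(p+q)\<close>-form: the sum over all ways of projecting \<open>p\<close>
  slots (those in \<open>S\<close>) by \<open>(1 - iI)/2\<close> and the remaining \<open>q\<close> slots by \<open>(1 + iI)/2\<close>, where the
  complex multilinear extension has been expanded over the set \<open>T\<close> of slots receiving an \<open>I\<close>.\<close>

definition type_part ::
  "('a, 'e) endo \<Rightarrow> nat \<Rightarrow> nat \<Rightarrow> ('a, 'e, complex) tensor \<Rightarrow> ('a, 'e, complex) tensor" where
  "type_part I p q \<alpha> x vs =
     (\<Sum>S | S \<subseteq> {..<p + q} \<and> card S = p. \<Sum>T\<in>Pow {..<p + q}.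
        (\<Prod>j\<in>T. if j \<in> S then - \<i> else \<i>) / 2 ^ (p + q) *
        \<alpha> x (map (\<lambda>j. if j \<in> T then I x (vs ! j) else vs ! j) [0..<p + q]))"

definition of_type ::
  "('a, 'e::euclidean_space) manifold \<Rightarrow> ('a, 'e) endo \<Rightarrow> nat \<Rightarrow> nat \<Rightarrow>
   ('a, 'e, complex) tensor \<Rightarrow> bool" where
  "of_type M I p q \<alpha> \<longleftrightarrow> tensor_eq_on (points M) (p + q) (type_part I p q \<alpha>) \<alpha>"

definition del ::
  "('a, 'e::euclidean_space) manifold \<Rightarrow> ('a, 'e) endo \<Rightarrow> nat \<Rightarrow>
   ('a, 'e, complex) tensor \<Rightarrow> ('a, 'e, complex) tensor" where
  "del M I k \<alpha> x vs =
     (\<Sum>p\<le>k. type_part I (p + 1) (k - p) (ext_d M (type_part I p (k - p) \<alpha>)) x vs)"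

definition delbar ::
  "('a, 'e::euclidean_space) manifold \<Rightarrow> ('a, 'e) endo \<Rightarrow> nat \<Rightarrow>
   ('a, 'e, complex) tensor \<Rightarrow> ('a, 'e, complex) tensor" where
  "delbar M I k \<alpha> x vs =
     (\<Sum>p\<le>k. type_part I p (k - p + 1) (ext_d M (type_part I p (k - p) \<alpha>)) x vs)"

text \<open>\<open>d\<^sup>c = i(\<partial>bar - \<partial>)\<close> on \<open>k\<close>-forms.\<close>

definition dc ::
  "('a, 'e::euclidean_space) manifold \<Rightarrow> ('a, 'e) endo \<Rightarrow> nat \<Rightarrow>
   ('a, 'e, complex) tensor \<Rightarrow> ('a, 'e, complex) tensor" where
  "dc M I k \<alpha> x vs = \<i> * (delbar M I k \<alpha> x vs - del M I k \<alpha> x vs)"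

definition holomorphic_form ::
  "('a, 'e::euclidean_space) manifold \<Rightarrow> ('a, 'e) endo \<Rightarrow> nat \<Rightarrow> ('a, 'e, complex) tensor \<Rightarrow> bool"
where
  "holomorphic_form M I p \<alpha> \<longleftrightarrow> smooth_form_on M (points M) p \<alpha> \<and> of_type M I p 0 \<alpha> \<and>
     tensor_eq_on (points M) (p + 1) (delbar M I p \<alpha>) (\<lambda>_ _. 0)"

text \<open>\<open>I\<close> is the unique (on the points of \<open>M\<close>) almost complex structure for which \<open>\<Omega>\<close> is a
  holomorphic 2-form.\<close>

definition determined_acs ::
  "('a, 'e::euclidean_space) manifold \<Rightarrow> ('a, 'e, complex) tensor \<Rightarrow> ('a, 'e) endo \<Rightarrow> bool" where
  "determined_acs M \<Omega> I \<longleftrightarrow>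
     almost_complex_structure M I \<and> holomorphic_form M I 2 \<Omega> \<and>
     (\<forall>I'. almost_complex_structure M I' \<and> holomorphic_form M I' 2 \<Omega> \<longrightarrow>
        (\<forall>x\<in>points M. I' x = I x))"


section \<open>Generalized Kaehler structures\<close>

definition fundamental_form ::
  "('a, 'e, real) tensor \<Rightarrow> ('a, 'e) endo \<Rightarrow> ('a, 'e, real) tensor" where
  "fundamental_form g I x vs = g x [I x (vs ! 0), vs ! 1]"

definition compatible_acs ::
  "('a, 'e::euclidean_space) manifold \<Rightarrow> ('a, 'e, real) tensor \<Rightarrow> ('a, 'e) endo \<Rightarrow> bool" where
  "compatible_acs M g I \<longleftrightarrow> (\<forall>x\<in>points M. \<forall>u v. g x [I x u, I x v] = g x [u, v])"

definition gk_H ::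
  "('a, 'e::euclidean_space) manifold \<Rightarrow> ('a, 'e, real) tensor \<Rightarrow> ('a, 'e) endo \<Rightarrow>
   ('a, 'e, complex) tensor" where
  "gk_H M g I x vs = - dc M I 2 (complexify (fundamental_form g I)) x vs"

definition generalized_kaehler ::
  "('a, 'e::euclidean_space) manifold \<Rightarrow> ('a, 'e, real) tensor \<Rightarrow> ('a, 'e) endo \<Rightarrow> ('a, 'e) endo \<Rightarrow>
   bool" where
  "generalized_kaehler M g I J \<longleftrightarrow>
     smooth_manifold M \<and> riemannian_metric M g \<and>
     integrable_acs M I \<and> compatible_acs M g I \<and>
     integrable_acs M J \<and> compatible_acs M g J \<and>
     tensor_eq_on (points M) 3
       (dc M I 2 (complexify (fundamental_form g I)))
       (\<lambda>x vs. - dc M J 2 (complexify (fundamental_form g J)) x vs) \<and>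
     tensor_eq_on (points M) 4 (ext_d M (gk_H M g I)) (\<lambda>_ _. 0)"

definition half_commutator :: "('a, 'e::real_vector) endo \<Rightarrow> ('a, 'e) endo \<Rightarrow> ('a, 'e) endo" where
  "half_commutator I J x v = (1 / 2) *\<^sub>R (I x (J x v) - J x (I x v))"

text \<open>Covectors at \<open>x\<close> are linear functionals on \<open>'e\<close>; \<open>sharp\<close> is the map \<open>g\<^sup>-\<^sup>1\<close> from covectors to
  vectors. The Poisson tensor is taken as a map from covectors to vectors, with the convention for
  which \<open>\<sigma>\<^sup>-\<^sup>1\<close> is \<open>gk_Omega\<close> below, i.e. the map \<open>u \<mapsto> \<Omega>(u, -)\<close>.\<close>

definition sharp :: "('a, 'e, real) tensor \<Rightarrow> 'a \<Rightarrow> ('e \<Rightarrow> real) \<Rightarrow> 'e" where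
  "sharp g x \<xi> = (THE w. \<forall>v. g x [w, v] = \<xi> v)"

definition poisson ::
  "('a, 'e::real_vector, real) tensor \<Rightarrow> ('a, 'e) endo \<Rightarrow> ('a, 'e) endo \<Rightarrow> 'a \<Rightarrow> ('e \<Rightarrow> real) \<Rightarrow> 'e"
where
  "poisson g I J x \<xi> = half_commutator I J x (sharp g x \<xi>)"

definition nondegenerate_gk ::
  "('a, 'e::euclidean_space) manifold \<Rightarrow> ('a, 'e, real) tensor \<Rightarrow> ('a, 'e) endo \<Rightarrow> ('a, 'e) endo \<Rightarrow>
   bool" where
  "nondegenerate_gk M g I J \<longleftrightarrow> generalized_kaehler M g I J \<and>
     (\<forall>x\<in>points M. \<forall>\<xi>. linear \<xi> \<and> (\<forall>\<zeta>::'e \<Rightarrow> real. linear \<zeta> \<longrightarrow> \<zeta> (poisson g I J x \<xi>) = 0) \<longrightarrow>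
        \<xi> = (\<lambda>_. 0))"

text \<open>\<open>\<Omega>(u,v) = g(([I,J]/2)\<^sup>-\<^sup>1 u, v)\<close>, for a nondegenerate structure.\<close>

definition gk_Omega ::
  "('a, 'e::real_vector, real) tensor \<Rightarrow> ('a, 'e) endo \<Rightarrow> ('a, 'e) endo \<Rightarrow> ('a, 'e, real) tensor"
where
  "gk_Omega g I J x vs = g x [inv (half_commutator I J x) (vs ! 0), vs ! 1]"


section \<open>Circle actions, principal bundles and connections\<close>

definition circle_action ::
  "('a, 'e::euclidean_space) manifold \<Rightarrow> (complex \<Rightarrow> 'a \<Rightarrow> 'a) \<Rightarrow> bool" where
  "circle_action M \<rho> \<longleftrightarrow>
     smooth_map (prod_manifold circle M) M (\<lambda>(z, x). \<rho> z x) \<and>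
     (\<forall>x\<in>points M. \<rho> 1 x = x \<and>
        (\<forall>z\<in>points circle. \<forall>w\<in>points circle. \<rho> (z * w) x = \<rho> z (\<rho> w x)))"

definition free_action ::
  "('a, 'e) manifold \<Rightarrow> (complex \<Rightarrow> 'a \<Rightarrow> 'a) \<Rightarrow> bool" where
  "free_action M \<rho> \<longleftrightarrow> (\<forall>x\<in>points M. \<forall>z\<in>points circle. \<rho> z x = x \<longrightarrow> z = 1)"

text \<open>The generating vector field; \<open>S\<^sup>1\<close> is parametrised with period \<open>2\<pi>\<close>.\<close>

definition generator ::
  "('a, 'e::euclidean_space) manifold \<Rightarrow> (complex \<Rightarrow> 'a \<Rightarrow> 'a) \<Rightarrow> 'a \<Rightarrow> 'e" where
  "generator M \<rho> x = tan_map (euclid :: (real, real) manifold) M (\<lambda>\<theta>. \<rho> (cis \<theta>) x) 0 1"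

definition preserves_tensor ::
  "('a, 'e::euclidean_space) manifold \<Rightarrow> (complex \<Rightarrow> 'a \<Rightarrow> 'a) \<Rightarrow> nat \<Rightarrow> ('a, 'e, 'v) tensor \<Rightarrow> bool"
where
  "preserves_tensor M \<rho> k \<alpha> \<longleftrightarrow>
     (\<forall>z\<in>points circle. tensor_eq_on (points M) k (pullback M M (\<rho> z) \<alpha>) \<alpha>)"

definition preserves_endo ::
  "('a, 'e::euclidean_space) manifold \<Rightarrow> (complex \<Rightarrow> 'a \<Rightarrow> 'a) \<Rightarrow> ('a, 'e) endo \<Rightarrow> bool" where
  "preserves_endo M \<rho> A \<longleftrightarrow>
     (\<forall>z\<in>points circle. \<forall>x\<in>points M. \<forall>v.
        tan_map M M (\<rho> z) x (A x v) = A (\<rho> z x) (tan_map M M (\<rho> z) x v))"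

text \<open>The three functions of a tri-Hamiltonian action are the components of one map to
  \<open>\<real>\<^sup>3\<close>.\<close>

definition tri_hamiltonian ::
  "('a, 'e::euclidean_space) manifold \<Rightarrow> ('a, 'e, real) tensor \<Rightarrow> ('a, 'e) endo \<Rightarrow> ('a, 'e) endo \<Rightarrow>
   (complex \<Rightarrow> 'a \<Rightarrow> 'a) \<Rightarrow> ('a \<Rightarrow> real^3) \<Rightarrow> bool" where
  "tri_hamiltonian M g I J \<rho> \<mu> \<longleftrightarrow> smooth_map M euclid \<mu> \<and>
     (\<forall>x\<in>points M. \<forall>v.
        fun_d M (\<lambda>x. \<mu> x $ 1) x [v] = gk_Omega g I J x [generator M \<rho> x, v] \<and>
        fun_d M (\<lambda>x. \<mu> x $ 2) x [v] = gk_Omega g I J x [I x (generator M \<rho> x), v] \<and>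
        fun_d M (\<lambda>x. \<mu> x $ 3) x [v] = gk_Omega g I J x [J x (generator M \<rho> x), v])"

definition principal_circle_bundle ::
  "('n, 'f::euclidean_space) manifold \<Rightarrow> ('m, 'e::euclidean_space) manifold \<Rightarrow>
   (complex \<Rightarrow> 'm \<Rightarrow> 'm) \<Rightarrow> ('m \<Rightarrow> 'n) \<Rightarrow> bool" where
  "principal_circle_bundle N M \<rho> \<pi> \<longleftrightarrow>
     smooth_manifold N \<and> smooth_manifold M \<and> circle_action M \<rho> \<and> smooth_map M N \<pi> \<and>
     (\<forall>b\<in>points N. \<exists>U \<tau>. openin (mtop N) U \<and> b \<in> U \<and>
        (let P = {m \<in> points M. \<pi> m \<in> U} in
          diffeo (open_sub M P) (prod_manifold (open_sub N U) circle) (\<lambda>m. (\<pi> m, \<tau> m)) \<and>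
          (\<forall>m\<in>P. \<forall>z\<in>points circle. \<pi> (\<rho> z m) = \<pi> m \<and> \<tau> (\<rho> z m) = z * \<tau> m)))"

definition connection_form ::
  "('m, 'e::euclidean_space) manifold \<Rightarrow> (complex \<Rightarrow> 'm \<Rightarrow> 'm) \<Rightarrow> ('m, 'e, real) tensor \<Rightarrow> bool" where
  "connection_form M \<rho> \<eta> \<longleftrightarrow> smooth_form_on M (points M) 1 \<eta> \<and> preserves_tensor M \<rho> 1 \<eta> \<and>
     (\<forall>x\<in>points M. \<eta> x [generator M \<rho> x] = 1)"

text \<open>The closed 2-form \<open>\<beta>\<close> represents a class in (the image in de Rham cohomology of)
  \<open>H\<^sup>2(N, 2\<pi>\<int>)\<close>: it corresponds under the Cech-de Rham isomorphism to a Cech 2-cocycle of the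
  constant sheaf \<open>2\<pi>\<int>\<close> on some open cover. The cochain \<open>c\<close> below is automatically a cocycle, and
  locally constant because it is continuous and takes discrete values.\<close>

definition represents_2pi_int_class ::
  "('n, 'f::euclidean_space) manifold \<Rightarrow> ('n, 'f, real) tensor \<Rightarrow> bool" where
  "represents_2pi_int_class N \<beta> \<longleftrightarrow>
     (\<exists>(\<U> :: 'n set set) (A :: 'n set \<Rightarrow> ('n, 'f, real) tensor)
        (f :: 'n set \<Rightarrow> 'n set \<Rightarrow> 'n \<Rightarrow> real).
        (\<forall>U\<in>\<U>. openin (mtop N) U) \<and> \<Union>\<U> = points N \<and>
        (\<forall>U\<in>\<U>. smooth_form_on N U 1 (A U) \<and> tensor_eq_on U 2 (ext_d N (A U)) \<beta>) \<and>
        (\<forall>U\<in>\<U>. \<forall>V\<in>\<U>. smooth_map (open_sub N (U \<inter> V)) euclid (f U V) \<and>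
           tensor_eq_on (U \<inter> V) 1 (fun_d N (f U V)) (\<lambda>x vs. A V x vs - A U x vs)) \<and>
        (\<forall>U\<in>\<U>. \<forall>V\<in>\<U>. \<forall>W\<in>\<U>. \<forall>x\<in>U \<inter> V \<inter> W.
           let c = f V W x - f U W x + f U V x in \<exists>n::int. c = 2 * pi * of_int n))"


section \<open>The construction\<close>

text \<open>\<open>\<partial>f/\<partial>\<mu>\<^sub>i\<close> in the local coordinates given by a local diffeomorphism \<open>\<iota>\<close> to \<open>\<real>\<^sup>3\<close>.\<close>

definition mu_partial ::
  "('n, real^3) manifold \<Rightarrow> ('n \<Rightarrow> real^3) \<Rightarrow> 3 \<Rightarrow> ('n \<Rightarrow> real) \<Rightarrow> 'n \<Rightarrow> real" where
  "mu_partial N \<iota> i f x = fun_d N f x [inv (tan_map N euclid \<iota> x) (axis i 1)]"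

definition curvature_beta ::
  "('n, real^3) manifold \<Rightarrow> ('n \<Rightarrow> real^3) \<Rightarrow> ('n \<Rightarrow> real) \<Rightarrow> ('n \<Rightarrow> real) \<Rightarrow> ('n, real^3, real) tensor"
where
  "curvature_beta N \<iota> p W x vs =
     (let D = mu_partial N \<iota>; pW = (\<lambda>y. p y * W y); d\<mu> = (\<lambda>i. fun_d N (\<lambda>y. \<iota> y $ i)) in
        (D 3 W x + D 2 pW x) * wedge (d\<mu> 1) (d\<mu> 2) x vs
      - (D 2 W x + D 3 pW x) * wedge (d\<mu> 1) (d\<mu> 3) x vs
      + D 1 W x * wedge (d\<mu> 2) (d\<mu> 3) x vs)"

definition construction_data ::
  "('n, real^3) manifold \<Rightarrow> ('n \<Rightarrow> real^3) \<Rightarrow> ('n \<Rightarrow> real) \<Rightarrow> ('n \<Rightarrow> real) \<Rightarrow>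
   ('m, real^4) manifold \<Rightarrow> (complex \<Rightarrow> 'm \<Rightarrow> 'm) \<Rightarrow> ('m \<Rightarrow> 'n) \<Rightarrow> ('m, real^4, real) tensor \<Rightarrow> bool"
where
  "construction_data N \<iota> p W M \<rho> \<pi> \<eta> \<longleftrightarrow>
     smooth_manifold N \<and>
     open_map (mtop N) euclidean \<iota> \<and> local_diffeo N euclid \<iota> \<and>
     smooth_map N euclid p \<and> smooth_map N euclid W \<and>
     (\<forall>x\<in>points N. -1 < p x \<and> p x < 1 \<and> 0 < W x) \<and>
     (\<forall>x\<in>points N. let D = mu_partial N \<iota> in
        D 1 (D 1 W) x + D 2 (D 2 W) x + D 3 (D 3 W) x + 2 * D 3 (D 2 (\<lambda>y. p y * W y)) x = 0) \<and>
     represents_2pi_int_class N (curvature_beta N \<iota> p W) \<and>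
     principal_circle_bundle N M \<rho> \<pi> \<and>
     connection_form M \<rho> \<eta> \<and>
     tensor_eq_on (points M) 2 (ext_d M \<eta>) (pullback M N \<pi> (curvature_beta N \<iota> p W))"

text \<open>In the following, \<open>\<mu>\<close>, \<open>p\<close> and \<open>W\<close> are functions on the total space.\<close>

definition constructed_metric ::
  "('m, real^4) manifold \<Rightarrow> ('m \<Rightarrow> real^3) \<Rightarrow> ('m \<Rightarrow> real) \<Rightarrow> ('m \<Rightarrow> real) \<Rightarrow>
   ('m, real^4, real) tensor \<Rightarrow> ('m, real^4, real) tensor" where
  "constructed_metric M \<mu> p W \<eta> x vs =
     (let d\<mu> = (\<lambda>i v. fun_d M (\<lambda>y. \<mu> y $ i) x [v]); u = vs ! 0; v = vs ! 1;
          h = (1 - (p x)\<^sup>2) * (d\<mu> 1 u * d\<mu> 1 v) + d\<mu> 2 u * d\<mu> 2 v + d\<mu> 3 u * d\<mu> 3 v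
              - p x * (d\<mu> 2 u * d\<mu> 3 v + d\<mu> 3 u * d\<mu> 2 v)
      in W x * h + inverse (W x) * (\<eta> x [u] * \<eta> x [v]))"

definition constructed_Omega_I ::
  "('m, real^4) manifold \<Rightarrow> ('m \<Rightarrow> real^3) \<Rightarrow> ('m \<Rightarrow> real) \<Rightarrow> ('m \<Rightarrow> real) \<Rightarrow>
   ('m, real^4, real) tensor \<Rightarrow> ('m, real^4, complex) tensor" where
  "constructed_Omega_I M \<mu> p W \<eta> =
     (let d\<mu> = (\<lambda>i. complexify (fun_d M (\<lambda>y. \<mu> y $ i))) in
      wedge (\<lambda>x vs. - d\<mu> 1 x vs + \<i> * d\<mu> 2 x vs)
        (\<lambda>x vs. complexify \<eta> x vs
           + \<i> * of_real (W x) * (d\<mu> 3 x vs - of_real (p x) * d\<mu> 2 x vs)))"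

definition constructed_Omega_J ::
  "('m, real^4) manifold \<Rightarrow> ('m \<Rightarrow> real^3) \<Rightarrow> ('m \<Rightarrow> real) \<Rightarrow> ('m \<Rightarrow> real) \<Rightarrow>
   ('m, real^4, real) tensor \<Rightarrow> ('m, real^4, complex) tensor" where
  "constructed_Omega_J M \<mu> p W \<eta> =
     (let d\<mu> = (\<lambda>i. complexify (fun_d M (\<lambda>y. \<mu> y $ i))) in
      wedge (\<lambda>x vs. - d\<mu> 1 x vs + \<i> * d\<mu> 3 x vs)
        (\<lambda>x vs. complexify \<eta> x vs
           + \<i> * of_real (W x) * (- d\<mu> 2 x vs + of_real (p x) * d\<mu> 3 x vs)))"

definition constructed_structure ::
  "('n \<Rightarrow> real^3) \<Rightarrow> ('n \<Rightarrow> real) \<Rightarrow> ('n \<Rightarrow> real) \<Rightarrow>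
   ('m, real^4) manifold \<Rightarrow> ('m \<Rightarrow> 'n) \<Rightarrow> ('m, real^4, real) tensor \<Rightarrow>
   ('m, real^4, real) tensor \<Rightarrow> ('m, real^4) endo \<Rightarrow> ('m, real^4) endo \<Rightarrow> bool" where
  "constructed_structure \<iota> p W M \<pi> \<eta> g I J \<longleftrightarrow>
     tensor_eq_on (points M) 2 g (constructed_metric M (\<iota> \<circ> \<pi>) (p \<circ> \<pi>) (W \<circ> \<pi>) \<eta>) \<and>
     determined_acs M (constructed_Omega_I M (\<iota> \<circ> \<pi>) (p \<circ> \<pi>) (W \<circ> \<pi>) \<eta>) I \<and>
     determined_acs M (constructed_Omega_J M (\<iota> \<circ> \<pi>) (p \<circ> \<pi>) (W \<circ> \<pi>) \<eta>) J"

end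

theory Submission
  imports Defs
begin

text \<open>All forms are expressed in the coframe \<open>d\<mu>\<^sub>1, d\<mu>\<^sub>2, d\<mu>\<^sub>3, \<eta>\<close>. The structure \<open>I\<close> is given by
  \<open>d\<mu>\<^sub>1 \<circ> I = d\<mu>\<^sub>2\<close> and \<open>\<eta> \<circ> I = - W (d\<mu>\<^sub>3 - p d\<mu>\<^sub>2)\<close>, and \<open>J\<close> arises from it by exchanging \<open>\<mu>\<^sub>2\<close> with
  \<open>\<mu>\<^sub>3\<close> and changing the sign of \<open>\<eta>\<close>. The formula for \<open>d\<eta> = \<beta>\<close> makes \<open>I\<close> and \<open>J\<close> integrable, and
  \<open>d\<^sup>c \<omega>\<^sub>I\<close> becomes an explicit closed 3-form which changes sign under the exchange.

  Conversely, the triple \<open>\<mu>\<close> is an invariant submersion, so the orbit space is a manifold with \<open>\<mu>\<close> as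
  local coordinates. Setting \<open>W = 1 / g(X, X)\<close>, \<open>\<eta> = W g(X, -)\<close> and \<open>I J + J I = - 2 p\<close>, linear algebra in the
  frame \<open>X, I X, J X, [I, J] X\<close> gives the formulas for \<open>g\<close>, \<open>I\<close> and \<open>J\<close>, and the vanishing Nijenhuis tensors
  of \<open>I\<close> and \<open>J\<close>, evaluated on \<open>X\<close>, give \<open>d\<eta> = \<beta>\<close>. The equation for \<open>W\<close> is \<open>d\<beta> = 0\<close>, and \<open>\<beta>\<close> is
  integral because the transition functions of the bundle have well-defined angles modulo \<open>2 \<pi>\<close>.\<close>

section \<open>Calculus of smooth functions\<close>

text \<open>The factors of \<open>Omega\<close> explain the formulas for \<open>I\<close>: with
  \<open>\<xi> = W (d\<mu>3 - p d\<mu>2)\<close>, both \<open>- d\<mu>1 + i d\<mu>2\<close> and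
  \<open>\<eta> + i \<xi>\<close> must be multiplied by \<open>i\<close> under composition with
  \<open>I\<close>. This prescribes \<open>I\<close> on the coframe, makes it unique, and turns
  integrability into the vanishing of the (0,2)-part of \<open>d (\<eta> + i \<xi>)\<close>, the
  first factor being closed. The locale \<open>gk_coframe\<close> keeps what this needs on the total
  space, so that \<open>J\<close> is a second instance and the converse can reuse the uniqueness.

  In the converse the inverse of the half-commutator is explicit because its square is
  \<open>- (1 - p^2)\<close>. Inserting \<open>X\<close> works because \<open>d \<eta>\<close> and
  \<open>d \<xi>\<close> vanish on \<open>X\<close>: only terms with \<open>I X\<close> or
  \<open>J X\<close> survive, and each test vector isolates one coefficient of the curvature.

  The global obstacle is the base. Compactness of the circle makes the orbit space Hausdorff, and
  local sections of \<open>\<mu>\<close> over convex subsets of \<real>^3 provide at once its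
  charts, the trivialisations, the gauge potentials and the Cech data.\<close>

lemma Ck_on_subset: "Ck_on n S f \<Longrightarrow> T \<subseteq> S \<Longrightarrow> Ck_on n T f"
  by (induction n arbitrary: f) (auto intro: continuous_on_subset)

lemma Ck_on_cong:
  assumes "open S" "\<And>x. x \<in> S \<Longrightarrow> f x = g x" "Ck_on n S f"
  shows "Ck_on n S g"
  using assms(2,3)
proof (induction n arbitrary: f g)
  case 0
  then show ?case using continuous_on_cong[of S S f g] by auto
next
  case (Suc n)
  have d: "f differentiable at x" if "x \<in> S" for x
    using Suc.prems that by simp
  have "g differentiable at x" if "x \<in> S" for x
    using d[OF that] has_derivative_transform_within_open[of f _ x UNIV S g] assms(1) that Suc.prems(1)
    unfolding differentiable_def by blast
  moreover have "Ck_on n S (\<lambda>x. frechet_derivative g (at x) v)" for v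
  proof (rule Suc.IH)
    show "Ck_on n S (\<lambda>x. frechet_derivative f (at x) v)"
      using Suc.prems(2) by simp
    fix x assume "x \<in> S"
    then show "frechet_derivative f (at x) v = frechet_derivative g (at x) v"
      using frechet_derivative_transform_within_open[OF d assms(1) _ Suc.prems(1)] by simp
  qed
  ultimately show ?case by simp
qed

text \<open>Any explicit derivative \<open>D\<close> may be supplied, so the closure proofs below
  never have to compute \<open>frechet_derivative\<close>.\<close>

lemma Ck_on_SucI:
  assumes "open S" "\<And>x. x \<in> S \<Longrightarrow> (f has_derivative D x) (at x)" "\<And>v. Ck_on n S (\<lambda>x. D x v)"
  shows "Ck_on (Suc n) S f"
proof -
  have "Ck_on n S (\<lambda>x. frechet_derivative f (at x) v)" for v
  proof (rule Ck_on_cong[OF assms(1) _ assms(3)])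
    fix x assume "x \<in> S"
    then show "D x v = frechet_derivative f (at x) v"
      using frechet_derivative_at[OF assms(2)] by metis
  qed
  then show ?thesis using assms(2) by (auto simp: differentiable_def)
qed

lemma Ck_on_SucD:
  assumes "Ck_on (Suc n) S f" "x \<in> S"
  shows "(f has_derivative frechet_derivative f (at x)) (at x)"
  using assms by (simp add: frechet_derivative_works)

lemma Ck_on_lower: "Ck_on (Suc n) S f \<Longrightarrow> Ck_on n S f"
proof (induction n arbitrary: f)
  case 0
  then show ?case
    by (auto intro!: continuous_at_imp_continuous_on differentiable_imp_continuous_within)
next
  case (Suc n)
  then show ?case by (metis Ck_on.simps(2))
qed

lemma Ck_on_local:
  assumes "\<And>x. x \<in> S \<Longrightarrow> \<exists>T. open T \<and> x \<in> T \<and> Ck_on n T f"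
  shows "Ck_on n S f"
  using assms
proof (induction n arbitrary: f)
  case 0
  have "continuous (at x) f" if "x \<in> S" for x
  proof -
    obtain T where "open T" "x \<in> T" "continuous_on T f" using 0 \<open>x \<in> S\<close> by auto
    then show ?thesis by (simp add: continuous_on_eq_continuous_at)
  qed
  then show ?case by (simp add: continuous_at_imp_continuous_on)
next
  case (Suc n)
  have "Ck_on n S (\<lambda>x. frechet_derivative f (at x) v)" for v
  proof (rule Suc.IH)
    fix x assume "x \<in> S"
    then show "\<exists>T. open T \<and> x \<in> T \<and> Ck_on n T (\<lambda>x. frechet_derivative f (at x) v)"
      using Suc.prems[of x] by auto
  qed
  then show ?case using Suc.prems by fastforce
qed

lemma Ck_on_const: "open S \<Longrightarrow> Ck_on n S (\<lambda>_. c)"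
proof (induction n arbitrary: c)
  case (Suc n)
  show ?case by (rule Ck_on_SucI[where D = "\<lambda>_ _. 0"]) (use Suc in auto)
qed simp

lemma Ck_on_add:
  assumes "open S" "Ck_on n S f" "Ck_on n S g"
  shows "Ck_on n S (\<lambda>x. f x + g x)"
  using assms(2,3)
proof (induction n arbitrary: f g)
  case 0
  then show ?case by (auto intro: continuous_intros)
next
  case (Suc n)
  show ?case
    by (rule Ck_on_SucI[OF assms(1)],
        rule has_derivative_add[OF Ck_on_SucD[OF Suc.prems(1)] Ck_on_SucD[OF Suc.prems(2)]])
      (use Suc in auto)
qed

lemma Ck_on_linear_comp:
  assumes "open S" "bounded_linear L" "Ck_on n S f"
  shows "Ck_on n S (\<lambda>x. L (f x))"
  using assms(3)
proof (induction n arbitrary: f)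
  case 0
  then show ?case
    by (auto intro: continuous_on_compose2[OF linear_continuous_on[OF assms(2), of UNIV]])
next
  case (Suc n)
  show ?case
    by (rule Ck_on_SucI[OF assms(1)],
        rule bounded_linear.has_derivative[OF assms(2) Ck_on_SucD[OF Suc.prems]])
      (use Suc in auto)
qed

lemma Ck_on_bilinear:
  assumes "open S" "bounded_bilinear b" "Ck_on n S f" "Ck_on n S g"
  shows "Ck_on n S (\<lambda>x. b (f x) (g x))"
  using assms(3,4)
proof (induction n arbitrary: f g)
  case 0
  then show ?case by (auto intro: bounded_bilinear.continuous_on[OF assms(2)])
next
  case (Suc n)
  have D: "Ck_on n S (\<lambda>x. frechet_derivative f (at x) v)" "Ck_on n S (\<lambda>x. frechet_derivative g (at x) v)"
    for v using Suc.prems by auto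
  show ?case
    by (rule Ck_on_SucI[OF assms(1)], rule bounded_bilinear.FDERIV[OF assms(2)
        Ck_on_SucD[OF Suc.prems(1)] Ck_on_SucD[OF Suc.prems(2)]])
      (use Suc.prems[THEN Ck_on_lower] in \<open>auto intro!: Ck_on_add[OF assms(1)] Suc.IH D\<close>)
qed

lemma Ck_on_sum:
  assumes "open S" "\<And>i. i \<in> I \<Longrightarrow> Ck_on n S (f i)"
  shows "Ck_on n S (\<lambda>x. \<Sum>i\<in>I. f i x)"
  using assms(2)
  by (induction I rule: infinite_finite_induct) (auto intro: Ck_on_const Ck_on_add assms(1))

lemma Ck_on_linear:
  assumes "open S" "bounded_linear L"
  shows "Ck_on n S L"
proof (cases n)
  case 0
  then show ?thesis using assms linear_continuous_on by auto
next
  case (Suc m)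
  show ?thesis unfolding Suc
    by (rule Ck_on_SucI[OF assms(1)], rule bounded_linear_imp_has_derivative[OF assms(2)])
      (rule Ck_on_const[OF assms(1)])
qed

lemma Ck_on_compose:
  fixes f :: "'a::euclidean_space \<Rightarrow> 'b::euclidean_space" and g :: "'b \<Rightarrow> 'c::real_normed_vector"
  assumes "open S" "open T" "\<And>x. x \<in> S \<Longrightarrow> f x \<in> T" "Ck_on n S f" "Ck_on n T g"
  shows "Ck_on n S (\<lambda>x. g (f x))"
  using assms(4,5)
proof (induction n arbitrary: g)
  case 0
  then show ?case using assms(3) by (auto intro: continuous_on_compose2)
next
  case (Suc n)
  let ?D = "\<lambda>x v. frechet_derivative g (at (f x)) (frechet_derivative f (at x) v)"
  show ?case
  proof (rule Ck_on_SucI[OF assms(1), where D = ?D])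
    fix x assume x: "x \<in> S"
    show "((\<lambda>x. g (f x)) has_derivative ?D x) (at x)"
      using diff_chain_at[OF Ck_on_SucD[OF Suc.prems(1) x] Ck_on_SucD[OF Suc.prems(2) assms(3)[OF x]]]
      by (simp add: o_def)
  next
    fix v
    have *: "Ck_on n S (\<lambda>x. \<Sum>b\<in>Basis. (frechet_derivative f (at x) v \<bullet> b) *\<^sub>R
               frechet_derivative g (at (f x)) b)"
    proof (intro Ck_on_sum assms(1) Ck_on_bilinear[OF assms(1) bounded_bilinear_scaleR])
      fix b
      show "Ck_on n S (\<lambda>x. frechet_derivative f (at x) v \<bullet> b)"
        using Suc.prems(1) by (intro Ck_on_linear_comp[OF assms(1) bounded_linear_inner_left]) auto
      show "Ck_on n S (\<lambda>x. frechet_derivative g (at (f x)) b)"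
        using Suc.IH Ck_on_lower[OF Suc.prems(1)] Suc.prems(2) by auto
    qed
    show "Ck_on n S (\<lambda>x. ?D x v)"
    proof (rule Ck_on_cong[OF assms(1) _ *])
      fix x assume x: "x \<in> S"
      have "linear (frechet_derivative g (at (f x)))"
        using Ck_on_SucD[OF Suc.prems(2) assms(3)[OF x]] has_derivative_linear by blast
      from linear_sum[OF this] linear_scale[OF this]
      show "(\<Sum>b\<in>Basis. (frechet_derivative f (at x) v \<bullet> b) *\<^sub>R frechet_derivative g (at (f x)) b) = ?D x v"
        by (metis (no_types, lifting) euclidean_representation sum.cong)
    qed
  qed
qed

text \<open>The derivative \<open>- (inverse x * v * inverse x)\<close> is built from the function
  itself, so the order of differentiability climbs by induction.\<close>

lemma Ck_on_inverse_real: "Ck_on n (- {0}) (inverse :: real \<Rightarrow> real)"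
proof (induction n)
  case 0
  then show ?case by (auto intro!: continuous_intros)
next
  case (Suc n)
  show ?case
  proof (rule Ck_on_SucI[where D = "\<lambda>x v. - (inverse x * v * inverse x)"])
    fix x :: real assume "x \<in> - {0}"
    then show "(inverse has_derivative (\<lambda>v. - (inverse x * v * inverse x))) (at x)"
      by (auto intro: has_derivative_inverse')
  next
    fix v :: real
    have "Ck_on n (- {0}) (\<lambda>x::real. (- v) *\<^sub>R (inverse x * inverse x))"
      by (intro Ck_on_linear_comp[OF _ bounded_linear_scaleR_right]
          Ck_on_bilinear[OF _ bounded_bilinear_mult] Suc) auto
    then show "Ck_on n (- {0}) (\<lambda>x::real. - (inverse x * v * inverse x))"
      by (simp add: algebra_simps)
  qed auto
qed

subsection \<open>Smooth functions\<close>

lemma smooth_on_subset: "smooth_on S f \<Longrightarrow> T \<subseteq> S \<Longrightarrow> smooth_on T f"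
  by (auto simp: smooth_on_def intro: Ck_on_subset)

lemma smooth_on_cong:
  "open S \<Longrightarrow> (\<And>x. x \<in> S \<Longrightarrow> f x = g x) \<Longrightarrow> smooth_on S f \<Longrightarrow> smooth_on S g"
  unfolding smooth_on_def using Ck_on_cong by blast

lemma smooth_on_local:
  "(\<And>x. x \<in> S \<Longrightarrow> \<exists>T. open T \<and> x \<in> T \<and> smooth_on T f) \<Longrightarrow> smooth_on S f"
  unfolding smooth_on_def using Ck_on_local by metis

lemma smooth_on_has_derivative:
  "smooth_on S f \<Longrightarrow> x \<in> S \<Longrightarrow> (f has_derivative frechet_derivative f (at x)) (at x)"
  unfolding smooth_on_def using Ck_on_SucD by blast

lemma smooth_on_linear_derivative:
  "smooth_on S f \<Longrightarrow> x \<in> S \<Longrightarrow> linear (frechet_derivative f (at x))"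
  using smooth_on_has_derivative has_derivative_linear by blast

lemma smooth_on_continuous: "smooth_on S f \<Longrightarrow> continuous_on S f"
  unfolding smooth_on_def by (metis Ck_on.simps(1))

lemma smooth_on_derivative: "smooth_on S f \<Longrightarrow> smooth_on S (\<lambda>x. frechet_derivative f (at x) v)"
  unfolding smooth_on_def by (metis Ck_on.simps(2))

lemma smooth_on_const: "open S \<Longrightarrow> smooth_on S (\<lambda>_. c)"
  by (simp add: smooth_on_def Ck_on_const)

lemma smooth_on_linear: "open S \<Longrightarrow> bounded_linear L \<Longrightarrow> smooth_on S L"
  by (simp add: smooth_on_def Ck_on_linear)

lemma smooth_on_id: "open S \<Longrightarrow> smooth_on S (\<lambda>x. x)"
  by (simp add: smooth_on_linear bounded_linear_ident)

lemma smooth_on_add: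
  "open S \<Longrightarrow> smooth_on S f \<Longrightarrow> smooth_on S g \<Longrightarrow> smooth_on S (\<lambda>x. f x + g x)"
  by (simp add: smooth_on_def Ck_on_add)

lemma smooth_on_sum:
  "open S \<Longrightarrow> (\<And>i. i \<in> I \<Longrightarrow> smooth_on S (f i)) \<Longrightarrow> smooth_on S (\<lambda>x. \<Sum>i\<in>I. f i x)"
  by (simp add: smooth_on_def Ck_on_sum)

lemma smooth_on_linear_comp:
  "open S \<Longrightarrow> bounded_linear L \<Longrightarrow> smooth_on S f \<Longrightarrow> smooth_on S (\<lambda>x. L (f x))"
  by (simp add: smooth_on_def Ck_on_linear_comp)

lemma smooth_on_bilinear:
  "open S \<Longrightarrow> bounded_bilinear b \<Longrightarrow> smooth_on S f \<Longrightarrow> smooth_on S g \<Longrightarrow>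
    smooth_on S (\<lambda>x. b (f x) (g x))"
  by (simp add: smooth_on_def Ck_on_bilinear)

lemma smooth_on_compose:
  fixes f :: "'a::euclidean_space \<Rightarrow> 'b::euclidean_space"
  assumes "open S" "open T" "\<And>x. x \<in> S \<Longrightarrow> f x \<in> T" "smooth_on S f" "smooth_on T g"
  shows "smooth_on S (\<lambda>x. g (f x))"
  using assms Ck_on_compose[of S T f _ g] by (simp add: smooth_on_def)

lemmas smooth_on_scaleR = smooth_on_bilinear[OF _ bounded_bilinear_scaleR]
lemmas smooth_on_inner = smooth_on_bilinear[OF _ bounded_bilinear_inner]

lemma smooth_on_mult:
  fixes f g :: "'a::euclidean_space \<Rightarrow> 'b::real_normed_algebra"
  shows "open S \<Longrightarrow> smooth_on S f \<Longrightarrow> smooth_on S g \<Longrightarrow> smooth_on S (\<lambda>x. f x * g x)"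
  using smooth_on_bilinear[OF _ bounded_bilinear_mult] .

lemma smooth_on_uminus: "open S \<Longrightarrow> smooth_on S f \<Longrightarrow> smooth_on S (\<lambda>x. - f x)"
  using smooth_on_linear_comp[OF _ bounded_linear_minus[OF bounded_linear_ident]] by blast

lemma smooth_on_diff:
  "open S \<Longrightarrow> smooth_on S f \<Longrightarrow> smooth_on S g \<Longrightarrow> smooth_on S (\<lambda>x. f x - g x)"
  using smooth_on_add[OF _ _ smooth_on_uminus] by (metis (no_types, lifting) diff_conv_add_uminus smooth_on_cong)

lemma smooth_on_power:
  fixes f :: "'a::euclidean_space \<Rightarrow> real"
  shows "open S \<Longrightarrow> smooth_on S f \<Longrightarrow> smooth_on S (\<lambda>x. f x ^ n)"
  by (induction n) (auto intro: smooth_on_const smooth_on_mult)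

lemma smooth_on_prod:
  fixes f :: "'i \<Rightarrow> 'a::euclidean_space \<Rightarrow> real"
  shows "open S \<Longrightarrow> (\<And>i. i \<in> I \<Longrightarrow> smooth_on S (f i)) \<Longrightarrow> smooth_on S (\<lambda>x. \<Prod>i\<in>I. f i x)"
  by (induction I rule: infinite_finite_induct) (auto intro: smooth_on_const smooth_on_mult)

lemma smooth_on_inverse:
  fixes f :: "'a::euclidean_space \<Rightarrow> real"
  assumes "open S" "smooth_on S f" "\<And>x. x \<in> S \<Longrightarrow> f x \<noteq> 0"
  shows "smooth_on S (\<lambda>x. inverse (f x))"
proof (rule smooth_on_compose[OF assms(1) _ _ assms(2)])
  show "smooth_on (- {0}) (inverse :: real \<Rightarrow> real)"
    by (simp add: smooth_on_def Ck_on_inverse_real)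
qed (use assms in auto)

lemma smooth_on_divide:
  fixes f g :: "'a::euclidean_space \<Rightarrow> real"
  assumes "open S" "smooth_on S f" "smooth_on S g" "\<And>x. x \<in> S \<Longrightarrow> g x \<noteq> 0"
  shows "smooth_on S (\<lambda>x. f x / g x)"
  unfolding divide_inverse by (intro smooth_on_mult smooth_on_inverse assms)

lemma smooth_on_componentwise:
  fixes f :: "'a::euclidean_space \<Rightarrow> 'b::euclidean_space"
  assumes "open S" "\<And>b. b \<in> Basis \<Longrightarrow> smooth_on S (\<lambda>x. f x \<bullet> b)"
  shows "smooth_on S f"
proof -
  have "smooth_on S (\<lambda>x. \<Sum>b\<in>Basis. (f x \<bullet> b) *\<^sub>R b)"
    by (intro smooth_on_sum smooth_on_scaleR smooth_on_const assms)
  then show ?thesis by (simp add: euclidean_representation)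
qed

lemma smooth_on_vec:
  fixes f :: "'a::euclidean_space \<Rightarrow> real^'n"
  assumes "open S" "\<And>i. smooth_on S (\<lambda>x. f x $ i)"
  shows "smooth_on S f"
  by (rule smooth_on_componentwise) (use assms in \<open>auto simp: Basis_vec_def inner_axis\<close>)

lemma smooth_on_vec_nth:
  fixes f :: "'a::euclidean_space \<Rightarrow> real^'n"
  shows "open S \<Longrightarrow> smooth_on S f \<Longrightarrow> smooth_on S (\<lambda>x. f x $ i)"
  by (rule smooth_on_linear_comp[OF _ bounded_linear_vec_nth])

lemma smooth_on_Pair:
  fixes f :: "'a::euclidean_space \<Rightarrow> 'b::euclidean_space" and g :: "'a \<Rightarrow> 'c::euclidean_space"
  assumes "open S" "smooth_on S f" "smooth_on S g"
  shows "smooth_on S (\<lambda>x. (f x, g x))"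
proof -
  have "bounded_linear (\<lambda>x::'b. (x, 0::'c))" "bounded_linear (\<lambda>x::'c. (0::'b, x))"
    by (auto intro!: linear_conv_bounded_linear[THEN iffD1] linearI)
  then have "smooth_on S (\<lambda>x. (f x, 0) + (0, g x))"
    by (intro smooth_on_add smooth_on_linear_comp[where L = "\<lambda>x. (x, 0)"]
        smooth_on_linear_comp[where L = "\<lambda>x. (0, x)"] assms)
  then show ?thesis by simp
qed

text \<open>Expanding the varying vector in the basis reduces this to fixed vectors. It serves
  whenever a vector field is inserted into an endomorphism or a form.\<close>

lemma smooth_on_linear_apply:
  fixes h :: "'a::euclidean_space \<Rightarrow> 'b::euclidean_space" and A :: "'a \<Rightarrow> 'b \<Rightarrow> 'c::real_normed_vector"
  assumes "open S" "smooth_on S h" "\<And>v. smooth_on S (\<lambda>x. A x v)" "\<And>x. x \<in> S \<Longrightarrow> linear (A x)"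
  shows "smooth_on S (\<lambda>x. A x (h x))"
proof -
  have *: "smooth_on S (\<lambda>x. \<Sum>b\<in>Basis. (h x \<bullet> b) *\<^sub>R A x b)"
    by (intro smooth_on_sum smooth_on_scaleR smooth_on_inner smooth_on_const assms)
  show ?thesis
  proof (rule smooth_on_cong[OF assms(1) _ *])
    fix x assume "x \<in> S"
    note l = assms(4)[OF this]
    show "(\<Sum>b\<in>Basis. (h x \<bullet> b) *\<^sub>R A x b) = A x (h x)"
      using linear_sum[OF l] linear_scale[OF l]
      by (metis (no_types, lifting) euclidean_representation sum.cong)
  qed
qed

lemmas smooth_on_intros = smooth_on_const smooth_on_id smooth_on_add smooth_on_diff smooth_on_mult
  smooth_on_uminus smooth_on_power smooth_on_inverse smooth_on_divide smooth_on_sum smooth_on_scaleR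

subsection \<open>Symmetry of second derivatives\<close>

text \<open>The mean value theorem is applied twice, first in the direction \<open>u\<close> and
  then in the direction \<open>v\<close>. The second difference itself is symmetric in
  \<open>u\<close> and \<open>v\<close>, which is what the next lemma exploits.\<close>

lemma second_difference_mvt:
  fixes f :: "'a::euclidean_space \<Rightarrow> real"
  assumes "smooth_on (ball x r) f" "0 < s" "s * (norm u + norm v) < r"
  obtains \<xi> where "norm (\<xi> - x) \<le> s * (norm u + norm v)"
    "f (x + s *\<^sub>R u + s *\<^sub>R v) - f (x + s *\<^sub>R u) - f (x + s *\<^sub>R v) + f x =
      s * s * frechet_derivative (\<lambda>z. frechet_derivative f (at z) u) (at \<xi>) v"
proof -
  have bound: "norm (a *\<^sub>R u + b *\<^sub>R v) \<le> s * (norm u + norm v)"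
    if "0 \<le> a" "a \<le> s" "0 \<le> b" "b \<le> s" for a b
  proof -
    have "norm (a *\<^sub>R u + b *\<^sub>R v) \<le> a * norm u + b * norm v"
      using norm_triangle_ineq[of "a *\<^sub>R u" "b *\<^sub>R v"] that by simp
    also have "\<dots> \<le> s * norm u + s * norm v"
      using that by (intro add_mono mult_right_mono) auto
    finally show ?thesis by (simp add: algebra_simps)
  qed
  have inb: "x + (a *\<^sub>R u + b *\<^sub>R v) \<in> ball x r" if "0 \<le> a" "a \<le> s" "0 \<le> b" "b \<le> s" for a b
    using bound[OF that] assms(3) unfolding mem_ball dist_norm by (metis add_diff_cancel_left' dist_commute dist_norm order.strict_trans1)
  define D where "D = (\<lambda>z. frechet_derivative f (at z) u)"
  have dD: "(D has_derivative frechet_derivative D (at z)) (at z)" if "z \<in> ball x r" for z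
    unfolding D_def by (rule smooth_on_has_derivative[OF smooth_on_derivative[OF assms(1)] that])
  \<comment> \<open>\<open>h s - h 0\<close> is the whole second difference. The summand
    \<open>0 *\<^sub>R v\<close> is kept so that \<open>dline\<close> covers both terms.\<close>
  define h where "h = (\<lambda>a. f (x + (a *\<^sub>R u + s *\<^sub>R v)) - f (x + (a *\<^sub>R u + 0 *\<^sub>R v)))"
  have dline: "((\<lambda>a. f (x + (a *\<^sub>R u + b *\<^sub>R v))) has_real_derivative D (x + (a *\<^sub>R u + b *\<^sub>R v))) (at a)"
    if "0 \<le> a" "a \<le> s" "0 \<le> b" "b \<le> s" for a b
  proof -
    have 1: "((\<lambda>a. x + (a *\<^sub>R u + b *\<^sub>R v)) has_derivative (\<lambda>k. k *\<^sub>R u)) (at a)"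
      by (auto intro!: derivative_eq_intros)
    note 2 = smooth_on_has_derivative[OF assms(1) inb[OF that]]
    show ?thesis
      using diff_chain_at[OF 1 2] linear_scale[OF smooth_on_linear_derivative[OF assms(1) inb[OF that]]]
      by (simp add: has_field_derivative_def o_def D_def mult.commute[of _ "frechet_derivative _ _ _"])
  qed
  have "(h has_real_derivative D (x + (a *\<^sub>R u + s *\<^sub>R v)) - D (x + (a *\<^sub>R u + 0 *\<^sub>R v))) (at a)"
    if "0 \<le> a" "a \<le> s" for a
    unfolding h_def by (intro DERIV_diff dline) (use that assms in auto)
  then obtain a where a: "0 < a" "a < s"
    "h s - h 0 = (s - 0) * (D (x + (a *\<^sub>R u + s *\<^sub>R v)) - D (x + (a *\<^sub>R u + 0 *\<^sub>R v)))"
    using MVT2[OF assms(2), of h "\<lambda>a. D (x + (a *\<^sub>R u + s *\<^sub>R v)) - D (x + (a *\<^sub>R u + 0 *\<^sub>R v))"] by blast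
  have "((\<lambda>b. D (x + (a *\<^sub>R u + b *\<^sub>R v))) has_real_derivative
      frechet_derivative D (at (x + (a *\<^sub>R u + b *\<^sub>R v))) v) (at b)" if "0 \<le> b" "b \<le> s" for b
  proof -
    have 1: "((\<lambda>b. x + (a *\<^sub>R u + b *\<^sub>R v)) has_derivative (\<lambda>k. k *\<^sub>R v)) (at b)"
      by (auto intro!: derivative_eq_intros)
    have z: "x + (a *\<^sub>R u + b *\<^sub>R v) \<in> ball x r" using inb that a by simp
    show ?thesis
      using diff_chain_at[OF 1 dD[OF z]] linear_scale[OF has_derivative_linear[OF dD[OF z]]]
      by (simp add: has_field_derivative_def o_def mult.commute[of _ "frechet_derivative _ _ _"])
  qed
  then obtain b where b: "0 < b" "b < s" "D (x + (a *\<^sub>R u + s *\<^sub>R v)) - D (x + (a *\<^sub>R u + 0 *\<^sub>R v)) =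
      (s - 0) * frechet_derivative D (at (x + (a *\<^sub>R u + b *\<^sub>R v))) v"
    using MVT2[OF assms(2), of "\<lambda>b. D (x + (a *\<^sub>R u + b *\<^sub>R v))"
        "\<lambda>b. frechet_derivative D (at (x + (a *\<^sub>R u + b *\<^sub>R v))) v"] by blast
  show ?thesis
  proof (rule that[of "x + (a *\<^sub>R u + b *\<^sub>R v)"])
    show "norm (x + (a *\<^sub>R u + b *\<^sub>R v) - x) \<le> s * (norm u + norm v)"
      using bound[of a b] a b by simp
    show "f (x + s *\<^sub>R u + s *\<^sub>R v) - f (x + s *\<^sub>R u) - f (x + s *\<^sub>R v) + f x =
        s * s * frechet_derivative (\<lambda>z. frechet_derivative f (at z) u) (at (x + (a *\<^sub>R u + b *\<^sub>R v))) v"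
      using a(3) b(3) by (simp add: h_def D_def add.assoc)
  qed
qed

text \<open>Both mixed derivatives, taken at suitable points near \<open>x\<close>, equal the same
  second difference divided by \<open>s * s\<close>; continuity lets these points tend to
  \<open>x\<close>.\<close>

lemma second_derivative_symmetric:
  fixes f :: "'a::euclidean_space \<Rightarrow> real"
  assumes "open S" "smooth_on S f" "x \<in> S"
  shows "frechet_derivative (\<lambda>z. frechet_derivative f (at z) u) (at x) v =
    frechet_derivative (\<lambda>z. frechet_derivative f (at z) v) (at x) u"
proof -
  define P where "P = (\<lambda>z. frechet_derivative (\<lambda>z. frechet_derivative f (at z) u) (at z) v)"
  define Q where "Q = (\<lambda>z. frechet_derivative (\<lambda>z. frechet_derivative f (at z) v) (at z) u)"
  have c: "continuous (at x) P" "continuous (at x) Q"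
    using assms unfolding P_def Q_def
    by (auto intro!: smooth_on_continuous[THEN continuous_on_interior] smooth_on_derivative simp: interior_open)
  have "dist (P x) (Q x) < 2 * e" if "e > 0" for e
  proof -
    obtain d1 where d1: "d1 > 0" "\<And>z. dist z x < d1 \<Longrightarrow> dist (P z) (P x) < e"
      using c(1) \<open>e > 0\<close> unfolding continuous_at_eps_delta by blast
    obtain d2 where d2: "d2 > 0" "\<And>z. dist z x < d2 \<Longrightarrow> dist (Q z) (Q x) < e"
      using c(2) \<open>e > 0\<close> unfolding continuous_at_eps_delta by blast
    obtain r where r: "r > 0" "ball x r \<subseteq> S" using assms open_contains_ball by blast
    define m where "m = min r (min d1 d2)"
    \<comment> \<open>The summand 1 keeps the denominator positive when \<open>u\<close> and
      \<open>v\<close> vanish; the factor 2 keeps the intermediate points strictly within distance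
      \<open>m\<close> of \<open>x\<close>.\<close>
    define s where "s = m / (2 * (norm u + norm v + 1))"
    have m: "m > 0" using r d1 d2 by (simp add: m_def)
    have s: "s > 0" using m unfolding s_def by (auto intro!: divide_pos_pos add_nonneg_pos)
    have n0: "norm u + norm v + 1 > 0" by (auto intro!: add_nonneg_pos)
    have sm: "s * (norm u + norm v) < m"
    proof -
      have "s * (norm u + norm v) \<le> s * (norm u + norm v + 1)" using s by simp
      also have "\<dots> = m / 2" using n0 unfolding s_def by (simp add: field_simps)
      finally show ?thesis using m by simp
    qed
    have sb: "smooth_on (ball x r) f" using assms(2) r(2) by (rule smooth_on_subset)
    obtain \<xi> where \<xi>: "norm (\<xi> - x) \<le> s * (norm u + norm v)"
      "f (x + s *\<^sub>R u + s *\<^sub>R v) - f (x + s *\<^sub>R u) - f (x + s *\<^sub>R v) + f x = s * s * P \<xi>"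
      using second_difference_mvt[OF sb s, of u v] sm unfolding P_def m_def by auto
    obtain \<zeta> where \<zeta>: "norm (\<zeta> - x) \<le> s * (norm v + norm u)"
      "f (x + s *\<^sub>R v + s *\<^sub>R u) - f (x + s *\<^sub>R v) - f (x + s *\<^sub>R u) + f x = s * s * Q \<zeta>"
      using second_difference_mvt[OF sb s, of v u] sm unfolding Q_def m_def by (auto simp: add.commute)
    have "s * s * P \<xi> = s * s * Q \<zeta>" using \<xi>(2) \<zeta>(2) by (simp add: algebra_simps)
    then have "P \<xi> = Q \<zeta>" using s by simp
    moreover have "dist (P \<xi>) (P x) < e" using d1(2)[of \<xi>] \<xi>(1) sm by (auto simp: dist_norm m_def)
    moreover have "dist (Q \<zeta>) (Q x) < e" using d2(2)[of \<zeta>] \<zeta>(1) sm by (auto simp: dist_norm m_def add.commute)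
    ultimately show ?thesis using dist_triangle_half_l by (simp add: dist_real_def)
  qed
  from this[of "dist (P x) (Q x) / 2"] have "P x = Q x"
    by (cases "P x = Q x") auto
  then show ?thesis by (simp add: P_def Q_def)
qed

subsection \<open>Inverse functions\<close>

lemma smooth_on_det:
  fixes A :: "'a::euclidean_space \<Rightarrow> real^'n^'n"
  assumes "open S" "\<And>i j. smooth_on S (\<lambda>x. A x $ i $ j)"
  shows "smooth_on S (\<lambda>x. det (A x))"
  unfolding det_def by (intro smooth_on_intros smooth_on_prod assms)

text \<open>Cramer's rule writes each coordinate of the solution as a quotient of two determinants,
  hence of polynomials in smooth entries.\<close>

lemma smooth_on_inv_linear:
  fixes A :: "'a::euclidean_space \<Rightarrow> real^'n \<Rightarrow> real^'n"
  assumes "open S" "\<And>v. smooth_on S (\<lambda>x. A x v)" "smooth_on S w"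
    and "\<And>x. x \<in> S \<Longrightarrow> linear (A x)" "\<And>x. x \<in> S \<Longrightarrow> inj (A x)"
  shows "smooth_on S (\<lambda>x. inv (A x) (w x))"
proof -
  define B where "B = (\<lambda>x. matrix (A x))"
  have entry: "smooth_on S (\<lambda>x. B x $ i $ j)" for i j
    unfolding B_def matrix_def using assms(1,2) by (simp add: smooth_on_vec_nth)
  have d: "det (B x) \<noteq> 0" if "x \<in> S" for x
    unfolding B_def using det_nz_iff_inj assms(4,5) that by blast
  have C: "smooth_on S (\<lambda>x. (\<chi> i j. if j = k then w x $ i else B x $ i $ j) $ i $ j)" for k i j
    using entry smooth_on_vec_nth[OF assms(1,3)] by (cases "j = k") auto
  have s: "smooth_on S (\<lambda>x. \<chi> k. det (\<chi> i j. if j = k then w x $ i else B x $ i $ j) / det (B x))"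
    (is "smooth_on S ?u")
  proof (rule smooth_on_vec[OF assms(1)])
    fix k
    have "smooth_on S (\<lambda>x. det (\<chi> i j. if j = k then w x $ i else B x $ i $ j) / det (B x))"
      by (rule smooth_on_divide[OF assms(1) smooth_on_det[OF assms(1) C] smooth_on_det[OF assms(1) entry] d])
    then show "smooth_on S (\<lambda>x. ?u x $ k)" by simp
  qed
  show ?thesis
  proof (rule smooth_on_cong[OF assms(1) _ s])
    fix x assume x: "x \<in> S"
    have "B x *v ?u x = w x" using cramer[OF d[OF x]] by blast
    then have "A x (?u x) = w x"
      unfolding B_def fun_cong[OF matrix_vector_mul(2)[OF assms(4)[OF x]]] .
    then show "?u x = inv (A x) (w x)" using inv_f_f[OF assms(5)[OF x], of "?u x"] by (simp only:)
  qed
qed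

text \<open>Invariance of domain gives openness. The derivative of the inverse at \<open>y\<close>
  is the inverse of the derivative at the preimage of \<open>y\<close>, so one more order of
  differentiability of the inverse follows from the order already known.\<close>

lemma smooth_on_inv_into:
  fixes f :: "real^'n \<Rightarrow> real^'n"
  assumes "open S" "smooth_on S f" "inj_on f S" "\<And>x. x \<in> S \<Longrightarrow> inj (frechet_derivative f (at x))"
  shows "open (f ` S)" "smooth_on (f ` S) (inv_into S f)"
proof -
  let ?g = "inv_into S f"
  have cf: "continuous_on S f" using assms(2) by (rule smooth_on_continuous)
  show op: "open (f ` S)" by (rule invariance_of_domain[OF cf assms(1,3)])
  have cg: "continuous_on (f ` S) ?g"
    by (rule continuous_on_inverse_open[OF assms(1) cf]) (use assms(3) in auto)
  have gS: "?g y \<in> S" "f (?g y) = y" if "y \<in> f ` S" for y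
    using that by (auto simp: inv_into_into f_inv_into_f)
  have lin: "linear (frechet_derivative f (at x))" if "x \<in> S" for x
    by (rule smooth_on_linear_derivative[OF assms(2) that])
  have der: "(?g has_derivative inv (frechet_derivative f (at (?g y)))) (at y)" if y: "y \<in> f ` S" for y
  proof (rule has_derivative_inverse_basic[where f = f and g = ?g, OF smooth_on_has_derivative[OF assms(2) gS(1)[OF y]] _ _ _ op y])
    let ?D = "frechet_derivative f (at (?g y))"
    have inj: "inj ?D" and l: "linear ?D" using assms(4) lin gS y by auto
    show "bounded_linear (inv ?D)"
      using inj_linear_imp_inv_bounded_linear[OF _ inj] l by (simp add: linear_conv_bounded_linear)
    show "inv ?D \<circ> ?D = id" by (rule inv_o_cancel[OF inj])
    show "continuous (at y) ?g" using cg op y continuous_on_eq_continuous_at by blast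
  qed (use gS in auto)
  have "Ck_on n (f ` S) ?g" for n
  proof (induction n)
    case 0
    then show ?case using cg by simp
  next
    case (Suc n)
    show ?case
    proof (rule Ck_on_SucI[OF op der])
      fix v
      have "smooth_on S (\<lambda>x. inv (frechet_derivative f (at x)) v)"
        by (intro smooth_on_inv_linear assms lin smooth_on_derivative smooth_on_const)
      then have "Ck_on n S (\<lambda>x. inv (frechet_derivative f (at x)) v)" by (simp add: smooth_on_def)
      from Ck_on_compose[OF op assms(1) gS(1) Suc this]
      show "Ck_on n (f ` S) (\<lambda>y. inv (frechet_derivative f (at (?g y))) v)" .
    qed
  qed
  then show "smooth_on (f ` S) ?g" by (simp add: smooth_on_def)
qed

text \<open>The inverse function theorem is applied to the derivative as a
  \<open>blinfun\<close>-valued map \<open>F\<close>; in finite dimension its continuity follows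
  from that on each fixed vector.\<close>

lemma smooth_on_locally_invertible:
  fixes f :: "real^'n \<Rightarrow> real^'n"
  assumes "open S" "smooth_on S f" "x0 \<in> S" "inj (frechet_derivative f (at x0))"
  obtains U where "open U" "U \<subseteq> S" "x0 \<in> U" "inj_on f U" "\<And>x. x \<in> U \<Longrightarrow> inj (frechet_derivative f (at x))"
proof -
  define F where "F = (\<lambda>x. Blinfun (frechet_derivative f (at x)))"
  have F: "blinfun_apply (F x) = frechet_derivative f (at x)" if "x \<in> S" for x
    unfolding F_def
    by (rule bounded_linear_Blinfun_apply)
      (use smooth_on_linear_derivative[OF assms(2) that] linear_conv_bounded_linear in blast)
  have "continuous_on S (\<lambda>x. blinfun_apply (F x) v)" for v
    using smooth_on_continuous[OF smooth_on_derivative[OF assms(2), of v]]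
    by (rule continuous_on_cong[OF refl, THEN iffD1, rotated]) (simp add: F)
  then have cF: "continuous_on S F" by (intro continuous_on_blinfun_componentwise)
  let ?D = "frechet_derivative f (at x0)"
  obtain h where h: "linear h" "h \<circ> ?D = id"
    using linear_injective_left_inverse[OF smooth_on_linear_derivative[OF assms(2,3)] assms(4)] by blast
  have bh: "blinfun_apply (Blinfun h) = h"
    using h(1) by (intro bounded_linear_Blinfun_apply) (simp add: linear_conv_bounded_linear)
  have i: "Blinfun h o\<^sub>L F x0 = id_blinfun"
    by (rule blinfun_eqI) (use h(2) in \<open>simp add: bh F[OF assms(3)] fun_eq_iff\<close>)
  have dF: "(f has_derivative blinfun_apply (F x)) (at x)" if "x \<in> S" for x
    using F[OF that] smooth_on_has_derivative[OF assms(2) that] by simp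
  show ?thesis
  proof (rule inverse_function_theorem[OF assms(1) dF cF assms(3) i])
    fix U' V g g' assume U': "open U'" "U' \<subseteq> S" "x0 \<in> U'" "homeomorphism U' V f g"
      "\<And>y. y \<in> V \<Longrightarrow> bij (blinfun_apply (F (g y)))"
    show ?thesis
  proof (rule that[OF U'(1,2,3)])
    show "inj_on f U'" using U'(4) unfolding homeomorphism_def by (intro inj_on_inverseI[of _ g]) auto
    fix x assume x: "x \<in> U'"
    then have "g (f x) = x" "f x \<in> V" using U'(4) unfolding homeomorphism_def by auto
    then have "bij (blinfun_apply (F x))" using U'(5) by metis
    then show "inj (frechet_derivative f (at x))" using F x U'(2) by (metis bij_is_inj subsetD)
  qed
qed
qed

section \<open>Smooth maps between manifolds\<close>

text \<open>Charts without the separation axioms, so that open subsets, products and model spaces need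
  only be checked for what smooth maps use.\<close>

definition premanifold :: "('a, 'e::euclidean_space) manifold \<Rightarrow> bool" where
  "premanifold M \<longleftrightarrow>
     \<Union> (fst ` atlas M) = points M \<and>
     (\<forall>(U, \<phi>)\<in>atlas M. openin (mtop M) U \<and> open (\<phi> ` U) \<and>
        homeomorphic_map (subtopology (mtop M) U) (top_of_set (\<phi> ` U)) \<phi>) \<and>
     (\<forall>(U, \<phi>)\<in>atlas M. \<forall>(V, \<psi>)\<in>atlas M.
        smooth_on (\<phi> ` (U \<inter> V)) (\<psi> \<circ> inv_into U \<phi>))"

lemma smooth_manifold_premanifold: "smooth_manifold M \<Longrightarrow> premanifold M"
  by (simp add: smooth_manifold_def premanifold_def)

lemma points_openin: "openin (mtop M) U \<Longrightarrow> U \<subseteq> points M"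
  unfolding points_def by (rule openin_subset)

lemma chart_openin: "premanifold M \<Longrightarrow> (U, \<phi>) \<in> atlas M \<Longrightarrow> openin (mtop M) U"
  by (auto simp: premanifold_def)

lemma chart_subset: "premanifold M \<Longrightarrow> (U, \<phi>) \<in> atlas M \<Longrightarrow> U \<subseteq> points M"
  by (simp add: chart_openin points_openin)

lemma chart_exists:
  assumes "premanifold M" "x \<in> points M"
  obtains U \<phi> where "(U, \<phi>) \<in> atlas M" "x \<in> U"
proof -
  have "x \<in> \<Union> (fst ` atlas M)" using assms by (simp add: premanifold_def)
  then obtain c where "c \<in> atlas M" "x \<in> fst c" by blast
  then show ?thesis using that[of "fst c" "snd c"] by simp
qed

lemma chart_homeomorphic:
  assumes "premanifold M" "(U, \<phi>) \<in> atlas M"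
  shows "homeomorphic_map (subtopology (mtop M) U) (top_of_set (\<phi> ` U)) \<phi>" "open (\<phi> ` U)"
  using assms by (auto simp: premanifold_def)

lemma chart_inj: "premanifold M \<Longrightarrow> (U, \<phi>) \<in> atlas M \<Longrightarrow> inj_on \<phi> U"
  using chart_homeomorphic(1)[THEN homeomorphic_imp_injective_map] chart_subset
  by (metis inf.absorb_iff2 points_def topspace_subtopology)

lemma chart_inv: "premanifold M \<Longrightarrow> (U, \<phi>) \<in> atlas M \<Longrightarrow> x \<in> U \<Longrightarrow> inv_into U \<phi> (\<phi> x) = x"
  by (simp add: chart_inj)

lemma chart_image_open:
  assumes "premanifold M" "(U, \<phi>) \<in> atlas M" "openin (mtop M) W" "W \<subseteq> U"
  shows "open (\<phi> ` W)"
proof -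
  have "openin (subtopology (mtop M) U) W"
    using assms(3,4) by (simp add: openin_subset_topspace_eq openin_subtopology_Int subset_openin_subtopology)
  then have "openin (top_of_set (\<phi> ` U)) (\<phi> ` W)"
    using homeomorphic_imp_open_map[OF chart_homeomorphic(1)[OF assms(1,2)]] by (simp add: open_map_def)
  then show ?thesis using chart_homeomorphic(2)[OF assms(1,2)] openin_open_trans by blast
qed

lemma chart_Int_open:
  "premanifold M \<Longrightarrow> (U, \<phi>) \<in> atlas M \<Longrightarrow> openin (mtop M) W \<Longrightarrow> open (\<phi> ` (U \<inter> W))"
  by (rule chart_image_open) (auto intro: openin_Int chart_openin)

lemma chart_continuous:
  assumes "premanifold M" "(U, \<phi>) \<in> atlas M"
  shows "continuous_map (subtopology (mtop M) U) euclidean \<phi>"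
  using homeomorphic_imp_continuous_map[OF chart_homeomorphic(1)[OF assms]]
  using continuous_map_into_fulltopology by blast

lemma chart_vimage_openin:
  assumes "premanifold M" "(U, \<phi>) \<in> atlas M" "open S"
  shows "openin (mtop M) (U \<inter> \<phi> -` S)"
proof -
  have U: "U \<subseteq> topspace (mtop M)" using chart_subset[OF assms(1,2)] by (simp add: points_def)
  have "openin (subtopology (mtop M) U) {x \<in> topspace (subtopology (mtop M) U). \<phi> x \<in> S}"
    by (rule openin_continuous_map_preimage[OF chart_continuous[OF assms(1,2)]]) (use assms(3) in simp)
  moreover have "{x \<in> topspace (subtopology (mtop M) U). \<phi> x \<in> S} = U \<inter> \<phi> -` S" using U by auto
  ultimately show ?thesis using openin_trans_full chart_openin[OF assms(1,2)] by metis
qed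

lemma chart_inv_continuous:
  assumes "premanifold M" "(U, \<phi>) \<in> atlas M"
  shows "continuous_map (top_of_set (\<phi> ` U)) (mtop M) (inv_into U \<phi>)"
  unfolding continuous_map_def
proof (intro conjI allI impI)
  show "inv_into U \<phi> \<in> topspace (top_of_set (\<phi> ` U)) \<rightarrow> topspace (mtop M)"
    using chart_subset[OF assms] by (auto simp: points_def chart_inv[OF assms])
  fix W assume W: "openin (mtop M) W"
  have "{y \<in> topspace (top_of_set (\<phi> ` U)). inv_into U \<phi> y \<in> W} = \<phi> ` (U \<inter> W)"
    using chart_inv[OF assms] by auto
  moreover have "open (\<phi> ` (U \<inter> W))" by (rule chart_Int_open[OF assms W])
  ultimately show "openin (top_of_set (\<phi> ` U)) {y \<in> topspace (top_of_set (\<phi> ` U)). inv_into U \<phi> y \<in> W}"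
    by (auto intro: open_subset)
qed

lemma chart_transition:
  "premanifold M \<Longrightarrow> (U, \<phi>) \<in> atlas M \<Longrightarrow> (V, \<psi>) \<in> atlas M \<Longrightarrow>
    smooth_on (\<phi> ` (U \<inter> V)) (\<lambda>y. \<psi> (inv_into U \<phi> y))"
  unfolding premanifold_def by (fastforce simp: o_def)

lemma chart_at_atlas:
  assumes "premanifold M" "x \<in> points M"
  shows "chart_at M x \<in> atlas M" "x \<in> fst (chart_at M x)"
proof -
  obtain U \<phi> where "(U, \<phi>) \<in> atlas M" "x \<in> U" using chart_exists assms by metis
  then have "\<exists>c. c \<in> atlas M \<and> x \<in> fst c" by force
  from someI_ex[OF this] show "chart_at M x \<in> atlas M" "x \<in> fst (chart_at M x)"
    by (auto simp: chart_at_def)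
qed

section \<open>Euclidean space and open submanifolds\<close>

lemma points_euclid [simp]: "points euclid = UNIV"
  by (simp add: points_def euclid_def)

lemma mtop_euclid [simp]: "mtop euclid = euclidean"
  by (simp add: euclid_def)

lemma atlas_euclid [simp]: "atlas euclid = {(UNIV, id)}"
  by (simp add: euclid_def)

lemma chart_at_euclid [simp]: "chart_at euclid x = (UNIV, id)"
  by (auto simp: chart_at_def intro!: some_equality)

lemma premanifold_euclid [simp]: "premanifold euclid"
  using smooth_on_id[of UNIV] homeomorphic_map_id[of euclidean euclidean]
  by (simp add: premanifold_def id_def comp_def)

lemma points_open_sub: "points (open_sub M U) = points M \<inter> U"
  by (simp add: points_def open_sub_def)

lemma points_open_sub_openin: "openin (mtop M) U \<Longrightarrow> points (open_sub M U) = U"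
  using points_openin by (auto simp: points_open_sub)

lemma mtop_open_sub [simp]: "mtop (open_sub M U) = subtopology (mtop M) U"
  by (simp add: open_sub_def)

lemma atlas_open_sub: "atlas (open_sub M U) = (\<lambda>(V, \<phi>). (V \<inter> U, \<phi>)) ` atlas M"
  by (simp add: open_sub_def)

lemma atlas_open_sub_cases:
  assumes "(W, \<phi>) \<in> atlas (open_sub M U)"
  obtains V where "(V, \<phi>) \<in> atlas M" "W = V \<inter> U"
  using assms by (auto simp: atlas_open_sub)

text \<open>Charts of \<open>open_sub\<close> keep the coordinate map but shrink its domain, so the
  inverses taken over the two domains have to be compared.\<close>

lemma inv_into_Int:
  assumes "inj_on \<phi> V" "y \<in> \<phi> ` (V \<inter> U)"
  shows "inv_into (V \<inter> U) \<phi> y = inv_into V \<phi> y"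
  using assms by (metis IntD1 Int_lower1 f_inv_into_f image_eqI inj_on_subset inv_into_f_f inv_into_into)

lemma premanifold_open_sub:
  assumes M: "premanifold M" and U: "openin (mtop M) U"
  shows "premanifold (open_sub M U)"
  unfolding premanifold_def
proof (intro conjI)
  show "\<Union> (fst ` atlas (open_sub M U)) = points (open_sub M U)"
  proof -
    have "\<Union> (fst ` atlas (open_sub M U)) = \<Union> (fst ` atlas M) \<inter> U"
      by (simp add: atlas_open_sub image_image case_prod_beta)
    then show ?thesis using M by (simp add: premanifold_def points_open_sub)
  qed
  have "openin (subtopology (mtop M) U) (V \<inter> U) \<and> open (\<phi> ` (V \<inter> U)) \<and>
      homeomorphic_map (subtopology (subtopology (mtop M) U) (V \<inter> U)) (top_of_set (\<phi> ` (V \<inter> U))) \<phi>"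
    if V: "(V, \<phi>) \<in> atlas M" for V \<phi>
  proof (intro conjI)
    show "open (\<phi> ` (V \<inter> U))" by (rule chart_Int_open[OF M V U])
    show "openin (subtopology (mtop M) U) (V \<inter> U)"
      using chart_openin[OF M V] by (auto simp: openin_subtopology)
    have "homeomorphic_map (subtopology (subtopology (mtop M) V) (V \<inter> U))
        (subtopology (top_of_set (\<phi> ` V)) (\<phi> ` (V \<inter> U))) \<phi>"
      by (rule homeomorphic_map_subtopologies[OF chart_homeomorphic(1)[OF M V]])
        (use chart_inv[OF M V] chart_subset[OF M V] in \<open>auto simp: points_def inj_on_image_Int[OF chart_inj[OF M V]]\<close>)
    moreover have "\<phi> ` V \<inter> \<phi> ` (V \<inter> U) = \<phi> ` (V \<inter> U)" by blast
    moreover have "V \<inter> (V \<inter> U) = U \<inter> (V \<inter> U)" by blast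
    ultimately show "homeomorphic_map (subtopology (subtopology (mtop M) U) (V \<inter> U)) (top_of_set (\<phi> ` (V \<inter> U))) \<phi>"
      by (simp only: subtopology_subtopology)
  qed
  then show "\<forall>(W, \<phi>)\<in>atlas (open_sub M U). openin (mtop (open_sub M U)) W \<and> open (\<phi> ` W) \<and>
        homeomorphic_map (subtopology (mtop (open_sub M U)) W) (top_of_set (\<phi> ` W)) \<phi>"
    unfolding mtop_open_sub by (blast elim: atlas_open_sub_cases)
  show "\<forall>(W, \<phi>)\<in>atlas (open_sub M U). \<forall>(W', \<psi>)\<in>atlas (open_sub M U).
        smooth_on (\<phi> ` (W \<inter> W')) (\<psi> \<circ> inv_into W \<phi>)"
  proof clarify
    fix W \<phi> W' \<psi> assume W: "(W, \<phi>) \<in> atlas (open_sub M U)" "(W', \<psi>) \<in> atlas (open_sub M U)"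
    obtain V where V: "(V, \<phi>) \<in> atlas M" "W = V \<inter> U" using W(1) by (rule atlas_open_sub_cases)
    obtain V' where V': "(V', \<psi>) \<in> atlas M" "W' = V' \<inter> U" using W(2) by (rule atlas_open_sub_cases)
    have "openin (mtop M) (W \<inter> W')" using V V' U chart_openin[OF M] by blast
    then have o: "open (\<phi> ` (W \<inter> W'))" by (rule chart_image_open[OF M V(1)]) (use V in auto)
    show "smooth_on (\<phi> ` (W \<inter> W')) (\<psi> \<circ> inv_into W \<phi>)"
    proof (rule smooth_on_cong[OF o _ smooth_on_subset[OF chart_transition[OF M V(1) V'(1)]]])
      fix y assume "y \<in> \<phi> ` (W \<inter> W')"
      then have "y \<in> \<phi> ` (V \<inter> U)" using V by blast
      then show "\<psi> (inv_into V \<phi> y) = (\<psi> \<circ> inv_into W \<phi>) y"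
        by (simp add: V(2) inv_into_Int[OF chart_inj[OF M V(1)]])
    qed (use V V' in auto)
  qed
qed

section \<open>Smooth maps: locality, composition, restriction\<close>

lemma smooth_map_continuous: "smooth_map M N f \<Longrightarrow> continuous_map (mtop M) (mtop N) f"
  by (simp add: smooth_map_def)

lemma smooth_map_points: "smooth_map M N f \<Longrightarrow> x \<in> points M \<Longrightarrow> f x \<in> points N"
  using smooth_map_continuous continuous_map_image_subset_topspace unfolding points_def by blast

lemma smooth_map_vimage:
  assumes "smooth_map M N f" "openin (mtop N) V"
  shows "openin (mtop M) {x \<in> points M. f x \<in> V}"
  using openin_continuous_map_preimage[OF smooth_map_continuous[OF assms(1)] assms(2)] by (simp add: points_def)

lemma smooth_map_chart:
  assumes "smooth_map M N f" "(U, \<phi>) \<in> atlas M" "(V, \<psi>) \<in> atlas N"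
  shows "smooth_on (\<phi> ` (U \<inter> f -` V)) (\<lambda>y. \<psi> (f (inv_into U \<phi> y)))"
  using assms unfolding smooth_map_def by (fastforce simp: o_def)

lemma smooth_map_chart_open:
  assumes "premanifold M" "premanifold N" "smooth_map M N f" "(U, \<phi>) \<in> atlas M" "(V, \<psi>) \<in> atlas N"
  shows "openin (mtop M) (U \<inter> f -` V)" "open (\<phi> ` (U \<inter> f -` V))"
proof -
  have "U \<inter> f -` V = U \<inter> {x \<in> points M. f x \<in> V}" using chart_subset[OF assms(1,4)] by blast
  then show "openin (mtop M) (U \<inter> f -` V)"
    using smooth_map_vimage[OF assms(3) chart_openin[OF assms(2,5)]] chart_openin[OF assms(1,4)] by auto
  then show "open (\<phi> ` (U \<inter> f -` V))" by (rule chart_image_open[OF assms(1,4)]) auto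
qed

text \<open>The definition of \<open>smooth_map\<close> speaks of all pairs of charts. Smooth
  transitions on both sides reduce it to one pair of charts around each point.\<close>

lemma smooth_mapI_local:
  assumes M: "premanifold M" and N: "premanifold N" and c: "continuous_map (mtop M) (mtop N) f"
    and loc: "\<And>x. x \<in> points M \<Longrightarrow> \<exists>U \<phi> V \<psi> W. (U, \<phi>) \<in> atlas M \<and> (V, \<psi>) \<in> atlas N \<and> openin (mtop M) W \<and>
      x \<in> W \<and> W \<subseteq> U \<and> f ` W \<subseteq> V \<and> smooth_on (\<phi> ` W) (\<lambda>y. \<psi> (f (inv_into U \<phi> y)))"
  shows "smooth_map M N f"
proof -
  have "smooth_on (\<phi>' ` (U' \<inter> f -` V')) (\<psi>' \<circ> f \<circ> inv_into U' \<phi>')"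
    if U': "(U', \<phi>') \<in> atlas M" and V': "(V', \<psi>') \<in> atlas N" for U' \<phi>' V' \<psi>'
  proof (rule smooth_on_local)
    fix y assume "y \<in> \<phi>' ` (U' \<inter> f -` V')"
    then obtain x where x: "x \<in> U'" "f x \<in> V'" "y = \<phi>' x" by auto
    then have "x \<in> points M" using chart_subset[OF M U'] by blast
    then obtain U \<phi> V \<psi> W where U: "(U, \<phi>) \<in> atlas M" and V: "(V, \<psi>) \<in> atlas N"
      and W: "openin (mtop M) W" "x \<in> W" "W \<subseteq> U" "f ` W \<subseteq> V"
      and s: "smooth_on (\<phi> ` W) (\<lambda>y. \<psi> (f (inv_into U \<phi> y)))" using loc by metis
    define W' where "W' = W \<inter> U' \<inter> {x \<in> points M. f x \<in> V'}"
    have "openin (mtop M) {x \<in> points M. f x \<in> V'}"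
      using openin_continuous_map_preimage[OF c chart_openin[OF N V']] by (simp add: points_def)
    then have oW': "openin (mtop M) W'" unfolding W'_def using W(1) chart_openin[OF M U'] by blast
    have xW': "x \<in> W'" using x W \<open>x \<in> points M\<close> by (simp add: W'_def)
    have o: "open (\<phi>' ` W')" by (rule chart_image_open[OF M U' oW']) (auto simp: W'_def)
    have o2: "open (\<phi> ` W)" by (rule chart_image_open[OF M U W(1,3)])
    have vo: "openin (mtop N) (V \<inter> V')" using chart_openin[OF N] V V' by blast
    have o3: "open (\<psi> ` (V \<inter> V'))" by (rule chart_image_open[OF N V vo]) auto
    have i: "inv_into U' \<phi>' z \<in> W'" if "z \<in> \<phi>' ` W'" for z
      using that chart_inv[OF M U'] by (auto simp: W'_def)
    have s1: "smooth_on (\<phi>' ` W') (\<lambda>z. \<phi> (inv_into U' \<phi>' z))"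
      by (rule smooth_on_subset[OF chart_transition[OF M U' U]]) (use W(3) in \<open>auto simp: W'_def\<close>)
    have s1': "smooth_on (\<phi> ` W') (\<lambda>y. \<psi> (f (inv_into U \<phi> y)))"
      by (rule smooth_on_subset[OF s]) (auto simp: W'_def)
    have o2': "open (\<phi> ` W')" by (rule chart_image_open[OF M U oW']) (use W(3) in \<open>auto simp: W'_def\<close>)
    have s2: "smooth_on (\<phi>' ` W') (\<lambda>z. \<psi> (f (inv_into U \<phi> (\<phi> (inv_into U' \<phi>' z)))))"
      by (rule smooth_on_compose[OF o o2' _ s1 s1']) (use i in auto)
    have s3: "smooth_on (\<phi>' ` W') (\<lambda>z. \<psi>' (inv_into V \<psi> (\<psi> (f (inv_into U \<phi> (\<phi> (inv_into U' \<phi>' z)))))))"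
    proof (rule smooth_on_compose[OF o o3 _ s2 chart_transition[OF N V V']])
      fix z assume "z \<in> \<phi>' ` W'"
      then have "inv_into U' \<phi>' z \<in> W'" by (rule i)
      then have "inv_into U \<phi> (\<phi> (inv_into U' \<phi>' z)) \<in> W'" using chart_inv[OF M U] W(3) by (auto simp: W'_def)
      then show "\<psi> (f (inv_into U \<phi> (\<phi> (inv_into U' \<phi>' z)))) \<in> \<psi> ` (V \<inter> V')"
        using W(4) by (auto simp: W'_def)
    qed
    have "smooth_on (\<phi>' ` W') (\<psi>' \<circ> f \<circ> inv_into U' \<phi>')"
    proof (rule smooth_on_cong[OF o _ s3])
      fix z assume "z \<in> \<phi>' ` W'"
      then have w: "inv_into U' \<phi>' z \<in> W'" by (rule i)
      then have "inv_into U' \<phi>' z \<in> U" "f (inv_into U' \<phi>' z) \<in> V" using W by (auto simp: W'_def)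
      then show "\<psi>' (inv_into V \<psi> (\<psi> (f (inv_into U \<phi> (\<phi> (inv_into U' \<phi>' z)))))) = (\<psi>' \<circ> f \<circ> inv_into U' \<phi>') z"
        by (simp add: chart_inv[OF M U] chart_inv[OF N V])
    qed
    then show "\<exists>T. open T \<and> y \<in> T \<and> smooth_on T (\<psi>' \<circ> f \<circ> inv_into U' \<phi>')"
      using o xW' x(3) by blast
  qed
  then show ?thesis using c by (auto simp: smooth_map_def)
qed

lemma smooth_map_compose:
  assumes M: "premanifold M" and N: "premanifold N" and K: "premanifold K"
    and f: "smooth_map M N f" and g: "smooth_map N K g"
  shows "smooth_map M K (\<lambda>x. g (f x))"
proof (rule smooth_mapI_local[OF M K])
  show "continuous_map (mtop M) (mtop K) (\<lambda>x. g (f x))"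
    using continuous_map_compose[OF smooth_map_continuous[OF f] smooth_map_continuous[OF g]] by (simp add: o_def)
  fix x assume x: "x \<in> points M"
  have fx: "f x \<in> points N" "g (f x) \<in> points K"
    using smooth_map_points[OF f x] smooth_map_points[OF g] by auto
  obtain U \<phi> where U: "(U, \<phi>) \<in> atlas M" "x \<in> U" using chart_exists[OF M x] .
  obtain V \<psi> where V: "(V, \<psi>) \<in> atlas N" "f x \<in> V" using chart_exists[OF N fx(1)] .
  obtain S \<kappa> where S: "(S, \<kappa>) \<in> atlas K" "g (f x) \<in> S" using chart_exists[OF K fx(2)] .
  note o1 = smooth_map_chart_open[OF M N f U(1) V(1)]
  note o2 = smooth_map_chart_open[OF N K g V(1) S(1)]
  define W where "W = U \<inter> {x \<in> points M. f x \<in> V \<inter> g -` S}"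
  have W: "openin (mtop M) W" unfolding W_def
    using smooth_map_vimage[OF f o2(1)] chart_openin[OF M U(1)] by auto
  have oW: "open (\<phi> ` W)" by (rule chart_image_open[OF M U(1) W]) (simp add: W_def)
  have s1: "smooth_on (\<phi> ` W) (\<lambda>y. \<psi> (f (inv_into U \<phi> y)))"
    by (rule smooth_on_subset[OF smooth_map_chart[OF f U(1) V(1)]]) (auto simp: W_def)
  have s2: "smooth_on (\<phi> ` W) (\<lambda>y. \<kappa> (g (inv_into V \<psi> (\<psi> (f (inv_into U \<phi> y))))))"
    by (rule smooth_on_compose[OF oW o2(2) _ s1 smooth_map_chart[OF g V(1) S(1)]])
      (auto simp: W_def chart_inv[OF M U(1)])
  have "smooth_on (\<phi> ` W) (\<lambda>y. \<kappa> (g (f (inv_into U \<phi> y))))"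
    by (rule smooth_on_cong[OF oW _ s2]) (auto simp: W_def chart_inv[OF M U(1)] chart_inv[OF N V(1)])
  then show "\<exists>U \<phi> V \<psi> W. (U, \<phi>) \<in> atlas M \<and> (V, \<psi>) \<in> atlas K \<and> openin (mtop M) W \<and> x \<in> W \<and> W \<subseteq> U \<and>
      (\<lambda>x. g (f x)) ` W \<subseteq> V \<and> smooth_on (\<phi> ` W) (\<lambda>y. \<psi> (g (f (inv_into U \<phi> y))))"
    using U S V W x by (intro exI[of _ U] exI[of _ \<phi>] exI[of _ S] exI[of _ \<kappa>] exI[of _ W]) (auto simp: W_def)
qed

lemma smooth_map_restrict:
  assumes M: "premanifold M" and N: "premanifold N" and f: "smooth_map M N f" and W: "openin (mtop M) W"
  shows "smooth_map (open_sub M W) N f"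
  unfolding smooth_map_def
proof (intro conjI)
  show "continuous_map (mtop (open_sub M W)) (mtop N) f"
    using smooth_map_continuous[OF f] by (simp add: continuous_map_from_subtopology)
  show "\<forall>(U, \<phi>)\<in>atlas (open_sub M W). \<forall>(V, \<psi>)\<in>atlas N.
      smooth_on (\<phi> ` (U \<inter> f -` V)) (\<psi> \<circ> f \<circ> inv_into U \<phi>)"
  proof (clarsimp simp: atlas_open_sub)
    fix U \<phi> V \<psi> assume U: "(U, \<phi>) \<in> atlas M" and V: "(V, \<psi>) \<in> atlas N"
    have "openin (mtop M) (W \<inter> (U \<inter> f -` V))"
      using W smooth_map_chart_open(1)[OF M N f U V] by blast
    moreover have "W \<inter> (U \<inter> f -` V) = U \<inter> W \<inter> f -` V" by blast
    ultimately have o: "open (\<phi> ` (U \<inter> W \<inter> f -` V))" by (intro chart_image_open[OF M U]) auto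
    show "smooth_on (\<phi> ` (U \<inter> W \<inter> f -` V)) (\<psi> \<circ> f \<circ> inv_into (U \<inter> W) \<phi>)"
    proof (rule smooth_on_cong[OF o _ smooth_on_subset[OF smooth_map_chart[OF f U V]]])
      fix y assume "y \<in> \<phi> ` (U \<inter> W \<inter> f -` V)"
      then have "y \<in> \<phi> ` (U \<inter> W)" by blast
      then show "\<psi> (f (inv_into U \<phi> y)) = (\<psi> \<circ> f \<circ> inv_into (U \<inter> W) \<phi>) y"
        by (simp add: inv_into_Int[OF chart_inj[OF M U]])
    qed blast
  qed
qed

lemma open_sub_points: "premanifold M \<Longrightarrow> open_sub M (points M) = M"
proof -
  assume M: "premanifold M"
  have "(\<lambda>(V, \<phi>). (V \<inter> points M, \<phi>)) ` atlas M = (\<lambda>c. c) ` atlas M"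
    by (rule image_cong[OF refl]) (use chart_subset[OF M] in auto)
  then show ?thesis by (simp add: open_sub_def points_def)
qed

lemma open_sub_open_sub: "open_sub (open_sub M U) V = open_sub M (U \<inter> V)"
  by (auto simp: open_sub_def subtopology_subtopology image_image case_prod_beta Int_assoc)

lemma smooth_map_smaller:
  assumes "premanifold M" "premanifold N" "openin (mtop M) U" "openin (mtop M) V" "V \<subseteq> U"
    "smooth_map (open_sub M U) N f"
  shows "smooth_map (open_sub M V) N f"
proof -
  have "openin (mtop (open_sub M U)) V" using assms(3,4,5) by (simp add: openin_open_subtopology)
  from smooth_map_restrict[OF premanifold_open_sub[OF assms(1,3)] assms(2,6) this] assms(5)
  show ?thesis by (simp add: open_sub_open_sub inf_absorb2)
qed

lemma smooth_map_into_open_sub: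
  assumes M: "premanifold M" and N: "premanifold N" and f: "smooth_map M N f" and V: "f ` points M \<subseteq> V"
  shows "smooth_map M (open_sub N V) f"
  unfolding smooth_map_def
proof (intro conjI)
  show "continuous_map (mtop M) (mtop (open_sub N V)) f"
    using smooth_map_continuous[OF f] V by (auto simp: continuous_map_in_subtopology points_def)
  show "\<forall>(U, \<phi>)\<in>atlas M. \<forall>(W, \<psi>)\<in>atlas (open_sub N V).
      smooth_on (\<phi> ` (U \<inter> f -` W)) (\<psi> \<circ> f \<circ> inv_into U \<phi>)"
  proof (clarsimp simp: atlas_open_sub)
    fix U \<phi> W \<psi> assume U: "(U, \<phi>) \<in> atlas M" and W: "(W, \<psi>) \<in> atlas N"
    show "smooth_on (\<phi> ` (U \<inter> (f -` W \<inter> f -` V))) (\<psi> \<circ> f \<circ> inv_into U \<phi>)"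
      unfolding o_def by (rule smooth_on_subset[OF smooth_map_chart[OF f U W]]) blast
  qed
qed

lemma smooth_map_from_open_sub_into:
  assumes "premanifold N" "openin (mtop N) V" "smooth_map M (open_sub N V) f" "premanifold M"
  shows "smooth_map M N f"
proof (rule smooth_mapI_local[OF assms(4,1)])
  show "continuous_map (mtop M) (mtop N) f"
    using smooth_map_continuous[OF assms(3)] by (simp add: continuous_map_in_subtopology)
  fix x assume x: "x \<in> points M"
  have fx: "f x \<in> V" using smooth_map_points[OF assms(3) x] points_open_sub_openin[OF assms(2)] by simp
  have "f x \<in> points N" using fx points_openin[OF assms(2)] by blast
  then obtain S \<psi> where S: "(S, \<psi>) \<in> atlas N" "f x \<in> S" using chart_exists[OF assms(1)] by metis
  then have S': "(S \<inter> V, \<psi>) \<in> atlas (open_sub N V)" by (force simp: atlas_open_sub)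
  obtain U \<phi> where U: "(U, \<phi>) \<in> atlas M" "x \<in> U" using chart_exists[OF assms(4) x] .
  note o = smooth_map_chart_open[OF assms(4) premanifold_open_sub[OF assms(1,2)] assms(3) U(1) S']
  show "\<exists>U \<phi> V \<psi> W. (U, \<phi>) \<in> atlas M \<and> (V, \<psi>) \<in> atlas N \<and> openin (mtop M) W \<and> x \<in> W \<and> W \<subseteq> U \<and>
      f ` W \<subseteq> V \<and> smooth_on (\<phi> ` W) (\<lambda>y. \<psi> (f (inv_into U \<phi> y)))"
    by (intro exI[of _ U] exI[of _ \<phi>] exI[of _ S] exI[of _ \<psi>] exI[of _ "U \<inter> f -` (S \<inter> V)"] conjI
        U(1) S(1) o(1) smooth_map_chart[OF assms(3) U(1) S']) (use U(2) fx S(2) in auto)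
qed

lemma smooth_map_local:
  assumes M: "premanifold M" and N: "premanifold N"
    and loc: "\<And>x. x \<in> points M \<Longrightarrow> \<exists>U. openin (mtop M) U \<and> x \<in> U \<and> smooth_map (open_sub M U) N f"
  shows "smooth_map M N f"
proof (rule smooth_mapI_local[OF M N])
  have "continuous_map (mtop M) (mtop N) f \<longleftrightarrow> (\<forall>x\<in>topspace (mtop M). \<exists>U. openin (mtop M) U \<and> x \<in> U \<and>
      continuous_map (subtopology (mtop M) U) (mtop N) f)"
  proof (intro iffI ballI)
    assume l: "\<forall>x\<in>topspace (mtop M). \<exists>U. openin (mtop M) U \<and> x \<in> U \<and> continuous_map (subtopology (mtop M) U) (mtop N) f"
    define \<U> where "\<U> = {U. openin (mtop M) U \<and> continuous_map (subtopology (mtop M) U) (mtop N) f}"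
    show "continuous_map (mtop M) (mtop N) f"
      unfolding continuous_map_def
    proof (intro conjI allI impI)
      show "f \<in> topspace (mtop M) \<rightarrow> topspace (mtop N)"
      proof
        fix x assume x: "x \<in> topspace (mtop M)"
        then obtain U where U: "x \<in> U" "continuous_map (subtopology (mtop M) U) (mtop N) f" using l by blast
        show "f x \<in> topspace (mtop N)"
          using continuous_map_image_subset_topspace[OF U(2)] U(1) x by auto
      qed
      fix V assume V: "openin (mtop N) V"
      have "{x \<in> topspace (mtop M). f x \<in> V} = (\<Union>U\<in>\<U>. {x \<in> topspace (subtopology (mtop M) U). f x \<in> V})"
        using l by (auto simp: \<U>_def)
      moreover have "openin (mtop M) {x \<in> topspace (subtopology (mtop M) U). f x \<in> V}" if "U \<in> \<U>" for U
        using that openin_continuous_map_preimage[OF _ V] openin_trans_full unfolding \<U>_def by blast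
      ultimately show "openin (mtop M) {x \<in> topspace (mtop M). f x \<in> V}" by auto
    qed
  next
    fix x assume "continuous_map (mtop M) (mtop N) f" "x \<in> topspace (mtop M)"
    then show "\<exists>U. openin (mtop M) U \<and> x \<in> U \<and> continuous_map (subtopology (mtop M) U) (mtop N) f"
      by (metis continuous_map_from_subtopology openin_topspace)
  qed
  then show "continuous_map (mtop M) (mtop N) f"
    using loc smooth_map_continuous unfolding points_def mtop_open_sub[symmetric] by metis
  fix x assume x: "x \<in> points M"
  then obtain A where A: "openin (mtop M) A" "x \<in> A" and f: "smooth_map (open_sub M A) N f" using loc by blast
  note MA = premanifold_open_sub[OF M A(1)]
  have xA: "x \<in> points (open_sub M A)" using A points_open_sub_openin by metis
  obtain U \<phi> where U: "(U, \<phi>) \<in> atlas M" "x \<in> U" using chart_exists[OF M x] .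
  obtain V \<psi> where V: "(V, \<psi>) \<in> atlas N" "f x \<in> V" using chart_exists[OF N smooth_map_points[OF f xA]] .
  have UA: "(U \<inter> A, \<phi>) \<in> atlas (open_sub M A)" using U(1) by (force simp: atlas_open_sub)
  have o: "openin (mtop M) (U \<inter> A \<inter> f -` V)"
    using smooth_map_chart_open(1)[OF MA N f UA V(1)] A(1) by (simp add: openin_open_subtopology)
  have op: "open (\<phi> ` (U \<inter> A \<inter> f -` V))" by (rule chart_image_open[OF M U(1) o]) auto
  have "smooth_on (\<phi> ` (U \<inter> A \<inter> f -` V)) (\<lambda>y. \<psi> (f (inv_into U \<phi> y)))"
  proof (rule smooth_on_cong[OF op _ smooth_map_chart[OF f UA V(1)]])
    fix y assume "y \<in> \<phi> ` (U \<inter> A \<inter> f -` V)"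
    then have "y \<in> \<phi> ` (U \<inter> A)" by blast
    then show "\<psi> (f (inv_into (U \<inter> A) \<phi> y)) = \<psi> (f (inv_into U \<phi> y))"
      by (simp add: inv_into_Int[OF chart_inj[OF M U(1)]])
  qed
  then show "\<exists>U \<phi> V \<psi> W. (U, \<phi>) \<in> atlas M \<and> (V, \<psi>) \<in> atlas N \<and> openin (mtop M) W \<and> x \<in> W \<and> W \<subseteq> U \<and>
      f ` W \<subseteq> V \<and> smooth_on (\<phi> ` W) (\<lambda>y. \<psi> (f (inv_into U \<phi> y)))"
    using U V o A(2) by (intro exI[of _ U] exI[of _ \<phi>] exI[of _ V] exI[of _ \<psi>] exI[of _ "U \<inter> A \<inter> f -` V"]) auto
qed

lemma smooth_map_cong:
  assumes M: "premanifold M" and N: "premanifold N" and "smooth_map M N f" "\<And>x. x \<in> points M \<Longrightarrow> f x = g x"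
  shows "smooth_map M N g"
proof (rule smooth_mapI_local[OF M N])
  show "continuous_map (mtop M) (mtop N) g"
    using continuous_map_eq[OF smooth_map_continuous[OF assms(3)]] assms(4) by (simp add: points_def)
  fix x assume x: "x \<in> points M"
  obtain U \<phi> where U: "(U, \<phi>) \<in> atlas M" "x \<in> U" using chart_exists[OF M x] .
  obtain V \<psi> where V: "(V, \<psi>) \<in> atlas N" "f x \<in> V" using chart_exists[OF N smooth_map_points[OF assms(3) x]] .
  note o = smooth_map_chart_open[OF M N assms(3) U(1) V(1)]
  have "smooth_on (\<phi> ` (U \<inter> f -` V)) (\<lambda>y. \<psi> (g (inv_into U \<phi> y)))"
    by (rule smooth_on_cong[OF o(2) _ smooth_map_chart[OF assms(3) U(1) V(1)]])
      (use assms(4) chart_subset[OF M U(1)] in \<open>auto simp: chart_inv[OF M U(1)]\<close>)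
  moreover have "g ` (U \<inter> f -` V) \<subseteq> V" using assms(4) chart_subset[OF M U(1)] by fastforce
  ultimately show "\<exists>U \<phi> V \<psi> W. (U, \<phi>) \<in> atlas M \<and> (V, \<psi>) \<in> atlas N \<and> openin (mtop M) W \<and> x \<in> W \<and> W \<subseteq> U \<and>
      g ` W \<subseteq> V \<and> smooth_on (\<phi> ` W) (\<lambda>y. \<psi> (g (inv_into U \<phi> y)))"
    using U V o(1) by (intro exI[of _ U] exI[of _ \<phi>] exI[of _ V] exI[of _ \<psi>] exI[of _ "U \<inter> f -` V"]) auto
qed

lemma smooth_map_id: "premanifold M \<Longrightarrow> smooth_map M M (\<lambda>x. x)"
  unfolding smooth_map_def by (auto simp: o_def intro: chart_transition)

lemma smooth_map_const:
  assumes M: "premanifold M" and N: "premanifold N" and "a \<in> points N"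
  shows "smooth_map M N (\<lambda>_. a)"
proof (rule smooth_mapI_local[OF M N])
  show "continuous_map (mtop M) (mtop N) (\<lambda>_. a)" using assms(3) by (simp add: points_def)
  fix x assume x: "x \<in> points M"
  obtain U \<phi> where U: "(U, \<phi>) \<in> atlas M" "x \<in> U" using chart_exists[OF M x] .
  obtain V \<psi> where V: "(V, \<psi>) \<in> atlas N" "a \<in> V" using chart_exists[OF N assms(3)] .
  show "\<exists>U \<phi> V \<psi> W. (U, \<phi>) \<in> atlas M \<and> (V, \<psi>) \<in> atlas N \<and> openin (mtop M) W \<and> x \<in> W \<and> W \<subseteq> U \<and>
      (\<lambda>_. a) ` W \<subseteq> V \<and> smooth_on (\<phi> ` W) (\<lambda>y. \<psi> a)"
    using U V chart_openin[OF M U(1)] chart_homeomorphic(2)[OF M U(1)]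
    by (intro exI[of _ U] exI[of _ \<phi>] exI[of _ V] exI[of _ \<psi>] exI[of _ U]) (auto intro: smooth_on_const)
qed

lemma smooth_map_chart_map:
  assumes M: "premanifold M" and U: "(U, \<phi>) \<in> atlas M"
  shows "smooth_map (open_sub M U) euclid \<phi>"
  unfolding smooth_map_def
proof (intro conjI)
  show "continuous_map (mtop (open_sub M U)) (mtop euclid) \<phi>" using chart_continuous[OF M U] by simp
  show "\<forall>(W, \<psi>)\<in>atlas (open_sub M U). \<forall>(V, \<kappa>)\<in>atlas euclid.
      smooth_on (\<psi> ` (W \<inter> \<phi> -` V)) (\<kappa> \<circ> \<phi> \<circ> inv_into W \<psi>)"
  proof (clarsimp simp: atlas_open_sub)
    fix W \<psi> assume W: "(W, \<psi>) \<in> atlas M"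
    show "smooth_on (\<psi> ` (W \<inter> U)) (\<phi> \<circ> inv_into (W \<inter> U) \<psi>)"
      by (rule smooth_on_cong[OF _ _ chart_transition[OF M W U]])
        (simp_all add: inv_into_Int[OF chart_inj[OF M W]] chart_Int_open[OF M W chart_openin[OF M U]])
  qed
qed

lemma smooth_map_chart_inv:
  assumes M: "premanifold M" and U: "(U, \<phi>) \<in> atlas M"
  shows "smooth_map (open_sub euclid (\<phi> ` U)) M (inv_into U \<phi>)"
  unfolding smooth_map_def
proof (intro conjI)
  show "continuous_map (mtop (open_sub euclid (\<phi> ` U))) (mtop M) (inv_into U \<phi>)"
    using chart_inv_continuous[OF M U] by simp
  show "\<forall>(W, \<psi>)\<in>atlas (open_sub euclid (\<phi> ` U)). \<forall>(V, \<kappa>)\<in>atlas M.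
      smooth_on (\<psi> ` (W \<inter> inv_into U \<phi> -` V)) (\<kappa> \<circ> inv_into U \<phi> \<circ> inv_into W \<psi>)"
  proof (clarsimp simp: atlas_open_sub)
    fix V \<kappa> assume V: "(V, \<kappa>) \<in> atlas M"
    have e: "\<phi> ` U \<inter> inv_into U \<phi> -` V = \<phi> ` (U \<inter> V)" using chart_inv[OF M U] by auto
    have i: "inv_into (\<phi> ` U) id y = y" if "y \<in> \<phi> ` (U \<inter> V)" for y
      using inv_into_f_f[of id "\<phi> ` U" y] that by auto
    show "smooth_on (\<phi> ` U \<inter> inv_into U \<phi> -` V) (\<kappa> \<circ> inv_into U \<phi> \<circ> inv_into (\<phi> ` U) id)"
      unfolding e by (rule smooth_on_cong[OF _ _ chart_transition[OF M U V]])
        (simp_all add: i chart_Int_open[OF M U chart_openin[OF M V]])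
  qed
qed

text \<open>The bridge between maps of manifolds and \<open>smooth_on\<close>; the only chart of an
  open subset of the model space is the restricted identity, whose inverse is
  \<open>inv_into S id\<close>.\<close>

lemma smooth_map_euclid:
  assumes "open S"
  shows "smooth_map (open_sub euclid S) euclid f \<longleftrightarrow> smooth_on S f"
proof
  assume "smooth_map (open_sub euclid S) euclid f"
  from smooth_map_chart[OF this, of S id UNIV id]
  have "smooth_on S (\<lambda>y. f (inv_into S id y))" by (simp add: atlas_open_sub)
  then show "smooth_on S f"
    by (rule smooth_on_cong[OF assms, rotated]) (use inv_into_f_f[of id S] in auto)
next
  assume s: "smooth_on S f"
  have "smooth_on S (\<lambda>y. f (inv_into S id y))"
    by (rule smooth_on_cong[OF assms _ s]) (use inv_into_f_f[of id S] in auto)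
  then show "smooth_map (open_sub euclid S) euclid f"
    using smooth_on_continuous[OF s] by (simp add: smooth_map_def atlas_open_sub o_def)
qed

lemma smooth_map_real:
  assumes M: "premanifold M" and f: "smooth_map M euclid f" and U: "(U, \<phi>) \<in> atlas M"
  shows "smooth_on (\<phi> ` U) (\<lambda>y. f (inv_into U \<phi> y))"
  using smooth_map_chart[OF f U, of UNIV id] by simp

lemma smooth_map_realI:
  assumes M: "premanifold M" and f: "\<And>U \<phi>. (U, \<phi>) \<in> atlas M \<Longrightarrow> smooth_on (\<phi> ` U) (\<lambda>y. f (inv_into U \<phi> y))"
  shows "smooth_map M euclid f"
proof (rule smooth_map_local[OF M premanifold_euclid])
  fix x assume "x \<in> points M"
  then obtain U \<phi> where U: "(U, \<phi>) \<in> atlas M" "x \<in> U" using chart_exists[OF M] by metis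
  note oU = chart_openin[OF M U(1)]
  have o: "open (\<phi> ` U)" by (rule chart_homeomorphic(2)[OF M U(1)])
  have 1: "smooth_map (open_sub M U) (open_sub euclid (\<phi> ` U)) \<phi>"
    by (rule smooth_map_into_open_sub[OF premanifold_open_sub[OF M oU] _ smooth_map_chart_map[OF M U(1)]])
      (auto simp: points_open_sub)
  have 2: "smooth_map (open_sub euclid (\<phi> ` U)) euclid (\<lambda>y. f (inv_into U \<phi> y))"
    using f[OF U(1)] smooth_map_euclid[OF o] by blast
  have P: "premanifold (open_sub euclid (\<phi> ` U))" by (rule premanifold_open_sub) (use o in auto)
  have "smooth_map (open_sub M U) euclid (\<lambda>x. f (inv_into U \<phi> (\<phi> x)))"
    by (rule smooth_map_compose[OF premanifold_open_sub[OF M oU] P premanifold_euclid 1 2])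
  then have "smooth_map (open_sub M U) euclid f"
    by (rule smooth_map_cong[OF premanifold_open_sub[OF M oU] premanifold_euclid])
      (simp add: points_open_sub chart_inv[OF M U(1)])
  then show "\<exists>U. openin (mtop M) U \<and> x \<in> U \<and> smooth_map (open_sub M U) euclid f"
    using oU U(2) by blast
qed

subsection \<open>Products and the circle\<close>

lemma points_prod: "points (prod_manifold M N) = points M \<times> points N"
  by (simp add: points_def prod_manifold_def)

lemma mtop_prod: "mtop (prod_manifold M N) = prod_topology (mtop M) (mtop N)"
  by (simp add: prod_manifold_def)

lemma atlas_prodI: "(U, \<phi>) \<in> atlas M \<Longrightarrow> (V, \<psi>) \<in> atlas N \<Longrightarrow> (U \<times> V, map_prod \<phi> \<psi>) \<in> atlas (prod_manifold M N)"
  by (force simp: prod_manifold_def)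

lemma atlas_prod_cases:
  assumes "(W, h) \<in> atlas (prod_manifold M N)"
  obtains U \<phi> V \<psi> where "(U, \<phi>) \<in> atlas M" "(V, \<psi>) \<in> atlas N" "W = U \<times> V" "h = map_prod \<phi> \<psi>"
  using assms by (auto simp: prod_manifold_def)

lemma inv_into_map_prod:
  assumes "inj_on \<phi> U" "inj_on \<psi> V" "a \<in> \<phi> ` U" "b \<in> \<psi> ` V"
  shows "inv_into (U \<times> V) (map_prod \<phi> \<psi>) (a, b) = (inv_into U \<phi> a, inv_into V \<psi> b)"
proof -
  have "inj_on (map_prod \<phi> \<psi>) (U \<times> V)" using assms(1,2) by (auto simp: inj_on_def)
  moreover have "map_prod \<phi> \<psi> (inv_into U \<phi> a, inv_into V \<psi> b) = (a, b)" using assms by (simp add: f_inv_into_f)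
  ultimately show ?thesis
    using inv_into_f_f[of "map_prod \<phi> \<psi>" "U \<times> V" "(inv_into U \<phi> a, inv_into V \<psi> b)"] assms
    by (simp add: inv_into_into)
qed

lemma map_prod_image_Int: "map_prod \<phi> \<psi> ` ((U \<times> V) \<inter> (U' \<times> V')) = (\<phi> ` (U \<inter> U')) \<times> (\<psi> ` (V \<inter> V'))"
  unfolding Times_Int_Times by auto

lemma smooth_on_fst: "open S \<Longrightarrow> smooth_on S (fst :: 'a::euclidean_space \<times> 'b::euclidean_space \<Rightarrow> 'a)"
  by (simp add: smooth_on_linear bounded_linear_fst)

lemma smooth_on_snd: "open S \<Longrightarrow> smooth_on S (snd :: 'a::euclidean_space \<times> 'b::euclidean_space \<Rightarrow> 'b)"
  by (simp add: smooth_on_linear bounded_linear_snd)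

lemma UN_Times_image: "(\<Union>x\<in>A \<times> B. F (fst x) \<times> G (snd x)) = \<Union> (F ` A) \<times> \<Union> (G ` B)"
  by auto

lemma premanifold_prod:
  assumes M: "premanifold M" and N: "premanifold N"
  shows "premanifold (prod_manifold M N)"
  unfolding premanifold_def
proof (intro conjI)
  have "\<Union> (fst ` atlas (prod_manifold M N)) = \<Union> (fst ` atlas M) \<times> \<Union> (fst ` atlas N)"
    using UN_Times_image[of fst fst "atlas M" "atlas N"]
    by (simp add: prod_manifold_def image_image case_prod_beta)
  then show "\<Union> (fst ` atlas (prod_manifold M N)) = points (prod_manifold M N)"
    using M N by (simp add: premanifold_def points_prod)
  show "\<forall>(W, h)\<in>atlas (prod_manifold M N). openin (mtop (prod_manifold M N)) W \<and> open (h ` W) \<and>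
      homeomorphic_map (subtopology (mtop (prod_manifold M N)) W) (top_of_set (h ` W)) h"
  proof clarify
    fix W h assume "(W, h) \<in> atlas (prod_manifold M N)"
    then obtain U \<phi> V \<psi> where U: "(U, \<phi>) \<in> atlas M" and V: "(V, \<psi>) \<in> atlas N"
      and W: "W = U \<times> V" and h: "h = map_prod \<phi> \<psi>" by (rule atlas_prod_cases)
    have im: "h ` W = (\<phi> ` U) \<times> (\<psi> ` V)" unfolding W h by auto
    obtain f where f: "homeomorphic_maps (subtopology (mtop M) U) (top_of_set (\<phi> ` U)) \<phi> f"
      using chart_homeomorphic(1)[OF M U] homeomorphic_map_maps by blast
    obtain g where g: "homeomorphic_maps (subtopology (mtop N) V) (top_of_set (\<psi> ` V)) \<psi> g"
      using chart_homeomorphic(1)[OF N V] homeomorphic_map_maps by blast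
    have "homeomorphic_maps (prod_topology (subtopology (mtop M) U) (subtopology (mtop N) V))
        (prod_topology (top_of_set (\<phi> ` U)) (top_of_set (\<psi> ` V))) (\<lambda>(x,y). (\<phi> x, \<psi> y)) (\<lambda>(x,y). (f x, g y))"
      using f g homeomorphic_maps_prod by blast
    then have "homeomorphic_map (prod_topology (subtopology (mtop M) U) (subtopology (mtop N) V))
        (prod_topology (top_of_set (\<phi> ` U)) (top_of_set (\<psi> ` V))) h"
      unfolding h map_prod_def homeomorphic_map_maps by blast
    then have "homeomorphic_map (subtopology (mtop (prod_manifold M N)) W) (top_of_set (h ` W)) h"
      unfolding im unfolding W mtop_prod subtopology_Times prod_topology_subtopology_eu .
    moreover have "open (h ` W)"
      unfolding im using chart_homeomorphic(2)[OF M U] chart_homeomorphic(2)[OF N V] by (rule open_Times)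
    ultimately show "openin (mtop (prod_manifold M N)) W \<and> open (h ` W) \<and>
      homeomorphic_map (subtopology (mtop (prod_manifold M N)) W) (top_of_set (h ` W)) h"
      using chart_openin[OF M U] chart_openin[OF N V] by (simp add: W mtop_prod openin_prod_Times_iff)
  qed
  show "\<forall>(W, h)\<in>atlas (prod_manifold M N). \<forall>(W', h')\<in>atlas (prod_manifold M N).
      smooth_on (h ` (W \<inter> W')) (h' \<circ> inv_into W h)"
  proof clarify
    fix W h W' h' assume 1: "(W, h) \<in> atlas (prod_manifold M N)" and 2: "(W', h') \<in> atlas (prod_manifold M N)"
    from 1 obtain U \<phi> V \<psi> where U: "(U, \<phi>) \<in> atlas M" and V: "(V, \<psi>) \<in> atlas N"
      and W: "W = U \<times> V" and h: "h = map_prod \<phi> \<psi>" by (rule atlas_prod_cases)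
    from 2 obtain U' \<phi>' V' \<psi>' where U': "(U', \<phi>') \<in> atlas M" and V': "(V', \<psi>') \<in> atlas N"
      and W': "W' = U' \<times> V'" and h': "h' = map_prod \<phi>' \<psi>'" by (rule atlas_prod_cases)
    have im: "h ` (W \<inter> W') = \<phi> ` (U \<inter> U') \<times> \<psi> ` (V \<inter> V')"
      unfolding W W' h by (rule map_prod_image_Int)
    have oU: "open (\<phi> ` (U \<inter> U'))" by (rule chart_Int_open[OF M U chart_openin[OF M U']])
    have oV: "open (\<psi> ` (V \<inter> V'))" by (rule chart_Int_open[OF N V chart_openin[OF N V']])
    have o: "open (h ` (W \<inter> W'))" unfolding im using oU oV by (rule open_Times)
    have s: "smooth_on (h ` (W \<inter> W')) (\<lambda>z. (\<phi>' (inv_into U \<phi> (fst z)), \<psi>' (inv_into V \<psi> (snd z))))"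
      by (intro smooth_on_Pair o smooth_on_compose[OF o oU _ smooth_on_fst[OF o] chart_transition[OF M U U']]
          smooth_on_compose[OF o oV _ smooth_on_snd[OF o] chart_transition[OF N V V']]) (auto simp: im)
    show "smooth_on (h ` (W \<inter> W')) (h' \<circ> inv_into W h)"
    proof (rule smooth_on_cong[OF o _ s])
      fix z assume "z \<in> h ` (W \<inter> W')"
      then have "fst z \<in> \<phi> ` U" "snd z \<in> \<psi> ` V" by (auto simp: im)
      then show "(\<phi>' (inv_into U \<phi> (fst z)), \<psi>' (inv_into V \<psi> (snd z))) = (h' \<circ> inv_into W h) z"
        using inv_into_map_prod[OF chart_inj[OF M U] chart_inj[OF N V], of "fst z" "snd z"]
        by (simp add: W h h')
    qed
  qed
qed

lemma smooth_map_Pair: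
  assumes M: "premanifold M" and N: "premanifold N" and K: "premanifold K"
    and f: "smooth_map M N f" and g: "smooth_map M K g"
  shows "smooth_map M (prod_manifold N K) (\<lambda>x. (f x, g x))"
proof (rule smooth_mapI_local[OF M premanifold_prod[OF N K]])
  show "continuous_map (mtop M) (mtop (prod_manifold N K)) (\<lambda>x. (f x, g x))"
    unfolding mtop_prod by (intro continuous_map_pairedI smooth_map_continuous f g)
  fix x assume x: "x \<in> points M"
  obtain U \<phi> where U: "(U, \<phi>) \<in> atlas M" "x \<in> U" using chart_exists[OF M x] .
  obtain V \<psi> where V: "(V, \<psi>) \<in> atlas N" "f x \<in> V" using chart_exists[OF N smooth_map_points[OF f x]] .
  obtain S \<kappa> where S: "(S, \<kappa>) \<in> atlas K" "g x \<in> S" using chart_exists[OF K smooth_map_points[OF g x]] .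
  define W where "W = U \<inter> f -` V \<inter> (U \<inter> g -` S)"
  have W: "openin (mtop M) W" unfolding W_def
    using smooth_map_chart_open(1)[OF M N f U(1) V(1)] smooth_map_chart_open(1)[OF M K g U(1) S(1)] by blast
  have o: "open (\<phi> ` W)" by (rule chart_image_open[OF M U(1) W]) (auto simp: W_def)
  have s: "smooth_on (\<phi> ` W) (\<lambda>y. (\<psi> (f (inv_into U \<phi> y)), \<kappa> (g (inv_into U \<phi> y))))"
    by (intro smooth_on_Pair o smooth_on_subset[OF smooth_map_chart[OF f U(1) V(1)]]
        smooth_on_subset[OF smooth_map_chart[OF g U(1) S(1)]]) (auto simp: W_def)
  show "\<exists>U \<phi> V \<psi> W. (U, \<phi>) \<in> atlas M \<and> (V, \<psi>) \<in> atlas (prod_manifold N K) \<and> openin (mtop M) W \<and> x \<in> W \<and>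
      W \<subseteq> U \<and> (\<lambda>x. (f x, g x)) ` W \<subseteq> V \<and> smooth_on (\<phi> ` W) (\<lambda>y. \<psi> (f (inv_into U \<phi> y), g (inv_into U \<phi> y)))"
    by (intro exI[of _ U] exI[of _ \<phi>] exI[of _ "V \<times> S"] exI[of _ "map_prod \<psi> \<kappa>"] exI[of _ W])
      (use U V S W s atlas_prodI[OF V(1) S(1)] in \<open>auto simp: W_def\<close>)
qed

lemma smooth_map_fst:
  assumes M: "premanifold M" and N: "premanifold N"
  shows "smooth_map (prod_manifold M N) M fst"
proof (rule smooth_mapI_local[OF premanifold_prod[OF M N] M])
  show "continuous_map (mtop (prod_manifold M N)) (mtop M) fst" by (simp add: mtop_prod continuous_map_fst)
  fix x assume x: "x \<in> points (prod_manifold M N)"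
  have xp: "fst x \<in> points M" "snd x \<in> points N" using x by (auto simp: points_prod)
  obtain U \<phi> where U: "(U, \<phi>) \<in> atlas M" "fst x \<in> U" using chart_exists[OF M xp(1)] .
  obtain V \<psi> where V: "(V, \<psi>) \<in> atlas N" "snd x \<in> V" using chart_exists[OF N xp(2)] .
  have im: "map_prod \<phi> \<psi> ` (U \<times> V) = \<phi> ` U \<times> \<psi> ` V" by auto
  have o: "open (\<phi> ` U \<times> \<psi> ` V)" by (intro open_Times chart_homeomorphic(2)[OF M U(1)] chart_homeomorphic(2)[OF N V(1)])
  have "smooth_on (\<phi> ` U \<times> \<psi> ` V) (\<lambda>y. \<phi> (fst (inv_into (U \<times> V) (map_prod \<phi> \<psi>) y)))"
    by (rule smooth_on_cong[OF o _ smooth_on_fst[OF o]])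
      (auto simp: inv_into_map_prod[OF chart_inj[OF M U(1)] chart_inj[OF N V(1)]] chart_inv[OF M U(1)])
  then show "\<exists>U \<phi> V \<psi> W. (U, \<phi>) \<in> atlas (prod_manifold M N) \<and> (V, \<psi>) \<in> atlas M \<and>
      openin (mtop (prod_manifold M N)) W \<and> x \<in> W \<and> W \<subseteq> U \<and> fst ` W \<subseteq> V \<and>
      smooth_on (\<phi> ` W) (\<lambda>y. \<psi> (fst (inv_into U \<phi> y)))"
    by (intro exI[of _ "U \<times> V"] exI[of _ "map_prod \<phi> \<psi>"] exI[of _ U] exI[of _ \<phi>])
      (use U V atlas_prodI[OF U(1) V(1)] chart_openin[OF premanifold_prod[OF M N]] in \<open>auto simp: im mem_Times_iff\<close>)
qed

lemma smooth_map_snd: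
  assumes M: "premanifold M" and N: "premanifold N"
  shows "smooth_map (prod_manifold M N) N snd"
proof (rule smooth_mapI_local[OF premanifold_prod[OF M N] N])
  show "continuous_map (mtop (prod_manifold M N)) (mtop N) snd" by (simp add: mtop_prod continuous_map_snd)
  fix x assume x: "x \<in> points (prod_manifold M N)"
  have xp: "fst x \<in> points M" "snd x \<in> points N" using x by (auto simp: points_prod)
  obtain U \<phi> where U: "(U, \<phi>) \<in> atlas M" "fst x \<in> U" using chart_exists[OF M xp(1)] .
  obtain V \<psi> where V: "(V, \<psi>) \<in> atlas N" "snd x \<in> V" using chart_exists[OF N xp(2)] .
  have im: "map_prod \<phi> \<psi> ` (U \<times> V) = \<phi> ` U \<times> \<psi> ` V" by auto
  have o: "open (\<phi> ` U \<times> \<psi> ` V)" by (intro open_Times chart_homeomorphic(2)[OF M U(1)] chart_homeomorphic(2)[OF N V(1)])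
  have "smooth_on (\<phi> ` U \<times> \<psi> ` V) (\<lambda>y. \<psi> (snd (inv_into (U \<times> V) (map_prod \<phi> \<psi>) y)))"
    by (rule smooth_on_cong[OF o _ smooth_on_snd[OF o]])
      (auto simp: inv_into_map_prod[OF chart_inj[OF M U(1)] chart_inj[OF N V(1)]] chart_inv[OF N V(1)])
  then show "\<exists>U \<phi> V \<psi> W. (U, \<phi>) \<in> atlas (prod_manifold M N) \<and> (V, \<psi>) \<in> atlas N \<and>
      openin (mtop (prod_manifold M N)) W \<and> x \<in> W \<and> W \<subseteq> U \<and> snd ` W \<subseteq> V \<and>
      smooth_on (\<phi> ` W) (\<lambda>y. \<psi> (snd (inv_into U \<phi> y)))"
    by (intro exI[of _ "U \<times> V"] exI[of _ "map_prod \<phi> \<psi>"] exI[of _ V] exI[of _ \<psi>])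
      (use U V atlas_prodI[OF U(1) V(1)] chart_openin[OF premanifold_prod[OF M N]] in \<open>auto simp: im mem_Times_iff\<close>)
qed

section \<open>The angle on the circle\<close>

lemma cis_eq_cis: "cis s = cis t \<longleftrightarrow> (\<exists>n::int. s = t + 2 * pi * n)"
  using sin_cos_eq_iff[of s t] by (auto simp: complex_eq_iff)

lemma cis_cancel:
  assumes "cis s = cis t" "\<bar>s - t\<bar> < 2 * pi"
  shows "s = t"
proof -
  obtain n :: int where n: "s = t + 2 * pi * n" using assms(1) cis_eq_cis by blast
  have "2 * pi * \<bar>real_of_int n\<bar> < 2 * pi * 1" using n assms(2) by (simp add: abs_mult)
  then have "\<bar>real_of_int n\<bar> < 1" by (subst (asm) mult_less_cancel_left_pos) auto
  then have "n = 0" by linarith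
  then show ?thesis using n by simp
qed

lemma inj_on_cis: "inj_on cis {a<..<a + 2 * pi}"
  by (rule inj_onI) (auto intro!: cis_cancel)

lemma cis_image_interval: "cis ` {a<..<a + 2 * pi} = sphere 0 1 - {cis a}"
proof (intro equalityI subsetI)
  fix z assume "z \<in> cis ` {a<..<a + 2 * pi}"
  then obtain t where t: "a < t" "t < a + 2 * pi" "z = cis t" by auto
  have "cis t \<noteq> cis a" using cis_cancel[of t a] t by auto
  then show "z \<in> sphere 0 1 - {cis a}" using t by simp
next
  fix z assume z: "z \<in> sphere 0 1 - {cis a}"
  \<comment> \<open>Rotation by \<open>- a\<close> moves the omitted point \<open>cis a\<close> to
    1, where \<open>Arg2pi\<close> jumps, so \<open>a + t\<close> is the angle of \<open>z\<close>
    in the interval.\<close>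
  define t where "t = Arg2pi (z * cis (- a))"
  have n1: "norm (z * cis (- a)) = 1" using z by (simp add: norm_mult)
  have t: "0 \<le> t" "t < 2 * pi" using Arg2pi unfolding t_def by auto
  have "cis t = z * cis (- a)"
    using n1 complex_norm_eq_1_exp[of "z * cis (- a)"] unfolding t_def cis_conv_exp by simp
  then have "cis (a + t) = cis a * (z * cis (- a))" by (simp only: cis_mult[symmetric])
  also have "\<dots> = z * (cis a * cis (- a))" by (simp only: mult_ac)
  finally have c: "cis (a + t) = z" by (simp add: cis_mult)
  have "t \<noteq> 0" using c z by auto
  then show "z \<in> cis ` {a<..<a + 2 * pi}" using c t by (auto intro!: image_eqI[of _ _ "a + t"])
qed

lemma angle_continuous: "continuous_on (cis ` {a<..<a + 2 * pi}) (inv_into {a<..<a + 2 * pi} cis)"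
proof -
  let ?I = "{a<..<a + 2 * pi}"
  \<comment> \<open>On the arc the angle is \<open>a + Arg2pi (z * cis (- a))\<close>, a formula
    that is continuous off the nonnegative real axis.\<close>
  have A: "Arg2pi (cis t * cis (- a)) = t - a" if "t \<in> ?I" for t
    using that Arg2pi_unique[of 1 "t - a" "cis t * cis (- a)"] by (simp add: cis_mult cis_conv_exp[of "t - a"])
  have "continuous_on (cis ` ?I) (\<lambda>z. a + Arg2pi (z * cis (- a)))"
  proof (intro continuous_at_imp_continuous_on ballI)
    fix z assume "z \<in> cis ` ?I"
    then obtain t where t: "t \<in> ?I" "z = cis t" by blast
    have "z * cis (- a) \<notin> \<real>\<^sub>\<ge>\<^sub>0"
    proof
      assume "z * cis (- a) \<in> \<real>\<^sub>\<ge>\<^sub>0"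
      then have "Arg2pi (z * cis (- a)) = 0" by (simp add: Arg2pi_eq_0 complex_nonneg_Reals_iff complex_is_Real_iff)
      then show False using A[OF t(1)] t by simp
    qed
    then have "isCont (\<lambda>z. Arg2pi (z * cis (- a))) z"
      using isCont_o2[of z "\<lambda>z. z * cis (- a)" Arg2pi] continuous_at_Arg2pi by (simp add: continuous_intros)
    then show "isCont (\<lambda>z. a + Arg2pi (z * cis (- a))) z" by (intro continuous_intros)
  qed
  then show ?thesis
    by (rule continuous_on_cong[OF refl, THEN iffD1, rotated]) (auto simp: A inj_on_cis)
qed

lemma points_circle: "points circle = sphere 0 1"
  by (simp add: points_def circle_def)

lemma mtop_circle: "mtop circle = top_of_set (sphere 0 1)"
  by (simp add: circle_def)

lemma atlas_circle: "atlas circle = range (\<lambda>a. (cis ` {a<..<a + 2 * pi}, inv_into {a<..<a + 2 * pi} cis))"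
  by (simp add: circle_def)

text \<open>Locally the angle of \<open>cis t\<close> is \<open>t\<close> minus a fixed multiple of
  \<open>2 * pi\<close>, hence a translation.\<close>

lemma smooth_on_angle_cis:
  "smooth_on {t. cis t \<in> cis ` {a<..<a + 2 * pi}} (\<lambda>t. inv_into {a<..<a + 2 * pi} cis (cis t))"
proof (rule smooth_on_local)
  fix t assume "t \<in> {t. cis t \<in> cis ` {a<..<a + 2 * pi}}"
  then obtain s where s: "s \<in> {a<..<a + 2 * pi}" "cis t = cis s" by auto
  then obtain n :: int where n: "t = s + 2 * pi * n" using cis_eq_cis by blast
  define T where "T = {a + 2 * pi * n<..<a + 2 * pi * n + 2 * pi}"
  have "smooth_on T (\<lambda>t. t - 2 * pi * n)"
    unfolding T_def by (intro smooth_on_intros) auto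
  then have "smooth_on T (\<lambda>t. inv_into {a<..<a + 2 * pi} cis (cis t))"
  proof (rule smooth_on_cong[rotated 2])
    fix t assume t: "t \<in> T"
    have "cis (t - 2 * pi * n) = cis t" unfolding cis_eq_cis by (rule exI[of _ "- n"]) simp
    moreover have "t - 2 * pi * n \<in> {a<..<a + 2 * pi}" using t by (auto simp: T_def)
    ultimately show "t - 2 * pi * n = inv_into {a<..<a + 2 * pi} cis (cis t)"
      using inv_into_f_f[OF inj_on_cis] by metis
  qed (simp add: T_def)
  moreover have "open T" "t \<in> T" using s n by (auto simp: T_def)
  ultimately show "\<exists>T. open T \<and> t \<in> T \<and> smooth_on T (\<lambda>t. inv_into {a<..<a + 2 * pi} cis (cis t))" by blast
qed

lemma premanifold_circle [simp]: "premanifold circle"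
  unfolding premanifold_def
proof (intro conjI)
  have "z \<in> \<Union> (fst ` atlas circle)" if z: "z \<in> sphere 0 1" for z
  proof -
    \<comment> \<open>The chart that omits the antipode of \<open>z\<close> contains
      \<open>z\<close>.\<close>
    have "z \<noteq> cis (Arg2pi (- z))"
      using z complex_norm_eq_1_exp[of "- z"] unfolding cis_conv_exp by (auto simp: eq_neg_iff_add_eq_0)
    then have "z \<in> cis ` {Arg2pi (- z)<..<Arg2pi (- z) + 2 * pi}" using z by (simp only: cis_image_interval) simp
    then show ?thesis unfolding atlas_circle image_image fst_conv by (intro UN_I[OF UNIV_I])
  qed
  moreover have "\<Union> (fst ` atlas circle) \<subseteq> sphere 0 1" by (auto simp: atlas_circle)
  ultimately show "\<Union> (fst ` atlas circle) = points circle"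
    unfolding points_circle by blast
  have H: "openin (mtop circle) (cis ` I) \<and> open (inv_into I cis ` (cis ` I)) \<and>
      homeomorphic_map (subtopology (mtop circle) (cis ` I)) (top_of_set (inv_into I cis ` (cis ` I))) (inv_into I cis)"
    if I: "I = {a<..<a + 2 * pi}" for a I
  proof -
    have i: "inv_into I cis ` (cis ` I) = I" using inj_on_cis[of a] by (simp add: I)
    have "openin (mtop circle) (cis ` I)"
      by (auto simp: mtop_circle I cis_image_interval openin_open Diff_eq intro!: exI[of _ "- {cis a}"])
    moreover have "homeomorphic_maps (top_of_set (cis ` I)) (top_of_set I) (inv_into I cis) cis"
      using angle_continuous[of a] inj_on_cis[of a] i unfolding homeomorphic_maps_def
      by (auto simp: I continuous_map_in_subtopology intro!: continuous_intros)
    moreover have "sphere 0 1 \<inter> cis ` I = cis ` I" using cis_image_interval[of a] I by auto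
    ultimately show ?thesis
      unfolding i by (auto simp: mtop_circle subtopology_subtopology I homeomorphic_map_maps)
  qed
  then show "\<forall>(U, \<phi>)\<in>atlas circle. openin (mtop circle) U \<and> open (\<phi> ` U) \<and>
      homeomorphic_map (subtopology (mtop circle) U) (top_of_set (\<phi> ` U)) \<phi>"
    by (force simp: atlas_circle)
  have T: "smooth_on (inv_into I cis ` (cis ` I \<inter> cis ` J)) (inv_into J cis \<circ> inv_into (cis ` I) (inv_into I cis))"
    if I: "I = {a<..<a + 2 * pi}" and J: "J = {b<..<b + 2 * pi}" for a b I J
  proof -
    have i: "inv_into I cis (cis t) = t" if "t \<in> I" for t using inj_on_cis[of a] that by (simp add: I)
    have j: "inv_into (cis ` I) (inv_into I cis) t = cis t" if "t \<in> I" for t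
      by (rule inv_into_f_eq[OF inj_on_inv_into]) (use that i in auto)
    have im: "inv_into I cis ` (cis ` I \<inter> cis ` J) = I \<inter> {t. cis t \<in> cis ` J}"
    proof (intro equalityI subsetI)
      fix t assume "t \<in> inv_into I cis ` (cis ` I \<inter> cis ` J)"
      then obtain s where s: "s \<in> I" "cis s \<in> cis ` J" "t = inv_into I cis (cis s)" by blast
      then show "t \<in> I \<inter> {t. cis t \<in> cis ` J}" by (simp add: i)
    next
      fix t assume "t \<in> I \<inter> {t. cis t \<in> cis ` J}"
      then show "t \<in> inv_into I cis ` (cis ` I \<inter> cis ` J)"
        using i[of t] by (intro image_eqI[of _ _ "cis t"]) auto
    qed
    have o: "open (I \<inter> {t. cis t \<in> cis ` J})"
    proof -
      have "{t. cis t \<in> cis ` J} = cis -` (- {cis b})" unfolding J cis_image_interval by auto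
      moreover have "open (cis -` (- {cis b}))" by (rule open_vimage) (auto intro: continuous_intros)
      ultimately show ?thesis by (simp add: I open_Int)
    qed
    show ?thesis unfolding im
      by (rule smooth_on_cong[OF o _ smooth_on_subset[OF smooth_on_angle_cis[of b]]]) (use j J in auto)
  qed
  then show "\<forall>(U, \<phi>)\<in>atlas circle. \<forall>(V, \<psi>)\<in>atlas circle. smooth_on (\<phi> ` (U \<inter> V)) (\<psi> \<circ> inv_into U \<phi>)"
    by (force simp: atlas_circle)
qed

lemma smooth_map_cis: "smooth_map euclid circle cis"
proof -
  have "smooth_on (cis -` V) (\<psi> \<circ> cis)" if "(V, \<psi>) \<in> atlas circle" for V \<psi>
    using that smooth_on_angle_cis by (auto simp: atlas_circle o_def vimage_def)
  then show ?thesis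
    by (auto simp: smooth_map_def mtop_circle continuous_map_in_subtopology intro!: continuous_intros)
qed

lemma cis_in_circle [simp]: "cis t \<in> points circle"
  by (simp add: points_circle)

lemma circle_cis:
  assumes "z \<in> points circle"
  obtains t where "z = cis t"
proof
  show "z = cis (Arg2pi z)"
    using assms complex_norm_eq_1_exp[of z] by (simp add: cis_conv_exp points_circle)
qed

section \<open>Tangent maps\<close>

text \<open>Charts, their inverses and local sections are smooth only near a point, so the chain
  rule for \<open>tan_map\<close> is stated for germs.\<close>

definition smooth_near ::
  "('a, 'e::euclidean_space) manifold \<Rightarrow> ('b, 'f::euclidean_space) manifold \<Rightarrow> ('a \<Rightarrow> 'b) \<Rightarrow> 'a \<Rightarrow> bool"
where
  "smooth_near M N f x \<longleftrightarrow> (\<exists>W. openin (mtop M) W \<and> x \<in> W \<and> smooth_map (open_sub M W) N f)"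

lemma smooth_nearI: "openin (mtop M) W \<Longrightarrow> x \<in> W \<Longrightarrow> smooth_map (open_sub M W) N f \<Longrightarrow> smooth_near M N f x"
  by (auto simp: smooth_near_def)

lemma smooth_map_near: "premanifold M \<Longrightarrow> smooth_map M N f \<Longrightarrow> x \<in> points M \<Longrightarrow> smooth_near M N f x"
  by (rule smooth_nearI[of M "points M"]) (auto simp: points_def[symmetric] open_sub_points intro: openin_topspace[of "mtop M", folded points_def])

lemma smooth_near_points: "smooth_near M N f x \<Longrightarrow> x \<in> points M \<and> f x \<in> points N"
  unfolding smooth_near_def using smooth_map_points points_open_sub_openin points_openin by (metis subsetD)

lemma smooth_near_chart:
  assumes M: "premanifold M" and N: "premanifold N" and f: "smooth_near M N f x"
    and U: "(U, \<phi>) \<in> atlas M" "x \<in> U" and V: "(V, \<psi>) \<in> atlas N" "f x \<in> V"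
  obtains A where "openin (mtop M) A" "x \<in> A" "A \<subseteq> U" "f ` A \<subseteq> V" "open (\<phi> ` A)"
    "smooth_on (\<phi> ` A) (\<lambda>y. \<psi> (f (inv_into U \<phi> y)))"
proof -
  obtain W where W: "openin (mtop M) W" "x \<in> W" and f: "smooth_map (open_sub M W) N f"
    using f by (auto simp: smooth_near_def)
  note MW = premanifold_open_sub[OF M W(1)]
  have UW: "(U \<inter> W, \<phi>) \<in> atlas (open_sub M W)" using U(1) by (force simp: atlas_open_sub)
  define A where "A = U \<inter> W \<inter> f -` V"
  have A: "openin (mtop M) A"
    using smooth_map_chart_open(1)[OF MW N f UW V(1)] W(1) by (simp add: openin_open_subtopology A_def)
  have op: "open (\<phi> ` A)" by (rule chart_image_open[OF M U(1) A]) (auto simp: A_def)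
  have "smooth_on (\<phi> ` A) (\<lambda>y. \<psi> (f (inv_into U \<phi> y)))"
  proof (rule smooth_on_cong[OF op _ smooth_map_chart[OF f UW V(1), folded A_def]])
    fix y assume "y \<in> \<phi> ` A"
    then have "y \<in> \<phi> ` (U \<inter> W)" by (auto simp: A_def)
    then show "\<psi> (f (inv_into (U \<inter> W) \<phi> y)) = \<psi> (f (inv_into U \<phi> y))"
      by (simp add: inv_into_Int[OF chart_inj[OF M U(1)]])
  qed
  then show ?thesis using that[OF A _ _ _ op] U V W by (auto simp: A_def)
qed

lemma tan_map_chart:
  assumes "chart_at M x = (U, \<phi>)" "chart_at N (f x) = (V, \<psi>)"
  shows "tan_map M N f x = frechet_derivative (\<lambda>y. \<psi> (f (inv_into U \<phi> y))) (at (\<phi> x))"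
  using assms by (simp add: tan_map_def o_def)

lemma chart_at_cases:
  assumes "premanifold M" "x \<in> points M"
  obtains U \<phi> where "chart_at M x = (U, \<phi>)" "(U, \<phi>) \<in> atlas M" "x \<in> U"
  using chart_at_atlas[OF assms] by (metis prod.collapse)

lemma tan_map_has_derivative:
  assumes M: "premanifold M" and N: "premanifold N" and f: "smooth_near M N f x"
    and c: "chart_at M x = (U, \<phi>)" "chart_at N (f x) = (V, \<psi>)"
  shows "((\<lambda>y. \<psi> (f (inv_into U \<phi> y))) has_derivative tan_map M N f x) (at (\<phi> x))"
proof -
  have p: "x \<in> points M" "f x \<in> points N" using smooth_near_points[OF f] by auto
  have U: "(U, \<phi>) \<in> atlas M" "x \<in> U" using chart_at_atlas[OF M p(1)] c by auto
  have V: "(V, \<psi>) \<in> atlas N" "f x \<in> V" using chart_at_atlas[OF N p(2)] c by auto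
  obtain A where "x \<in> A" "smooth_on (\<phi> ` A) (\<lambda>y. \<psi> (f (inv_into U \<phi> y)))"
    using smooth_near_chart[OF M N f U V] by metis
  then show ?thesis unfolding tan_map_chart[of M x U \<phi> N f V \<psi>, OF c] by (intro smooth_on_has_derivative) auto
qed

lemma tan_map_linear:
  assumes "premanifold M" "premanifold N" "smooth_near M N f x"
  shows "linear (tan_map M N f x)"
  using has_derivative_linear[OF tan_map_has_derivative[OF assms]] by (metis prod.exhaust_sel)

lemma tan_map_unique:
  assumes M: "premanifold M" and U: "chart_at M x = (U, \<phi>)" and V: "chart_at N (f x) = (V, \<psi>)"
    and D: "((\<lambda>y. \<psi> (f (inv_into U \<phi> y))) has_derivative D) (at (\<phi> x))"
  shows "tan_map M N f x = D"
  unfolding tan_map_chart[of M x U \<phi> N f V \<psi>, OF U V] using frechet_derivative_at[OF D] by simp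

text \<open>The preferred chart at \<open>f x\<close> mediates: the two coordinate expressions
  compose because this chart and its inverse cancel near \<open>x\<close>.\<close>

lemma tan_map_compose:
  assumes M: "premanifold M" and N: "premanifold N" and K: "premanifold K"
    and f: "smooth_near M N f x" and g: "smooth_near N K g (f x)"
  shows "tan_map M K (\<lambda>x. g (f x)) x v = tan_map N K g (f x) (tan_map M N f x v)"
proof -
  have p: "x \<in> points M" "f x \<in> points N" "g (f x) \<in> points K"
    using smooth_near_points[OF f] smooth_near_points[OF g] by auto
  obtain U \<phi> where U: "chart_at M x = (U, \<phi>)" "(U, \<phi>) \<in> atlas M" "x \<in> U" using chart_at_cases[OF M p(1)] .
  obtain V \<psi> where V: "chart_at N (f x) = (V, \<psi>)" "(V, \<psi>) \<in> atlas N" "f x \<in> V" using chart_at_cases[OF N p(2)] .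
  obtain S \<kappa> where S: "chart_at K (g (f x)) = (S, \<kappa>)" using p(3) by fastforce
  obtain A where A: "x \<in> A" "A \<subseteq> U" "f ` A \<subseteq> V" "open (\<phi> ` A)"
    using smooth_near_chart[OF M N f U(2,3) V(2,3)] by metis
  have i: "inv_into U \<phi> (\<phi> x) = x" using chart_inv[OF M U(2,3)] .
  have 1: "((\<lambda>y. \<psi> (f (inv_into U \<phi> y))) has_derivative tan_map M N f x) (at (\<phi> x))"
    by (rule tan_map_has_derivative[OF M N f U(1) V(1)])
  have 2: "((\<lambda>y. \<kappa> (g (inv_into V \<psi> y))) has_derivative tan_map N K g (f x)) (at (\<psi> (f x)))"
    by (rule tan_map_has_derivative[OF N K g V(1) S])
  have "((\<lambda>y. \<kappa> (g (inv_into V \<psi> (\<psi> (f (inv_into U \<phi> y)))))) has_derivative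
      (\<lambda>v. tan_map N K g (f x) (tan_map M N f x v))) (at (\<phi> x))"
    using diff_chain_at[OF 1, of "\<lambda>y. \<kappa> (g (inv_into V \<psi> y))"] 2 by (simp add: i o_def)
  then have "((\<lambda>y. \<kappa> (g (f (inv_into U \<phi> y)))) has_derivative
      (\<lambda>v. tan_map N K g (f x) (tan_map M N f x v))) (at (\<phi> x))"
  proof (rule has_derivative_transform_within_open[OF _ A(4)])
    fix y assume "y \<in> \<phi> ` A"
    then obtain a where a: "a \<in> A" "y = \<phi> a" by blast
    then have "a \<in> U" "f a \<in> V" using A by auto
    then show "\<kappa> (g (inv_into V \<psi> (\<psi> (f (inv_into U \<phi> y))))) = \<kappa> (g (f (inv_into U \<phi> y)))"
      by (simp add: a chart_inv[OF M U(2)] chart_inv[OF N V(2)])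
  qed (use A in auto)
  then show ?thesis using tan_map_unique[OF M U(1), of K "\<lambda>x. g (f x)"] S by metis
qed

lemma smooth_near_compose:
  assumes M: "premanifold M" and N: "premanifold N" and K: "premanifold K"
    and f: "smooth_near M N f x" and g: "smooth_near N K g (f x)"
  shows "smooth_near M K (\<lambda>x. g (f x)) x"
proof -
  obtain W where W: "openin (mtop M) W" "x \<in> W" and f: "smooth_map (open_sub M W) N f"
    using f by (auto simp: smooth_near_def)
  obtain V where V: "openin (mtop N) V" "f x \<in> V" and g: "smooth_map (open_sub N V) K g"
    using g by (auto simp: smooth_near_def)
  note MW = premanifold_open_sub[OF M W(1)]
  define A where "A = {x \<in> W. f x \<in> V}"
  have A: "openin (mtop M) A"
    using smooth_map_vimage[OF f V(1)] points_open_sub_openin[OF W(1)] W(1)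
    by (simp add: A_def openin_open_subtopology)
  have f': "smooth_map (open_sub M A) N f"
    by (rule smooth_map_smaller[OF M N W(1) A _ f]) (auto simp: A_def)
  note MA = premanifold_open_sub[OF M A]
  have "smooth_map (open_sub M A) (open_sub N V) f"
    by (rule smooth_map_into_open_sub[OF MA N f']) (auto simp: points_open_sub A_def)
  from smooth_map_compose[OF MA premanifold_open_sub[OF N V(1)] K this g]
  show ?thesis using A W V by (intro smooth_nearI[of M A]) (auto simp: A_def)
qed

lemma frechet_derivative_cong_open:
  assumes "open S" "x \<in> S" "\<And>y. y \<in> S \<Longrightarrow> f y = g y"
  shows "frechet_derivative f (at x) = frechet_derivative g (at x)"
proof -
  have "(f has_derivative D) (at x) \<longleftrightarrow> (g has_derivative D) (at x)" for D
    using has_derivative_transform_within_open[of f D x UNIV S g]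
      has_derivative_transform_within_open[of g D x UNIV S f] assms by auto
  then show ?thesis by (simp add: frechet_derivative_def)
qed

lemma tan_map_cong:
  assumes M: "premanifold M" and W: "openin (mtop M) W" "x \<in> W" and eq: "\<And>z. z \<in> W \<Longrightarrow> f z = g z"
  shows "tan_map M N f x = tan_map M N g x"
proof -
  obtain U \<phi> where U: "chart_at M x = (U, \<phi>)" "(U, \<phi>) \<in> atlas M" "x \<in> U"
    using chart_at_cases[OF M] points_openin[OF W(1)] W(2) by blast
  obtain V \<psi> where V: "chart_at N (f x) = (V, \<psi>)" by fastforce
  then have V': "chart_at N (g x) = (V, \<psi>)" using eq W(2) by simp
  show ?thesis unfolding tan_map_chart[of M x U \<phi> N f V \<psi>, OF U(1) V] tan_map_chart[of M x U \<phi> N g V \<psi>, OF U(1) V']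
    by (rule frechet_derivative_cong_open[OF chart_Int_open[OF M U(2) W(1)]])
      (use U W eq chart_inv[OF M U(2)] in auto)
qed

lemma tan_map_id:
  assumes M: "premanifold M" and x: "x \<in> points M"
  shows "tan_map M M (\<lambda>x. x) x v = v"
proof -
  obtain U \<phi> where U: "chart_at M x = (U, \<phi>)" "(U, \<phi>) \<in> atlas M" "x \<in> U" using chart_at_cases[OF M x] .
  have "((\<lambda>y. \<phi> (inv_into U \<phi> y)) has_derivative (\<lambda>v. v)) (at (\<phi> x))"
    by (rule has_derivative_transform_within_open[OF has_derivative_ident chart_homeomorphic(2)[OF M U(2)]])
      (use U chart_inv[OF M U(2)] in auto)
  from tan_map_unique[OF M U(1), of M "\<lambda>x. x", OF U(1) this] show ?thesis by simp
qed

lemma tan_map_euclid: "tan_map euclid euclid f x = frechet_derivative f (at x)"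
  by (simp add: tan_map_def o_def)

lemma smooth_near_euclid: "open S \<Longrightarrow> x \<in> S \<Longrightarrow> smooth_on S f \<Longrightarrow> smooth_near euclid euclid f x"
  by (rule smooth_nearI[of _ S]) (auto simp: smooth_map_euclid)

lemma smooth_near_chart_map:
  "premanifold M \<Longrightarrow> (U, \<phi>) \<in> atlas M \<Longrightarrow> x \<in> U \<Longrightarrow> smooth_near M euclid \<phi> x"
  by (rule smooth_nearI[OF chart_openin _ smooth_map_chart_map])

lemma smooth_near_chart_inv:
  "premanifold M \<Longrightarrow> (U, \<phi>) \<in> atlas M \<Longrightarrow> y \<in> \<phi> ` U \<Longrightarrow> smooth_near euclid M (inv_into U \<phi>) y"
  by (rule smooth_nearI[of _ "\<phi> ` U"]) (auto simp: chart_homeomorphic(2) smooth_map_chart_inv)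

text \<open>Obtained by differentiating the two identities between a chart and its inverse. It
  compares components in an arbitrary chart with those in the preferred chart, which are the tangent
  vectors themselves.\<close>

lemma chart_frame:
  assumes M: "premanifold M" and U: "(U, \<phi>) \<in> atlas M" and x: "x \<in> U"
  shows "tan_map M euclid \<phi> x (tan_map euclid M (inv_into U \<phi>) (\<phi> x) v) = v"
    and "tan_map euclid M (inv_into U \<phi>) (\<phi> x) (tan_map M euclid \<phi> x w) = w"
proof -
  note i = chart_inv[OF M U]
  have o: "open (\<phi> ` U)" by (rule chart_homeomorphic(2)[OF M U])
  have s1: "smooth_near euclid M (inv_into U \<phi>) (\<phi> x)" using smooth_near_chart_inv[OF M U] x by blast
  have s2: "smooth_near M euclid \<phi> x" by (rule smooth_near_chart_map[OF M U x])
  have "tan_map euclid euclid (\<lambda>y. \<phi> (inv_into U \<phi> y)) (\<phi> x) v = tan_map euclid euclid (\<lambda>y. y) (\<phi> x) v"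
    by (rule fun_cong[OF tan_map_cong[of _ "\<phi> ` U"]]) (use x o i in auto)
  then show "tan_map M euclid \<phi> x (tan_map euclid M (inv_into U \<phi>) (\<phi> x) v) = v"
    using tan_map_compose[OF premanifold_euclid M premanifold_euclid s1, of \<phi> v] s2
    by (simp add: i[OF x] tan_map_id)
  have "tan_map M M (\<lambda>x. inv_into U \<phi> (\<phi> x)) x w = tan_map M M (\<lambda>x. x) x w"
    by (rule fun_cong[OF tan_map_cong[OF M chart_openin[OF M U] x]]) (use i in auto)
  then show "tan_map euclid M (inv_into U \<phi>) (\<phi> x) (tan_map M euclid \<phi> x w) = w"
    using tan_map_compose[OF M premanifold_euclid M s2 s1, of w] chart_subset[OF M U] x
    by (auto simp: tan_map_id[OF M])
qed

text \<open>Tangent vectors are components in the preferred chart by convention, so there the change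
  of frame is trivial. Derivatives computed in the preferred chart at \<open>x\<close> thus speak
  directly of tangent vectors at \<open>x\<close>.\<close>

lemma chart_at_frame:
  assumes M: "premanifold M" and x: "x \<in> points M" and U: "chart_at M x = (U, \<phi>)"
  shows "tan_map euclid M (inv_into U \<phi>) (\<phi> x) v = v" "tan_map M euclid \<phi> x v = v"
proof -
  have U': "(U, \<phi>) \<in> atlas M" "x \<in> U" using chart_at_atlas[OF M x] U by auto
  have "((\<lambda>y. \<phi> (inv_into U \<phi> y)) has_derivative (\<lambda>v. v)) (at (\<phi> x))"
    by (rule has_derivative_transform_within_open[OF has_derivative_ident chart_homeomorphic(2)[OF M U'(1)]])
      (use U'(2) chart_inv[OF M U'(1)] in auto)
  then have "((\<lambda>y. id (\<phi> (inv_into U \<phi> y))) has_derivative (\<lambda>v. v)) (at (\<phi> x))" by simp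
  from tan_map_unique[OF M U, of euclid \<phi> UNIV id, OF _ this]
  show *: "tan_map M euclid \<phi> x v = v" for v by simp
  show "tan_map euclid M (inv_into U \<phi>) (\<phi> x) v = v"
    using chart_frame(2)[OF M U', of v] by (simp add: *)
qed

section \<open>Exterior calculus\<close>

lemma coord_rep_chart:
  "coord_rep M (U, \<phi>) \<alpha> y vs = \<alpha> (inv_into U \<phi> y) (map (tan_map euclid M (inv_into U \<phi>) y) vs)"
  by (simp add: coord_rep_def pullback_def)

lemma fun_d_tan_map: "fun_d M f x [v] = tan_map M euclid f x v"
  by (simp add: fun_d_def ext_d_def flat_d_def tan_map_def coord_rep_def pullback_def o_def case_prod_beta)

lemma tan_map_fun_d:
  assumes M: "premanifold M" and N: "premanifold N"
    and h: "smooth_near M N h x" and f: "smooth_near N euclid f (h x)"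
  shows "fun_d N f (h x) [tan_map M N h x v] = fun_d M (\<lambda>x. f (h x)) x [v]"
  unfolding fun_d_tan_map using tan_map_compose[OF M N premanifold_euclid h f] by simp

lemma coord_rep_fun_d:
  assumes M: "premanifold M" and U: "(U, \<phi>) \<in> atlas M" and x: "x \<in> U" and f: "smooth_near M euclid f x"
  shows "coord_rep M (U, \<phi>) (fun_d M f) (\<phi> x) [v] = frechet_derivative (\<lambda>y. f (inv_into U \<phi> y)) (at (\<phi> x)) v"
proof -
  have "smooth_near euclid M (inv_into U \<phi>) (\<phi> x)" using smooth_near_chart_inv[OF M U] x by blast
  from tan_map_fun_d[OF premanifold_euclid M this, of f v] f
  show ?thesis by (simp add: coord_rep_chart chart_inv[OF M U x] fun_d_tan_map tan_map_euclid)
qed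

lemma length_one: "length vs = 1 \<Longrightarrow> vs = [vs ! 0]"
  by (cases vs) auto

lemma smooth_tensor_on_linear:
  assumes "smooth_tensor_on M U k \<alpha>" "x \<in> U" "length vs = k" "i < k"
  shows "linear (\<lambda>v. \<alpha> x (vs[i := v]))"
  using assms by (simp add: smooth_tensor_on_def)

lemma smooth_tensor_on_chart:
  assumes "smooth_tensor_on M U k \<alpha>" "(V, \<phi>) \<in> atlas M" "length vs = k"
  shows "smooth_on (\<phi> ` (V \<inter> U)) (\<lambda>y. coord_rep M (V, \<phi>) \<alpha> y vs)"
  using assms by (auto simp: smooth_tensor_on_def)

lemma one_form_linear:
  assumes "smooth_tensor_on M U 1 \<alpha>" "x \<in> U"
  shows "linear (\<lambda>v. \<alpha> x [v])"
  using smooth_tensor_on_linear[OF assms, of "[0]" 0] by simp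

lemma smooth_one_form_chart:
  assumes "smooth_tensor_on M U 1 \<alpha>" "(V, \<phi>) \<in> atlas M"
  shows "smooth_on (\<phi> ` (V \<inter> U)) (\<lambda>y. \<alpha> (inv_into V \<phi> y) [tan_map euclid M (inv_into V \<phi>) y v])"
  using smooth_tensor_on_chart[OF assms, of "[v]"] by (simp add: coord_rep_chart)

lemma smooth_one_formI:
  assumes "\<And>x. x \<in> U \<Longrightarrow> linear (\<lambda>v. \<alpha> x [v])"
    and "\<And>V \<phi> v. (V, \<phi>) \<in> atlas M \<Longrightarrow> smooth_on (\<phi> ` (V \<inter> U)) (\<lambda>y. coord_rep M (V, \<phi>) \<alpha> y [v])"
  shows "smooth_tensor_on M U 1 \<alpha>"
  unfolding smooth_tensor_on_def
proof (intro conjI ballI allI impI, goal_cases)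
  case (1 x vs i)
  then obtain w where "vs = [w]" using length_one by metis
  then show ?case using assms(1)[OF 1(1)] 1(3) by simp
next
  case (2 c)
  have "smooth_on (snd c ` (fst c \<inter> U)) (\<lambda>y. coord_rep M (fst c, snd c) \<alpha> y vs)" if l: "length vs = 1" for vs
  proof -
    obtain v where "vs = [v]" using length_one[OF l] by blast
    then show ?thesis using assms(2)[of "fst c" "snd c" v] 2 by simp
  qed
  then show ?case by (simp add: case_prod_beta)
qed

lemma smooth_form_on_one: "smooth_form_on M U 1 \<alpha> \<longleftrightarrow> smooth_tensor_on M U 1 \<alpha>"
  unfolding smooth_form_on_def using length_one by (metis distinct_singleton)

lemma chart_Int_ball:
  assumes "premanifold M" "(V, \<phi>) \<in> atlas M" "openin (mtop M) U" "y \<in> \<phi> ` (V \<inter> U)"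
  shows "inv_into V \<phi> y \<in> V \<inter> U" "\<phi> (inv_into V \<phi> y) = y"
  using assms(4) chart_inv[OF assms(1,2)] by auto

lemma smooth_fun_d:
  assumes M: "premanifold M" and U: "openin (mtop M) U" and f: "smooth_map (open_sub M U) euclid f"
  shows "smooth_tensor_on M U 1 (fun_d M f)"
proof (rule smooth_one_formI)
  have n: "smooth_near M euclid f x" if "x \<in> U" for x using smooth_nearI[OF U that f] .
  fix x assume "x \<in> U"
  then show "linear (\<lambda>v. fun_d M f x [v])"
    unfolding fun_d_tan_map using tan_map_linear[OF M premanifold_euclid n] by simp
next
  have n: "smooth_near M euclid f x" if "x \<in> U" for x using smooth_nearI[OF U that f] .
  fix V \<phi> v assume V: "(V, \<phi>) \<in> atlas M"
  have o: "open (\<phi> ` (V \<inter> U))" by (rule chart_Int_open[OF M V U])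
  have VU: "(V \<inter> U, \<phi>) \<in> atlas (open_sub M U)" using V by (force simp: atlas_open_sub)
  have "smooth_on (\<phi> ` (V \<inter> U)) (\<lambda>y. f (inv_into (V \<inter> U) \<phi> y))"
    by (rule smooth_map_real[OF premanifold_open_sub[OF M U] f VU])
  then have s: "smooth_on (\<phi> ` (V \<inter> U)) (\<lambda>y. f (inv_into V \<phi> y))"
    by (rule smooth_on_cong[OF o, rotated]) (simp add: inv_into_Int[OF chart_inj[OF M V]])
  show "smooth_on (\<phi> ` (V \<inter> U)) (\<lambda>y. coord_rep M (V, \<phi>) (fun_d M f) y [v])"
  proof (rule smooth_on_cong[OF o _ smooth_on_derivative[OF s, of v]])
    fix y assume "y \<in> \<phi> ` (V \<inter> U)"
    then obtain x where x: "x \<in> V" "x \<in> U" "y = \<phi> x" by auto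
    show "frechet_derivative (\<lambda>y. f (inv_into V \<phi> y)) (at y) v = coord_rep M (V, \<phi>) (fun_d M f) y [v]"
      unfolding x(3) coord_rep_fun_d[OF M V x(1) n[OF x(2)]] ..
  qed
qed

lemma smooth_chart_function:
  assumes M: "premanifold M" and U: "openin (mtop M) U" and f: "smooth_map (open_sub M U) euclid f" and V: "(V, \<phi>) \<in> atlas M"
  shows "smooth_on (\<phi> ` (V \<inter> U)) (\<lambda>y. f (inv_into V \<phi> y))"
proof -
  have VU: "(V \<inter> U, \<phi>) \<in> atlas (open_sub M U)" using V by (force simp: atlas_open_sub)
  from smooth_map_real[OF premanifold_open_sub[OF M U] f VU] show ?thesis
    by (rule smooth_on_cong[OF chart_Int_open[OF M V U], rotated]) (simp add: inv_into_Int[OF chart_inj[OF M V]])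
qed

lemma smooth_tensor_on_add:
  assumes M: "premanifold M" and U: "openin (mtop M) U" and "smooth_tensor_on M U k \<alpha>" "smooth_tensor_on M U k \<beta>"
  shows "smooth_tensor_on M U k (\<lambda>x vs. \<alpha> x vs + \<beta> x vs)"
  unfolding smooth_tensor_on_def
proof (intro conjI ballI allI impI, goal_cases)
  case (1 x vs i)
  then show ?case using smooth_tensor_on_linear[OF assms(3)] smooth_tensor_on_linear[OF assms(4)]
    by (intro linear_compose_add) auto
next
  case (2 c)
  then obtain V \<phi> where c: "c = (V, \<phi>)" "(V, \<phi>) \<in> atlas M" by (cases c) auto
  show ?case unfolding c
    using smooth_tensor_on_chart[OF assms(3) c(2)] smooth_tensor_on_chart[OF assms(4) c(2)]
    by (auto simp: coord_rep_chart intro!: smooth_on_add chart_Int_open[OF M c(2) U])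
qed

lemma smooth_tensor_on_linear_image:
  assumes M: "premanifold M" and U: "openin (mtop M) U" and \<alpha>: "smooth_tensor_on M U k \<alpha>" and L: "bounded_linear L"
  shows "smooth_tensor_on M U k (\<lambda>x vs. L (\<alpha> x vs))"
  unfolding smooth_tensor_on_def
proof (intro conjI ballI allI impI, goal_cases)
  case (1 x vs i)
  then show ?case using linear_compose[OF smooth_tensor_on_linear[OF \<alpha>] bounded_linear.linear[OF L]] by (simp add: o_def)
next
  case (2 c)
  then obtain V \<phi> where c: "c = (V, \<phi>)" "(V, \<phi>) \<in> atlas M" by (cases c) auto
  show ?case unfolding c
    using smooth_tensor_on_chart[OF \<alpha> c(2)]
    by (auto simp: coord_rep_chart intro!: smooth_on_linear_comp[OF _ L] chart_Int_open[OF M c(2) U])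
qed

lemma smooth_tensor_on_mult:
  fixes \<alpha> :: "('a, 'e::euclidean_space, real) tensor"
  assumes M: "premanifold M" and U: "openin (mtop M) U" and f: "smooth_map (open_sub M U) euclid f" and \<alpha>: "smooth_tensor_on M U k \<alpha>"
  shows "smooth_tensor_on M U k (\<lambda>x vs. f x * \<alpha> x vs)"
  unfolding smooth_tensor_on_def
proof (intro conjI ballI allI impI, goal_cases)
  case (1 x vs i)
  then show ?case using linear_compose_scale_right[OF smooth_tensor_on_linear[OF \<alpha>], of x vs i "f x"] by simp
next
  case (2 c)
  then obtain V \<phi> where c: "c = (V, \<phi>)" "(V, \<phi>) \<in> atlas M" by (cases c) auto
  show ?case unfolding c
    using smooth_tensor_on_chart[OF \<alpha> c(2)] smooth_chart_function[OF M U f c(2)]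
    by (auto simp: coord_rep_chart intro!: smooth_on_mult chart_Int_open[OF M c(2) U])
qed

lemma smooth_tensor_on_product:
  fixes \<alpha> \<beta> :: "('a, 'e::euclidean_space, real) tensor"
  assumes M: "premanifold M" and U: "openin (mtop M) U" and \<alpha>: "smooth_tensor_on M U 1 \<alpha>" and \<beta>: "smooth_tensor_on M U 1 \<beta>"
  shows "smooth_tensor_on M U 2 (\<lambda>x vs. \<alpha> x [vs ! 0] * \<beta> x [vs ! 1])"
  unfolding smooth_tensor_on_def
proof (intro conjI ballI allI impI, goal_cases)
  case (1 x vs i)
  note la = one_form_linear[OF \<alpha> 1(1)] and lb = one_form_linear[OF \<beta> 1(1)]
  have "i = 0 \<or> i = 1" using 1 by auto
  then show ?case
    using linear_compose_scale_right[OF lb, of "\<alpha> x [vs ! 0]"] linear_compose_scale_right[OF la, of "\<beta> x [vs ! 1]"] 1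
    by (auto simp: mult.commute)
next
  case (2 c)
  then obtain V \<phi> where c: "c = (V, \<phi>)" "(V, \<phi>) \<in> atlas M" by (cases c) auto
  show ?case unfolding c
    using smooth_one_form_chart[OF \<alpha> c(2)] smooth_one_form_chart[OF \<beta> c(2)]
    by (auto simp: coord_rep_chart intro!: smooth_on_mult chart_Int_open[OF M c(2) U])
qed

subsection \<open>The exterior derivative\<close>

text \<open>Partial derivatives of one component in the preferred chart. They depend on the chart;
  only the alternating sums forming \<open>ext_d\<close> have an invariant meaning.\<close>

definition component_d ::
  "('a, 'e::euclidean_space) manifold \<Rightarrow> ('a, 'e, 'v::real_normed_vector) tensor \<Rightarrow> 'a \<Rightarrow> 'e list \<Rightarrow> 'e \<Rightarrow> 'v" where
  "component_d M \<alpha> x vs =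
     frechet_derivative (\<lambda>z. coord_rep M (chart_at M x) \<alpha> z vs) (at (snd (chart_at M x) x))"

lemma ext_d_1: "ext_d M \<alpha> x [u, v] = component_d M \<alpha> x [v] u - component_d M \<alpha> x [u] v"
  by (simp add: ext_d_def flat_d_def component_d_def lessThan_Suc)

lemma ext_d_2: "ext_d M \<alpha> x [u, v, w] =
    component_d M \<alpha> x [v, w] u - component_d M \<alpha> x [u, w] v + component_d M \<alpha> x [u, v] w"
  by (simp add: ext_d_def flat_d_def component_d_def lessThan_Suc numeral_2_eq_2)

lemma ext_d_3: "ext_d M \<alpha> x [a, b, c, d] =
    component_d M \<alpha> x [b, c, d] a - component_d M \<alpha> x [a, c, d] b +
    component_d M \<alpha> x [a, b, d] c - component_d M \<alpha> x [a, b, c] d"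
  by (simp add: ext_d_def flat_d_def component_d_def lessThan_Suc numeral_eq_Suc)

lemma component_d_cong:
  assumes M: "premanifold M" and U: "openin (mtop M) U" "x \<in> U"
    and eq: "\<And>z vs. z \<in> U \<Longrightarrow> length vs = k \<Longrightarrow> \<alpha> z vs = \<beta> z vs" and "length vs = k"
  shows "component_d M \<alpha> x vs = component_d M \<beta> x vs"
proof -
  obtain V \<phi> where V: "chart_at M x = (V, \<phi>)" "(V, \<phi>) \<in> atlas M" "x \<in> V"
    using chart_at_cases[OF M] points_openin[OF U(1)] U(2) by blast
  have "frechet_derivative (\<lambda>z. coord_rep M (V, \<phi>) \<alpha> z vs) (at (\<phi> x)) =
      frechet_derivative (\<lambda>z. coord_rep M (V, \<phi>) \<beta> z vs) (at (\<phi> x))"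
    by (rule frechet_derivative_cong_open[OF chart_Int_open[OF M V(2) U(1)]])
      (use U V chart_Int_ball[OF M V(2) U(1)] eq assms(5) in \<open>auto simp: coord_rep_chart\<close>)
  then show ?thesis by (simp add: component_d_def V)
qed

lemma component_has_derivative:
  assumes M: "premanifold M" and U: "openin (mtop M) U" "x \<in> U" and \<alpha>: "smooth_tensor_on M U k \<alpha>" and "length vs = k"
  shows "((\<lambda>z. coord_rep M (chart_at M x) \<alpha> z vs) has_derivative component_d M \<alpha> x vs) (at (snd (chart_at M x) x))"
proof -
  obtain V \<phi> where V: "chart_at M x = (V, \<phi>)" "(V, \<phi>) \<in> atlas M" "x \<in> V"
    using chart_at_cases[OF M] points_openin[OF U(1)] U(2) by blast
  show ?thesis unfolding component_d_def V(1)
    by (rule smooth_on_has_derivative[OF smooth_tensor_on_chart[OF \<alpha> V(2) assms(5)]]) (use U V in auto)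
qed

lemma component_d_eqI:
  assumes "((\<lambda>z. coord_rep M (chart_at M x) \<alpha> z vs) has_derivative D) (at (snd (chart_at M x) x))"
  shows "component_d M \<alpha> x vs = D"
  using frechet_derivative_at[OF assms] by (simp add: component_d_def)

lemma component_d_add:
  assumes M: "premanifold M" and U: "openin (mtop M) U" "x \<in> U"
    and "smooth_tensor_on M U k \<alpha>" "smooth_tensor_on M U k \<beta>" "length vs = k"
  shows "component_d M (\<lambda>x vs. \<alpha> x vs + \<beta> x vs) x vs u = component_d M \<alpha> x vs u + component_d M \<beta> x vs u"
proof -
  obtain V \<phi> where V: "chart_at M x = (V, \<phi>)" by fastforce
  from has_derivative_add[OF component_has_derivative[OF M U assms(4,6)] component_has_derivative[OF M U assms(5,6)]]
  show ?thesis by (subst component_d_eqI) (auto simp: V coord_rep_chart)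
qed

lemma component_d_linear_image:
  assumes M: "premanifold M" and U: "openin (mtop M) U" "x \<in> U"
    and "smooth_tensor_on M U k \<alpha>" "length vs = k" and L: "bounded_linear L"
  shows "component_d M (\<lambda>x vs. L (\<alpha> x vs)) x vs u = L (component_d M \<alpha> x vs u)"
proof -
  obtain V \<phi> where V: "chart_at M x = (V, \<phi>)" by fastforce
  from bounded_linear.has_derivative[OF L component_has_derivative[OF M U assms(4,5)]]
  show ?thesis by (subst component_d_eqI) (auto simp: V coord_rep_chart)
qed

lemma function_has_derivative:
  assumes M: "premanifold M" and U: "openin (mtop M) U" "x \<in> U" and f: "smooth_map (open_sub M U) euclid f"
    and V: "chart_at M x = (V, \<phi>)"
  shows "((\<lambda>z. f (inv_into V \<phi> z)) has_derivative (\<lambda>v. fun_d M f x [v])) (at (\<phi> x))"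
proof -
  have x: "x \<in> points M" using U points_openin by blast
  have V': "(V, \<phi>) \<in> atlas M" "x \<in> V" using chart_at_atlas[OF M x] V by auto
  have "((\<lambda>z. f (inv_into V \<phi> z)) has_derivative frechet_derivative (\<lambda>z. f (inv_into V \<phi> z)) (at (\<phi> x))) (at (\<phi> x))"
    by (rule smooth_on_has_derivative[OF smooth_chart_function[OF M U(1) f V'(1)]]) (use U V' in auto)
  moreover have "fun_d M f x [v] = frechet_derivative (\<lambda>z. f (inv_into V \<phi> z)) (at (\<phi> x)) v" for v
    unfolding fun_d_tan_map using tan_map_chart[of M x V \<phi> euclid f UNIV id] V by simp
  ultimately show ?thesis by simp
qed

lemma one_form_has_derivative:
  assumes M: "premanifold M" and U: "openin (mtop M) U" "x \<in> U" and \<alpha>: "smooth_tensor_on M U 1 \<alpha>"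
    and V: "chart_at M x = (V, \<phi>)"
  shows "((\<lambda>z. \<alpha> (inv_into V \<phi> z) [tan_map euclid M (inv_into V \<phi>) z v]) has_derivative component_d M \<alpha> x [v]) (at (\<phi> x))"
  using component_has_derivative[OF M U \<alpha>, of "[v]"] by (simp add: V coord_rep_chart)

text \<open>This is the symmetry of second derivatives of the coordinate expression of
  \<open>f\<close>.\<close>

lemma ext_d_fun_d:
  fixes f :: "'a \<Rightarrow> real"
  assumes M: "premanifold M" and U: "openin (mtop M) U" "x \<in> U" and f: "smooth_map (open_sub M U) euclid f"
  shows "component_d M (fun_d M f) x [u] v = component_d M (fun_d M f) x [v] u"
    and "ext_d M (fun_d M f) x [u, v] = 0"
proof -
  obtain V \<phi> where V: "chart_at M x = (V, \<phi>)" "(V, \<phi>) \<in> atlas M" "x \<in> V"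
    using chart_at_cases[OF M] points_openin[OF U(1)] U(2) by blast
  have o: "open (\<phi> ` (V \<inter> U))" by (rule chart_Int_open[OF M V(2) U(1)])
  let ?f = "\<lambda>z. f (inv_into V \<phi> z)"
  have s: "smooth_on (\<phi> ` (V \<inter> U)) ?f" by (rule smooth_chart_function[OF M U(1) f V(2)])
  have c: "component_d M (fun_d M f) x [w] = frechet_derivative (\<lambda>z. frechet_derivative ?f (at z) w) (at (\<phi> x))" for w
    unfolding component_d_def V fst_conv snd_conv
  proof (rule frechet_derivative_cong_open[OF o])
    fix z assume "z \<in> \<phi> ` (V \<inter> U)"
    then obtain a where a: "a \<in> V" "a \<in> U" "z = \<phi> a" by auto
    show "coord_rep M (V, \<phi>) (fun_d M f) z [w] = frechet_derivative ?f (at z) w"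
      unfolding a(3) by (rule coord_rep_fun_d[OF M V(2) a(1) smooth_nearI[OF U(1) a(2) f]])
  qed (use U V in auto)
  show "component_d M (fun_d M f) x [u] v = component_d M (fun_d M f) x [v] u"
    unfolding c by (rule second_derivative_symmetric[OF o s]) (use U V in auto)
  then show "ext_d M (fun_d M f) x [u, v] = 0" by (simp add: ext_d_1)
qed

lemma component_d_mult_one:
  fixes f :: "'a \<Rightarrow> real"
  assumes M: "premanifold M" and U: "openin (mtop M) U" "x \<in> U" and f: "smooth_map (open_sub M U) euclid f"
    and \<alpha>: "smooth_tensor_on M U 1 \<alpha>"
  shows "component_d M (\<lambda>x vs. f x * \<alpha> x vs) x [v] u = fun_d M f x [u] * \<alpha> x [v] + f x * component_d M \<alpha> x [v] u"
proof -
  have x: "x \<in> points M" using U points_openin by blast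
  obtain V \<phi> where V: "chart_at M x = (V, \<phi>)" "(V, \<phi>) \<in> atlas M" "x \<in> V" using chart_at_cases[OF M x] .
  note D = has_derivative_mult[OF function_has_derivative[OF M U f V(1)] one_form_has_derivative[OF M U \<alpha> V(1), of v]]
  have "((\<lambda>z. coord_rep M (chart_at M x) (\<lambda>x vs. f x * \<alpha> x vs) z [v]) has_derivative
      (\<lambda>u. fun_d M f x [u] * \<alpha> x [v] + f x * component_d M \<alpha> x [v] u)) (at (snd (chart_at M x) x))"
    unfolding V(1) snd_conv coord_rep_chart list.map
    by (rule has_derivative_eq_rhs[OF D])
      (simp add: fun_eq_iff chart_inv[OF M V(2,3)] chart_at_frame[OF M x V(1)])
  from component_d_eqI[OF this] show ?thesis by simp
qed

lemma ext_d_mult_one: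
  fixes f :: "'a \<Rightarrow> real"
  assumes "premanifold M" "openin (mtop M) U" "x \<in> U" "smooth_map (open_sub M U) euclid f" "smooth_tensor_on M U 1 \<alpha>"
  shows "ext_d M (\<lambda>x vs. f x * \<alpha> x vs) x [u, v] =
    fun_d M f x [u] * \<alpha> x [v] - fun_d M f x [v] * \<alpha> x [u] + f x * ext_d M \<alpha> x [u, v]"
  unfolding ext_d_1 component_d_mult_one[OF assms] by (simp add: algebra_simps)

lemma component_d_mult_wedge:
  fixes f :: "'a \<Rightarrow> real"
  assumes M: "premanifold M" and U: "openin (mtop M) U" "x \<in> U" and f: "smooth_map (open_sub M U) euclid f"
    and \<alpha>: "smooth_tensor_on M U 1 \<alpha>" and \<beta>: "smooth_tensor_on M U 1 \<beta>"
  shows "component_d M (\<lambda>x vs. f x * wedge \<alpha> \<beta> x vs) x [v, w] u = fun_d M f x [u] * wedge \<alpha> \<beta> x [v, w] +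
    f x * (component_d M \<alpha> x [v] u * \<beta> x [w] + \<alpha> x [v] * component_d M \<beta> x [w] u
         - component_d M \<alpha> x [w] u * \<beta> x [v] - \<alpha> x [w] * component_d M \<beta> x [v] u)"
proof -
  have x: "x \<in> points M" using U points_openin by blast
  obtain V \<phi> where V: "chart_at M x = (V, \<phi>)" "(V, \<phi>) \<in> atlas M" "x \<in> V" using chart_at_cases[OF M x] .
  note d = function_has_derivative[OF M U f V(1)] one_form_has_derivative[OF M U \<alpha> V(1)] one_form_has_derivative[OF M U \<beta> V(1)]
  note D = has_derivative_mult[OF d(1) has_derivative_diff[OF has_derivative_mult[OF d(2,3), of v w] has_derivative_mult[OF d(2,3), of w v]]]
  have "((\<lambda>z. coord_rep M (chart_at M x) (\<lambda>x vs. f x * wedge \<alpha> \<beta> x vs) z [v, w]) has_derivative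
      (\<lambda>u. fun_d M f x [u] * wedge \<alpha> \<beta> x [v, w] +
    f x * (component_d M \<alpha> x [v] u * \<beta> x [w] + \<alpha> x [v] * component_d M \<beta> x [w] u
         - component_d M \<alpha> x [w] u * \<beta> x [v] - \<alpha> x [w] * component_d M \<beta> x [v] u))) (at (snd (chart_at M x) x))"
    unfolding V(1) snd_conv coord_rep_chart list.map wedge_def nth_Cons_0 nth_Cons_Suc One_nat_def
    by (rule has_derivative_eq_rhs[OF D])
      (simp add: fun_eq_iff chart_inv[OF M V(2,3)] chart_at_frame[OF M x V(1)] algebra_simps)
  from component_d_eqI[OF this] show ?thesis by simp
qed

lemma ext_d_mult_wedge:
  fixes f :: "'a \<Rightarrow> real"
  assumes "premanifold M" "openin (mtop M) U" "x \<in> U" "smooth_map (open_sub M U) euclid f"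
    "smooth_tensor_on M U 1 \<alpha>" "smooth_tensor_on M U 1 \<beta>"
  shows "ext_d M (\<lambda>x vs. f x * wedge \<alpha> \<beta> x vs) x [u, v, w] =
    fun_d M f x [u] * wedge \<alpha> \<beta> x [v, w] - fun_d M f x [v] * wedge \<alpha> \<beta> x [u, w] + fun_d M f x [w] * wedge \<alpha> \<beta> x [u, v] +
    f x * (ext_d M \<alpha> x [u, v] * \<beta> x [w] - ext_d M \<alpha> x [u, w] * \<beta> x [v] + ext_d M \<alpha> x [v, w] * \<beta> x [u]
      - \<alpha> x [u] * ext_d M \<beta> x [v, w] + \<alpha> x [v] * ext_d M \<beta> x [u, w] - \<alpha> x [w] * ext_d M \<beta> x [u, v])"
  unfolding ext_d_2 ext_d_1 component_d_mult_wedge[OF assms] by (simp add: algebra_simps)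

text \<open>The wedge of a 1-form with an alternating 2-form: the three terms are the
  (1,2)-shuffles.\<close>

definition wedge12 :: "('a, 'e, real) tensor \<Rightarrow> ('a, 'e, real) tensor \<Rightarrow> ('a, 'e, real) tensor" where
  "wedge12 \<alpha> \<omega> x vs = \<alpha> x [vs ! 0] * \<omega> x [vs ! 1, vs ! 2] - \<alpha> x [vs ! 1] * \<omega> x [vs ! 0, vs ! 2]
     + \<alpha> x [vs ! 2] * \<omega> x [vs ! 0, vs ! 1]"

lemma component_d_wedge12:
  assumes M: "premanifold M" and U: "openin (mtop M) U" "x \<in> U"
    and \<alpha>: "smooth_tensor_on M U 1 \<alpha>" and \<omega>: "smooth_tensor_on M U 2 \<omega>"
  shows "component_d M (wedge12 \<alpha> \<omega>) x [b, c, d] u =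
     component_d M \<alpha> x [b] u * \<omega> x [c, d] + \<alpha> x [b] * component_d M \<omega> x [c, d] u
   - component_d M \<alpha> x [c] u * \<omega> x [b, d] - \<alpha> x [c] * component_d M \<omega> x [b, d] u
   + component_d M \<alpha> x [d] u * \<omega> x [b, c] + \<alpha> x [d] * component_d M \<omega> x [b, c] u"
proof -
  have x: "x \<in> points M" using U points_openin by blast
  obtain V \<phi> where V: "chart_at M x = (V, \<phi>)" "(V, \<phi>) \<in> atlas M" "x \<in> V" using chart_at_cases[OF M x] .
  have d: "((\<lambda>z. \<omega> (inv_into V \<phi> z) [tan_map euclid M (inv_into V \<phi>) z v, tan_map euclid M (inv_into V \<phi>) z w])
      has_derivative component_d M \<omega> x [v, w]) (at (\<phi> x))" for v w
    using component_has_derivative[OF M U \<omega>, of "[v, w]"] by (simp add: V coord_rep_chart)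
  note m = has_derivative_mult[OF one_form_has_derivative[OF M U \<alpha> V(1)] d]
  note D = has_derivative_add[OF has_derivative_diff[OF m[of b c d] m[of c b d]] m[of d b c]]
  have "((\<lambda>z. coord_rep M (chart_at M x) (wedge12 \<alpha> \<omega>) z [b, c, d]) has_derivative
      (\<lambda>u. component_d M \<alpha> x [b] u * \<omega> x [c, d] + \<alpha> x [b] * component_d M \<omega> x [c, d] u
   - component_d M \<alpha> x [c] u * \<omega> x [b, d] - \<alpha> x [c] * component_d M \<omega> x [b, d] u
   + component_d M \<alpha> x [d] u * \<omega> x [b, c] + \<alpha> x [d] * component_d M \<omega> x [b, c] u)) (at (snd (chart_at M x) x))"
    unfolding V(1) snd_conv coord_rep_chart list.map wedge12_def numeral_2_eq_2 nth_Cons_0 nth_Cons_Suc One_nat_def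
    by (rule has_derivative_eq_rhs[OF D])
      (simp add: fun_eq_iff chart_inv[OF M V(2,3)] chart_at_frame[OF M x V(1)] algebra_simps)
  from component_d_eqI[OF this] show ?thesis by simp
qed

text \<open>The graded Leibniz rule: the first six terms are the shuffles of
  \<open>d \<alpha>\<close> with \<open>\<omega>\<close>, the bracket contains those of
  \<open>\<alpha>\<close> with \<open>d \<omega>\<close>.\<close>

lemma ext_d_wedge12:
  assumes "premanifold M" "openin (mtop M) U" "x \<in> U" "smooth_tensor_on M U 1 \<alpha>" "smooth_tensor_on M U 2 \<omega>"
  shows "ext_d M (wedge12 \<alpha> \<omega>) x [a, b, c, d] =
     ext_d M \<alpha> x [a, b] * \<omega> x [c, d] - ext_d M \<alpha> x [a, c] * \<omega> x [b, d] + ext_d M \<alpha> x [a, d] * \<omega> x [b, c]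
   + ext_d M \<alpha> x [b, c] * \<omega> x [a, d] - ext_d M \<alpha> x [b, d] * \<omega> x [a, c] + ext_d M \<alpha> x [c, d] * \<omega> x [a, b]
   - (\<alpha> x [a] * ext_d M \<omega> x [b, c, d] - \<alpha> x [b] * ext_d M \<omega> x [a, c, d]
     + \<alpha> x [c] * ext_d M \<omega> x [a, b, d] - \<alpha> x [d] * ext_d M \<omega> x [a, b, c])"
  unfolding ext_d_3 ext_d_2 ext_d_1 component_d_wedge12[OF assms] by (simp add: algebra_simps)

lemma ext_d_cong:
  assumes "premanifold M" "openin (mtop M) U" "x \<in> U"
    "\<And>z vs. z \<in> U \<Longrightarrow> length vs = k \<Longrightarrow> \<alpha> z vs = \<beta> z vs" "length vs = Suc k"
  shows "ext_d M \<alpha> x vs = ext_d M \<beta> x vs"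
proof -
  have "component_d M \<alpha> x (take i vs @ drop (Suc i) vs) = component_d M \<beta> x (take i vs @ drop (Suc i) vs)"
    if "i < length vs" for i
    by (rule component_d_cong[OF assms(1-4)]) (use that assms(5) in auto)
  then show ?thesis by (simp add: ext_d_def flat_d_def component_d_def)
qed

lemma ext_d_add:
  assumes "premanifold M" "openin (mtop M) U" "x \<in> U"
    "smooth_tensor_on M U k \<alpha>" "smooth_tensor_on M U k \<beta>" "length vs = Suc k"
  shows "ext_d M (\<lambda>x vs. \<alpha> x vs + \<beta> x vs) x vs = ext_d M \<alpha> x vs + ext_d M \<beta> x vs"
proof -
  have *: "component_d M (\<lambda>x vs. \<alpha> x vs + \<beta> x vs) x (take i vs @ drop (Suc i) vs) u =
    component_d M \<alpha> x (take i vs @ drop (Suc i) vs) u + component_d M \<beta> x (take i vs @ drop (Suc i) vs) u"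
    if "i < length vs" for i u
    by (rule component_d_add[OF assms(1-5)]) (use that assms(6) in auto)
  show ?thesis
    unfolding ext_d_def flat_d_def component_d_def[symmetric]
    by (simp add: * scaleR_add_right sum.distrib)
qed

lemma ext_d_linear_image:
  assumes "premanifold M" "openin (mtop M) U" "x \<in> U" "smooth_tensor_on M U k \<alpha>" "length vs = Suc k"
    and L: "bounded_linear L"
  shows "ext_d M (\<lambda>x vs. L (\<alpha> x vs)) x vs = L (ext_d M \<alpha> x vs)"
proof -
  have *: "component_d M (\<lambda>x vs. L (\<alpha> x vs)) x (take i vs @ drop (Suc i) vs) u =
    L (component_d M \<alpha> x (take i vs @ drop (Suc i) vs) u)" if "i < length vs" for i u
    by (rule component_d_linear_image[OF assms(1-4) _ L]) (use that assms(5) in auto)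
  interpret bounded_linear L by (rule L)
  show ?thesis
    unfolding ext_d_def flat_d_def component_d_def[symmetric]
    by (simp add: * sum scaleR)
qed

lemma ext_d_zero:
  assumes "premanifold M" "openin (mtop M) U" "x \<in> U" "\<And>z vs. z \<in> U \<Longrightarrow> length vs = k \<Longrightarrow> \<alpha> z vs = 0" "length vs = Suc k"
  shows "ext_d M \<alpha> x vs = 0"
proof -
  have "ext_d M \<alpha> x vs = ext_d M (\<lambda>_ _. 0) x vs"
    by (rule ext_d_cong[OF assms(1-3) _ assms(5)]) (use assms(4) in auto)
  also have "\<dots> = 0" by (simp add: ext_d_def flat_d_def coord_rep_def pullback_def)
  finally show ?thesis .
qed

section \<open>Almost complex structures\<close>

text \<open>Unfolds a sum over subsets of an explicit set one element at a time, for the sums over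
  sets of slots in \<open>type_part\<close>.\<close>

lemma sum_Pow_insert:
  assumes "finite A" "a \<notin> A"
  shows "sum f (Pow (insert a A)) = sum f (Pow A) + (\<Sum>S\<in>Pow A. f (insert a S))"
proof -
  have "inj_on (insert a) (Pow A)" using assms(2) by (auto simp: inj_on_def)
  then show ?thesis unfolding Pow_insert
    by (subst sum.union_disjoint) (use assms in \<open>auto simp: sum.reindex\<close>)
qed

text \<open>Moving the cardinality condition into the summand turns the outer sum into one over a
  power set, to which \<open>sum_Pow_insert\<close> applies.\<close>

lemma type_part_Pow:
  "type_part I p q \<alpha> x vs = (\<Sum>S\<in>Pow {..<p + q}. if card S = p then (\<Sum>T\<in>Pow {..<p + q}.
     (\<Prod>j\<in>T. if j \<in> S then - \<i> else \<i>) / 2 ^ (p + q) *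
        \<alpha> x (map (\<lambda>j. if j \<in> T then I x (vs ! j) else vs ! j) [0..<p + q])) else 0)"
proof -
  have "{S. S \<subseteq> {..<p + q} \<and> card S = p} = {S \<in> Pow {..<p + q}. card S = p}" by auto
  then show ?thesis unfolding type_part_def by (simp only: sum.inter_filter[OF finite_Pow_iff[THEN iffD2, OF finite_lessThan]])
qed

lemma lessThan_insert: "{..<2::nat} = {1, 0}" "{..<3::nat} = {2, 1, 0}"
  by auto

lemma upt_list: "[0..<2] = [0, 1]" "[0..<3] = [0, 1, 2]"
  by (simp_all add: upt_rec)

lemma type_part_two:
  "type_part I 2 0 \<alpha> x [u, v] = (\<alpha> x [u, v] - \<i> * \<alpha> x [I x u, v] - \<i> * \<alpha> x [u, I x v] - \<alpha> x [I x u, I x v]) / 4"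
  "type_part I (Suc 0) (Suc 0) \<alpha> x [u, v] = (\<alpha> x [u, v] + \<alpha> x [I x u, I x v]) / 2"
  "type_part I 0 2 \<alpha> x [u, v] = (\<alpha> x [u, v] + \<i> * \<alpha> x [I x u, v] + \<i> * \<alpha> x [u, I x v] - \<alpha> x [I x u, I x v]) / 4"
proof -
  have 2: "Suc 0 + Suc 0 = 2" by simp
  show "type_part I 2 0 \<alpha> x [u, v] = (\<alpha> x [u, v] - \<i> * \<alpha> x [I x u, v] - \<i> * \<alpha> x [u, I x v] - \<alpha> x [I x u, I x v]) / 4"
    "type_part I (Suc 0) (Suc 0) \<alpha> x [u, v] = (\<alpha> x [u, v] + \<alpha> x [I x u, I x v]) / 2"
    "type_part I 0 2 \<alpha> x [u, v] = (\<alpha> x [u, v] + \<i> * \<alpha> x [I x u, v] + \<i> * \<alpha> x [u, I x v] - \<alpha> x [I x u, I x v]) / 4"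
    unfolding type_part_Pow add_0 add_0_right 2 lessThan_insert upt_list
    by (simp_all add: sum_Pow_insert field_simps)
qed

text \<open>The coefficient at a set of slots carrying \<open>I\<close> adds up, over all choices of
  the holomorphic slots, a factor \<open>- \<i>\<close> for each carrying slot among them and
  \<open>\<i>\<close> for each other. For type (2,1) this gives 3, \<open>- \<i>\<close>, 1,
  \<open>- 3 * \<i>\<close> for zero to three insertions; type (1,2) has the conjugates.\<close>

lemma type_part_three:
  "type_part I 2 (Suc 0) \<alpha> x [u, v, w] = (3 * \<alpha> x [u, v, w] - \<i> * (\<alpha> x [I x u, v, w] + \<alpha> x [u, I x v, w] + \<alpha> x [u, v, I x w])
     + (\<alpha> x [I x u, I x v, w] + \<alpha> x [I x u, v, I x w] + \<alpha> x [u, I x v, I x w]) - 3 * \<i> * \<alpha> x [I x u, I x v, I x w]) / 8"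
  "type_part I (Suc 0) 2 \<alpha> x [u, v, w] = (3 * \<alpha> x [u, v, w] + \<i> * (\<alpha> x [I x u, v, w] + \<alpha> x [u, I x v, w] + \<alpha> x [u, v, I x w])
     + (\<alpha> x [I x u, I x v, w] + \<alpha> x [I x u, v, I x w] + \<alpha> x [u, I x v, I x w]) + 3 * \<i> * \<alpha> x [I x u, I x v, I x w]) / 8"
proof -
  have 3: "2 + Suc 0 = 3" "Suc 0 + 2 = 3" by auto
  show "type_part I 2 (Suc 0) \<alpha> x [u, v, w] = (3 * \<alpha> x [u, v, w] - \<i> * (\<alpha> x [I x u, v, w] + \<alpha> x [u, I x v, w] + \<alpha> x [u, v, I x w])
     + (\<alpha> x [I x u, I x v, w] + \<alpha> x [I x u, v, I x w] + \<alpha> x [u, I x v, I x w]) - 3 * \<i> * \<alpha> x [I x u, I x v, I x w]) / 8"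
    unfolding type_part_Pow 3 lessThan_insert upt_list by (simp add: sum_Pow_insert field_simps)
  show "type_part I (Suc 0) 2 \<alpha> x [u, v, w] = (3 * \<alpha> x [u, v, w] + \<i> * (\<alpha> x [I x u, v, w] + \<alpha> x [u, I x v, w] + \<alpha> x [u, v, I x w])
     + (\<alpha> x [I x u, I x v, w] + \<alpha> x [I x u, v, I x w] + \<alpha> x [u, I x v, I x w]) + 3 * \<i> * \<alpha> x [I x u, I x v, I x w]) / 8"
    unfolding type_part_Pow 3 lessThan_insert upt_list by (simp add: sum_Pow_insert field_simps)
qed

lemma type_part_zero:
  assumes "\<And>vs. length vs = p + q \<Longrightarrow> \<alpha> x vs = 0"
  shows "type_part I p q \<alpha> x vs = 0"
  using assms by (simp add: type_part_def)

lemma type_part_cong: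
  assumes "\<And>vs. length vs = p + q \<Longrightarrow> \<alpha> x vs = \<beta> x vs"
  shows "type_part I p q \<alpha> x vs = type_part I p q \<beta> x vs"
  using assms by (simp add: type_part_def)

lemma length_two_cases: "length vs = 2 \<Longrightarrow> (\<And>u v. vs = [u, v] \<Longrightarrow> P) \<Longrightarrow> P"
  by (auto simp: length_Suc_conv numeral_2_eq_2)

lemma length_three_cases: "length vs = 3 \<Longrightarrow> (\<And>u v w. vs = [u, v, w] \<Longrightarrow> P) \<Longrightarrow> P"
  by (auto simp: length_Suc_conv numeral_3_eq_3)

lemma length_four_cases: "length vs = 4 \<Longrightarrow> (\<And>a b c d. vs = [a, b, c, d] \<Longrightarrow> P) \<Longrightarrow> P"
  by (auto simp: length_Suc_conv numeral_eq_Suc)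

lemma openin_points: "openin (mtop M) (points M)"
  by (simp add: points_def)

text \<open>For a form of type (1,1) only the middle terms of \<open>\<partial>\<close> and of its conjugate survive.\<close>

lemma dc_type_11:
  assumes M: "premanifold M" and x: "x \<in> points M"
    and t: "\<And>z u v. z \<in> points M \<Longrightarrow> \<alpha> z [I z u, I z v] = \<alpha> z [u, v]"
    and l: "\<And>z u v. z \<in> points M \<Longrightarrow> \<alpha> z [I z u, v] = - \<alpha> z [u, I z v]"
  shows "dc M I 2 \<alpha> x [u, v, w] = - (ext_d M \<alpha> x [I x u, v, w] + ext_d M \<alpha> x [u, I x v, w] + ext_d M \<alpha> x [u, v, I x w]
      + 3 * ext_d M \<alpha> x [I x u, I x v, I x w]) / 4"
proof -
  have z: "type_part I p (2 - p) \<alpha> z vs = 0" if "z \<in> points M" "length vs = 2" "p = 0 \<or> p = 2" for p z vs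
    using that t[OF that(1)] l[OF that(1)] by (auto elim!: length_two_cases simp: type_part_two)
  have o: "type_part I (Suc 0) (Suc 0) \<alpha> z vs = \<alpha> z vs" if "z \<in> points M" "length vs = 2" for z vs
    using that t[OF that(1)] by (auto elim!: length_two_cases simp: type_part_two)
  have d0: "ext_d M (type_part I p (2 - p) \<alpha>) x vs = 0" if "p = 0 \<or> p = 2" "length vs = 3" for p vs
    by (rule ext_d_zero[OF M openin_points x z]) (use that in auto)
  have d1: "ext_d M (type_part I (Suc 0) (Suc 0) \<alpha>) x vs = ext_d M \<alpha> x vs" if "length vs = 3" for vs
    by (rule ext_d_cong[OF M openin_points x o]) (use that in auto)
  have s: "{..2::nat} = {0, 1, 2}" by auto
  have a: "del M I 2 \<alpha> x [u, v, w] = type_part I 2 (Suc 0) (ext_d M \<alpha>) x [u, v, w]" for u v w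
    unfolding del_def s
    using type_part_zero[of 1 2 "ext_d M (type_part I 0 2 \<alpha>)" x I "[u,v,w]"] d0[of 0]
      type_part_zero[of 3 0 "ext_d M (type_part I 2 0 \<alpha>)" x I "[u,v,w]"] d0[of 2]
      type_part_cong[of 2 1 "ext_d M (type_part I (Suc 0) (Suc 0) \<alpha>)" x "ext_d M \<alpha>" I] d1
    by (simp add: numeral_eq_Suc)
  have b: "delbar M I 2 \<alpha> x [u, v, w] = type_part I (Suc 0) 2 (ext_d M \<alpha>) x [u, v, w]" for u v w
    unfolding delbar_def s
    using type_part_zero[of 0 3 "ext_d M (type_part I 0 2 \<alpha>)" x I "[u,v,w]"] d0[of 0]
      type_part_zero[of 2 1 "ext_d M (type_part I 2 0 \<alpha>)" x I "[u,v,w]"] d0[of 2]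
      type_part_cong[of 1 2 "ext_d M (type_part I (Suc 0) (Suc 0) \<alpha>)" x "ext_d M \<alpha>" I] d1
    by (simp add: numeral_eq_Suc)
  \<comment> \<open>The resulting combination annihilates the types (3,0) and (0,3): there the three
    single insertions of \<open>I\<close> contribute three times \<open>\<i>\<close> or
    \<open>- \<i>\<close>, and three times the triple insertion contributes the opposite.\<close>
  show ?thesis unfolding dc_def a b type_part_three by (simp add: field_simps)
qed

text \<open>Multiplication by \<open>\<i>\<close> in both slots means type (2,0). The other type
  parts of \<open>\<Omega>\<close> are then zero, and the remaining term of \<open>delbar\<close> is
  a type part of \<open>d \<Omega>\<close>, which is zero.\<close>

lemma holomorphic_formI:
  assumes M: "premanifold M" and s: "smooth_form_on M (points M) 2 \<Omega>"
    and l: "\<And>z u v. z \<in> points M \<Longrightarrow> \<Omega> z [I z u, v] = \<i> * \<Omega> z [u, v]"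
    and r: "\<And>z u v. z \<in> points M \<Longrightarrow> \<Omega> z [u, I z v] = \<i> * \<Omega> z [u, v]"
    and d: "\<And>z vs. z \<in> points M \<Longrightarrow> length vs = 3 \<Longrightarrow> ext_d M \<Omega> z vs = 0"
  shows "holomorphic_form M I 2 \<Omega>"
proof -
  have t20: "type_part I 2 0 \<Omega> z vs = \<Omega> z vs" if "z \<in> points M" "length vs = 2" for z vs
    using that l[OF that(1)] r[OF that(1)] by (auto elim!: length_two_cases simp: type_part_two)
  have t0: "type_part I p (2 - p) \<Omega> z vs = 0" if "z \<in> points M" "length vs = 2" "p = 0 \<or> p = 1" for p z vs
    using that l[OF that(1)] r[OF that(1)] by (auto elim!: length_two_cases simp: type_part_two)
  have ty: "of_type M I 2 0 \<Omega>" using t20 by (simp add: of_type_def tensor_eq_on_def)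
  have s3: "{..2::nat} = {0, 1, 2}" by auto
  have "delbar M I 2 \<Omega> x vs = 0" if x: "x \<in> points M" and vs: "length vs = 3" for x vs
  proof -
    have 0: "type_part I p (2 - p + 1) (ext_d M (type_part I p (2 - p) \<Omega>)) x vs = 0" if "p = 0 \<or> p = 1" for p
      by (rule type_part_zero, rule ext_d_zero[OF M openin_points x t0]) (use that in auto)
    have 2: "type_part I 2 1 (ext_d M (type_part I 2 0 \<Omega>)) x vs = 0"
    proof (rule type_part_zero)
      fix ws :: "'b list" assume "length ws = 2 + 1"
      then have w: "length ws = 3" by simp
      have "ext_d M (type_part I 2 0 \<Omega>) x ws = ext_d M \<Omega> x ws"
        by (rule ext_d_cong[OF M openin_points x t20]) (use w in auto)
      then show "ext_d M (type_part I 2 0 \<Omega>) x ws = 0" using d[OF x w] by simp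
    qed
    show ?thesis unfolding delbar_def s3 using 0[of 0] 0[of 1] 2 by simp
  qed
  then show ?thesis using s ty by (simp add: holomorphic_form_def tensor_eq_on_def)
qed

text \<open>A form of type (2,0) equals its own projection, and replacing \<open>u\<close> by
  \<open>I u\<close> in the formula for the projection multiplies it by \<open>\<i>\<close>.\<close>

lemma holomorphic_form_left:
  assumes I: "almost_complex_structure M I" and h: "holomorphic_form M I 2 \<Omega>" and x: "x \<in> points M"
  shows "\<Omega> x [I x u, v] = \<i> * \<Omega> x [u, v]"
proof -
  have t: "type_part I 2 0 \<Omega> x [u, v] = \<Omega> x [u, v]" for u v
    using h x by (simp add: holomorphic_form_def of_type_def tensor_eq_on_def)
  have s: "smooth_tensor_on M (points M) 2 \<Omega>" using h by (simp add: holomorphic_form_def smooth_form_on_def)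
  have n: "\<Omega> x [- u, v] = - \<Omega> x [u, v]" for u v
    using linear_neg[OF smooth_tensor_on_linear[OF s x, of "[u, v]" 0], of u] by simp
  have II: "I x (I x u) = - u" using I x by (simp add: almost_complex_structure_def)
  have h1: "\<Omega> x [I x u, v] = (\<Omega> x [I x u, v] + \<i> * \<Omega> x [u, v] - \<i> * \<Omega> x [I x u, I x v] + \<Omega> x [u, I x v]) / 4"
    using t[of "I x u" v, unfolded type_part_two] by (simp add: II n)
  have h2: "\<i> * \<Omega> x [u, v] = \<i> * ((\<Omega> x [u, v] - \<i> * \<Omega> x [I x u, v] - \<i> * \<Omega> x [u, I x v] - \<Omega> x [I x u, I x v]) / 4)"
    using t[of u v, unfolded type_part_two] by (rule arg_cong[OF sym])
  also have h3: "\<dots> = (\<Omega> x [I x u, v] + \<i> * \<Omega> x [u, v] - \<i> * \<Omega> x [I x u, I x v] + \<Omega> x [u, I x v]) / 4"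
    by (simp add: field_simps)
  finally show ?thesis using h1 by (rule trans[OF _ sym, rotated])
qed

text \<open>A product rule in which the derivative of \<open>a\<close> is given for fixed vectors
  only, so the moving vector \<open>h z\<close> is expanded in the basis.\<close>

lemma has_derivative_linear_apply:
  fixes a :: "'e::euclidean_space \<Rightarrow> 'f::euclidean_space \<Rightarrow> real"
  assumes "open S" "y \<in> S" "\<And>z. z \<in> S \<Longrightarrow> linear (a z)"
    and a: "\<And>w. ((\<lambda>z. a z w) has_derivative a' w) (at y)" and h: "(h has_derivative h') (at y)"
  shows "((\<lambda>z. a z (h z)) has_derivative (\<lambda>u. a' (h y) u + a y (h' u))) (at y)"
proof -
  have r: "a z w = (\<Sum>b\<in>Basis. (w \<bullet> b) * a z b)" if "z \<in> S" for z w
    using linear_sum[OF assms(3)[OF that], of "\<lambda>b. (w \<bullet> b) *\<^sub>R b" Basis] linear_scale[OF assms(3)[OF that]]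
    by (simp add: euclidean_representation)
  have "((\<lambda>z. \<Sum>b\<in>Basis. (h y \<bullet> b) * a z b) has_derivative (\<lambda>u. \<Sum>b\<in>Basis. (h y \<bullet> b) * a' b u)) (at y)"
    by (intro has_derivative_sum has_derivative_mult_right a)
  then have "((\<lambda>z. a z (h y)) has_derivative (\<lambda>u. \<Sum>b\<in>Basis. (h y \<bullet> b) * a' b u)) (at y)"
    by (rule has_derivative_transform_within_open[OF _ assms(1,2)]) (simp add: r[of _ "h y"])
  then have a': "a' (h y) = (\<lambda>u. \<Sum>b\<in>Basis. (h y \<bullet> b) * a' b u)" using has_derivative_unique a by blast
  have "((\<lambda>z. \<Sum>b\<in>Basis. (h z \<bullet> b) * a z b) has_derivative
      (\<lambda>u. \<Sum>b\<in>Basis. (h y \<bullet> b) * a' b u + (h' u \<bullet> b) * a y b)) (at y)"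
    by (intro has_derivative_sum has_derivative_mult has_derivative_inner_left a h)
  then have "((\<lambda>z. a z (h z)) has_derivative (\<lambda>u. \<Sum>b\<in>Basis. (h y \<bullet> b) * a' b u + (h' u \<bullet> b) * a y b)) (at y)"
    by (rule has_derivative_transform_within_open[OF _ assms(1,2)]) (simp add: r[of _ "h _"])
  then show ?thesis unfolding a' by (simp add: sum.distrib r[OF assms(2), of "h' _"])
qed

text \<open>If \<open>\<alpha> + \<i> \<beta>\<close> is of type (1,0), its value on the Nijenhuis tensor is the (0,2)-part of its
  exterior derivative, up to a factor; this is the real part.\<close>

lemma nijenhuis_one_form:
  fixes \<alpha> \<beta> :: "('a, 'e::euclidean_space, real) tensor"
  assumes M: "premanifold M" and I: "almost_complex_structure M I" and x: "x \<in> points M"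
    and \<alpha>: "smooth_tensor_on M (points M) 1 \<alpha>" and \<beta>: "smooth_tensor_on M (points M) 1 \<beta>"
    and a: "\<And>z v. z \<in> points M \<Longrightarrow> \<alpha> z [I z v] = - \<beta> z [v]"
    and b: "\<And>z v. z \<in> points M \<Longrightarrow> \<beta> z [I z v] = \<alpha> z [v]"
  shows "\<alpha> x [nijenhuis M I x u v] =
    ext_d M \<alpha> x [u, v] - ext_d M \<alpha> x [I x u, I x v] - ext_d M \<beta> x [I x u, v] - ext_d M \<beta> x [u, I x v]"
proof -
  obtain V \<phi> where V: "chart_at M x = (V, \<phi>)" "(V, \<phi>) \<in> atlas M" "x \<in> V" using chart_at_cases[OF M x] .
  define A where "A = coord_endo M (V, \<phi>) I"
  let ?y = "\<phi> x" and ?Q = "inv_into V \<phi>"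
  let ?E = "\<lambda>z. tan_map euclid M ?Q z"
  have o: "open (\<phi> ` V)" "?y \<in> \<phi> ` V" using chart_homeomorphic(2)[OF M V(2)] V(3) by auto
  have Q: "?Q z \<in> points M" "?Q z \<in> V" "\<phi> (?Q z) = z" if "z \<in> \<phi> ` V" for z
    using that chart_inv[OF M V(2)] chart_subset[OF M V(2)] by auto
  have EA: "?E z (A z w) = I (?Q z) (?E z w)" if "z \<in> \<phi> ` V" for z w
    using chart_frame(2)[OF M V(2) Q(2)[OF that]] by (simp add: A_def coord_endo_def Let_def Q(3)[OF that])
  have Ay: "A ?y w = I x w" for w
    using chart_at_frame[OF M x V(1)] by (simp add: A_def coord_endo_def Let_def chart_inv[OF M V(2,3)])
  have lE: "linear (?E z)" if "z \<in> \<phi> ` V" for z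
    by (rule tan_map_linear[OF premanifold_euclid M smooth_near_chart_inv[OF M V(2) that]])
  have sA: "smooth_on (\<phi> ` V) (\<lambda>z. A z w)" for w
    using I V(2) by (auto simp: almost_complex_structure_def A_def)
  define B where "B = (\<lambda>w. frechet_derivative (\<lambda>z. A z w) (at ?y))"
  have B: "((\<lambda>z. A z w) has_derivative B w) (at ?y)" for w
    unfolding B_def by (rule smooth_on_has_derivative[OF sA o(2)])
  \<comment> \<open>Brackets with constant fields are single derivatives of \<open>A\<close> applied
    to a fixed vector, and the bracket of two constant fields is zero.\<close>
  have N: "nijenhuis M I x u v = B v (I x u) - B u (I x v) + I x (B u v) - I x (B v u)" for u v
  proof -
    have lI: "linear (I x)" using I x by (simp add: almost_complex_structure_def)
    show ?thesis unfolding nijenhuis_def V(1) Let_def flat_bracket_def snd_conv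
      unfolding A_def[symmetric] Ay B_def
      by (simp add: frechet_derivative_const linear_neg[OF lI])
  qed
  \<comment> \<open>Differentiating the relation \<open>\<gamma> (I w) = k * \<delta> w\<close> in
    the chart trades the derivative of \<open>I\<close> for derivatives of the two forms.\<close>
  have rel: "\<gamma> x [B w u'] = k * component_d M \<delta> x [w] u' - component_d M \<gamma> x [I x w] u'"
    if \<gamma>: "smooth_tensor_on M (points M) 1 \<gamma>" and \<delta>: "smooth_tensor_on M (points M) 1 \<delta>"
      and g: "\<And>z v. z \<in> points M \<Longrightarrow> \<gamma> z [I z v] = k * \<delta> z [v]" for \<gamma> \<delta> :: "('a, 'e, real) tensor" and k w u'
  proof -
    let ?c = "\<lambda>z w. \<gamma> (?Q z) [?E z w]"
    have lin: "linear (?c z)" if "z \<in> \<phi> ` V" for z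
      using linear_compose[OF lE[OF that] one_form_linear[OF \<gamma> Q(1)[OF that]]] by (simp add: o_def)
    note dc = one_form_has_derivative[OF M openin_points x \<gamma> V(1)]
    have "((\<lambda>z. ?c z (A z w)) has_derivative (\<lambda>u. component_d M \<gamma> x [A ?y w] u + ?c ?y (B w u))) (at ?y)"
      by (rule has_derivative_linear_apply[where a = ?c and a' = "\<lambda>w. component_d M \<gamma> x [w]" and h = "\<lambda>z. A z w" and h' = "B w", OF o lin dc B])
    moreover have "((\<lambda>z. ?c z (A z w)) has_derivative (\<lambda>u. k * component_d M \<delta> x [w] u)) (at ?y)"
      by (rule has_derivative_transform_within_open[OF has_derivative_mult_right[OF
            one_form_has_derivative[OF M openin_points x \<delta> V(1)]] o]) (simp add: EA g Q(1))
    ultimately have "(\<lambda>u. component_d M \<gamma> x [A ?y w] u + ?c ?y (B w u)) = (\<lambda>u. k * component_d M \<delta> x [w] u)"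
      by (rule has_derivative_unique)
    from fun_cong[OF this, of u'] show ?thesis
      by (simp add: Ay chart_inv[OF M V(2,3)] chart_at_frame[OF M x V(1)])
  qed
  have ra: "\<alpha> x [B w u'] = - component_d M \<beta> x [w] u' - component_d M \<alpha> x [I x w] u'" for w u'
    using rel[OF \<alpha> \<beta>, of "-1"] a by simp
  have rb: "\<beta> x [B w u'] = component_d M \<alpha> x [w] u' - component_d M \<beta> x [I x w] u'" for w u'
    using rel[OF \<beta> \<alpha>, of 1] b by simp
  note l = one_form_linear[OF \<alpha> x]
  have "\<alpha> x [nijenhuis M I x u v] = \<alpha> x [B v (I x u)] - \<alpha> x [B u (I x v)] - \<beta> x [B u v] + \<beta> x [B v u]"
    unfolding N using linear_add[OF l] linear_diff[OF l] by (simp add: a[OF x])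
  then show ?thesis unfolding ra rb ext_d_1 by simp
qed

section \<open>The generalized Kaehler structure of an adapted coframe\<close>

lemma smooth_map_real_comp2:
  fixes M :: "('a, 'e::euclidean_space) manifold"
  assumes M: "premanifold M" and "smooth_map M euclid f" "smooth_map M euclid g"
    and op: "\<And>(S :: 'e set) a b. open S \<Longrightarrow> smooth_on S a \<Longrightarrow> smooth_on S b \<Longrightarrow> smooth_on S (\<lambda>y. op (a y) (b y))"
  shows "smooth_map M euclid (\<lambda>x. op (f x) (g x))"
  by (rule smooth_map_realI[OF M], rule op)
    (auto intro: smooth_map_real[OF M] chart_homeomorphic(2)[OF M] assms)

lemma smooth_map_mult:
  fixes f g :: "'a \<Rightarrow> real"
  shows "premanifold M \<Longrightarrow> smooth_map M euclid f \<Longrightarrow> smooth_map M euclid g \<Longrightarrow> smooth_map M euclid (\<lambda>x. f x * g x)"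
  by (rule smooth_map_real_comp2) (auto intro: smooth_on_mult)

lemma smooth_map_diff:
  fixes f g :: "'a \<Rightarrow> real"
  shows "premanifold M \<Longrightarrow> smooth_map M euclid f \<Longrightarrow> smooth_map M euclid g \<Longrightarrow> smooth_map M euclid (\<lambda>x. f x - g x)"
  by (rule smooth_map_real_comp2) (auto intro: smooth_on_diff)

lemma smooth_map_uminus:
  fixes f :: "'a \<Rightarrow> real"
  shows "premanifold M \<Longrightarrow> smooth_map M euclid f \<Longrightarrow> smooth_map M euclid (\<lambda>x. - f x)"
  using smooth_map_real_comp2[of M f f "\<lambda>a b. - a"] smooth_on_uminus by blast

lemma smooth_map_power2:
  fixes f :: "'a \<Rightarrow> real"
  shows "premanifold M \<Longrightarrow> smooth_map M euclid f \<Longrightarrow> smooth_map M euclid (\<lambda>x. (f x)\<^sup>2)"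
  by (simp add: power2_eq_square smooth_map_mult)

lemma smooth_map_inverse:
  fixes f :: "'a \<Rightarrow> real"
  assumes "premanifold M" "smooth_map M euclid f" "\<And>x. x \<in> points M \<Longrightarrow> f x \<noteq> 0"
  shows "smooth_map M euclid (\<lambda>x. inverse (f x))"
proof (rule smooth_map_realI[OF assms(1)], rule smooth_on_inverse)
  fix U \<phi> x assume U: "(U, \<phi>) \<in> atlas M"
  show "open (\<phi> ` U)" by (rule chart_homeomorphic(2)[OF assms(1) U])
  show "smooth_on (\<phi> ` U) (\<lambda>x. f (inv_into U \<phi> x))" by (rule smooth_map_real[OF assms(1,2) U])
  assume "x \<in> \<phi> ` U"
  then have "inv_into U \<phi> x \<in> points M" using chart_subset[OF assms(1) U] by (auto simp: chart_inv[OF assms(1) U])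
  then show "f (inv_into U \<phi> x) \<noteq> 0" by (rule assms(3))
qed

lemma smooth_map_real_const: "premanifold M \<Longrightarrow> smooth_map M euclid (\<lambda>_. c)"
  by (rule smooth_map_const) auto

lemmas smooth_fun_intros = smooth_map_mult smooth_map_diff smooth_map_uminus smooth_map_power2 smooth_map_real_const

lemma fun_d_eqI:
  assumes M: "premanifold M" and x: "x \<in> points M" and V: "chart_at M x = (V, \<phi>)" and f: "smooth_map M euclid f"
    and D: "((\<lambda>z. f (inv_into V \<phi> z)) has_derivative D) (at (\<phi> x))"
  shows "fun_d M f x [v] = D v"
  using has_derivative_unique[OF function_has_derivative[OF M openin_points x _ V] D] f
  by (metis open_sub_points[OF M])

lemma fun_d_mult:
  fixes f g :: "'a \<Rightarrow> real"
  assumes M: "premanifold M" and f: "smooth_map M euclid f" and g: "smooth_map M euclid g" and x: "x \<in> points M"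
  shows "fun_d M (\<lambda>x. f x * g x) x [v] = f x * fun_d M g x [v] + fun_d M f x [v] * g x"
proof -
  obtain V \<phi> where V: "chart_at M x = (V, \<phi>)" "(V, \<phi>) \<in> atlas M" "x \<in> V" using chart_at_cases[OF M x] .
  note d = function_has_derivative[OF M openin_points x _ V(1), unfolded open_sub_points[OF M]]
  show ?thesis
    using fun_d_eqI[OF M x V(1) smooth_map_mult[OF M f g] has_derivative_mult[OF d[OF f] d[OF g]]]
    by (simp add: chart_inv[OF M V(2,3)])
qed

lemma fun_d_diff:
  fixes f g :: "'a \<Rightarrow> real"
  assumes M: "premanifold M" and f: "smooth_map M euclid f" and g: "smooth_map M euclid g" and x: "x \<in> points M"
  shows "fun_d M (\<lambda>x. f x - g x) x [v] = fun_d M f x [v] - fun_d M g x [v]"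
proof -
  obtain V \<phi> where V: "chart_at M x = (V, \<phi>)" "(V, \<phi>) \<in> atlas M" "x \<in> V" using chart_at_cases[OF M x] .
  note d = function_has_derivative[OF M openin_points x _ V(1), unfolded open_sub_points[OF M]]
  show ?thesis
    using fun_d_eqI[OF M x V(1) smooth_map_diff[OF M f g] has_derivative_diff[OF d[OF f] d[OF g]]] by simp
qed

lemma fun_d_const:
  fixes c :: real
  assumes M: "premanifold M" and x: "x \<in> points M"
  shows "fun_d M (\<lambda>_. c) x [v] = 0"
proof -
  obtain V \<phi> where V: "chart_at M x = (V, \<phi>)" by fastforce
  show ?thesis using fun_d_eqI[where f = "\<lambda>_. c", OF M x V smooth_map_real_const[OF M] has_derivative_const] by simp
qed

lemma fun_d_uminus:
  fixes f :: "'a \<Rightarrow> real"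
  assumes M: "premanifold M" and f: "smooth_map M euclid f" and x: "x \<in> points M"
  shows "fun_d M (\<lambda>x. - f x) x [v] = - fun_d M f x [v]"
  using fun_d_diff[OF M smooth_map_real_const[OF M, of 0] f x] fun_d_const[OF M x] by simp

lemma smooth_tensor_on_scale:
  fixes \<alpha> :: "('a, 'e::euclidean_space, real) tensor"
  assumes M: "premanifold M" and f: "smooth_map M euclid f" and \<alpha>: "smooth_tensor_on M (points M) k \<alpha>"
  shows "smooth_tensor_on M (points M) k (\<lambda>x vs. f x * \<alpha> x vs)"
  by (rule smooth_tensor_on_mult[OF M openin_points _ \<alpha>]) (simp add: open_sub_points[OF M] f)

lemma smooth_tensor_on_wedge:
  assumes M: "premanifold M" and U: "openin (mtop M) U" and \<alpha>: "smooth_tensor_on M U 1 \<alpha>" and \<beta>: "smooth_tensor_on M U 1 (\<beta> :: ('a, 'e::euclidean_space, real) tensor)"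
  shows "smooth_tensor_on M U 2 (wedge \<alpha> \<beta>)"
proof -
  have "smooth_tensor_on M U 2 (\<lambda>x vs. \<alpha> x [vs ! 0] * \<beta> x [vs ! 1] + - (\<beta> x [vs ! 0] * \<alpha> x [vs ! 1]))"
    by (intro smooth_tensor_on_add[OF M U] smooth_tensor_on_product[OF M U] \<alpha> \<beta>
        smooth_tensor_on_linear_image[OF M U _ bounded_linear_minus[OF bounded_linear_ident]])
  moreover have "(\<lambda>x vs. \<alpha> x [vs ! 0] * \<beta> x [vs ! 1] + - (\<beta> x [vs ! 0] * \<alpha> x [vs ! 1])) = wedge \<alpha> \<beta>"
    by (auto simp: wedge_def fun_eq_iff)
  ultimately show ?thesis by simp
qed

lemma smooth_tensor_on_wedge12:
  assumes M: "premanifold M" and U: "openin (mtop M) U" and \<alpha>: "smooth_tensor_on M U 1 \<alpha>" and \<omega>: "smooth_tensor_on M U 2 \<omega>"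
  shows "smooth_tensor_on M U 3 (wedge12 \<alpha> \<omega>)"
  unfolding smooth_tensor_on_def
proof (intro conjI ballI allI impI, goal_cases)
  case (1 x vs i)
  note la = one_form_linear[OF \<alpha> 1(1)]
  have l1: "linear (\<lambda>v. \<omega> x [v, w])" for w using smooth_tensor_on_linear[OF \<omega> 1(1), of "[0, w]" 0] by simp
  have l2: "linear (\<lambda>v. \<omega> x [w, v])" for w using smooth_tensor_on_linear[OF \<omega> 1(1), of "[w, 0]" 1] by simp
  have la': "linear (\<lambda>v. \<alpha> x [v] * c)" for c
    using linear_compose_scale_right[OF la, of c] by (simp add: mult.commute)
  note l1' = linear_compose_scale_right[OF l1, simplified] and l2' = linear_compose_scale_right[OF l2, simplified]
  have "i = 0 \<or> i = 1 \<or> i = 2" using 1 by auto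
  then show ?case
    using 1(2) by (auto simp: wedge12_def intro!: linear_compose_add linear_compose_sub la' l1' l2')
next
  case (2 c)
  then obtain V \<phi> where c: "c = (V, \<phi>)" "(V, \<phi>) \<in> atlas M" by (cases c) auto
  have s: "smooth_on (\<phi> ` (V \<inter> U)) (\<lambda>y. \<omega> (inv_into V \<phi> y) [tan_map euclid M (inv_into V \<phi>) y v, tan_map euclid M (inv_into V \<phi>) y w])" for v w
    using smooth_tensor_on_chart[OF \<omega> c(2), of "[v, w]"] by (simp add: coord_rep_chart)
  show ?case unfolding c
    using smooth_one_form_chart[OF \<alpha> c(2)] s
    by (auto simp: coord_rep_chart wedge12_def intro!: smooth_on_mult smooth_on_add smooth_on_diff chart_Int_open[OF M c(2) U])
qed

lemma ext_d_wedge: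
  fixes \<alpha> \<beta> :: "('a, 'e::euclidean_space, real) tensor"
  assumes M: "premanifold M" and x: "x \<in> points M" and "smooth_tensor_on M (points M) 1 \<alpha>" "smooth_tensor_on M (points M) 1 \<beta>"
  shows "ext_d M (wedge \<alpha> \<beta>) x [u, v, w] =
      ext_d M \<alpha> x [u, v] * \<beta> x [w] - ext_d M \<alpha> x [u, w] * \<beta> x [v] + ext_d M \<alpha> x [v, w] * \<beta> x [u]
      - \<alpha> x [u] * ext_d M \<beta> x [v, w] + \<alpha> x [v] * ext_d M \<beta> x [u, w] - \<alpha> x [w] * ext_d M \<beta> x [u, v]"
  using ext_d_mult_wedge[OF M openin_points x _ assms(3,4), of "\<lambda>_. 1"] smooth_map_real_const[OF M, of "1::real"]
  by (simp add: open_sub_points[OF M] fun_d_const[OF M x])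

text \<open>The data of the construction as seen on the total space: \<open>p1\<close>, ...,
  \<open>W3\<close> stand for the pulled-back partial derivatives and \<open>d\<eta>\<close> is the
  curvature equation. Since the base is not mentioned, exchanging the indices 2 and 3 gives another
  instance.\<close>

locale gk_coframe =
  fixes M :: "('m, real^4) manifold" and m1 m2 m3 p W p1 p2 p3 W1 W2 W3 :: "'m \<Rightarrow> real"
    and \<eta> :: "('m, real^4, real) tensor"
  assumes M: "premanifold M"
    and m1: "smooth_map M euclid m1" and m2: "smooth_map M euclid m2" and m3: "smooth_map M euclid m3"
    and p: "smooth_map M euclid p" and W: "smooth_map M euclid W"
    and \<eta>: "smooth_tensor_on M (points M) 1 \<eta>"
    and bounds: "x \<in> points M \<Longrightarrow> -1 < p x \<and> p x < 1 \<and> 0 < W x"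
    and dp: "x \<in> points M \<Longrightarrow> fun_d M p x [v] = p1 x * fun_d M m1 x [v] + p2 x * fun_d M m2 x [v] + p3 x * fun_d M m3 x [v]"
    and dW: "x \<in> points M \<Longrightarrow> fun_d M W x [v] = W1 x * fun_d M m1 x [v] + W2 x * fun_d M m2 x [v] + W3 x * fun_d M m3 x [v]"
    and d\<eta>: "x \<in> points M \<Longrightarrow> ext_d M \<eta> x [u, v] =
        (W3 x + p2 x * W x + p x * W2 x) * wedge (fun_d M m1) (fun_d M m2) x [u, v]
      - (W2 x + p3 x * W x + p x * W3 x) * wedge (fun_d M m1) (fun_d M m3) x [u, v]
      + W1 x * wedge (fun_d M m2) (fun_d M m3) x [u, v]"
    and inj: "x \<in> points M \<Longrightarrow> fun_d M m1 x [v] = 0 \<Longrightarrow> fun_d M m2 x [v] = 0 \<Longrightarrow> fun_d M m3 x [v] = 0 \<Longrightarrow>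
      \<eta> x [v] = 0 \<Longrightarrow> v = 0"
begin

abbreviation "A1 \<equiv> fun_d M m1"
abbreviation "A2 \<equiv> fun_d M m2"
abbreviation "A3 \<equiv> fun_d M m3"

text \<open>The values are forced by requiring \<open>- A1 + \<i> A2\<close> and
  \<open>\<eta> + \<i> W (A3 - p A2)\<close> to be of type (1,0): composition with \<open>I\<close>
  must multiply them by \<open>\<i>\<close>.\<close>

definition adapted :: "('m, real^4) endo \<Rightarrow> bool" where
  "adapted I \<longleftrightarrow> (\<forall>x\<in>points M. \<forall>v. A1 x [I x v] = A2 x [v] \<and> A2 x [I x v] = - A1 x [v] \<and>
     A3 x [I x v] = - p x * A1 x [v] + \<eta> x [v] / W x \<and> \<eta> x [I x v] = - W x * (A3 x [v] - p x * A2 x [v]))"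

lemma W0: "x \<in> points M \<Longrightarrow> W x \<noteq> 0"
  using bounds by force

lemma smooth_A: "smooth_tensor_on M (points M) 1 A1" "smooth_tensor_on M (points M) 1 A2" "smooth_tensor_on M (points M) 1 A3"
  by (rule smooth_fun_d[OF M openin_points], simp add: open_sub_points[OF M] m1 m2 m3)+

lemmas linear_A = smooth_A[THEN one_form_linear] \<eta>[THEN one_form_linear]

lemma ext_d_A [simp]:
  assumes "x \<in> points M"
  shows "ext_d M A1 x [u, v] = 0" "ext_d M A2 x [u, v] = 0" "ext_d M A3 x [u, v] = 0" "ext_d M (fun_d M p) x [u, v] = 0"
  using ext_d_fun_d(2)[OF M openin_points assms] m1 m2 m3 p by (simp_all add: open_sub_points[OF M])

lemma coframe_eqI:
  assumes "x \<in> points M" "A1 x [u] = A1 x [v]" "A2 x [u] = A2 x [v]" "A3 x [u] = A3 x [v]" "\<eta> x [u] = \<eta> x [v]"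
  shows "u = v"
  using inj[OF assms(1), of "u - v"] linear_A[OF assms(1), THEN linear_diff, of u v] assms by simp

text \<open>The coframe collected into one vector, so that injectivity gives surjectivity by
  dimension and \<open>smooth_on_inv_linear\<close> applies.\<close>

definition frame :: "'m \<Rightarrow> real^4 \<Rightarrow> real^4" where
  "frame x v = (\<chi> i. if i = 1 then A1 x [v] else if i = 2 then A2 x [v] else if i = 3 then A3 x [v] else \<eta> x [v])"

lemma frame_nth: "frame x v $ 1 = A1 x [v]" "frame x v $ 2 = A2 x [v]" "frame x v $ 3 = A3 x [v]" "frame x v $ 4 = \<eta> x [v]"
  by (simp_all add: frame_def)

lemma frame_linear: "x \<in> points M \<Longrightarrow> linear (frame x)"
  by (auto intro!: linearI simp: frame_def vec_eq_iff linear_add[OF linear_A(1)] linear_add[OF linear_A(2)]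
      linear_add[OF linear_A(3)] linear_add[OF linear_A(4)] linear_scale[OF linear_A(1)] linear_scale[OF linear_A(2)]
      linear_scale[OF linear_A(3)] linear_scale[OF linear_A(4)])

lemma frame_inj: "x \<in> points M \<Longrightarrow> inj (frame x)"
  using coframe_eqI[of x] by (metis frame_nth injI)

lemma frame_surj: "x \<in> points M \<Longrightarrow> surj (frame x)"
  using linear_injective_imp_surjective frame_linear frame_inj by blast

lemma coframe_ex:
  assumes "x \<in> points M"
  obtains v where "A1 x [v] = a" "A2 x [v] = b" "A3 x [v] = c" "\<eta> x [v] = d"
proof -
  obtain v where v: "(\<chi> i. if i = 1 then a else if i = 2 then b else if i = 3 then c else d) = frame x v"
    using frame_surj[OF assms] by (rule surjE)
  show ?thesis by (rule that[of v]) (simp_all add: frame_nth[symmetric] v[symmetric])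
qed

lemma adaptedD:
  assumes "adapted I" "x \<in> points M"
  shows "A1 x [I x v] = A2 x [v]" "A2 x [I x v] = - A1 x [v]"
    "A3 x [I x v] = - p x * A1 x [v] + \<eta> x [v] / W x" "\<eta> x [I x v] = - W x * (A3 x [v] - p x * A2 x [v])"
  using assms by (auto simp: adapted_def)

text \<open>\<open>C\<close> lists the prescribed values of the coframe on \<open>I v\<close>.
  Solving \<open>frame x (I x v) = C x v\<close> gives \<open>I\<close>, and Cramer's rule applied
  in charts gives its smoothness.\<close>

lemma adapted_exists: "\<exists>I. almost_complex_structure M I \<and> adapted I"
proof -
  define C :: "'m \<Rightarrow> real^4 \<Rightarrow> real^4" where "C = (\<lambda>x v. (\<chi> i. if i = 1 then A2 x [v] else if i = 2 then - A1 x [v] else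
     if i = 3 then - p x * A1 x [v] + \<eta> x [v] * inverse (W x) else - W x * (A3 x [v] - p x * A2 x [v])))"
  define I where "I = (\<lambda>x v. inv (frame x) (C x v))"
  have fI: "frame x (I x v) = C x v" if "x \<in> points M" for x v
    unfolding I_def using frame_surj[OF that] by (simp add: surj_f_inv_f)
  have ad: "adapted I" unfolding adapted_def
  proof (intro ballI allI)
    fix x v assume "x \<in> points M"
    from fI[OF this, of v] frame_nth[of x "I x v"]
    show "A1 x [I x v] = A2 x [v] \<and> A2 x [I x v] = - A1 x [v] \<and>
     A3 x [I x v] = - p x * A1 x [v] + \<eta> x [v] / W x \<and> \<eta> x [I x v] = - W x * (A3 x [v] - p x * A2 x [v])"
      by (simp add: C_def divide_inverse)
  qed
  have lC: "linear (C x)" if x: "x \<in> points M" for x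
    by (auto intro!: linearI simp: C_def vec_eq_iff algebra_simps linear_add[OF linear_A(1)[OF x]] linear_add[OF linear_A(2)[OF x]]
      linear_add[OF linear_A(3)[OF x]] linear_add[OF linear_A(4)[OF x]] linear_scale[OF linear_A(1)[OF x]] linear_scale[OF linear_A(2)[OF x]]
      linear_scale[OF linear_A(3)[OF x]] linear_scale[OF linear_A(4)[OF x]])
  have lI: "linear (I x)" if x: "x \<in> points M" for x
  proof -
    have "linear (inv (frame x))"
      using inj_linear_imp_inv_bounded_linear[OF _ frame_inj[OF x]] frame_linear[OF x] by (simp add: linear_conv_bounded_linear)
    from linear_compose[OF lC[OF x] this] show ?thesis by (simp add: I_def o_def)
  qed
  have II: "I x (I x v) = - v" if x: "x \<in> points M" for x v
    by (rule coframe_eqI[OF x])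
      (use W0[OF x] in \<open>simp_all add: adaptedD[OF ad x] linear_neg[OF linear_A(1)[OF x]] linear_neg[OF linear_A(2)[OF x]]
        linear_neg[OF linear_A(3)[OF x]] linear_neg[OF linear_A(4)[OF x]] field_simps\<close>)
  have sI: "smooth_on (\<phi> ` V) (\<lambda>y. coord_endo M (V, \<phi>) I y v)" if V: "(V, \<phi>) \<in> atlas M" for V \<phi> v
  proof -
    let ?Q = "inv_into V \<phi>" and ?E = "tan_map euclid M (inv_into V \<phi>)"
    have o: "open (\<phi> ` V)" by (rule chart_homeomorphic(2)[OF M V])
    have VM: "V \<inter> points M = V" using chart_subset[OF M V] by blast
    have Q: "?Q y \<in> points M" "?Q y \<in> V" "\<phi> (?Q y) = y" if "y \<in> \<phi> ` V" for y
      using that chart_inv[OF M V] chart_subset[OF M V] by auto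
    have lE: "linear (?E y)" if "y \<in> \<phi> ` V" for y
      by (rule tan_map_linear[OF premanifold_euclid M smooth_near_chart_inv[OF M V that]])
    have iE: "inj (?E y)" if "y \<in> \<phi> ` V" for y
      using chart_frame(1)[OF M V Q(2)[OF that]] Q(3)[OF that] by (metis injI)
    note s = smooth_A[THEN smooth_one_form_chart, OF V, unfolded VM] \<eta>[THEN smooth_one_form_chart, OF V, unfolded VM]
    have sf: "smooth_on (\<phi> ` V) (\<lambda>y. frame (?Q y) (?E y w))" for w
    proof (rule smooth_on_vec[OF o])
      fix i show "smooth_on (\<phi> ` V) (\<lambda>y. frame (?Q y) (?E y w) $ i)"
        using s[of w] by (cases "i = 1"; cases "i = 2"; cases "i = 3") (simp_all add: frame_def)
    qed
    have sC: "smooth_on (\<phi> ` V) (\<lambda>y. C (?Q y) (?E y v))"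
    proof (rule smooth_on_vec[OF o])
      have sW: "smooth_on (\<phi> ` V) (\<lambda>y. W (?Q y))" and sp: "smooth_on (\<phi> ` V) (\<lambda>y. p (?Q y))"
        using smooth_map_real[OF M _ V] W p by auto
      have si: "smooth_on (\<phi> ` V) (\<lambda>y. inverse (W (?Q y)))"
        by (rule smooth_on_inverse[OF o sW]) (use W0 Q in auto)
      fix i show "smooth_on (\<phi> ` V) (\<lambda>y. C (?Q y) (?E y v) $ i)"
        using s[of v] sW sp si
        by (cases "i = 1"; cases "i = 2"; cases "i = 3")
          (simp_all add: C_def smooth_on_mult smooth_on_add smooth_on_diff smooth_on_uminus o)
    qed
    have "smooth_on (\<phi> ` V) (\<lambda>y. inv (\<lambda>w. frame (?Q y) (?E y w)) (C (?Q y) (?E y v)))"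
    proof (rule smooth_on_inv_linear[OF o sf sC])
      fix y assume y: "y \<in> \<phi> ` V"
      show "linear (\<lambda>w. frame (?Q y) (?E y w))"
        using linear_compose[OF lE[OF y] frame_linear[OF Q(1)[OF y]]] by (simp add: o_def)
      show "inj (\<lambda>w. frame (?Q y) (?E y w))"
        using inj_compose[OF frame_inj[OF Q(1)[OF y]] iE[OF y]] by (simp add: o_def)
    qed
    then show ?thesis
    proof (rule smooth_on_cong[OF o, rotated])
      fix y assume y: "y \<in> \<phi> ` V"
      have "frame (?Q y) (?E y (coord_endo M (V, \<phi>) I y v)) = C (?Q y) (?E y v)"
        using chart_frame(2)[OF M V Q(2)[OF y]] fI[OF Q(1)[OF y]] by (simp add: coord_endo_def Let_def Q(3)[OF y])
      moreover have "inj (\<lambda>w. frame (?Q y) (?E y w))"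
        using inj_compose[OF frame_inj[OF Q(1)[OF y]] iE[OF y]] by (simp add: o_def)
      ultimately show "inv (\<lambda>w. frame (?Q y) (?E y w)) (C (?Q y) (?E y v)) = coord_endo M (V, \<phi>) I y v"
        by (intro inv_f_eq)
    qed
  qed
  have "almost_complex_structure M I" unfolding almost_complex_structure_def using lI II sI by auto
  then show ?thesis using ad by blast
qed

text \<open>The imaginary part of the (1,0)-form \<open>\<eta> + \<i> \<xi>\<close>, written as a
  sum of scaled forms to suit the rules for \<open>ext_d\<close>.\<close>

definition \<xi> :: "('m, real^4, real) tensor" where
  "\<xi> x vs = W x * A3 x vs + (- (p x * W x)) * A2 x vs"

lemma smooth_\<xi>: "smooth_tensor_on M (points M) 1 \<xi>"
proof -
  have "smooth_tensor_on M (points M) 1 (\<lambda>x vs. W x * A3 x vs + (- (p x * W x)) * A2 x vs)"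
    by (intro smooth_tensor_on_add[OF M openin_points] smooth_tensor_on_scale[OF M] smooth_A smooth_fun_intros M W p)
  then show ?thesis by (simp add: \<xi>_def[abs_def])
qed

lemma d\<xi>:
  assumes x: "x \<in> points M"
  shows "ext_d M \<xi> x [u, v] = fun_d M W x [u] * A3 x [v] - fun_d M W x [v] * A3 x [u]
    - (p x * fun_d M W x [u] + fun_d M p x [u] * W x) * A2 x [v] + (p x * fun_d M W x [v] + fun_d M p x [v] * W x) * A2 x [u]"
proof -
  have "ext_d M (\<lambda>x vs. W x * A3 x vs + (- (p x * W x)) * A2 x vs) x [u, v] =
     ext_d M (\<lambda>x vs. W x * A3 x vs) x [u, v] + ext_d M (\<lambda>x vs. (- (p x * W x)) * A2 x vs) x [u, v]"
    by (rule ext_d_add[OF M openin_points x smooth_tensor_on_scale[OF M W smooth_A(3)]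
          smooth_tensor_on_scale[OF M smooth_map_uminus[OF M smooth_map_mult[OF M p W]] smooth_A(2)]]) simp
  also have "ext_d M (\<lambda>x vs. W x * A3 x vs) x [u, v] = fun_d M W x [u] * A3 x [v] - fun_d M W x [v] * A3 x [u]"
    using ext_d_mult_one[OF M openin_points x _ smooth_A(3), of W] W x by (simp add: open_sub_points[OF M])
  also have "ext_d M (\<lambda>x vs. (- (p x * W x)) * A2 x vs) x [u, v] =
      fun_d M (\<lambda>x. - (p x * W x)) x [u] * A2 x [v] - fun_d M (\<lambda>x. - (p x * W x)) x [v] * A2 x [u]"
    using ext_d_mult_one[OF M openin_points x _ smooth_A(2), of "\<lambda>x. - (p x * W x)"] x
      smooth_map_uminus[OF M smooth_map_mult[OF M p W]] by (simp add: open_sub_points[OF M])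
  finally have "ext_d M \<xi> x [u, v] = fun_d M W x [u] * A3 x [v] - fun_d M W x [v] * A3 x [u]
      + (fun_d M (\<lambda>x. - (p x * W x)) x [u] * A2 x [v] - fun_d M (\<lambda>x. - (p x * W x)) x [v] * A2 x [u])"
    unfolding \<xi>_def[abs_def] .
  then show ?thesis
    unfolding fun_d_uminus[OF M smooth_map_mult[OF M p W] x] fun_d_mult[OF M p W x] by (simp add: algebra_simps)
qed

text \<open>The Nijenhuis tensor is tested on the coframe. On \<open>A1\<close> and
  \<open>A2\<close> it vanishes because these forms are closed. On \<open>\<eta>\<close> and
  \<open>\<xi>\<close> the curvature equation enters: it makes the (0,2)-part of
  \<open>d (\<eta> + \<i> \<xi>)\<close> vanish.\<close>

lemma adapted_integrable:
  assumes I: "almost_complex_structure M I" "adapted I"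
  shows "integrable_acs M I"
proof -
  have "nijenhuis M I x u v = 0" if x: "x \<in> points M" for x u v
  proof -
    let ?N = "nijenhuis M I x u v"
    note r = adaptedD[OF I(2)] and W0 = W0[OF x]
    have neg: "smooth_tensor_on M (points M) 1 (\<lambda>x vs. - \<alpha> x vs)" "ext_d M (\<lambda>x vs. - \<alpha> x vs) x [u, v] = - ext_d M \<alpha> x [u, v]"
      if "smooth_tensor_on M (points M) 1 \<alpha>" for \<alpha> :: "('m, real^4, real) tensor" and u v
      using smooth_tensor_on_linear_image[OF M openin_points that bounded_linear_minus[OF bounded_linear_ident]]
        ext_d_linear_image[OF M openin_points x that _ bounded_linear_minus[OF bounded_linear_ident], of "[u, v]"] by simp_all
    have n1: "A1 x [?N] = 0"
      using nijenhuis_one_form[OF M I(1) x smooth_A(1) neg(1)[OF smooth_A(2)]] by (simp add: r x neg(2)[OF smooth_A(2)])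
    have n2: "A2 x [?N] = 0"
      using nijenhuis_one_form[OF M I(1) x smooth_A(2,1)] by (simp add: r x)
    have xi: "\<xi> z [I z v] = \<eta> z [v]" if "z \<in> points M" for z v
      using gk_coframe.W0[OF gk_coframe_axioms that] by (simp add: \<xi>_def r[OF that] field_simps)
    have n4: "\<eta> x [?N] = ext_d M \<eta> x [u, v] - ext_d M \<eta> x [I x u, I x v] - ext_d M \<xi> x [I x u, v] - ext_d M \<xi> x [u, I x v]"
      by (rule nijenhuis_one_form[OF M I(1) x \<eta> smooth_\<xi>]) (use xi in \<open>simp_all add: r \<xi>_def algebra_simps\<close>)
    have n3: "\<xi> x [?N] = ext_d M \<xi> x [u, v] - ext_d M \<xi> x [I x u, I x v] - ext_d M (\<lambda>x vs. - \<eta> x vs) x [I x u, v] - ext_d M (\<lambda>x vs. - \<eta> x vs) x [u, I x v]"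
      by (rule nijenhuis_one_form[OF M I(1) x smooth_\<xi> neg(1)[OF \<eta>]]) (use xi in \<open>simp_all add: r \<xi>_def algebra_simps\<close>)
    \<comment> \<open>Writing the values of \<open>\<eta>\<close> as multiples of \<open>W\<close>
      removes the denominators in \<open>A3 (I v)\<close> and leaves polynomial identities.\<close>
    obtain e f where ef: "\<eta> x [u] = W x * e" "\<eta> x [v] = W x * f"
      using W0 by (metis nonzero_mult_div_cancel_left times_divide_eq_right)
    have n4': "\<eta> x [?N] = 0"
      unfolding n4 d\<eta>[OF x] d\<xi>[OF x] dp[OF x] dW[OF x] wedge_def
      using W0 by (simp add: r[OF x] ef) (simp add: algebra_simps)
    have n3': "\<xi> x [?N] = 0"
      unfolding n3 neg(2)[OF \<eta>] d\<eta>[OF x] d\<xi>[OF x] dp[OF x] dW[OF x] wedge_def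
      using W0 by (simp add: r[OF x] ef) (simp add: algebra_simps)
    have "A3 x [?N] = 0" using n3' n2 W0 by (simp add: \<xi>_def)
    then show ?thesis using inj[OF x n1 n2 _ n4'] by blast
  qed
  then show ?thesis using I(1) by (simp add: integrable_acs_def)
qed

end

context gk_coframe
begin

section \<open>Metric, holomorphic 2-form and torsion of the coframe\<close>

definition gk_metric :: "('m, real^4, real) tensor" where
  "gk_metric x vs = W x * (1 - (p x)\<^sup>2) * (A1 x [vs ! 0] * A1 x [vs ! 1]) + W x * (A2 x [vs ! 0] * A2 x [vs ! 1])
     + W x * (A3 x [vs ! 0] * A3 x [vs ! 1]) + (- (W x * p x)) * (A2 x [vs ! 0] * A3 x [vs ! 1])
     + (- (W x * p x)) * (A3 x [vs ! 0] * A2 x [vs ! 1]) + inverse (W x) * (\<eta> x [vs ! 0] * \<eta> x [vs ! 1])"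

lemma metric_riemannian: "riemannian_metric M gk_metric"
proof -
  have "smooth_tensor_on M (points M) 2 gk_metric"
    unfolding gk_metric_def[abs_def]
    by (intro smooth_tensor_on_add[OF M openin_points] smooth_tensor_on_scale[OF M] smooth_tensor_on_product[OF M openin_points]
        smooth_A \<eta> smooth_fun_intros M W p smooth_map_inverse W0)
  moreover have "gk_metric x [u, v] = gk_metric x [v, u]" for x u v by (simp add: gk_metric_def algebra_simps)
  moreover have "gk_metric x [v, v] > 0" if x: "x \<in> points M" and "v \<noteq> 0" for x v
  proof -
    have b: "W x > 0" "(p x)\<^sup>2 < 1" using bounds[OF x] by (auto simp: abs_square_less_1)
    \<comment> \<open>Completing the square in \<open>A3\<close>: since
      \<open>p\<^sup>2 < 1\<close>, every summand is nonnegative.\<close>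
    have e: "gk_metric x [v, v] = W x * ((1 - (p x)\<^sup>2) * ((A1 x [v])\<^sup>2 + (A2 x [v])\<^sup>2) + (A3 x [v] - p x * A2 x [v])\<^sup>2)
        + inverse (W x) * (\<eta> x [v])\<^sup>2"
      by (simp add: gk_metric_def power2_eq_square algebra_simps)
    have nn: "0 \<le> (1 - (p x)\<^sup>2) * ((A1 x [v])\<^sup>2 + (A2 x [v])\<^sup>2)" using b by (intro mult_nonneg_nonneg) auto
    have n2: "0 \<le> W x * ((1 - (p x)\<^sup>2) * ((A1 x [v])\<^sup>2 + (A2 x [v])\<^sup>2) + (A3 x [v] - p x * A2 x [v])\<^sup>2)"
      using b nn by (intro mult_nonneg_nonneg) auto
    have "gk_metric x [v, v] \<noteq> 0"
    proof
      assume "gk_metric x [v, v] = 0"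
      then have "inverse (W x) * (\<eta> x [v])\<^sup>2 = 0"
        "W x * ((1 - (p x)\<^sup>2) * ((A1 x [v])\<^sup>2 + (A2 x [v])\<^sup>2) + (A3 x [v] - p x * A2 x [v])\<^sup>2) = 0"
        using e n2 b by (smt (verit) mult_nonneg_nonneg positive_imp_inverse_positive zero_le_power2)+
      then have "\<eta> x [v] = 0" "(1 - (p x)\<^sup>2) * ((A1 x [v])\<^sup>2 + (A2 x [v])\<^sup>2) = 0" "(A3 x [v] - p x * A2 x [v])\<^sup>2 = 0"
        using b nn by (auto simp: add_nonneg_eq_0_iff)
      then have "\<eta> x [v] = 0" "A1 x [v] = 0" "A2 x [v] = 0" "A3 x [v] = 0" using b by (auto simp: sum_power2_eq_zero_iff)
      then show False using inj[OF x] \<open>v \<noteq> 0\<close> by blast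
    qed
    moreover have "gk_metric x [v, v] \<ge> 0" unfolding e using n2 b by (intro add_nonneg_nonneg mult_nonneg_nonneg) auto
    ultimately show ?thesis by simp
  qed
  ultimately show ?thesis by (simp add: riemannian_metric_def)
qed

lemma adapted_compatible: "adapted I \<Longrightarrow> compatible_acs M gk_metric I"
  using W0 by (auto simp: compatible_acs_def gk_metric_def adaptedD power2_eq_square field_simps)

text \<open>The product \<open>(- A1 + \<i> A2) \<and> (\<eta> + \<i> \<xi>)\<close> split into real
  and imaginary part; the term with \<open>A2 \<and> A2\<close> has disappeared from the real
  part.\<close>

definition Omega :: "('m, real^4, complex) tensor" where
  "Omega x vs = complex_of_real ((-1) * wedge A1 \<eta> x vs + (- W x) * wedge A2 A3 x vs)
     + \<i> * complex_of_real (wedge A2 \<eta> x vs + ((- W x) * wedge A1 A3 x vs + (p x * W x) * wedge A1 A2 x vs))"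

lemma d_mult_wedge:
  fixes f :: "'m \<Rightarrow> real"
  assumes x: "x \<in> points M" and f: "smooth_map M euclid f"
    and \<alpha>: "smooth_tensor_on M (points M) 1 \<alpha>" and \<beta>: "smooth_tensor_on M (points M) 1 \<beta>"
  shows "smooth_tensor_on M (points M) 2 (\<lambda>x vs. f x * wedge \<alpha> \<beta> x vs)"
    "ext_d M (\<lambda>x vs. f x * wedge \<alpha> \<beta> x vs) x [u, v, w] =
    fun_d M f x [u] * wedge \<alpha> \<beta> x [v, w] - fun_d M f x [v] * wedge \<alpha> \<beta> x [u, w] + fun_d M f x [w] * wedge \<alpha> \<beta> x [u, v] +
    f x * (ext_d M \<alpha> x [u, v] * \<beta> x [w] - ext_d M \<alpha> x [u, w] * \<beta> x [v] + ext_d M \<alpha> x [v, w] * \<beta> x [u]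
      - \<alpha> x [u] * ext_d M \<beta> x [v, w] + \<alpha> x [v] * ext_d M \<beta> x [u, w] - \<alpha> x [w] * ext_d M \<beta> x [u, v])"
  using smooth_tensor_on_scale[OF M f smooth_tensor_on_wedge[OF M openin_points \<alpha> \<beta>]]
    ext_d_mult_wedge[OF M openin_points x _ \<alpha> \<beta>] f by (auto simp: open_sub_points[OF M])

lemma ext_d_add3:
  assumes "x \<in> points M" "smooth_tensor_on M (points M) 2 \<alpha>" "smooth_tensor_on M (points M) 2 \<beta>"
  shows "ext_d M (\<lambda>x vs. \<alpha> x vs + \<beta> x vs) x [u, v, w] = ext_d M \<alpha> x [u, v, w] + ext_d M \<beta> x [u, v, w]"
  by (rule ext_d_add[OF M openin_points assms]) simp

text \<open>Closedness is a match of coefficients. \<open>A1 \<and> d \<eta>\<close> sees only the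
  \<open>W1\<close> term of the curvature, which cancels \<open>d W \<and> A2 \<and> A3\<close>;
  \<open>A2 \<and> d \<eta>\<close> sees only the middle term, which cancels the derivatives of
  \<open>W\<close> and of \<open>p W\<close>.\<close>

lemma Omega_parts:
  shows "smooth_tensor_on M (points M) 2 (\<lambda>x vs. (-1) * wedge A1 \<eta> x vs + (- W x) * wedge A2 A3 x vs)" (is "smooth_tensor_on _ _ _ ?R")
    and "smooth_tensor_on M (points M) 2 (\<lambda>x vs. wedge A2 \<eta> x vs + ((- W x) * wedge A1 A3 x vs + (p x * W x) * wedge A1 A2 x vs))"
      (is "smooth_tensor_on _ _ _ ?S")
    and "x \<in> points M \<Longrightarrow> ext_d M (\<lambda>x vs. (-1) * wedge A1 \<eta> x vs + (- W x) * wedge A2 A3 x vs) x [u, v, w] = 0"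
    and "x \<in> points M \<Longrightarrow> ext_d M (\<lambda>x vs. wedge A2 \<eta> x vs + ((- W x) * wedge A1 A3 x vs + (p x * W x) * wedge A1 A2 x vs)) x [u, v, w] = 0"
proof -
  note c = smooth_map_real_const[OF M, of "-1::real"] and nW = smooth_map_uminus[OF M W] and pW = smooth_map_mult[OF M p W]
  note s1 = smooth_tensor_on_scale[OF M c smooth_tensor_on_wedge[OF M openin_points smooth_A(1) \<eta>]]
  note s2 = smooth_tensor_on_scale[OF M nW smooth_tensor_on_wedge[OF M openin_points smooth_A(2,3)]]
  note s3 = smooth_tensor_on_wedge[OF M openin_points smooth_A(2) \<eta>]
  note s4 = smooth_tensor_on_scale[OF M nW smooth_tensor_on_wedge[OF M openin_points smooth_A(1,3)]]
  note s5 = smooth_tensor_on_scale[OF M pW smooth_tensor_on_wedge[OF M openin_points smooth_A(1,2)]]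
  note s45 = smooth_tensor_on_add[OF M openin_points s4 s5]
  show "smooth_tensor_on M (points M) 2 ?R" by (rule smooth_tensor_on_add[OF M openin_points s1 s2])
  show "smooth_tensor_on M (points M) 2 ?S" by (rule smooth_tensor_on_add[OF M openin_points s3 s45])
  assume x: "x \<in> points M"
  show "ext_d M ?R x [u, v, w] = 0"
    unfolding ext_d_add3[OF x s1 s2] d_mult_wedge(2)[OF x c smooth_A(1) \<eta>] d_mult_wedge(2)[OF x nW smooth_A(2,3)]
    unfolding fun_d_const[OF M x] fun_d_uminus[OF M W x] d\<eta>[OF x] dW[OF x] wedge_def ext_d_A[OF x]
    by (simp add: algebra_simps)
  show "ext_d M ?S x [u, v, w] = 0"
    unfolding ext_d_add3[OF x s3 s45] ext_d_add3[OF x s4 s5] ext_d_wedge[OF M x smooth_A(2) \<eta>] d_mult_wedge(2)[OF x nW smooth_A(1,3)]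
      d_mult_wedge(2)[OF x pW smooth_A(1,2)]
    unfolding fun_d_uminus[OF M W x] fun_d_mult[OF M p W x] d\<eta>[OF x] dW[OF x] dp[OF x] wedge_def ext_d_A[OF x]
    by (simp add: algebra_simps)
qed

lemma bounded_linear_of_real_i: "bounded_linear (\<lambda>s. \<i> * complex_of_real s)"
  by (rule bounded_linear_compose[OF bounded_linear_mult_right bounded_linear_of_real])

lemma Omega_smooth: "smooth_form_on M (points M) 2 Omega"
proof -
  have "smooth_tensor_on M (points M) 2 Omega" unfolding Omega_def[abs_def]
    by (intro smooth_tensor_on_add[OF M openin_points]
        smooth_tensor_on_linear_image[OF M openin_points Omega_parts(1) bounded_linear_of_real]
        smooth_tensor_on_linear_image[OF M openin_points Omega_parts(2) bounded_linear_of_real_i])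
  moreover have "Omega x vs = 0" if "length vs = 2" "\<not> distinct vs" for x vs
    using that by (auto elim!: length_two_cases simp: Omega_def wedge_def)
  ultimately show ?thesis by (simp add: smooth_form_on_def)
qed

lemma Omega_closed:
  assumes x: "x \<in> points M" and "length vs = 3"
  shows "ext_d M Omega x vs = 0"
proof -
  obtain u v w where vs: "vs = [u, v, w]" using assms(2) length_three_cases by blast
  note s1 = smooth_tensor_on_linear_image[OF M openin_points Omega_parts(1) bounded_linear_of_real]
  note s2 = smooth_tensor_on_linear_image[OF M openin_points Omega_parts(2) bounded_linear_of_real_i]
  have l: "length [u, v, w] = Suc 2" by simp
  show ?thesis unfolding vs Omega_def[abs_def] ext_d_add[OF M openin_points x s1 s2 l]
      ext_d_linear_image[OF M openin_points x Omega_parts(1) l bounded_linear_of_real]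
      ext_d_linear_image[OF M openin_points x Omega_parts(2) l bounded_linear_of_real_i]
      Omega_parts(3,4)[OF x] by simp
qed

text \<open>Uniqueness: pairing with the vectors dual to \<open>\<eta>\<close> and to
  \<open>A1\<close> recovers all four coframe values of \<open>I' x u\<close> from
  \<open>Omega\<close>. The constant \<open>c\<close> absorbs the sign that arises when the indices
  are exchanged for \<open>J\<close>.\<close>

lemma adapted_determined:
  assumes I: "almost_complex_structure M I" "adapted I" and c: "c \<noteq> 0"
  shows "determined_acs M (\<lambda>x vs. c * Omega x vs) I"
proof -
  have so: "smooth_tensor_on M (points M) 2 Omega" using Omega_smooth by (simp add: smooth_form_on_def)
  have s: "smooth_form_on M (points M) 2 (\<lambda>x vs. c * Omega x vs)"
    using smooth_tensor_on_linear_image[OF M openin_points so bounded_linear_mult_right] Omega_smooth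
    by (simp add: smooth_form_on_def)
  have d: "ext_d M (\<lambda>x vs. c * Omega x vs) z vs = 0" if "z \<in> points M" "length vs = 3" for z vs
    using ext_d_linear_image[OF M openin_points that(1) so _ bounded_linear_mult_right, of vs] Omega_closed[OF that] that
    by simp
  have l: "Omega z [I z u, v] = \<i> * Omega z [u, v]" "Omega z [u, I z v] = \<i> * Omega z [u, v]" if z: "z \<in> points M" for z u v
    using W0[OF z] by (simp_all add: Omega_def wedge_def adaptedD[OF I(2) z] complex_eq_iff field_simps)
  have h: "holomorphic_form M I 2 (\<lambda>x vs. c * Omega x vs)"
    by (rule holomorphic_formI[OF M s _ _ d]) (simp_all add: l)
  have "I' x = I x"
    if I': "almost_complex_structure M I'" "holomorphic_form M I' 2 (\<lambda>x vs. c * Omega x vs)" and x: "x \<in> points M" for I' x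
  proof
    fix u
    have eq: "Omega x [I' x u, v] = Omega x [I x u, v]" for v
      using holomorphic_form_left[OF I' x] l(1)[OF x] c by simp
    obtain e where e: "A1 x [e] = 0" "A2 x [e] = 0" "A3 x [e] = 0" "\<eta> x [e] = 1" using coframe_ex[OF x] .
    have 1: "A1 x [I' x u] = A1 x [I x u]" "A2 x [I' x u] = A2 x [I x u]"
      using eq[of e] by (simp_all add: Omega_def wedge_def e complex_eq_iff)
    obtain f where f: "A1 x [f] = 1" "A2 x [f] = 0" "A3 x [f] = 0" "\<eta> x [f] = 0" using coframe_ex[OF x] .
    have 2: "A3 x [I' x u] = A3 x [I x u]" "\<eta> x [I' x u] = \<eta> x [I x u]"
      using eq[of f] W0[OF x] 1 by (simp_all add: Omega_def wedge_def f complex_eq_iff)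
    show "I' x u = I x u" by (rule coframe_eqI[OF x 1 2])
  qed
  then show ?thesis unfolding determined_acs_def using I(1) h by blast
qed

text \<open>The 3-form \<open>H\<close>, by \<open>adapted_dc\<close>. In wedge notation it is
  \<open>A1 \<and> d p \<and> \<eta> - W d p \<and> A2 \<and> A3\<close>, visibly odd under exchange
  of \<open>A2\<close> with \<open>A3\<close> and of \<open>\<eta>\<close> with
  \<open>- \<eta>\<close>.\<close>

definition torsion :: "('m, real^4, real) tensor" where
  "torsion x vs = wedge12 A1 (wedge (fun_d M p) \<eta>) x vs + wedge12 (\<lambda>x vs. (- W x) * fun_d M p x vs) (wedge A2 A3) x vs"

lemma smooth_dp: "smooth_tensor_on M (points M) 1 (fun_d M p)"
  by (rule smooth_fun_d[OF M openin_points]) (simp add: open_sub_points[OF M] p)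

lemma torsion_smooth:
  "smooth_tensor_on M (points M) 3 (wedge12 A1 (wedge (fun_d M p) \<eta>))"
  "smooth_tensor_on M (points M) 3 (wedge12 (\<lambda>x vs. (- W x) * fun_d M p x vs) (wedge A2 A3))"
  by (intro smooth_tensor_on_wedge12 M openin_points smooth_A smooth_tensor_on_wedge smooth_dp \<eta> smooth_tensor_on_scale smooth_map_uminus W)+

text \<open>Both summands of the exterior derivative of the torsion are 4-forms in the three forms
  \<open>d\<mu>\<^sub>i\<close>, hence vanish.\<close>

lemma torsion_closed:
  assumes x: "x \<in> points M"
  shows "ext_d M torsion x [a, b, c, d] = 0"
proof -
  note sp = smooth_dp and sWp = smooth_tensor_on_scale[OF M smooth_map_uminus[OF M W] smooth_dp]
  have l: "length [a, b, c, d] = Suc 3" by simp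
  have dWp: "ext_d M (\<lambda>x vs. (- W x) * fun_d M p x vs) x [u, v] = - fun_d M W x [u] * fun_d M p x [v] + fun_d M W x [v] * fun_d M p x [u]" for u v
    using ext_d_mult_one[OF M openin_points x _ sp, of "\<lambda>x. - W x"] smooth_map_uminus[OF M W] fun_d_uminus[OF M W x] x
    by (simp add: open_sub_points[OF M])
  have 1: "ext_d M (wedge12 A1 (wedge (fun_d M p) \<eta>)) x [a, b, c, d] = 0"
    unfolding ext_d_wedge12[OF M openin_points x smooth_A(1) smooth_tensor_on_wedge[OF M openin_points sp \<eta>]]
      ext_d_wedge[OF M x sp \<eta>]
    unfolding ext_d_A[OF x] d\<eta>[OF x] dp[OF x] wedge_def by (simp add: algebra_simps)
  have 2: "ext_d M (wedge12 (\<lambda>x vs. (- W x) * fun_d M p x vs) (wedge A2 A3)) x [a, b, c, d] = 0"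
    unfolding ext_d_wedge12[OF M openin_points x sWp smooth_tensor_on_wedge[OF M openin_points smooth_A(2,3)]]
      ext_d_wedge[OF M x smooth_A(2,3)]
    unfolding ext_d_A[OF x] dWp dp[OF x] dW[OF x] wedge_def by (simp add: algebra_simps)
  show ?thesis unfolding torsion_def[abs_def] ext_d_add[OF M openin_points x torsion_smooth l] 1 2 by simp
qed

text \<open>What \<open>fundamental_form gk_metric I\<close> becomes for every adapted
  \<open>I\<close>; as a sum of scaled wedges it has a computable exterior derivative.\<close>

definition kaehler_form :: "('m, real^4, real) tensor" where
  "kaehler_form x vs = (- (W x * (1 - (p x)\<^sup>2))) * wedge A1 A2 x vs + (wedge \<eta> A3 x vs + (- p x) * wedge \<eta> A2 x vs)"

text \<open>The curvature equation cancels all derivatives of \<open>W\<close> in the exterior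
  derivative of \<open>kaehler_form\<close>, so only derivatives of \<open>p\<close> remain.
  Inserting \<open>I\<close> according to \<open>dc_type_11\<close> rearranges them into the
  torsion.\<close>

lemma adapted_dc:
  assumes I: "almost_complex_structure M I" "adapted I" and x: "x \<in> points M"
  shows "dc M I 2 (complexify (fundamental_form gk_metric I)) x [u, v, w] = - complex_of_real (torsion x [u, v, w])"
proof -
  let ?f = "- (W x * (1 - (p x)\<^sup>2))"
  have sf: "smooth_map M euclid (\<lambda>x. - (W x * (1 - (p x)\<^sup>2)))" and snp: "smooth_map M euclid (\<lambda>x. - p x)"
    by (intro smooth_fun_intros M W p)+
  note s1 = smooth_tensor_on_scale[OF M sf smooth_tensor_on_wedge[OF M openin_points smooth_A(1,2)]]
  note s2 = smooth_tensor_on_wedge[OF M openin_points \<eta> smooth_A(3)]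
  note s3 = smooth_tensor_on_scale[OF M snp smooth_tensor_on_wedge[OF M openin_points \<eta> smooth_A(2)]]
  note s23 = smooth_tensor_on_add[OF M openin_points s2 s3]
  have sk: "smooth_tensor_on M (points M) 2 kaehler_form"
    unfolding kaehler_form_def[abs_def] by (rule smooth_tensor_on_add[OF M openin_points s1 s23])
  have df: "fun_d M (\<lambda>x. - (W x * (1 - (p x)\<^sup>2))) x [v] =
      - fun_d M W x [v] * (1 - (p x)\<^sup>2) + 2 * W x * p x * fun_d M p x [v]" for v
  proof -
    have "fun_d M (\<lambda>x. - (W x * (1 - (p x)\<^sup>2))) x [v] = - (W x * (0 - (p x * fun_d M p x [v] + fun_d M p x [v] * p x)) + fun_d M W x [v] * (1 - p x * p x))"
      unfolding power2_eq_square by (subst fun_d_uminus fun_d_mult fun_d_diff fun_d_const; (intro smooth_fun_intros M W p x)?)+ simp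
    then show ?thesis by (simp add: power2_eq_square algebra_simps)
  qed
  have dk: "ext_d M kaehler_form x [u, v, w] = W x * (p2 x + p x * p3 x) * wedge12 A1 (wedge A2 A3) x [u, v, w]
      + p1 x * wedge12 \<eta> (wedge A1 A2) x [u, v, w] - p3 x * wedge12 \<eta> (wedge A2 A3) x [u, v, w]" for u v w
    unfolding kaehler_form_def[abs_def] ext_d_add3[OF x s1 s23] ext_d_add3[OF x s2 s3] d_mult_wedge(2)[OF x sf smooth_A(1,2)]
      ext_d_wedge[OF M x \<eta> smooth_A(3)] d_mult_wedge(2)[OF x snp \<eta> smooth_A(2)]
    unfolding df fun_d_uminus[OF M p x] ext_d_A[OF x]
      d\<eta>[OF x] dW[OF x] dp[OF x] wedge_def wedge12_def
    by (simp add: power2_eq_square algebra_simps)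
  have kf: "complexify (fundamental_form gk_metric I) z vs = complex_of_real (kaehler_form z vs)" if z: "z \<in> points M" and lv: "length vs = 2" for z vs
  proof -
    obtain u v where "vs = [u, v]" using lv length_two_cases by blast
    then show ?thesis using W0[OF z]
      by (simp add: complexify_def fundamental_form_def gk_metric_def kaehler_form_def wedge_def adaptedD[OF I(2) z] power2_eq_square field_simps)
  qed
  have dkf: "ext_d M (complexify (fundamental_form gk_metric I)) x [u, v, w] = complex_of_real (ext_d M kaehler_form x [u, v, w])" for u v w
  proof -
    have "ext_d M (complexify (fundamental_form gk_metric I)) x [u, v, w] = ext_d M (\<lambda>z vs. complex_of_real (kaehler_form z vs)) x [u, v, w]"
      by (rule ext_d_cong[OF M openin_points x kf]) auto
    also have "\<dots> = complex_of_real (ext_d M kaehler_form x [u, v, w])"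
      by (rule ext_d_linear_image[OF M openin_points x sk _ bounded_linear_of_real]) simp
    finally show ?thesis .
  qed
  have t: "complexify (fundamental_form gk_metric I) z [I z u, I z v] = complexify (fundamental_form gk_metric I) z [u, v]"
    "complexify (fundamental_form gk_metric I) z [I z u, v] = - complexify (fundamental_form gk_metric I) z [u, I z v]"
    if z: "z \<in> points M" for z u v
    using W0[OF z] by (simp_all add: kf[OF z] kaehler_form_def wedge_def adaptedD[OF I(2) z] power2_eq_square field_simps flip: of_real_minus)
  obtain e f h where ef: "\<eta> x [u] = W x * e" "\<eta> x [v] = W x * f" "\<eta> x [w] = W x * h"
    using W0[OF x] by (metis nonzero_mult_div_cancel_left times_divide_eq_right)
  let ?k = "\<lambda>u v w. ext_d M kaehler_form x [u, v, w]"
  have "?k (I x u) v w + ?k u (I x v) w + ?k u v (I x w) + 3 * ?k (I x u) (I x v) (I x w) = 4 * torsion x [u, v, w]"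
    unfolding dk torsion_def wedge12_def wedge_def dp[OF x] using W0[OF x]
    by (simp add: adaptedD[OF I(2) x] ef) (simp add: algebra_simps)
  note arg_cong[OF this, of complex_of_real]
  moreover have "dc M I 2 (complexify (fundamental_form gk_metric I)) x [u, v, w] =
      - (complex_of_real (?k (I x u) v w) + complex_of_real (?k u (I x v) w) + complex_of_real (?k u v (I x w))
        + 3 * complex_of_real (?k (I x u) (I x v) (I x w))) / 4"
    unfolding dkf[symmetric] by (rule dc_type_11[OF M x t])
  ultimately show ?thesis by (simp add: field_simps)
qed

lemma adapted_H_closed:
  assumes I: "almost_complex_structure M I" "adapted I"
  shows "tensor_eq_on (points M) 4 (ext_d M (gk_H M gk_metric I)) (\<lambda>_ _. 0)"
  unfolding tensor_eq_on_def
proof (intro ballI allI impI)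
  fix x :: 'm and vs :: "(real^4) list" assume x: "x \<in> points M" and "length vs = 4"
  then obtain a b c d where vs: "vs = [a, b, c, d]" using length_four_cases by blast
  have st: "smooth_tensor_on M (points M) 3 torsion"
    unfolding torsion_def[abs_def] by (rule smooth_tensor_on_add[OF M openin_points torsion_smooth])
  have "gk_H M gk_metric I z ws = complex_of_real (torsion z ws)" if "z \<in> points M" "length ws = 3" for z ws
    using that adapted_dc[OF I that(1)] by (auto elim!: length_three_cases simp: gk_H_def)
  then have "ext_d M (gk_H M gk_metric I) x vs = ext_d M (\<lambda>z ws. complex_of_real (torsion z ws)) x vs"
    by (intro ext_d_cong[OF M openin_points x]) (auto simp: vs)
  also have "\<dots> = complex_of_real (ext_d M torsion x vs)"
    by (rule ext_d_linear_image[OF M openin_points x st _ bounded_linear_of_real]) (simp add: vs)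
  finally show "ext_d M (gk_H M gk_metric I) x vs = 0" by (simp add: vs torsion_closed[OF x])
qed

end

section \<open>From the construction data to the structure\<close>

text \<open>Together \<open>f\<close> and \<open>e\<close> map onto \<open>real^4\<close>: a
  preimage under \<open>f\<close> is corrected along \<open>X\<close>. Equal dimensions turn this
  into injectivity. In the application \<open>f\<close> is the differential of the bundle projection
  and \<open>e\<close> the connection form.\<close>

lemma linear_3_plus_1_inj:
  fixes f :: "real^4 \<Rightarrow> real^3" and e :: "real^4 \<Rightarrow> real"
  assumes "linear f" "surj f" "linear e" "f X = 0" "e X = 1" "f v = 0" "e v = 0"
  shows "v = 0"
proof -
  define F :: "real^4 \<Rightarrow> real^4" where
    "F = (\<lambda>v. \<chi> i. if i = 1 then f v $ 1 else if i = 2 then f v $ 2 else if i = 3 then f v $ 3 else e v)"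
  have lF: "linear F"
    by (auto intro!: linearI simp: F_def vec_eq_iff linear_add[OF assms(1)] linear_add[OF assms(3)]
        linear_scale[OF assms(1)] linear_scale[OF assms(3)])
  have "surj F"
  proof (rule surjI)
    fix w :: "real^4"
    define b :: "real^3" where "b = (\<chi> i. if i = 1 then w $ 1 else if i = 2 then w $ 2 else w $ 3)"
    define u where "u = (inv f b) + (w $ 4 - e (inv f b)) *\<^sub>R X"
    have "f u = b" "e u = w $ 4"
      using assms surj_f_inv_f[OF assms(2)] by (simp_all add: u_def linear_add linear_scale)
    then show "F ((inv f (\<chi> i. if i = 1 then w $ 1 else if i = 2 then w $ 2 else w $ 3)) + (w $ 4 - e (inv f (\<chi> i. if i = 1 then w $ 1 else if i = 2 then w $ 2 else w $ 3))) *\<^sub>R X) = w"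
      unfolding b_def[symmetric] u_def[symmetric] using exhaust_4
      by (auto simp: F_def vec_eq_iff b_def)
  qed
  then have "inj F" using linear_surjective_imp_injective[OF lF] by blast
  moreover have "F v = F 0"
    using assms(6,7) linear_0[OF assms(1)] linear_0[OF assms(3)] by (auto simp: F_def vec_eq_iff)
  ultimately show ?thesis by (simp add: inj_eq)
qed

section \<open>Calculus along the local diffeomorphism and the bundle projection\<close>

lemma smooth_map_vec_nth:
  fixes f :: "'a \<Rightarrow> real^'n"
  assumes "premanifold M" "smooth_map M euclid f"
  shows "smooth_map M euclid (\<lambda>x. f x $ i)"
  by (rule smooth_map_realI[OF assms(1)], rule smooth_on_vec_nth)
    (auto intro: smooth_map_real[OF assms] chart_homeomorphic(2)[OF assms(1)])

lemma smooth_near_linear: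
  fixes L :: "'b::euclidean_space \<Rightarrow> 'c::euclidean_space"
  assumes "bounded_linear L"
  shows "smooth_near euclid euclid L y" "tan_map euclid euclid L y = L"
  using smooth_near_euclid[OF open_UNIV UNIV_I smooth_on_linear[OF open_UNIV assms]]
    frechet_derivative_at[OF bounded_linear_imp_has_derivative[OF assms]]
  by (auto simp: tan_map_euclid)

lemma fun_d_vec_nth:
  fixes f :: "'a \<Rightarrow> real^'n"
  assumes M: "premanifold M" and f: "smooth_near M euclid f x"
  shows "fun_d M (\<lambda>x. f x $ i) x [v] = tan_map M euclid f x v $ i"
  unfolding fun_d_tan_map
  using tan_map_compose[OF M premanifold_euclid premanifold_euclid f, of "\<lambda>y. y $ i" v]
    smooth_near_linear[OF bounded_linear_vec_nth, of i "f x"] by simp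

text \<open>Differentiating the local inverse composed with \<open>f\<close> gives a left inverse of
  the tangent map.\<close>

lemma local_diffeo_near:
  assumes N: "premanifold N" and K: "premanifold K" and f: "local_diffeo N K f" and y: "y \<in> points N"
  shows "smooth_near N K f y" "inj (tan_map N K f y)"
proof -
  obtain U where U: "openin (mtop N) U" "y \<in> U" "openin (mtop K) (f ` U)" and d: "diffeo (open_sub N U) (open_sub K (f ` U)) f"
    using f y unfolding local_diffeo_def by blast
  note NU = premanifold_open_sub[OF N U(1)] and KU = premanifold_open_sub[OF K U(3)]
  let ?h = "inv_into U f"
  have pU: "points (open_sub N U) = U" by (rule points_open_sub_openin[OF U(1)])
  have s1: "smooth_map (open_sub N U) K f"
    using d by (intro smooth_map_from_open_sub_into[OF K U(3) _ NU]) (simp add: diffeo_def)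
  have s2: "smooth_map (open_sub K (f ` U)) N ?h"
    using d pU by (intro smooth_map_from_open_sub_into[OF N U(1) _ KU]) (simp add: diffeo_def)
  have ij: "inj_on f U" using d pU by (simp add: diffeo_def bij_betw_def)
  show n: "smooth_near N K f y" by (rule smooth_nearI[OF U(1,2) s1])
  have n2: "smooth_near K N ?h (f y)" by (rule smooth_nearI[OF U(3) _ s2]) (use U in auto)
  have "tan_map K N ?h (f y) (tan_map N K f y v) = v" for v
  proof -
    have "tan_map N N (\<lambda>z. ?h (f z)) y v = tan_map N N (\<lambda>z. z) y v"
      by (rule fun_cong[OF tan_map_cong[OF N U(1,2)]]) (use ij in auto)
    then show ?thesis using tan_map_compose[OF N K N n n2, of v] tan_map_id[OF N y] by simp
  qed
  then show "inj (tan_map N K f y)" by (metis injI)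
qed

lemma action_curve:
  assumes M: "premanifold M" and \<rho>: "circle_action M \<rho>" and x: "x \<in> points M"
  shows "smooth_map euclid M (\<lambda>t. \<rho> (cis t) x)"
proof -
  have s: "smooth_map euclid (prod_manifold circle M) (\<lambda>t. (cis t, x))"
    by (intro smooth_map_Pair premanifold_euclid premanifold_circle M smooth_map_cis smooth_map_const x)
  have r: "smooth_map (prod_manifold circle M) M (\<lambda>(z, x). \<rho> z x)" using \<rho> by (simp add: circle_action_def)
  from smooth_map_compose[OF premanifold_euclid premanifold_prod[OF premanifold_circle M] M s r] show ?thesis by simp
qed

lemma action_translation:
  assumes M: "premanifold M" and \<rho>: "circle_action M \<rho>" and z: "z \<in> points circle"
  shows "smooth_map M M (\<rho> z)"
proof -
  have s: "smooth_map M (prod_manifold circle M) (\<lambda>x. (z, x))"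
    by (intro smooth_map_Pair premanifold_circle M smooth_map_id smooth_map_const z)
  have r: "smooth_map (prod_manifold circle M) M (\<lambda>(z, x). \<rho> z x)" using \<rho> by (simp add: circle_action_def)
  from smooth_map_compose[OF M premanifold_prod[OF premanifold_circle M] M s r] show ?thesis by simp
qed

lemma tan_map_constant:
  assumes M: "premanifold M" and N: "premanifold N" and x: "x \<in> points M" and a: "a \<in> points N"
  shows "tan_map M N (\<lambda>_. a) x v = 0"
proof -
  obtain U \<phi> where U: "chart_at M x = (U, \<phi>)" by fastforce
  obtain V \<psi> where V: "chart_at N a = (V, \<psi>)" by fastforce
  from tan_map_unique[OF M U, of N "\<lambda>_. a", OF V has_derivative_const] show ?thesis by simp
qed

text \<open>The projection is constant along the orbit curve whose velocity is the
  generator.\<close>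

lemma bundle_vertical:
  assumes B: "principal_circle_bundle N M \<rho> \<pi>" and x: "x \<in> points M"
  shows "tan_map M N \<pi> x (generator M \<rho> x) = 0"
proof -
  have N: "premanifold N" and M: "premanifold M" and \<rho>: "circle_action M \<rho>" and \<pi>: "smooth_map M N \<pi>"
    using B by (auto simp: principal_circle_bundle_def smooth_manifold_premanifold)
  let ?c = "\<lambda>t. \<rho> (cis t) x"
  have c: "smooth_near euclid M ?c 0" by (rule smooth_map_near[OF premanifold_euclid action_curve[OF M \<rho> x]]) simp
  have c0: "?c 0 = x" using \<rho> x by (simp add: circle_action_def)
  have px: "\<pi> x \<in> points N" by (rule smooth_map_points[OF \<pi> x])
  then obtain U \<tau> where U: "\<pi> x \<in> U"
    and inv: "\<And>m z. m \<in> points M \<Longrightarrow> \<pi> m \<in> U \<Longrightarrow> z \<in> points circle \<Longrightarrow> \<pi> (\<rho> z m) = \<pi> m"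
    using B unfolding principal_circle_bundle_def Let_def by blast
  have "tan_map M N \<pi> (?c 0) (tan_map euclid M ?c 0 1) = tan_map euclid N (\<lambda>t. \<pi> (?c t)) 0 1"
    by (rule tan_map_compose[OF premanifold_euclid M N c, symmetric]) (simp only: c0 smooth_map_near[OF M \<pi> x])
  also have "(\<lambda>t. \<pi> (?c t)) = (\<lambda>t. \<pi> x)" using inv[OF x U] by simp
  finally show ?thesis unfolding c0 generator_def by (simp add: tan_map_constant[OF premanifold_euclid N _ px])
qed

text \<open>The local trivialisation with its fibre coordinate frozen at \<open>\<tau> x\<close>
  inverts to a section through \<open>x\<close>, whose differential is a right inverse.\<close>

lemma bundle_submersion:
  assumes B: "principal_circle_bundle N M \<rho> \<pi>" and x: "x \<in> points M"
  shows "surj (tan_map M N \<pi> x)"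
proof -
  have N: "premanifold N" and M: "premanifold M" and \<rho>: "circle_action M \<rho>" and \<pi>: "smooth_map M N \<pi>"
    using B by (auto simp: principal_circle_bundle_def smooth_manifold_premanifold)
  have px: "\<pi> x \<in> points N" by (rule smooth_map_points[OF \<pi> x])
  then obtain U \<tau> where U: "openin (mtop N) U" "\<pi> x \<in> U"
    and d: "diffeo (open_sub M {m \<in> points M. \<pi> m \<in> U}) (prod_manifold (open_sub N U) circle) (\<lambda>m. (\<pi> m, \<tau> m))"
    using B unfolding principal_circle_bundle_def Let_def by blast
  define P where "P = {m \<in> points M. \<pi> m \<in> U}"
  have P: "openin (mtop M) P" unfolding P_def by (rule smooth_map_vimage[OF \<pi> U(1)])
  note NU = premanifold_open_sub[OF N U(1)] and MP = premanifold_open_sub[OF M P]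
  have pP: "points (open_sub M P) = P" by (rule points_open_sub_openin[OF P])
  define \<Phi> where "\<Phi> = inv_into P (\<lambda>m. (\<pi> m, \<tau> m))"
  have b: "bij_betw (\<lambda>m. (\<pi> m, \<tau> m)) P (U \<times> points circle)"
    using d by (simp add: diffeo_def P_def[symmetric] pP points_prod points_open_sub_openin[OF U(1)])
  have xP: "x \<in> P" using x U by (simp add: P_def)
  have tx: "\<tau> x \<in> points circle" using bij_betwE[OF b] xP by auto
  have s\<Phi>: "smooth_map (prod_manifold (open_sub N U) circle) M \<Phi>"
    using d by (intro smooth_map_from_open_sub_into[OF M P _ premanifold_prod[OF NU premanifold_circle]])
      (simp add: diffeo_def P_def[symmetric] pP \<Phi>_def)
  define s where "s = (\<lambda>b. \<Phi> (b, \<tau> x))"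
  have ss: "smooth_map (open_sub N U) M s" unfolding s_def
    by (rule smooth_map_compose[OF NU premanifold_prod[OF NU premanifold_circle] M _ s\<Phi>])
      (intro smooth_map_Pair NU premanifold_circle smooth_map_id smooth_map_const tx)
  have sx: "s (\<pi> x) = x" using b xP unfolding s_def \<Phi>_def
    by (metis (mono_tags, lifting) bij_betw_inv_into_left)
  have \<pi>s: "\<pi> (s b') = b'" if "b' \<in> U" for b'
    using bij_betw_inv_into_right[OF b, of "(b', \<tau> x)"] that tx by (simp add: s_def \<Phi>_def)
  have n: "smooth_near N M s (\<pi> x)" by (rule smooth_nearI[OF U ss])
  have "tan_map M N \<pi> x (tan_map N M s (\<pi> x) w) = w" for w
  proof -
    have "tan_map N N (\<lambda>b. \<pi> (s b)) (\<pi> x) w = tan_map N N (\<lambda>b. b) (\<pi> x) w"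
      by (rule fun_cong[OF tan_map_cong[OF N U]]) (simp add: \<pi>s)
    then show ?thesis
      using tan_map_compose[OF N M N n, of \<pi> w] tan_map_id[OF N px] smooth_map_near[OF M \<pi> x] by (simp add: sx)
  qed
  then show ?thesis by (rule surjI)
qed

text \<open>The differential of \<open>\<iota>\<close> is invertible, so \<open>w\<close> can be
  expanded in the basis dual to the differentials of the three coordinates, the vectors on which
  \<open>mu_partial\<close> evaluates.\<close>

lemma fun_d_mu_partial:
  fixes N :: "('n, real^3) manifold"
  assumes N: "premanifold N" and \<iota>: "local_diffeo N euclid \<iota>" and f: "smooth_near N euclid f y" and y: "y \<in> points N"
  shows "fun_d N f y [w] = mu_partial N \<iota> 1 f y * fun_d N (\<lambda>y. \<iota> y $ 1) y [w]
    + mu_partial N \<iota> 2 f y * fun_d N (\<lambda>y. \<iota> y $ 2) y [w] + mu_partial N \<iota> 3 f y * fun_d N (\<lambda>y. \<iota> y $ 3) y [w]"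
proof -
  note near = local_diffeo_near[OF N premanifold_euclid \<iota> y]
  let ?T = "tan_map N euclid \<iota> y"
  have l: "linear ?T" by (rule tan_map_linear[OF N premanifold_euclid near(1)])
  have li: "linear (inv ?T)"
    using inj_linear_imp_inv_bounded_linear[OF _ near(2)] l by (simp add: linear_conv_bounded_linear)
  have lf: "linear (\<lambda>v. fun_d N f y [v])"
    unfolding fun_d_tan_map using tan_map_linear[OF N premanifold_euclid f] by simp
  have L: "linear (\<lambda>u. fun_d N f y [inv ?T u])" using linear_compose[OF li lf] by (simp add: o_def)
  have r: "u = (u $ 1) *\<^sub>R axis 1 1 + (u $ 2) *\<^sub>R axis 2 1 + (u $ 3) *\<^sub>R axis 3 1" for u :: "real^3"
    using exhaust_3 by (auto simp: vec_eq_iff axis_def)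
  have "fun_d N f y [w] = fun_d N f y [inv ?T (?T w)]" using near(2) by simp
  also have "\<dots> = ?T w $ 1 * fun_d N f y [inv ?T (axis 1 1)] + ?T w $ 2 * fun_d N f y [inv ?T (axis 2 1)]
      + ?T w $ 3 * fun_d N f y [inv ?T (axis 3 1)]"
    by (subst r[of "?T w"]) (simp only: linear_add[OF L] linear_scale[OF L] real_scaleR_def)
  finally show ?thesis by (simp add: mu_partial_def fun_d_vec_nth[OF N near(1)] mult.commute)
qed

text \<open>Riesz representation for \<open>g x\<close>: the map \<open>L\<close> expresses
  \<open>g\<close> through the standard inner product and is bijective by positivity, so the
  description in \<open>sharp\<close> has exactly one solution.\<close>

lemma sharp_works:
  fixes g :: "('a, 'e::euclidean_space, real) tensor"
  assumes g: "riemannian_metric M g" and x: "x \<in> points M" and \<xi>: "linear \<xi>"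
  shows "g x [sharp g x \<xi>, v] = \<xi> v"
proof -
  have st: "smooth_tensor_on M (points M) 2 g" and pos: "\<And>v. v \<noteq> 0 \<Longrightarrow> g x [v, v] > 0"
    using g x by (auto simp: riemannian_metric_def)
  have l1: "linear (\<lambda>v. g x [v, w])" for w using smooth_tensor_on_linear[OF st x, of "[0, w]" 0] by simp
  have l2: "linear (\<lambda>v. g x [w, v])" for w using smooth_tensor_on_linear[OF st x, of "[w, 0]" 1] by simp
  define L where "L = (\<lambda>w. \<Sum>b\<in>Basis. g x [w, b] *\<^sub>R b)"
  have lL: "linear L" unfolding L_def
    by (rule linearI) (simp_all add: linear_add[OF l1] linear_scale[OF l1] scaleR_add_left sum.distrib scaleR_sum_right)
  have Lv: "L w \<bullet> v = g x [w, v]" for w v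
  proof -
    have "L w \<bullet> v = (\<Sum>b\<in>Basis. (v \<bullet> b) * g x [w, b])"
      unfolding L_def inner_sum_left inner_scaleR_left by (rule sum.cong) (simp_all add: inner_commute mult.commute)
    also have "\<dots> = g x [w, \<Sum>b\<in>Basis. (v \<bullet> b) *\<^sub>R b]"
      using linear_sum[OF l2, of w "\<lambda>b. (v \<bullet> b) *\<^sub>R b" Basis] linear_scale[OF l2] by simp
    finally show ?thesis by (simp add: euclidean_representation)
  qed
  have "inj L"
  proof (rule linear_injective_0[OF lL, THEN iffD2], intro allI impI)
    fix w assume "L w = 0"
    then have "g x [w, w] = 0" using Lv[of w w] by simp
    then show "w = 0" using pos by force
  qed
  then have sL: "surj L" using linear_injective_imp_surjective[OF lL] by blast
  obtain w where w: "(\<Sum>b\<in>Basis. \<xi> b *\<^sub>R b) = L w" using surjE[OF sL] by metis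
  have ex: "g x [w, v] = \<xi> v" for v
  proof -
    have "g x [w, v] = (\<Sum>b\<in>Basis. \<xi> b *\<^sub>R b) \<bullet> v" unfolding w Lv ..
    also have "\<dots> = (\<Sum>b\<in>Basis. (v \<bullet> b) * \<xi> b)"
      unfolding inner_sum_left inner_scaleR_left by (rule sum.cong) (simp_all add: inner_commute mult.commute)
    also have "\<dots> = \<xi> v" using linear_sum[OF \<xi>, of "\<lambda>b. (v \<bullet> b) *\<^sub>R b" Basis] linear_scale[OF \<xi>]
      by (simp add: euclidean_representation)
    finally show ?thesis .
  qed
  have "sharp g x \<xi> = w" unfolding sharp_def
  proof (rule the_equality)
    fix w' assume "\<forall>v. g x [w', v] = \<xi> v"
    then have "g x [w' - w, w' - w] = 0" using linear_diff[OF l1] ex by simp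
    then show "w' = w" using pos[of "w' - w"] by auto
  qed (use ex in blast)
  then show ?thesis using ex by simp
qed

text \<open>A covector in the kernel of the Poisson tensor has its \<open>sharp\<close> in the
  kernel of the commutator, and \<open>sharp\<close> has no kernel. The inner product with the image
  serves as the testing functional.\<close>

lemma nondegenerate_gkI:
  assumes gk: "generalized_kaehler M g I J"
    and A: "\<And>x w. x \<in> points M \<Longrightarrow> half_commutator I J x w = 0 \<Longrightarrow> w = 0"
  shows "nondegenerate_gk M g I J"
  unfolding nondegenerate_gk_def
proof (intro conjI ballI allI impI gk)
  fix x and \<xi> :: "'b \<Rightarrow> real" assume x: "x \<in> points M"
    and \<xi>: "linear \<xi> \<and> (\<forall>\<zeta>::'b \<Rightarrow> real. linear \<zeta> \<longrightarrow> \<zeta> (poisson g I J x \<xi>) = 0)"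
  have r: "riemannian_metric M g" using gk by (simp add: generalized_kaehler_def)
  let ?p = "poisson g I J x \<xi>"
  have "linear (\<lambda>v. ?p \<bullet> v)" by (rule bounded_linear.linear[OF bounded_linear_inner_right])
  then have "?p \<bullet> ?p = 0" using \<xi> by blast
  then have "sharp g x \<xi> = 0" using A[OF x] by (simp add: poisson_def)
  then have "\<xi> v = g x [0, v]" for v using sharp_works[OF r x, of \<xi> v] \<xi> by simp
  moreover have "linear (\<lambda>u. g x [u, v])" for v
    using smooth_tensor_on_linear[of M "points M" 2 g x "[0, v]" 0] r x by (simp add: riemannian_metric_def)
  ultimately show "\<xi> = (\<lambda>_. 0)" using linear_0 by fastforce
qed

text \<open>Everything is pulled back along \<open>\<pi>\<close>. The four forms have no common
  kernel because the coordinates detect whatever projects nontrivially to the base and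
  \<open>\<eta>\<close> detects the generator.\<close>

lemma construction_coframe:
  fixes N :: "('n, real^3) manifold" and M :: "('m, real^4) manifold"
  assumes D: "construction_data N \<iota> p W M \<rho> \<pi> \<eta>"
  shows "gk_coframe M (\<lambda>x. (\<iota> \<circ> \<pi>) x $ 1) (\<lambda>x. (\<iota> \<circ> \<pi>) x $ 2) (\<lambda>x. (\<iota> \<circ> \<pi>) x $ 3) (p \<circ> \<pi>) (W \<circ> \<pi>)
    (mu_partial N \<iota> 1 p \<circ> \<pi>) (mu_partial N \<iota> 2 p \<circ> \<pi>) (mu_partial N \<iota> 3 p \<circ> \<pi>)
    (mu_partial N \<iota> 1 W \<circ> \<pi>) (mu_partial N \<iota> 2 W \<circ> \<pi>) (mu_partial N \<iota> 3 W \<circ> \<pi>) \<eta>"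
proof -
  have B: "principal_circle_bundle N M \<rho> \<pi>" and dif: "local_diffeo N euclid \<iota>"
    and p: "smooth_map N euclid p" and W: "smooth_map N euclid W"
    and bd: "\<And>y. y \<in> points N \<Longrightarrow> -1 < p y \<and> p y < 1 \<and> 0 < W y"
    and c: "connection_form M \<rho> \<eta>"
    and curv: "tensor_eq_on (points M) 2 (ext_d M \<eta>) (pullback M N \<pi> (curvature_beta N \<iota> p W))"
    using D by (auto simp: construction_data_def)
  have N: "premanifold N" and M: "premanifold M" and \<pi>: "smooth_map M N \<pi>"
    using B by (auto simp: principal_circle_bundle_def smooth_manifold_premanifold)
  have \<pi>n: "smooth_near M N \<pi> x" and \<pi>p: "\<pi> x \<in> points N" if "x \<in> points M" for x
    using smooth_map_near[OF M \<pi> that] smooth_map_points[OF \<pi> that] by auto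
  note dn = local_diffeo_near[OF N premanifold_euclid dif]
  have \<iota>: "smooth_map N euclid \<iota>"
    by (rule smooth_map_local[OF N premanifold_euclid]) (use dn(1) in \<open>auto simp: smooth_near_def\<close>)
  have comp: "smooth_map M euclid (f \<circ> \<pi>)" if "smooth_map N euclid f" for f :: "'n \<Rightarrow> real"
    using smooth_map_compose[OF M N premanifold_euclid \<pi> that] by (simp add: o_def)
  have \<mu>: "smooth_map M euclid (\<lambda>x. (\<iota> \<circ> \<pi>) x $ i)" for i
    using smooth_map_compose[OF M N premanifold_euclid \<pi> smooth_map_vec_nth[OF N \<iota>]] by (simp add: o_def)
  have pb: "fun_d N f (\<pi> x) [tan_map M N \<pi> x v] = fun_d M (\<lambda>x. f (\<pi> x)) x [v]"
    if "x \<in> points M" "smooth_map N euclid f" for f :: "'n \<Rightarrow> real" and x v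
    by (rule tan_map_fun_d[OF M N \<pi>n[OF that(1)] smooth_map_near[OF N that(2) \<pi>p[OF that(1)]]])
  have pb\<mu>: "fun_d N (\<lambda>y. \<iota> y $ i) (\<pi> x) [tan_map M N \<pi> x v] = fun_d M (\<lambda>x. (\<iota> \<circ> \<pi>) x $ i) x [v]"
    if "x \<in> points M" for x v i
    using pb[OF that smooth_map_vec_nth[OF N \<iota>]] by (simp add: o_def)
  have dN: "fun_d M (f \<circ> \<pi>) x [v] = (mu_partial N \<iota> 1 f \<circ> \<pi>) x * fun_d M (\<lambda>x. (\<iota> \<circ> \<pi>) x $ 1) x [v] +
      (mu_partial N \<iota> 2 f \<circ> \<pi>) x * fun_d M (\<lambda>x. (\<iota> \<circ> \<pi>) x $ 2) x [v] +
      (mu_partial N \<iota> 3 f \<circ> \<pi>) x * fun_d M (\<lambda>x. (\<iota> \<circ> \<pi>) x $ 3) x [v]"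
    if x: "x \<in> points M" and f: "smooth_map N euclid f" for f :: "'n \<Rightarrow> real" and x v
    using fun_d_mu_partial[OF N dif smooth_map_near[OF N f \<pi>p[OF x]] \<pi>p[OF x], of "tan_map M N \<pi> x v"]
    unfolding pb[OF x f] pb\<mu>[OF x] by (simp add: o_def)
  have mp: "mu_partial N \<iota> i (\<lambda>y. p y * W y) y = p y * mu_partial N \<iota> i W y + mu_partial N \<iota> i p y * W y"
    if "y \<in> points N" for i y
    unfolding mu_partial_def by (rule fun_d_mult[OF N p W that])
  have \<eta>s: "smooth_tensor_on M (points M) 1 \<eta>" using c by (simp add: connection_form_def smooth_form_on_def)
  show ?thesis
  proof
    fix x u v assume x: "x \<in> points M"
    have "ext_d M \<eta> x [u, v] = pullback M N \<pi> (curvature_beta N \<iota> p W) x [u, v]"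
      using curv x by (simp add: tensor_eq_on_def)
    then show "ext_d M \<eta> x [u, v] =
       ((mu_partial N \<iota> 3 W \<circ> \<pi>) x + (mu_partial N \<iota> 2 p \<circ> \<pi>) x * (W \<circ> \<pi>) x + (p \<circ> \<pi>) x * (mu_partial N \<iota> 2 W \<circ> \<pi>) x) *
       wedge (fun_d M (\<lambda>x. (\<iota> \<circ> \<pi>) x $ 1)) (fun_d M (\<lambda>x. (\<iota> \<circ> \<pi>) x $ 2)) x [u, v] -
       ((mu_partial N \<iota> 2 W \<circ> \<pi>) x + (mu_partial N \<iota> 3 p \<circ> \<pi>) x * (W \<circ> \<pi>) x + (p \<circ> \<pi>) x * (mu_partial N \<iota> 3 W \<circ> \<pi>) x) *
       wedge (fun_d M (\<lambda>x. (\<iota> \<circ> \<pi>) x $ 1)) (fun_d M (\<lambda>x. (\<iota> \<circ> \<pi>) x $ 3)) x [u, v] +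
       (mu_partial N \<iota> 1 W \<circ> \<pi>) x *
       wedge (fun_d M (\<lambda>x. (\<iota> \<circ> \<pi>) x $ 2)) (fun_d M (\<lambda>x. (\<iota> \<circ> \<pi>) x $ 3)) x [u, v]"
      by (simp add: pullback_def curvature_beta_def Let_def wedge_def pb\<mu>[OF x, unfolded comp_apply] mp[OF \<pi>p[OF x]] add_ac)
  next
    fix x v assume x: "x \<in> points M"
      and z: "fun_d M (\<lambda>x. (\<iota> \<circ> \<pi>) x $ 1) x [v] = 0" "fun_d M (\<lambda>x. (\<iota> \<circ> \<pi>) x $ 2) x [v] = 0"
        "fun_d M (\<lambda>x. (\<iota> \<circ> \<pi>) x $ 3) x [v] = 0" "\<eta> x [v] = 0"
    have "fun_d N (\<lambda>y. \<iota> y $ i) (\<pi> x) [tan_map M N \<pi> x v] = 0" for i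
      unfolding pb\<mu>[OF x] using z exhaust_3[of i] by auto
    then have "tan_map N euclid \<iota> (\<pi> x) (tan_map M N \<pi> x v) $ i = 0" for i
      using fun_d_vec_nth[OF N dn(1)[OF \<pi>p[OF x]]] by metis
    then have "tan_map N euclid \<iota> (\<pi> x) (tan_map M N \<pi> x v) = tan_map N euclid \<iota> (\<pi> x) 0"
      using linear_0[OF tan_map_linear[OF N premanifold_euclid dn(1)[OF \<pi>p[OF x]]]] by (simp add: vec_eq_iff)
    then have k: "tan_map M N \<pi> x v = 0" using dn(2)[OF \<pi>p[OF x]] by (simp add: inj_eq)
    show "v = 0"
      by (rule linear_3_plus_1_inj[OF tan_map_linear[OF M N \<pi>n[OF x]] bundle_submersion[OF B x]
            one_form_linear[OF \<eta>s x] bundle_vertical[OF B x] _ k z(4)])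
        (use c x in \<open>simp add: connection_form_def\<close>)
  next
    fix x assume x: "x \<in> points M"
    show "- 1 < (p \<circ> \<pi>) x \<and> (p \<circ> \<pi>) x < 1 \<and> 0 < (W \<circ> \<pi>) x" using bd[OF \<pi>p[OF x]] by simp
  qed (use M \<mu> comp[OF p] comp[OF W] \<eta>s dN p W in auto)
qed

text \<open>\<open>J\<close> is obtained from \<open>I\<close> by exchanging \<open>\<mu>\<^sub>2\<close> with \<open>\<mu>\<^sub>3\<close> and changing the sign of \<open>\<eta>\<close>, which
  turns \<open>\<Omega>\<^sub>I\<close> into \<open>-\<Omega>\<^sub>J\<close> and the torsion into its negative.\<close>

lemma gk_coframe_swap:
  assumes "gk_coframe M m1 m2 m3 p W p1 p2 p3 W1 W2 W3 \<eta>"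
  shows "gk_coframe M m1 m3 m2 p W p1 p3 p2 W1 W3 W2 (\<lambda>x vs. - \<eta> x vs)"
proof -
  interpret gk_coframe M m1 m2 m3 p W p1 p2 p3 W1 W2 W3 \<eta> by (rule assms)
  note L = bounded_linear_minus[OF bounded_linear_ident]
  show ?thesis
  proof
    show "smooth_tensor_on M (points M) 1 (\<lambda>x vs. - \<eta> x vs)"
      by (rule smooth_tensor_on_linear_image[OF M openin_points \<eta> L])
    fix x u v assume x: "x \<in> points M"
    have "ext_d M (\<lambda>x vs. - \<eta> x vs) x [u, v] = - ext_d M \<eta> x [u, v]"
      by (rule ext_d_linear_image[OF M openin_points x \<eta> _ L]) simp
    then show "ext_d M (\<lambda>x vs. - \<eta> x vs) x [u, v] =
       (W2 x + p3 x * W x + p x * W3 x) * wedge A1 A3 x [u, v] -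
       (W3 x + p2 x * W x + p x * W2 x) * wedge A1 A2 x [u, v] + W1 x * wedge A3 A2 x [u, v]"
      by (simp add: d\<eta>[OF x] wedge_def algebra_simps)
  qed (use M m1 m2 m3 p W bounds dp dW inj in auto)
qed

lemma constructed_Omega_I_eq:
  assumes "gk_coframe M (\<lambda>x. \<mu> x $ 1) (\<lambda>x. \<mu> x $ 2) (\<lambda>x. \<mu> x $ 3) p W p1 p2 p3 W1 W2 W3 \<eta>"
  shows "constructed_Omega_I M \<mu> p W \<eta> =
    (\<lambda>x vs. 1 * gk_coframe.Omega M (\<lambda>x. \<mu> x $ 1) (\<lambda>x. \<mu> x $ 2) (\<lambda>x. \<mu> x $ 3) p W \<eta> x vs)"
  by (auto simp: fun_eq_iff constructed_Omega_I_def gk_coframe.Omega_def[OF assms] Let_def wedge_def complexify_def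
      complex_eq_iff algebra_simps)

lemma constructed_Omega_J_eq:
  assumes "gk_coframe M (\<lambda>x. \<mu> x $ 1) (\<lambda>x. \<mu> x $ 3) (\<lambda>x. \<mu> x $ 2) p W p1 p3 p2 W1 W3 W2 (\<lambda>x vs. - \<eta> x vs)"
  shows "constructed_Omega_J M \<mu> p W \<eta> =
    (\<lambda>x vs. (-1) * gk_coframe.Omega M (\<lambda>x. \<mu> x $ 1) (\<lambda>x. \<mu> x $ 3) (\<lambda>x. \<mu> x $ 2) p W (\<lambda>x vs. - \<eta> x vs) x vs)"
  by (auto simp: fun_eq_iff constructed_Omega_J_def gk_coframe.Omega_def[OF assms] Let_def wedge_def complexify_def
      complex_eq_iff algebra_simps)

lemma constructed_metric_eq:
  assumes "gk_coframe M (\<lambda>x. \<mu> x $ 1) (\<lambda>x. \<mu> x $ 2) (\<lambda>x. \<mu> x $ 3) p W p1 p2 p3 W1 W2 W3 \<eta>"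
  shows "constructed_metric M \<mu> p W \<eta> = gk_coframe.gk_metric M (\<lambda>x. \<mu> x $ 1) (\<lambda>x. \<mu> x $ 2) (\<lambda>x. \<mu> x $ 3) p W \<eta>"
  by (auto simp: fun_eq_iff constructed_metric_def gk_coframe.gk_metric_def[OF assms] Let_def algebra_simps)

text \<open>Two instances of \<open>gk_coframe\<close>, the second with exchanged indices, have the
  same metric and opposite torsion; the latter is the condition that links \<open>I\<close> and
  \<open>J\<close>.\<close>

theorem construction_forward:
  fixes N :: "('n, real^3) manifold" and M :: "('m, real^4) manifold"
  assumes D: "construction_data N \<iota> p W M \<rho> \<pi> \<eta>"
  shows "\<exists>g I J. nondegenerate_gk M g I J \<and> constructed_structure \<iota> p W M \<pi> \<eta> g I J"
proof -
  note cf = construction_coframe[OF D]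
  note cf' = gk_coframe_swap[OF cf]
  interpret A: gk_coframe M "\<lambda>x. (\<iota> \<circ> \<pi>) x $ 1" "\<lambda>x. (\<iota> \<circ> \<pi>) x $ 2" "\<lambda>x. (\<iota> \<circ> \<pi>) x $ 3" "p \<circ> \<pi>" "W \<circ> \<pi>"
    "mu_partial N \<iota> 1 p \<circ> \<pi>" "mu_partial N \<iota> 2 p \<circ> \<pi>" "mu_partial N \<iota> 3 p \<circ> \<pi>"
    "mu_partial N \<iota> 1 W \<circ> \<pi>" "mu_partial N \<iota> 2 W \<circ> \<pi>" "mu_partial N \<iota> 3 W \<circ> \<pi>" \<eta>
    by (rule cf)
  interpret B: gk_coframe M "\<lambda>x. (\<iota> \<circ> \<pi>) x $ 1" "\<lambda>x. (\<iota> \<circ> \<pi>) x $ 3" "\<lambda>x. (\<iota> \<circ> \<pi>) x $ 2" "p \<circ> \<pi>" "W \<circ> \<pi>"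
    "mu_partial N \<iota> 1 p \<circ> \<pi>" "mu_partial N \<iota> 3 p \<circ> \<pi>" "mu_partial N \<iota> 2 p \<circ> \<pi>"
    "mu_partial N \<iota> 1 W \<circ> \<pi>" "mu_partial N \<iota> 3 W \<circ> \<pi>" "mu_partial N \<iota> 2 W \<circ> \<pi>" "\<lambda>x vs. - \<eta> x vs"
    by (rule cf')
  have M: "smooth_manifold M" using D by (simp add: construction_data_def principal_circle_bundle_def)
  obtain I where I: "almost_complex_structure M I" "A.adapted I" using A.adapted_exists by blast
  obtain J where J: "almost_complex_structure M J" "B.adapted J" using B.adapted_exists by blast
  have gm: "B.gk_metric = A.gk_metric"
    by (intro ext, unfold A.gk_metric_def B.gk_metric_def) (simp add: algebra_simps)
  have t: "B.torsion x vs = - A.torsion x vs" for x vs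
    unfolding A.torsion_def B.torsion_def wedge12_def wedge_def by (simp add: algebra_simps)
  have "generalized_kaehler M A.gk_metric I J"
    unfolding generalized_kaehler_def
  proof (intro conjI M A.metric_riemannian A.adapted_integrable[OF I] B.adapted_integrable[OF J]
      A.adapted_compatible[OF I(2)] B.adapted_compatible[OF J(2), unfolded gm] A.adapted_H_closed[OF I])
    show "tensor_eq_on (points M) 3 (dc M I 2 (complexify (fundamental_form A.gk_metric I)))
        (\<lambda>x vs. - dc M J 2 (complexify (fundamental_form A.gk_metric J)) x vs)"
      unfolding tensor_eq_on_def
    proof (intro ballI allI impI)
      fix x :: 'm and vs :: "(real^4) list" assume x: "x \<in> points M" and "length vs = 3"
      then obtain u v w where vs: "vs = [u, v, w]" using length_three_cases by blast
      show "dc M I 2 (complexify (fundamental_form A.gk_metric I)) x vs =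
          - dc M J 2 (complexify (fundamental_form A.gk_metric J)) x vs"
        unfolding vs A.adapted_dc[OF I x] B.adapted_dc[OF J x, unfolded gm] t by simp
    qed
  qed
  then have "nondegenerate_gk M A.gk_metric I J"
  proof (rule nondegenerate_gkI)
    fix x w assume x: "x \<in> points M" and "half_commutator I J x w = 0"
    then have eq: "I x (J x w) = J x (I x w)" by (simp add: half_commutator_def)
    let ?a = "\<lambda>i. fun_d M (\<lambda>x. (\<iota> \<circ> \<pi>) x $ i) x [w]"
    let ?p = "p (\<pi> x)" and ?W = "W (\<pi> x)"
    have \<eta>J: "\<eta> x [J x v] = ?W * (fun_d M (\<lambda>x. \<iota> (\<pi> x) $ 2) x [v] - ?p * fun_d M (\<lambda>x. \<iota> (\<pi> x) $ 3) x [v])" for v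
      using B.adaptedD(4)[OF J(2) x, of v] by (simp add: comp_def)
    note r = A.adaptedD[OF I(2) x, unfolded comp_apply] B.adaptedD(1-3)[OF J(2) x, unfolded comp_apply] \<eta>J
    have W0: "?W \<noteq> 0" using A.W0[OF x] by simp
    have b: "-1 < ?p" "?p < 1" using A.bounds[OF x] by auto
    \<comment> \<open>The coframe components of \<open>I J w = J I w\<close> give one equation each:
      \<open>\<eta> = 0\<close>, \<open>A2 = p A3\<close>, \<open>A3 = p A2\<close> and
      \<open>(1 - p\<^sup>2) A1 = 0\<close> on \<open>w\<close>.\<close>
    have "\<eta> x [w] = 0"
      using arg_cong[OF eq, of "\<lambda>u. fun_d M (\<lambda>x. \<iota> (\<pi> x) $ 1) x [u]"] W0 by (simp add: r)
    moreover have "fun_d M (\<lambda>x. \<iota> (\<pi> x) $ 2) x [w] = ?p * fun_d M (\<lambda>x. \<iota> (\<pi> x) $ 3) x [w]"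
      using arg_cong[OF eq, of "\<lambda>u. fun_d M (\<lambda>x. \<iota> (\<pi> x) $ 3) x [u]"] W0 by (simp add: r field_simps)
    moreover have a3: "fun_d M (\<lambda>x. \<iota> (\<pi> x) $ 3) x [w] = ?p * fun_d M (\<lambda>x. \<iota> (\<pi> x) $ 2) x [w]"
      using arg_cong[OF eq, of "\<lambda>u. fun_d M (\<lambda>x. \<iota> (\<pi> x) $ 2) x [u]"] W0 by (simp add: r field_simps)
    moreover have "(1 - ?p * ?p) * fun_d M (\<lambda>x. \<iota> (\<pi> x) $ 1) x [w] = 0"
      using arg_cong[OF eq, of "\<lambda>u. \<eta> x [u]"] W0 by (simp add: r field_simps)
    moreover have "1 - ?p * ?p \<noteq> 0"
      using b abs_square_less_1[of ?p] by (auto simp: power2_eq_square)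
    ultimately have "\<eta> x [w] = 0" "fun_d M (\<lambda>x. \<iota> (\<pi> x) $ 1) x [w] = 0" "fun_d M (\<lambda>x. \<iota> (\<pi> x) $ 2) x [w] = 0"
      "fun_d M (\<lambda>x. \<iota> (\<pi> x) $ 3) x [w] = 0"
      by (auto simp: algebra_simps)
    then show "w = 0" using A.inj[OF x] by (simp add: comp_def)
  qed
  moreover have "constructed_structure \<iota> p W M \<pi> \<eta> A.gk_metric I J"
    unfolding constructed_structure_def constructed_metric_eq[OF cf] constructed_Omega_I_eq[OF cf] constructed_Omega_J_eq[OF cf']
    using A.adapted_determined[OF I, of 1] B.adapted_determined[OF J, of "-1"] by (simp add: tensor_eq_on_def)
  ultimately show ?thesis by blast
qed

section \<open>Circle actions with an invariant submersion\<close>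

lemma circle_mult: "z \<in> points circle \<Longrightarrow> w \<in> points circle \<Longrightarrow> z * w \<in> points circle"
  by (simp add: points_circle norm_mult)

lemma circle_inverse: "z \<in> points circle \<Longrightarrow> cnj z \<in> points circle \<and> cnj z * z = 1"
proof -
  assume "z \<in> points circle"
  then have n: "cmod z = 1" by (simp add: points_circle)
  then have "cnj z * z = 1" using complex_norm_square[of z] by (simp add: mult.commute)
  then show ?thesis using n by (simp add: points_circle)
qed

lemma prod_manifold_euclid: "prod_manifold euclid euclid = euclid"
  by (simp add: prod_manifold_def euclid_def map_prod.id)

text \<open>The inverse function theorem above is for maps of one space \<open>real^'n\<close> to itself, so the flow, a map from
  \<open>\<real> \<times> \<real>\<^sup>3\<close> to a manifold modelled on \<open>real^4\<close>, is brought into that form.\<close>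

definition split4 :: "real^4 \<Rightarrow> real \<times> (real^3)" where
  "split4 w = (w $ 4, \<chi> i. if i = 1 then w $ 1 else if i = 2 then w $ 2 else w $ 3)"

definition join4 :: "real \<times> (real^3) \<Rightarrow> real^4" where
  "join4 q = (\<chi> i. if i = 1 then snd q $ 1 else if i = 2 then snd q $ 2 else if i = 3 then snd q $ 3 else fst q)"

lemma join4_split4 [simp]: "join4 (split4 w) = w"
  using exhaust_4 by (auto simp: join4_def split4_def vec_eq_iff)

lemma split4_join4 [simp]: "split4 (join4 q) = q"
  using exhaust_3 by (auto simp: join4_def split4_def vec_eq_iff prod_eq_iff)

lemma linear_split4: "linear split4"
  by (rule linearI) (auto simp: split4_def vec_eq_iff)

lemma bounded_linear_split4: "bounded_linear split4"
  using linear_split4 by (simp add: linear_conv_bounded_linear)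

text \<open>Read in a chart of \<open>M\<close> and through \<open>split4\<close>, this is a
  statement on maps of \<open>real^4\<close> to itself. Because \<open>F\<close> is injective on
  \<open>T\<close>, the local inverses are all restrictions of \<open>inv_into T F\<close> and
  glue.\<close>

lemma inverse_smooth_map:
  fixes M :: "('m, real^4) manifold" and F :: "real \<times> (real^3) \<Rightarrow> 'm"
  assumes M: "premanifold M" and T: "open T" and F: "smooth_map (open_sub euclid T) M F" and i: "inj_on F T"
    and D: "\<And>q. q \<in> T \<Longrightarrow> inj (tan_map euclid M F q)"
  shows "openin (mtop M) (F ` T)" "smooth_map (open_sub M (F ` T)) euclid (inv_into T F)"
proof -
  have ET: "premanifold (open_sub euclid T)" by (rule premanifold_open_sub) (use T in auto)
  have pT: "points (open_sub euclid T) = T" by (simp add: points_open_sub)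
  have loc: "\<exists>W. openin (mtop M) W \<and> F q \<in> W \<and> W \<subseteq> F ` T \<and> smooth_map (open_sub M W) euclid (inv_into T F)"
    if q: "q \<in> T" for q
  proof -
    have Fq: "F q \<in> points M" using smooth_map_points[OF F] pT q by blast
    obtain U \<phi> where U: "(U, \<phi>) \<in> atlas M" "F q \<in> U" using chart_exists[OF M Fq] .
    define T' where "T' = {q \<in> T. F q \<in> U}"
    have oT': "open T'"
      using smooth_map_vimage[OF F chart_openin[OF M U(1)]] T by (simp add: pT T'_def openin_open_subtopology)
    define S where "S = split4 -` T'"
    have oS: "open S" unfolding S_def
      by (rule open_vimage[OF oT']) (rule linear_continuous_on[OF bounded_linear_split4])
    define f where "f = (\<lambda>w. \<phi> (F (split4 w)))"
    have sn: "smooth_near euclid M F q" if "q \<in> T" for q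
      by (rule smooth_nearI[of _ T]) (use T F that in auto)
    have sF: "smooth_map (open_sub euclid T') M F"
      by (rule smooth_map_smaller[OF premanifold_euclid M _ _ _ F]) (use T oT' in \<open>auto simp: T'_def\<close>)
    have sF': "smooth_map (open_sub euclid T') (open_sub M U) F"
      by (rule smooth_map_into_open_sub[OF premanifold_open_sub[OF premanifold_euclid] M sF])
        (use oT' in \<open>auto simp: points_open_sub T'_def\<close>)
    have "smooth_map (open_sub euclid T') euclid (\<lambda>q. \<phi> (F q))"
      by (rule smooth_map_compose[OF premanifold_open_sub[OF premanifold_euclid] premanifold_open_sub[OF M chart_openin[OF M U(1)]]
            premanifold_euclid sF' smooth_map_chart_map[OF M U(1)]]) (use oT' in auto)
    then have s\<phi>F: "smooth_on T' (\<lambda>q. \<phi> (F q))" using smooth_map_euclid[OF oT'] by blast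
    have sf: "smooth_on S f" unfolding f_def
      by (rule smooth_on_compose[OF oS oT' _ smooth_on_linear[OF oS bounded_linear_split4] s\<phi>F]) (simp add: S_def)
    have inf: "inj_on f S"
    proof (rule inj_onI)
      fix a b assume ab: "a \<in> S" "b \<in> S" "f a = f b"
      then have "F (split4 a) = F (split4 b)"
        using chart_inj[OF M U(1)] unfolding f_def S_def T'_def inj_on_def by auto
      then have "split4 a = split4 b" using i ab unfolding S_def T'_def inj_on_def by auto
      then show "a = b" by (metis join4_split4)
    qed
    have Df: "inj (frechet_derivative f (at w))" if w: "w \<in> S" for w
    proof -
      have wT: "split4 w \<in> T" "F (split4 w) \<in> U" using w by (auto simp: S_def T'_def)
      have 1: "smooth_near euclid M (\<lambda>w. F (split4 w)) w"
        by (rule smooth_near_compose[OF premanifold_euclid premanifold_euclid M smooth_near_linear(1)[OF bounded_linear_split4] sn[OF wT(1)]])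
      have 2: "smooth_near M euclid \<phi> (F (split4 w))" by (rule smooth_near_chart_map[OF M U(1) wT(2)])
      have E: "frechet_derivative f (at w) v = tan_map M euclid \<phi> (F (split4 w)) (tan_map euclid M F (split4 w) (split4 v))" for v
        unfolding tan_map_euclid[symmetric] f_def
        using tan_map_compose[OF premanifold_euclid M premanifold_euclid 1 2]
          tan_map_compose[OF premanifold_euclid premanifold_euclid M smooth_near_linear(1)[OF bounded_linear_split4] sn[OF wT(1)]]
          smooth_near_linear(2)[OF bounded_linear_split4] by simp
      have "inj (tan_map M euclid \<phi> (F (split4 w)))"
        using chart_frame(2)[OF M U(1) wT(2)] by (metis injI)
      moreover have "inj split4" by (metis injI join4_split4)
      ultimately have "inj (tan_map M euclid \<phi> (F (split4 w)) \<circ> (tan_map euclid M F (split4 w) \<circ> split4))"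
        using D[OF wT(1)] by (intro inj_compose)
      then show ?thesis unfolding o_def E[symmetric] .
    qed
    note inv = smooth_on_inv_into[OF oS sf inf Df]
    define W where "W = U \<inter> \<phi> -` (f ` S)"
    have W: "openin (mtop M) W" unfolding W_def by (rule chart_vimage_openin[OF M U(1) inv(1)])
    have WF: "\<exists>w\<in>S. m = F (split4 w)" if m: "m \<in> W" for m
    proof -
      obtain w where w: "w \<in> S" "\<phi> m = f w" using m by (auto simp: W_def)
      then have "m = F (split4 w)"
        using chart_inj[OF M U(1)] m unfolding W_def f_def S_def T'_def inj_on_def by auto
      then show ?thesis using w by blast
    qed
    have "W \<subseteq> F ` T" using WF by (auto simp: S_def T'_def)
    moreover have "F q \<in> W" using q U by (auto simp: W_def f_def S_def T'_def intro!: image_eqI[of _ _ "join4 q"])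
    moreover have "smooth_map (open_sub M W) euclid (inv_into T F)"
    proof -
      have MW: "premanifold (open_sub M W)" by (rule premanifold_open_sub[OF M W])
      have s1: "smooth_map (open_sub M W) euclid \<phi>"
        by (rule smooth_map_smaller[OF M premanifold_euclid chart_openin[OF M U(1)] W _ smooth_map_chart_map[OF M U(1)]])
          (auto simp: W_def)
      have s1': "smooth_map (open_sub M W) (open_sub euclid (f ` S)) \<phi>"
        by (rule smooth_map_into_open_sub[OF MW premanifold_euclid s1]) (auto simp: points_open_sub W_def)
      have "smooth_on (f ` S) (\<lambda>y. split4 (inv_into S f y))"
        by (rule smooth_on_linear_comp[OF inv(1) bounded_linear_split4 inv(2)])
      then have s2: "smooth_map (open_sub euclid (f ` S)) euclid (\<lambda>y. split4 (inv_into S f y))"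
        using smooth_map_euclid[OF inv(1)] by blast
      have "smooth_map (open_sub M W) euclid (\<lambda>m. split4 (inv_into S f (\<phi> m)))"
        by (rule smooth_map_compose[OF MW premanifold_open_sub[OF premanifold_euclid] premanifold_euclid s1' s2])
          (use inv(1) in auto)
      then show ?thesis
      proof (rule smooth_map_cong[OF MW premanifold_euclid])
        fix m assume "m \<in> points (open_sub M W)"
        then have "m \<in> W" by (simp add: points_open_sub)
        then obtain w where w: "w \<in> S" "m = F (split4 w)" using WF by blast
        have "inv_into S f (\<phi> m) = w" using inv_into_f_f[OF inf w(1)] by (simp add: f_def w(2))
        moreover have "inv_into T F m = split4 w" unfolding w(2) by (rule inv_into_f_f[OF i]) (use w in \<open>auto simp: S_def T'_def\<close>)
        ultimately show "split4 (inv_into S f (\<phi> m)) = inv_into T F m" by simp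
      qed
    qed
    ultimately show ?thesis using W by blast
  qed
  show o: "openin (mtop M) (F ` T)"
    unfolding openin_subopen[of _ "F ` T"] using loc by blast
  show "smooth_map (open_sub M (F ` T)) euclid (inv_into T F)"
  proof (rule smooth_map_local[OF premanifold_open_sub[OF M o] premanifold_euclid])
    fix m assume "m \<in> points (open_sub M (F ` T))"
    then obtain q where q: "q \<in> T" "m = F q" by (auto simp: points_open_sub)
    obtain W where W: "openin (mtop M) W" "F q \<in> W" "W \<subseteq> F ` T" "smooth_map (open_sub M W) euclid (inv_into T F)"
      using loc[OF q(1)] by blast
    then show "\<exists>W. openin (mtop (open_sub M (F ` T))) W \<and> m \<in> W \<and> smooth_map (open_sub (open_sub M (F ` T)) W) euclid (inv_into T F)"
      using o q by (intro exI[of _ W]) (auto simp: openin_open_subtopology open_sub_open_sub inf_absorb2)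
  qed
qed

section \<open>Free circle actions and their generator\<close>

locale free_circle_action =
  fixes M :: "('m, 'e::euclidean_space) manifold" and \<rho> :: "complex \<Rightarrow> 'm \<Rightarrow> 'm"
  assumes smooth_M: "smooth_manifold M" and act: "circle_action M \<rho>" and free: "free_action M \<rho>"
begin

lemma M: "premanifold M"
  using smooth_M by (rule smooth_manifold_premanifold)

abbreviation "X \<equiv> generator M \<rho>"

lemma act_one [simp]: "x \<in> points M \<Longrightarrow> \<rho> 1 x = x"
  using act by (simp add: circle_action_def)

lemma act_mult: "x \<in> points M \<Longrightarrow> z \<in> points circle \<Longrightarrow> w \<in> points circle \<Longrightarrow> \<rho> (z * w) x = \<rho> z (\<rho> w x)"
  using act by (simp add: circle_action_def)

lemma act_smooth: "z \<in> points circle \<Longrightarrow> smooth_map M M (\<rho> z)"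
  by (rule action_translation[OF M act])

lemma act_points [simp]: "x \<in> points M \<Longrightarrow> z \<in> points circle \<Longrightarrow> \<rho> z x \<in> points M"
  using smooth_map_points[OF act_smooth] by blast

lemma act_cancel:
  assumes x: "x \<in> points M" and z: "z \<in> points circle" and w: "w \<in> points circle" and eq: "\<rho> z x = \<rho> w x"
  shows "z = w"
proof -
  note c = circle_inverse[OF w]
  have "\<rho> (cnj w * z) x = \<rho> (cnj w * w) x"
    using act_mult[OF x, of "cnj w" z] act_mult[OF x, of "cnj w" w] c z w eq by metis
  then have "\<rho> (cnj w * z) x = x" using c x by simp
  then have "cnj w * z = 1" using free circle_mult[of "cnj w" z] c z x by (simp add: free_action_def)
  then have "w * (cnj w * z) = w" by simp
  moreover have "w * (cnj w * z) = (cnj w * w) * z" by (simp only: mult_ac)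
  ultimately show ?thesis using c by simp
qed

lemma curve_smooth: "x \<in> points M \<Longrightarrow> smooth_map euclid M (\<lambda>t. \<rho> (cis t) x)"
  by (rule action_curve[OF M act])

lemma curve_near: "x \<in> points M \<Longrightarrow> smooth_near euclid M (\<lambda>t. \<rho> (cis t) x) t"
  by (rule smooth_map_near[OF premanifold_euclid curve_smooth]) auto

text \<open>By the group law the orbit curve restarted at time \<open>t\<close> is the orbit curve
  of \<open>\<rho> (cis t) x\<close>.\<close>

lemma curve_velocity:
  assumes x: "x \<in> points M"
  shows "tan_map euclid M (\<lambda>t. \<rho> (cis t) x) t 1 = X (\<rho> (cis t) x)"
proof -
  have D: "((\<lambda>h. t + h) has_derivative (\<lambda>h. h)) (at 0)" by (auto intro!: derivative_eq_intros)
  have 1: "smooth_near euclid euclid (\<lambda>h. t + h) 0"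
    by (rule smooth_near_euclid[of UNIV]) (auto intro!: smooth_on_intros)
  have "tan_map euclid M (\<lambda>h. \<rho> (cis (t + h)) x) 0 1 = tan_map euclid M (\<lambda>t. \<rho> (cis t) x) t 1"
    using tan_map_compose[OF premanifold_euclid premanifold_euclid M 1, of "\<lambda>t. \<rho> (cis t) x" 1] curve_near[OF x]
    by (simp add: tan_map_euclid frechet_derivative_at[OF D, symmetric])
  moreover have "(\<lambda>h. \<rho> (cis (t + h)) x) = (\<lambda>h. \<rho> (cis h) (\<rho> (cis t) x))"
    using act_mult[OF x] by (simp add: cis_mult[symmetric] mult.commute fun_eq_iff)
  ultimately show ?thesis by (simp add: generator_def)
qed

lemma generator_translate:
  assumes x: "x \<in> points M" and z: "z \<in> points circle"
  shows "tan_map M M (\<rho> z) x (X x) = X (\<rho> z x)"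
proof -
  have "tan_map euclid M (\<lambda>t. \<rho> z (\<rho> (cis t) x)) 0 1 = tan_map M M (\<rho> z) x (X x)"
    using tan_map_compose[OF premanifold_euclid M M curve_near[OF x, of 0], of "\<rho> z" 1]
      smooth_map_near[OF M act_smooth[OF z] x] x by (simp add: generator_def)
  moreover have "(\<lambda>t. \<rho> z (\<rho> (cis t) x)) = (\<lambda>t. \<rho> (cis t) (\<rho> z x))"
    using z x by (simp add: fun_eq_iff mult.commute flip: act_mult)
  ultimately show ?thesis by (simp add: generator_def)
qed

text \<open>By equivariance a zero of the generator spreads along its orbit, so the orbit curve is
  locally constant. Then \<open>cis t\<close> fixes \<open>x\<close> for some small
  \<open>t > 0\<close>, against freeness.\<close>

lemma generator_nonzero:
  assumes x: "x \<in> points M"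
  shows "X x \<noteq> 0"
proof
  assume X0: "X x = 0"
  let ?c = "\<lambda>t. \<rho> (cis t) x"
  obtain U \<phi> where U: "(U, \<phi>) \<in> atlas M" "x \<in> U" using chart_exists[OF M x] .
  have "openin (mtop euclid) {t \<in> points euclid. ?c t \<in> U}"
    by (rule smooth_map_vimage[OF curve_smooth[OF x] chart_openin[OF M U(1)]])
  then have "open {t. ?c t \<in> U}" by simp
  moreover have "0 \<in> {t. ?c t \<in> U}" using U x by simp
  ultimately obtain e where e: "e > 0" "ball 0 e \<subseteq> {t. ?c t \<in> U}" using open_contains_ball by blast
  have d: "((\<lambda>t. \<phi> (?c t)) has_derivative (\<lambda>_. 0)) (at t)" if "t \<in> ball 0 e" for t
  proof -
    have ct: "?c t \<in> U" using e that by auto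
    have n: "smooth_near euclid euclid (\<lambda>t. \<phi> (?c t)) t"
      by (rule smooth_near_compose[OF premanifold_euclid M premanifold_euclid curve_near[OF x] smooth_near_chart_map[OF M U(1) ct]])
    have "X (?c t) = tan_map M M (\<rho> (cis t)) x 0" using generator_translate[OF x, of "cis t"] X0 by simp
    also have "\<dots> = 0"
      using linear_0[OF tan_map_linear[OF M M smooth_map_near[OF M act_smooth x]]] by simp
    finally have "tan_map euclid euclid (\<lambda>t. \<phi> (?c t)) t 1 = 0"
      using tan_map_compose[OF premanifold_euclid M premanifold_euclid curve_near[OF x] smooth_near_chart_map[OF M U(1) ct], of 1]
        curve_velocity[OF x, of t] linear_0[OF tan_map_linear[OF M premanifold_euclid smooth_near_chart_map[OF M U(1) ct]]] by simp
    moreover have lin: "linear (tan_map euclid euclid (\<lambda>t. \<phi> (?c t)) t)"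
      by (rule tan_map_linear[OF premanifold_euclid premanifold_euclid n])
    ultimately have "tan_map euclid euclid (\<lambda>t. \<phi> (?c t)) t = (\<lambda>_. 0)"
      using linear_scale[OF lin, of _ 1] by (auto simp: fun_eq_iff)
    then show ?thesis
      using tan_map_has_derivative[OF premanifold_euclid premanifold_euclid n, of UNIV id UNIV id] by simp
  qed
  \<comment> \<open>Positive, inside the ball on which the curve is constant, and below
    \<open>2 * pi\<close>, so that \<open>cis t\<close> is not 1.\<close>
  define t where "t = min (e / 2) 1"
  have t: "0 < t" "t < e" "t \<le> 1" using e by (auto simp: t_def)
  have "\<exists>k. \<forall>s\<in>ball 0 e. \<phi> (?c s) = k"
    by (rule has_derivative_zero_constant[of "ball 0 e"]) (use d in \<open>auto intro: has_derivative_at_withinI\<close>)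
  then obtain k where k: "\<And>s. s \<in> ball 0 e \<Longrightarrow> \<phi> (?c s) = k" by blast
  have "t \<in> ball 0 e" "0 \<in> ball 0 e" using t e by auto
  then have "\<phi> (?c t) = \<phi> (?c 0)" using k[of t] k[of 0] by simp
  then have "?c t = ?c 0" using chart_inj[OF M U(1)] e \<open>t \<in> ball 0 e\<close> \<open>0 \<in> ball 0 e\<close> unfolding inj_on_def by blast
  then have "cis t = cis 0" using act_cancel[OF x, of "cis t" "cis 0"] by (simp del: cis_zero)
  then show False using cis_cancel[of t 0] t pi_ge_two by simp
qed

end

section \<open>Local sections of an invariant submersion\<close>

locale circle_submersion = free_circle_action M \<rho>
  for M :: "('m, real^4) manifold" and \<rho> :: "complex \<Rightarrow> 'm \<Rightarrow> 'm" +
  fixes \<mu> :: "'m \<Rightarrow> real^3"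
  assumes \<mu>: "smooth_map M euclid \<mu>"
    and \<mu>_inv: "x \<in> points M \<Longrightarrow> z \<in> points circle \<Longrightarrow> \<mu> (\<rho> z x) = \<mu> x"
    and \<mu>_sub: "x \<in> points M \<Longrightarrow> surj (tan_map M euclid \<mu> x)"
begin

lemma \<mu>_near: "x \<in> points M \<Longrightarrow> smooth_near M euclid \<mu> x"
  by (rule smooth_map_near[OF M \<mu>])

text \<open>Convexity is imposed for the sake of overlaps: two such domains meet in a convex set,
  which makes single-valued angles of transition functions possible.\<close>

definition is_section :: "(real^3) set \<Rightarrow> (real^3 \<Rightarrow> 'm) \<Rightarrow> bool" where
  "is_section V s \<longleftrightarrow> open V \<and> convex V \<and> smooth_map (open_sub euclid V) M s \<and> (\<forall>v\<in>V. \<mu> (s v) = v)"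

text \<open>On the affine slice \<open>\<phi> x + L w\<close>, with \<open>L\<close> a right inverse
  of the differential of \<open>\<mu>\<close>, the map \<open>\<mu>\<close> has the identity as
  derivative at 0 and is locally invertible. A ball in the image is the required convex
  domain.\<close>

lemma section_exists:
  assumes x: "x \<in> points M"
  obtains V s where "is_section V s" "\<mu> x \<in> V" "s (\<mu> x) = x"
proof -
  obtain U \<phi> where U: "chart_at M x = (U, \<phi>)" "(U, \<phi>) \<in> atlas M" "x \<in> U" using chart_at_cases[OF M x] .
  let ?Q = "inv_into U \<phi>"
  define f where "f = (\<lambda>y. \<mu> (?Q y))"
  have sf: "smooth_on (\<phi> ` U) f" unfolding f_def by (rule smooth_map_real[OF M \<mu> U(2)])
  have oU: "open (\<phi> ` U)" by (rule chart_homeomorphic(2)[OF M U(2)])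
  have Df: "frechet_derivative f (at (\<phi> x)) = tan_map M euclid \<mu> x"
    unfolding f_def using tan_map_chart[of M x U \<phi> euclid \<mu> UNIV id] U by simp
  have lf: "linear (tan_map M euclid \<mu> x)" by (rule tan_map_linear[OF M premanifold_euclid \<mu>_near[OF x]])
  obtain L where L: "linear L" "tan_map M euclid \<mu> x \<circ> L = id"
    using linear_surjective_right_inverse[OF lf \<mu>_sub[OF x]] by blast
  have bL: "bounded_linear L" using L(1) by (simp add: linear_conv_bounded_linear)
  define h where "h = (\<lambda>w. \<phi> x + L w)"
  define S where "S = h -` (\<phi> ` U)"
  have sh: "smooth_on UNIV h" unfolding h_def by (intro smooth_on_add smooth_on_const smooth_on_linear bL) auto
  have oS: "open S" unfolding S_def by (rule open_vimage[OF oU smooth_on_continuous[OF sh]])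
  have sG: "smooth_on S (\<lambda>w. f (h w))"
    by (rule smooth_on_compose[OF oS oU _ smooth_on_subset[OF sh] sf]) (auto simp: S_def)
  have h0: "h 0 = \<phi> x" using linear_0[OF L(1)] by (simp add: h_def)
  have S0: "0 \<in> S" using U h0 by (simp add: S_def)
  have dh: "(h has_derivative L) (at 0)" unfolding h_def
    by (auto intro!: derivative_eq_intros bounded_linear_imp_has_derivative bL)
  have "((\<lambda>w. f (h w)) has_derivative (\<lambda>w. frechet_derivative f (at (h 0)) (L w))) (at 0)"
    using diff_chain_at[OF dh smooth_on_has_derivative[OF sf]] U h0 by (simp add: o_def)
  then have "((\<lambda>w. f (h w)) has_derivative id) (at 0)" using L(2) by (simp add: h0 Df o_def id_def fun_eq_iff)
  then have "inj (frechet_derivative (\<lambda>w. f (h w)) (at 0))" using frechet_derivative_at by (metis inj_on_id)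
  then obtain U0 where U0: "open U0" "U0 \<subseteq> S" "0 \<in> U0" "inj_on (\<lambda>w. f (h w)) U0"
    "\<And>w. w \<in> U0 \<Longrightarrow> inj (frechet_derivative (\<lambda>w. f (h w)) (at w))"
    using smooth_on_locally_invertible[OF oS sG S0] by blast
  note inv = smooth_on_inv_into[OF U0(1) smooth_on_subset[OF sG U0(2)] U0(4,5)]
  let ?k = "inv_into U0 (\<lambda>w. f (h w))"
  have f0: "f (h 0) = \<mu> x" by (simp add: h0 f_def chart_inv[OF M U(2,3)])
  have "\<mu> x \<in> (\<lambda>w. f (h w)) ` U0" using U0(3) f0 by force
  then obtain e where e: "e > 0" "ball (\<mu> x) e \<subseteq> (\<lambda>w. f (h w)) ` U0" using inv(1) open_contains_ball by blast
  define V where "V = ball (\<mu> x) e"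
  define s where "s = (\<lambda>v. ?Q (h (?k v)))"
  have kU: "?k v \<in> U0" "f (h (?k v)) = v" if "v \<in> V" for v
  proof -
    have "v \<in> (\<lambda>w. f (h w)) ` U0" using e that unfolding V_def by blast
    from inv_into_into[OF this] f_inv_into_f[OF this] show "?k v \<in> U0" "f (h (?k v)) = v" by auto
  qed
  have oV: "open V" by (simp add: V_def)
  have "smooth_on V (\<lambda>v. h (?k v))"
    by (rule smooth_on_compose[OF oV open_UNIV _ smooth_on_subset[OF inv(2)] sh]) (use e in \<open>auto simp: V_def\<close>)
  then have s1: "smooth_map (open_sub euclid V) euclid (\<lambda>v. h (?k v))" using smooth_map_euclid[OF oV] by blast
  have EV: "premanifold (open_sub euclid V)" by (rule premanifold_open_sub) (use oV in auto)
  have "smooth_map (open_sub euclid V) (open_sub euclid (\<phi> ` U)) (\<lambda>v. h (?k v))"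
    by (rule smooth_map_into_open_sub[OF EV premanifold_euclid s1])
      (use kU(1) U0(2) in \<open>auto simp: points_open_sub S_def\<close>)
  from smooth_map_compose[OF EV premanifold_open_sub[OF premanifold_euclid] M this smooth_map_chart_inv[OF M U(2)]]
  have "smooth_map (open_sub euclid V) M s" using oU by (simp add: s_def)
  moreover have "\<mu> (s v) = v" if "v \<in> V" for v using kU(2)[OF that] by (simp add: s_def f_def)
  moreover have "s (\<mu> x) = x"
  proof -
    have "?k (\<mu> x) = 0" using inv_into_f_f[OF U0(4,3)] f0 by simp
    then show ?thesis by (simp add: s_def h0 chart_inv[OF M U(2,3)])
  qed
  ultimately show ?thesis using that[of V s] oV e(1) by (simp add: is_section_def V_def)
qed

text \<open>Parametrises the orbits meeting a section by a real angle and the value of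
  \<open>\<mu>\<close>; it has period \<open>2 * pi\<close> in the first argument.\<close>

definition flow :: "(real^3 \<Rightarrow> 'm) \<Rightarrow> real \<times> (real^3) \<Rightarrow> 'm" where
  "flow s q = \<rho> (cis (fst q)) (s (snd q))"

context
  fixes V s assumes sec: "is_section V s"
begin

lemma section_facts: "open V" "convex V" "smooth_map (open_sub euclid V) M s" "v \<in> V \<Longrightarrow> \<mu> (s v) = v"
  using sec by (auto simp: is_section_def)

lemma section_points: "v \<in> V \<Longrightarrow> s v \<in> points M"
  using smooth_map_points[OF section_facts(3)] by (simp add: points_open_sub)

lemma section_near: "v \<in> V \<Longrightarrow> smooth_near euclid M s v"
  by (rule smooth_nearI[of _ V]) (use section_facts in auto)

lemma flow_smooth: "smooth_map (open_sub euclid (UNIV \<times> V)) M (flow s)"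
proof -
  let ?E = "open_sub euclid (UNIV \<times> V) :: (real \<times> (real^3), real \<times> (real^3)) manifold"
  have o: "open (UNIV \<times> V)" using section_facts(1) by (simp add: open_Times)
  have E: "premanifold ?E" by (rule premanifold_open_sub) (use o in auto)
  have EV: "premanifold (open_sub euclid V)" by (rule premanifold_open_sub) (use section_facts(1) in auto)
  have f: "smooth_map ?E euclid fst" "smooth_map ?E euclid snd"
    using smooth_map_euclid[OF o] smooth_on_fst[OF o] smooth_on_snd[OF o] by blast+
  have 1: "smooth_map ?E circle (\<lambda>q. cis (fst q))"
    by (rule smooth_map_compose[OF E premanifold_euclid premanifold_circle f(1) smooth_map_cis])
  have "smooth_map ?E (open_sub euclid V) snd"
    by (rule smooth_map_into_open_sub[OF E premanifold_euclid f(2)]) (auto simp: points_open_sub)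
  then have 2: "smooth_map ?E M (\<lambda>q. s (snd q))"
    by (rule smooth_map_compose[OF E EV M _ section_facts(3)])
  have r: "smooth_map (prod_manifold circle M) M (\<lambda>(z, x). \<rho> z x)" using act by (simp add: circle_action_def)
  from smooth_map_compose[OF E premanifold_prod[OF premanifold_circle M] M smooth_map_Pair[OF E premanifold_circle M 1 2] r]
  show ?thesis by (simp add: flow_def[abs_def])
qed

lemma flow_near: "v \<in> V \<Longrightarrow> smooth_near euclid M (flow s) (t, v)"
  by (rule smooth_nearI[of _ "UNIV \<times> V"]) (use flow_smooth section_facts(1) in \<open>auto simp: open_Times\<close>)

lemma flow_points: "v \<in> V \<Longrightarrow> flow s (t, v) \<in> points M"
  by (simp add: flow_def section_points)

lemma \<mu>_flow: "v \<in> V \<Longrightarrow> \<mu> (flow s (t, v)) = v"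
  by (simp add: flow_def \<mu>_inv section_points section_facts(4))

text \<open>The angular direction produces the generator, the others the translated differential of
  the section. The second claim differentiates \<open>\<mu> \<circ> flow s = snd\<close>.\<close>

lemma flow_derivative:
  assumes v: "v \<in> V"
  shows "tan_map euclid M (flow s) (t, v) (c, w) = c *\<^sub>R X (flow s (t, v)) + tan_map M M (\<rho> (cis t)) (s v) (tan_map euclid M s v w)"
    and "tan_map M euclid \<mu> (flow s (t, v)) (tan_map euclid M (flow s) (t, v) (c, w)) = w"
proof -
  let ?D = "tan_map euclid M (flow s) (t, v)"
  have l: "linear ?D" by (rule tan_map_linear[OF premanifold_euclid M flow_near[OF v]])
  have d1: "((\<lambda>t. (t, v)) has_derivative (\<lambda>h. (h, 0))) (at t)" by (auto intro!: derivative_eq_intros)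
  have d2: "((\<lambda>v. (t, v)) has_derivative (\<lambda>h. (0, h))) (at v)" by (auto intro!: derivative_eq_intros)
  have n1: "smooth_near euclid euclid (\<lambda>t. (t, v)) t"
    by (rule smooth_near_euclid[of UNIV]) (auto intro!: smooth_on_Pair smooth_on_intros)
  have n2: "smooth_near euclid euclid (\<lambda>v. (t, v)) v"
    by (rule smooth_near_euclid[of UNIV]) (auto intro!: smooth_on_Pair smooth_on_intros)
  have "tan_map euclid M (\<lambda>t. flow s (t, v)) t 1 = ?D (1, 0)"
    using tan_map_compose[OF premanifold_euclid premanifold_euclid M n1 flow_near[OF v], of 1]
    by (simp add: tan_map_euclid frechet_derivative_at[OF d1, symmetric])
  then have 1: "?D (1, 0) = X (flow s (t, v))"
    using curve_velocity[OF section_points[OF v], of t] by (simp add: flow_def)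
  have "tan_map euclid M (\<lambda>v. flow s (t, v)) v w = ?D (0, w)"
    using tan_map_compose[OF premanifold_euclid premanifold_euclid M n2 flow_near[OF v], of w]
    by (simp add: tan_map_euclid frechet_derivative_at[OF d2, symmetric])
  moreover have "tan_map euclid M (\<lambda>v. flow s (t, v)) v w = tan_map M M (\<rho> (cis t)) (s v) (tan_map euclid M s v w)"
    using tan_map_compose[OF premanifold_euclid M M section_near[OF v], of "\<rho> (cis t)" w]
      smooth_map_near[OF M act_smooth section_points[OF v]] by (simp add: flow_def)
  ultimately have 2: "?D (0, w) = tan_map M M (\<rho> (cis t)) (s v) (tan_map euclid M s v w)" by simp
  have "?D (c, w) = c *\<^sub>R ?D (1, 0) + ?D (0, w)"
    using linear_add[OF l, of "(c, 0)" "(0, w)"] linear_scale[OF l, of c "(1, 0)"] by simp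
  then show "?D (c, w) = c *\<^sub>R X (flow s (t, v)) + tan_map M M (\<rho> (cis t)) (s v) (tan_map euclid M s v w)"
    by (simp add: 1 2)
  have o: "open (UNIV \<times> V)" using section_facts(1) by (simp add: open_Times)
  have "tan_map M euclid \<mu> (flow s (t, v)) (?D (c, w)) = tan_map euclid euclid (\<lambda>q. \<mu> (flow s q)) (t, v) (c, w)"
    by (rule tan_map_compose[OF premanifold_euclid M premanifold_euclid flow_near[OF v] \<mu>_near[OF flow_points[OF v]], symmetric])
  also have "\<dots> = tan_map euclid euclid snd (t, v) (c, w)"
    by (rule fun_cong[OF tan_map_cong[of _ "UNIV \<times> V"]]) (use o v \<mu>_flow in auto)
  also have "\<dots> = w" using smooth_near_linear(2)[OF bounded_linear_snd] by (metis snd_conv)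
  finally show "tan_map M euclid \<mu> (flow s (t, v)) (?D (c, w)) = w" .
qed

text \<open>\<open>\<mu>\<close> detects the directions along the section, and what remains is a
  multiple of the generator, which vanishes nowhere.\<close>

lemma flow_immersion:
  assumes v: "v \<in> V"
  shows "inj (tan_map euclid M (flow s) (t, v))"
proof (rule linear_injective_0[OF tan_map_linear[OF premanifold_euclid M flow_near[OF v]], THEN iffD2], intro allI impI)
  fix q assume z: "tan_map euclid M (flow s) (t, v) q = 0"
  obtain c w where q: "q = (c, w)" by fastforce
  have w: "w = 0"
    using flow_derivative(2)[OF v, of t c w] z linear_0[OF tan_map_linear[OF M premanifold_euclid \<mu>_near[OF flow_points[OF v]]]]
    by (simp add: q)
  have "tan_map M M (\<rho> (cis t)) (s v) (tan_map euclid M s v 0) = 0"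
    using linear_0[OF tan_map_linear[OF premanifold_euclid M section_near[OF v]]]
      linear_0[OF tan_map_linear[OF M M smooth_map_near[OF M act_smooth section_points[OF v]]]] by simp
  then have "c *\<^sub>R X (flow s (t, v)) = 0" using flow_derivative(1)[OF v, of t c w] z by (simp add: q w)
  then show "q = 0" using generator_nonzero[OF flow_points[OF v]] by (simp add: q w prod_eq_iff)
qed

lemma flow_eq:
  assumes "v \<in> V" "v' \<in> V" "flow s (t, v) = flow s (t', v')"
  shows "v = v'" "cis t = cis t'"
proof -
  show "v = v'" using \<mu>_flow assms by metis
  then show "cis t = cis t'" using act_cancel[OF section_points[OF assms(1)]] assms(3) by (simp add: flow_def)
qed

lemma flow_inj: "inj_on (flow s) ({a<..<a + 2 * pi} \<times> V)"
proof (rule inj_onI)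
  fix q q' assume q: "q \<in> {a<..<a + 2 * pi} \<times> V" "q' \<in> {a<..<a + 2 * pi} \<times> V" "flow s q = flow s q'"
  obtain t v t' v' where e: "q = (t, v)" "q' = (t', v')" by fastforce
  have "v = v'" "cis t = cis t'" using flow_eq[of v v' t t'] q e by auto
  moreover have "\<bar>t - t'\<bar> < 2 * pi" using q e by auto
  ultimately show "q = q'" using cis_cancel e by auto
qed

text \<open>Periodicity in the angle is the only failure of injectivity, so the angle is confined to
  an interval of length \<open>2 * pi\<close>.\<close>

lemma flow_inverse:
  fixes a :: real
  defines "T \<equiv> {a<..<a + 2 * pi} \<times> V"
  shows "openin (mtop M) (flow s ` T)" "smooth_map (open_sub M (flow s ` T)) euclid (inv_into T (flow s))"
proof -
  have oT: "open T" unfolding T_def using section_facts(1) by (intro open_Times) auto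
  have o: "open (UNIV \<times> V)" using section_facts(1) by (simp add: open_Times)
  have sT: "smooth_map (open_sub euclid T) M (flow s)"
    by (rule smooth_map_smaller[OF premanifold_euclid M _ _ _ flow_smooth]) (use oT o in \<open>auto simp: T_def\<close>)
  have D: "inj (tan_map euclid M (flow s) q)" if "q \<in> T" for q
    using that flow_immersion by (auto simp: T_def)
  note i = inverse_smooth_map[OF M oT sT flow_inj[of a, folded T_def] D]
  show "openin (mtop M) (flow s ` T)" "smooth_map (open_sub M (flow s ` T)) euclid (inv_into T (flow s))" using i by blast+
qed

end

end

subsection \<open>The orbit space\<close>

context circle_submersion
begin

definition orb :: "'m \<Rightarrow> 'm set" where
  "orb x = (\<lambda>z. \<rho> z x) ` points circle"

text \<open>Functions on orbits are defined through a chosen point. They come from invariant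
  functions, so by \<open>rep_invariant\<close> the value does not depend on the choice.\<close>

definition rep :: "'m set \<Rightarrow> 'm" where
  "rep b = (SOME x. x \<in> b)"

definition qmu :: "'m set \<Rightarrow> real^3" where
  "qmu b = \<mu> (rep b)"

lemma one_in_circle [simp]: "1 \<in> points circle"
  by (simp add: points_circle)

lemma orb_self: "x \<in> points M \<Longrightarrow> x \<in> orb x"
  unfolding orb_def by (rule image_eqI[of _ _ 1]) auto

lemma orb_act:
  assumes x: "x \<in> points M" and z: "z \<in> points circle"
  shows "orb (\<rho> z x) = orb x"
proof
  show "orb (\<rho> z x) \<subseteq> orb x"
    using act_mult[OF x _ z] circle_mult[OF _ z] by (auto simp: orb_def simp flip: act_mult[OF x _ z] intro!: imageI)
  show "orb x \<subseteq> orb (\<rho> z x)"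
  proof
    fix y assume "y \<in> orb x"
    then obtain w where w: "w \<in> points circle" "y = \<rho> w x" by (auto simp: orb_def)
    note c = circle_inverse[OF z]
    have "w * cnj z * z = w" using c by (simp add: mult.assoc)
    then have "\<rho> (w * cnj z) (\<rho> z x) = y" using act_mult[OF x circle_mult[OF w(1)] z, of "cnj z"] c w(2) by metis
    then show "y \<in> orb (\<rho> z x)" using circle_mult[OF w(1)] c by (auto simp: orb_def)
  qed
qed

lemma orb_eqD:
  assumes "x \<in> points M" "y \<in> points M" "orb x = orb y"
  obtains z where "z \<in> points circle" "y = \<rho> z x"
  using orb_self[OF assms(2)] assms(3) by (auto simp: orb_def)

lemma rep_orb:
  assumes "x \<in> points M"
  obtains z where "z \<in> points circle" "rep (orb x) = \<rho> z x"
proof -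
  have "rep (orb x) \<in> orb x" unfolding rep_def by (rule someI[of _ x]) (rule orb_self[OF assms])
  then show ?thesis using that by (auto simp: orb_def)
qed

lemma rep_invariant:
  assumes "x \<in> points M" "\<And>z. z \<in> points circle \<Longrightarrow> f (\<rho> z x) = f x"
  shows "f (rep (orb x)) = f x"
  using rep_orb[OF assms(1)] assms(2) by metis

lemma qmu_orb [simp]: "x \<in> points M \<Longrightarrow> qmu (orb x) = \<mu> x"
  unfolding qmu_def by (rule rep_invariant) (use \<mu>_inv in auto)

text \<open>The quotient topology; the first conjunct confines open sets to the carrier, because the
  type \<open>'m set\<close> also contains sets that are not orbits.\<close>

definition quot_open :: "'m set set \<Rightarrow> bool" where
  "quot_open W \<longleftrightarrow> W \<subseteq> orb ` points M \<and> openin (mtop M) {x \<in> points M. orb x \<in> W}"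

text \<open>The atlas consists of the map induced by \<open>\<mu>\<close>, restricted to all open sets on which it is injective.\<close>

definition quot :: "('m set, real^3) manifold" where
  "quot = \<lparr>mtop = topology quot_open, atlas = {(U, \<phi>). quot_open U \<and> inj_on qmu U \<and> \<phi> = qmu}\<rparr>"

lemma openin_quot: "openin (mtop quot) W \<longleftrightarrow> quot_open W"
proof -
  have "istopology quot_open"
    unfolding istopology_def
  proof (intro conjI allI impI)
    fix S T assume "quot_open S" "quot_open T"
    moreover have "{x \<in> points M. orb x \<in> S \<inter> T} = {x \<in> points M. orb x \<in> S} \<inter> {x \<in> points M. orb x \<in> T}" by auto
    ultimately show "quot_open (S \<inter> T)" by (auto simp: quot_open_def)
  next
    fix K assume K: "\<forall>S\<in>K. quot_open S"
    have "{x \<in> points M. orb x \<in> \<Union>K} = (\<Union>S\<in>K. {x \<in> points M. orb x \<in> S})" by auto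
    moreover have "openin (mtop M) (\<Union>S\<in>K. {x \<in> points M. orb x \<in> S})" using K by (auto simp: quot_open_def)
    ultimately show "quot_open (\<Union>K)" using K by (auto simp: quot_open_def)
  qed
  then show ?thesis by (simp add: quot_def)
qed

lemma points_quot: "points quot = orb ` points M"
proof -
  have "{x \<in> points M. orb x \<in> orb ` points M} = points M" by blast
  then have "openin (mtop quot) (orb ` points M)" by (simp add: openin_quot quot_open_def openin_points)
  then have "orb ` points M \<subseteq> points quot" by (rule points_openin)
  moreover have "quot_open (points quot)" using openin_points openin_quot by blast
  ultimately show ?thesis by (auto simp: quot_open_def)
qed

lemma atlas_quot: "(U, \<phi>) \<in> atlas quot \<longleftrightarrow> openin (mtop quot) U \<and> inj_on qmu U \<and> \<phi> = qmu"
  unfolding openin_quot by (auto simp: quot_def)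

lemma orb_points: "x \<in> points M \<Longrightarrow> orb x \<in> points quot"
  by (simp add: points_quot)

lemma orb_continuous: "continuous_map (mtop M) (mtop quot) orb"
  unfolding continuous_map_def openin_quot
  using orb_points by (auto simp: quot_open_def points_def)

text \<open>The saturation of \<open>W\<close> is the union of the preimages of \<open>W\<close>
  under the single group elements.\<close>

lemma orb_open:
  assumes W: "openin (mtop M) W"
  shows "openin (mtop quot) (orb ` W)"
  unfolding openin_quot quot_open_def
proof
  have sub: "W \<subseteq> points M" by (rule points_openin[OF W])
  show "orb ` W \<subseteq> orb ` points M" using sub by blast
  have "{x \<in> points M. orb x \<in> orb ` W} = (\<Union>z\<in>points circle. {x \<in> points M. \<rho> z x \<in> W})"
  proof (intro equalityI subsetI)
    fix x assume "x \<in> {x \<in> points M. orb x \<in> orb ` W}"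
    then obtain w where w: "x \<in> points M" "w \<in> W" "orb x = orb w" by blast
    then obtain z where "z \<in> points circle" "w = \<rho> z x" using orb_eqD[of x w] sub by blast
    then show "x \<in> (\<Union>z\<in>points circle. {x \<in> points M. \<rho> z x \<in> W})" using w by blast
  next
    fix x assume "x \<in> (\<Union>z\<in>points circle. {x \<in> points M. \<rho> z x \<in> W})"
    then obtain z where z: "z \<in> points circle" "x \<in> points M" "\<rho> z x \<in> W" by blast
    then show "x \<in> {x \<in> points M. orb x \<in> orb ` W}" using orb_act[OF z(2,1)] by (auto intro!: image_eqI[of _ _ "\<rho> z x"])
  qed
  moreover have "openin (mtop M) (\<Union>z\<in>points circle. {x \<in> points M. \<rho> z x \<in> W})"
    using smooth_map_vimage[OF act_smooth W] by blast
  ultimately show "openin (mtop M) {x \<in> points M. orb x \<in> orb ` W}" by simp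
qed

lemma qmu_continuous: "continuous_map (mtop quot) euclidean qmu"
  unfolding continuous_map_def openin_quot
proof (intro conjI allI impI)
  fix S :: "(real^3) set" assume "openin euclidean S"
  then have "openin (mtop M) {x \<in> points M. \<mu> x \<in> S}" using smooth_map_vimage[OF \<mu>] by simp
  moreover have "{x \<in> points M. orb x \<in> {b \<in> topspace (mtop quot). qmu b \<in> S}} = {x \<in> points M. \<mu> x \<in> S}"
    using orb_points by (auto simp: points_def)
  ultimately show "quot_open {b \<in> topspace (mtop quot). qmu b \<in> S}"
    unfolding quot_open_def using points_quot by (auto simp: points_def)
qed simp

text \<open>A section through a point of \<open>W\<close> stays in \<open>W\<close> near the base
  value, so the image contains a neighbourhood of that value.\<close>

lemma \<mu>_open:
  assumes W: "openin (mtop M) W"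
  shows "open (\<mu> ` W)"
proof (subst openin_subopen[of euclidean, unfolded open_openin[symmetric]], intro ballI)
  fix v assume "v \<in> \<mu> ` W"
  then obtain x where x: "x \<in> W" "v = \<mu> x" by blast
  then have "x \<in> points M" using points_openin[OF W] by blast
  then obtain V s where s: "is_section V s" "\<mu> x \<in> V" "s (\<mu> x) = x" using section_exists by blast
  have "openin (mtop (open_sub euclid V)) {v \<in> points (open_sub euclid V). s v \<in> W}"
    by (rule smooth_map_vimage[OF _ W]) (use s in \<open>simp add: is_section_def\<close>)
  then have o: "open {v \<in> V. s v \<in> W}"
    using s(1) by (simp add: is_section_def points_open_sub openin_open_subtopology)
  have "{v \<in> V. s v \<in> W} \<subseteq> \<mu> ` W" using s(1) by (auto simp: is_section_def intro!: image_eqI[of _ \<mu> "s _"])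
  then show "\<exists>T. open T \<and> v \<in> T \<and> T \<subseteq> \<mu> ` W" using o s x by (intro exI[of _ "{v \<in> V. s v \<in> W}"]) auto
qed

lemma qmu_open: "openin (mtop quot) W \<Longrightarrow> open (qmu ` W)"
proof -
  assume W: "openin (mtop quot) W"
  then have "qmu ` W = \<mu> ` {x \<in> points M. orb x \<in> W}"
    unfolding openin_quot quot_open_def by (auto simp: image_iff) (metis (no_types, lifting) imageE qmu_orb subsetD)+
  then show ?thesis using W \<mu>_open by (simp add: openin_quot quot_open_def)
qed

text \<open>The part of the orbit space that a section meets. Since \<open>\<mu>\<close>
  distinguishes the points of a section, \<open>qmu\<close> is injective there and tubes are chart
  domains.\<close>

definition tube :: "(real^3) set \<Rightarrow> (real^3 \<Rightarrow> 'm) \<Rightarrow> 'm set set" where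
  "tube V s = (\<lambda>v. orb (s v)) ` V"

definition total :: "(real^3) set \<Rightarrow> (real^3 \<Rightarrow> 'm) \<Rightarrow> 'm set" where
  "total V s = flow s ` (UNIV \<times> V)"

context
  fixes V s assumes sec: "is_section V s"
begin

lemma total_open: "openin (mtop M) (total V s)"
proof -
  \<comment> \<open>An angle \<open>t\<close> lies in the interval of length \<open>2 * pi\<close>
    starting at \<open>t - 1\<close>, and \<open>flow_inverse\<close> makes the image of each such
    piece open.\<close>
  have "total V s = (\<Union>a. flow s ` ({a<..<a + 2 * pi} \<times> V))"
  proof (intro equalityI subsetI)
    fix m assume "m \<in> total V s"
    then obtain t v where "v \<in> V" "m = flow s (t, v)" by (auto simp: total_def)
    then show "m \<in> (\<Union>a. flow s ` ({a<..<a + 2 * pi} \<times> V))"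
      using pi_ge_two by (intro UN_I[of "t - 1"] image_eqI[of _ _ "(t, v)"]) auto
  qed (auto simp: total_def)
  then show ?thesis using flow_inverse(1)[OF sec] by auto
qed

lemma orb_flow: "v \<in> V \<Longrightarrow> orb (flow s (t, v)) = orb (s v)"
  by (simp add: flow_def orb_act section_points[OF sec])

lemma tube_image: "tube V s = orb ` total V s"
  unfolding tube_def total_def using orb_flow by (force simp: image_iff)

lemma tube_open: "openin (mtop quot) (tube V s)"
  unfolding tube_image by (rule orb_open[OF total_open])

lemma qmu_section: "v \<in> V \<Longrightarrow> qmu (orb (s v)) = v"
  using section_points[OF sec] section_facts(4)[OF sec] by simp

lemma tube_chart: "(tube V s, qmu) \<in> atlas quot"
  unfolding atlas_quot using tube_open by (auto simp: tube_def inj_on_def qmu_section)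

lemma qmu_tube: "qmu ` tube V s = V"
  using qmu_section by (force simp: tube_def)

lemma tubeD: "b \<in> tube V s \<Longrightarrow> qmu b \<in> V \<and> orb (s (qmu b)) = b"
  using qmu_section by (auto simp: tube_def)

lemma total_iff: "m \<in> total V s \<longleftrightarrow> m \<in> points M \<and> orb m \<in> tube V s"
proof
  assume "m \<in> total V s"
  then show "m \<in> points M \<and> orb m \<in> tube V s" unfolding tube_image using points_openin[OF total_open] by blast
next
  assume m: "m \<in> points M \<and> orb m \<in> tube V s"
  then obtain v where v: "v \<in> V" "orb m = orb (s v)" by (auto simp: tube_def)
  obtain z where z: "z \<in> points circle" "m = \<rho> z (s v)"
    using orb_eqD[of "s v" m] v section_points[OF sec v(1)] m by metis
  obtain t where "z = cis t" using circle_cis[OF z(1)] .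
  then show "m \<in> total V s" using v z by (auto simp: total_def flow_def intro!: image_eqI[of _ _ "(t, v)"])
qed

end

lemma tube_exists:
  assumes "b \<in> points quot"
  obtains V s where "is_section V s" "b \<in> tube V s"
proof -
  obtain x where x: "x \<in> points M" "b = orb x" using assms by (auto simp: points_quot)
  obtain V s where s: "is_section V s" "\<mu> x \<in> V" "s (\<mu> x) = x" using section_exists[OF x(1)] .
  have "b \<in> tube V s" unfolding tube_def x(2) by (rule image_eqI[of _ _ "\<mu> x"]) (simp_all add: s)
  then show ?thesis by (rule that[OF s(1)])
qed

text \<open>All charts are restrictions of the one map \<open>qmu\<close>, so the transitions are
  identities. Tubes show that the chart domains cover.\<close>

lemma premanifold_quot: "premanifold quot"
  unfolding premanifold_def
proof (intro conjI)
  show "\<Union> (fst ` atlas quot) = points quot"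
  proof
    show "\<Union> (fst ` atlas quot) \<subseteq> points quot" using points_openin[of quot] by (force simp: atlas_quot)
    show "points quot \<subseteq> \<Union> (fst ` atlas quot)"
    proof
      fix b assume "b \<in> points quot"
      then obtain V s where "is_section V s" "b \<in> tube V s" by (rule tube_exists)
      then show "b \<in> \<Union> (fst ` atlas quot)" using tube_chart by force
    qed
  qed
  have "open (qmu ` U) \<and> homeomorphic_map (subtopology (mtop quot) U) (top_of_set (qmu ` U)) qmu"
    if U: "openin (mtop quot) U" "inj_on qmu U" for U
  proof
    show o: "open (qmu ` U)" by (rule qmu_open[OF U(1)])
    have ts: "topspace (subtopology (mtop quot) U) = U" using openin_subset[OF U(1)] by auto
    show "homeomorphic_map (subtopology (mtop quot) U) (top_of_set (qmu ` U)) qmu"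
    proof (rule bijective_open_imp_homeomorphic_map)
      show "continuous_map (subtopology (mtop quot) U) (top_of_set (qmu ` U)) qmu"
        using continuous_map_from_subtopology[OF qmu_continuous] ts by (auto simp: continuous_map_in_subtopology)
      show "open_map (subtopology (mtop quot) U) (top_of_set (qmu ` U)) qmu"
        unfolding open_map_def using U o qmu_open by (auto simp: openin_open_subtopology openin_open_eq)
      show "qmu ` topspace (subtopology (mtop quot) U) = topspace (top_of_set (qmu ` U))" by (simp add: ts[simplified])
      show "inj_on qmu (topspace (subtopology (mtop quot) U))" using U(2) ts by simp
    qed
  qed
  then show "\<forall>(U, \<phi>)\<in>atlas quot. openin (mtop quot) U \<and> open (\<phi> ` U) \<and>
      homeomorphic_map (subtopology (mtop quot) U) (top_of_set (\<phi> ` U)) \<phi>"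
    by (auto simp: atlas_quot)
  have "smooth_on (qmu ` (U \<inter> V)) (qmu \<circ> inv_into U qmu)"
    if U: "openin (mtop quot) U" "inj_on qmu U" and V: "openin (mtop quot) V" for U V
  proof (rule smooth_on_cong[OF _ _ smooth_on_id])
    show "open (qmu ` (U \<inter> V))" by (rule qmu_open) (use U V in blast)
    then show "open (qmu ` (U \<inter> V))" .
    fix v assume "v \<in> qmu ` (U \<inter> V)"
    then have "v \<in> qmu ` U" by blast
    then show "v = (qmu \<circ> inv_into U qmu) v" by (simp add: f_inv_into_f)
  qed
  then show "\<forall>(U, \<phi>)\<in>atlas quot. \<forall>(V, \<psi>)\<in>atlas quot. smooth_on (\<phi> ` (U \<inter> V)) (\<psi> \<circ> inv_into U \<phi>)"
    by (auto simp: atlas_quot)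
qed

text \<open>Orbits are compact, hence disjoint orbits have disjoint neighbourhoods in
  \<open>M\<close>. These are shrunk to the orbits they contain; the result is still open because
  projecting along the compact circle is a closed map.\<close>

lemma quot_Hausdorff: "Hausdorff_space (mtop quot)"
  unfolding Hausdorff_space_def
proof (intro allI impI)
  fix b c assume "b \<in> topspace (mtop quot) \<and> c \<in> topspace (mtop quot) \<and> b \<noteq> c"
  then obtain x y where x: "x \<in> points M" "b = orb x" and y: "y \<in> points M" "c = orb y" and ne: "orb x \<noteq> orb y"
    using points_quot by (auto simp: points_def)
  have cptC: "compact_space (mtop circle)" by (simp add: mtop_circle compact_space_subtopology)
  have cpt: "compactin (mtop M) (orb x)" if x: "x \<in> points M" for x
  proof -
    have "smooth_map circle (prod_manifold circle M) (\<lambda>z. (z, x))"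
      by (intro smooth_map_Pair premanifold_circle M smooth_map_id smooth_map_const x)
    moreover have r: "smooth_map (prod_manifold circle M) M (\<lambda>(z, x). \<rho> z x)" using act by (simp add: circle_action_def)
    ultimately have "smooth_map circle M (\<lambda>z. \<rho> z x)"
      using smooth_map_compose[OF premanifold_circle premanifold_prod[OF premanifold_circle M] M] by fastforce
    from image_compactin[OF _ smooth_map_continuous[OF this], of "points circle"]
    show ?thesis using cptC by (simp add: orb_def compact_space_def points_def)
  qed
  have disj: "disjnt (orb x) (orb y)"
  proof (rule ccontr)
    assume "\<not> disjnt (orb x) (orb y)"
    then obtain z w where zw: "z \<in> points circle" "w \<in> points circle" "\<rho> z x = \<rho> w y" by (auto simp: disjnt_def orb_def)
    then have "orb x = orb y" using orb_act[OF x(1) zw(1)] orb_act[OF y(1) zw(2)] by simp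
    then show False using ne by simp
  qed
  have H: "Hausdorff_space (mtop M)" using smooth_M by (simp add: smooth_manifold_def)
  obtain A B where AB: "openin (mtop M) A" "openin (mtop M) B" "orb x \<subseteq> A" "orb y \<subseteq> B" "disjnt A B"
    using Hausdorff_space_compact_separation[OF H cpt[OF x(1)] cpt[OF y(1)] disj] by metis
  define sat where "sat = (\<lambda>A. {b \<in> points quot. b \<subseteq> A})"
  have so: "openin (mtop quot) (sat A)" if A: "openin (mtop M) A" for A
  proof -
    have cl: "closed_map (prod_topology (mtop circle) (mtop M)) (mtop M) snd"
      using closed_map_snd[OF cptC] by blast
    have r: "continuous_map (prod_topology (mtop circle) (mtop M)) (mtop M) (\<lambda>(z, x). \<rho> z x)"
      using act smooth_map_continuous by (fastforce simp: circle_action_def mtop_prod)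
    \<comment> \<open>The pairs whose action leaves \<open>A\<close>; the second projection of this
      closed set consists of the points whose orbit is not contained in \<open>A\<close>.\<close>
    let ?C = "{q \<in> topspace (prod_topology (mtop circle) (mtop M)). (\<lambda>(z, x). \<rho> z x) q \<in> topspace (mtop M) - A}"
    have "closedin (prod_topology (mtop circle) (mtop M)) ?C"
      by (rule closedin_continuous_map_preimage[OF r]) (use A in blast)
    then have c: "closedin (mtop M) (snd ` ?C)" using cl by (simp add: closed_map_def)
    have "{x \<in> points M. orb x \<in> sat A} = topspace (mtop M) - snd ` ?C"
    proof (intro equalityI subsetI)
      fix x assume x: "x \<in> {x \<in> points M. orb x \<in> sat A}"
      then have "\<rho> z x \<in> A" if "z \<in> points circle" for z using that by (auto simp: sat_def orb_def)
      then have "x \<notin> snd ` ?C" by (auto simp: points_def)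
      then show "x \<in> topspace (mtop M) - snd ` ?C" using x by (auto simp: points_def)
    next
      fix x assume x: "x \<in> topspace (mtop M) - snd ` ?C"
      then have xM: "x \<in> points M" by (simp add: points_def)
      have "\<rho> z x \<in> A" if z: "z \<in> points circle" for z
      proof (rule ccontr)
        assume "\<rho> z x \<notin> A"
        then have "(z, x) \<in> ?C" using z xM act_points[OF xM z] by (auto simp: points_def)
        then have "x \<in> snd ` ?C" by force
        then show False using x by blast
      qed
      then show "x \<in> {x \<in> points M. orb x \<in> sat A}" using xM orb_points by (auto simp: sat_def orb_def)
    qed
    then have "openin (mtop M) {x \<in> points M. orb x \<in> sat A}"
      using openin_diff[OF openin_topspace c] by (simp only:)
    then show ?thesis unfolding openin_quot quot_open_def using points_quot by (auto simp: sat_def)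
  qed
  have "disjnt (sat A) (sat B)"
  proof (rule ccontr)
    assume "\<not> disjnt (sat A) (sat B)"
    then obtain x where x: "x \<in> points M" "orb x \<subseteq> A" "orb x \<subseteq> B" by (auto simp: disjnt_def sat_def points_quot)
    then show False using AB(5) orb_self[OF x(1)] by (auto simp: disjnt_def)
  qed
  then show "\<exists>U V. openin (mtop quot) U \<and> openin (mtop quot) V \<and> b \<in> U \<and> c \<in> V \<and> disjnt U V"
    using so[OF AB(1)] so[OF AB(2)] AB x y orb_points by (intro exI[of _ "sat A"] exI[of _ "sat B"]) (auto simp: sat_def)
qed

lemma smooth_quot: "smooth_manifold quot"
proof -
  have "open_map (mtop M) (mtop quot) orb" using orb_open by (simp add: open_map_def)
  moreover have "orb ` topspace (mtop M) = topspace (mtop quot)" using points_quot by (simp add: points_def)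
  ultimately have "second_countable (mtop quot)"
    using second_countable_open_map_image[OF orb_continuous] smooth_M by (auto simp: smooth_manifold_def)
  then show ?thesis using premanifold_quot quot_Hausdorff by (simp add: smooth_manifold_def premanifold_def)
qed

end

context circle_submersion
begin

section \<open>The orbit space as the base of a principal bundle\<close>

lemma orb_smooth: "smooth_map M quot orb"
  unfolding smooth_map_def
proof (intro conjI orb_continuous, clarify)
  fix V \<phi> U \<psi> assume V: "(V, \<phi>) \<in> atlas M" and U: "(U, \<psi>) \<in> atlas quot"
  have VM: "V \<subseteq> points M" by (rule chart_subset[OF M V])
  have "V \<inter> orb -` U = V \<inter> {x \<in> points M. orb x \<in> U}" using VM by blast
  moreover have "openin (mtop M) {x \<in> points M. orb x \<in> U}"
    using U by (simp add: atlas_quot openin_quot quot_open_def)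
  ultimately have o: "open (\<phi> ` (V \<inter> orb -` U))" using chart_Int_open[OF M V] by simp
  show "smooth_on (\<phi> ` (V \<inter> orb -` U)) (\<psi> \<circ> orb \<circ> inv_into V \<phi>)"
    by (rule smooth_on_cong[OF o _ smooth_on_subset[OF smooth_map_real[OF M \<mu> V]]])
      (use U VM in \<open>auto simp: atlas_quot chart_inv[OF M V]\<close>)
qed

lemma qmu_smooth: "smooth_map quot euclid qmu"
proof (rule smooth_map_local[OF premanifold_quot premanifold_euclid])
  fix b assume "b \<in> points quot"
  then obtain V s where s: "is_section V s" "b \<in> tube V s" by (rule tube_exists)
  then show "\<exists>U. openin (mtop quot) U \<and> b \<in> U \<and> smooth_map (open_sub quot U) euclid qmu"
    using tube_open smooth_map_chart_map[OF premanifold_quot tube_chart] by blast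
qed

lemma premanifold_tube: "is_section V s \<Longrightarrow> premanifold (open_sub quot (tube V s))"
  by (rule premanifold_open_sub[OF premanifold_quot tube_open])

lemma premanifold_V: "open V \<Longrightarrow> premanifold (open_sub euclid V)"
  by (rule premanifold_open_sub) auto

lemma smooth_map_tube:
  assumes s: "is_section V s" and K: "premanifold K" and h: "smooth_map (open_sub euclid V) K h"
  shows "smooth_map (open_sub quot (tube V s)) K (\<lambda>b. h (qmu b))"
proof -
  note P = premanifold_tube[OF s]
  have q: "smooth_map (open_sub quot (tube V s)) euclid qmu"
    by (rule smooth_map_restrict[OF premanifold_quot premanifold_euclid qmu_smooth tube_open[OF s]])
  have "smooth_map (open_sub quot (tube V s)) (open_sub euclid V) qmu"
    by (rule smooth_map_into_open_sub[OF P premanifold_euclid q]) (use tubeD[OF s] in \<open>auto simp: points_open_sub\<close>)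
  from smooth_map_compose[OF P premanifold_V[OF section_facts(1)[OF s]] K this h] show ?thesis .
qed

lemma section_smooth: "is_section V s \<Longrightarrow> smooth_map (open_sub quot (tube V s)) M (\<lambda>b. s (qmu b))"
  by (rule smooth_map_tube[OF _ M section_facts(3)])

definition descend :: "('m \<Rightarrow> real) \<Rightarrow> 'm set \<Rightarrow> real" where
  "descend f b = f (rep b)"

lemma descend_orb:
  "x \<in> points M \<Longrightarrow> (\<And>z. z \<in> points circle \<Longrightarrow> f (\<rho> z x) = f x) \<Longrightarrow> descend f (orb x) = f x"
  unfolding descend_def by (rule rep_invariant)

text \<open>On a tube the descended function is \<open>f\<close> along the section, composed with
  the chart.\<close>

lemma descend_smooth:
  assumes f: "smooth_map M euclid f" and inv: "\<And>x z. x \<in> points M \<Longrightarrow> z \<in> points circle \<Longrightarrow> f (\<rho> z x) = f x"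
  shows "smooth_map quot euclid (descend f)"
proof (rule smooth_map_local[OF premanifold_quot premanifold_euclid])
  fix b assume "b \<in> points quot"
  then obtain V s where s: "is_section V s" "b \<in> tube V s" by (rule tube_exists)
  have "smooth_map (open_sub quot (tube V s)) euclid (\<lambda>b. f (s (qmu b)))"
    by (rule smooth_map_compose[OF premanifold_tube[OF s(1)] M premanifold_euclid section_smooth[OF s(1)] f])
  then have "smooth_map (open_sub quot (tube V s)) euclid (descend f)"
  proof (rule smooth_map_cong[OF premanifold_tube[OF s(1)] premanifold_euclid])
    fix b assume "b \<in> points (open_sub quot (tube V s))"
    then have "b \<in> tube V s" by (simp add: points_open_sub)
    note t = tubeD[OF s(1) this]
    then show "f (s (qmu b)) = descend f b"
      using descend_orb[of "s (qmu b)" f] section_points[OF s(1)] inv by metis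
  qed
  then show "\<exists>U. openin (mtop quot) U \<and> b \<in> U \<and> smooth_map (open_sub quot U) euclid (descend f)"
    using tube_open[OF s(1)] s(2) by blast
qed

lemma qmu_local_diffeo: "local_diffeo quot euclid qmu"
  unfolding local_diffeo_def
proof
  fix b assume "b \<in> points quot"
  then obtain V s where s: "is_section V s" "b \<in> tube V s" by (rule tube_exists)
  let ?U = "tube V s"
  note c = tube_chart[OF s(1)] and P = premanifold_tube[OF s(1)] and oV = section_facts(1)[OF s(1)] and im = qmu_tube[OF s(1)]
  have pU: "points (open_sub quot ?U) = ?U" by (rule points_open_sub_openin[OF tube_open[OF s(1)]])
  have "diffeo (open_sub quot ?U) (open_sub euclid (qmu ` ?U)) qmu"
    unfolding diffeo_def pU im
  proof (intro conjI)
    show "bij_betw qmu ?U (points (open_sub euclid V))"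
      using chart_inj[OF premanifold_quot c] im by (simp add: bij_betw_def points_open_sub)
    show "smooth_map (open_sub quot ?U) (open_sub euclid V) qmu"
      by (rule smooth_map_into_open_sub[OF P premanifold_euclid smooth_map_chart_map[OF premanifold_quot c]])
        (use im pU in auto)
    have "smooth_map (open_sub euclid V) quot (inv_into ?U qmu)"
      using smooth_map_chart_inv[OF premanifold_quot c] im by simp
    then show "smooth_map (open_sub euclid V) (open_sub quot ?U) (inv_into ?U qmu)"
      by (rule smooth_map_into_open_sub[OF premanifold_V[OF oV] premanifold_quot])
        (use im in \<open>auto simp: points_open_sub inv_into_into\<close>)
  qed
  then show "\<exists>U. openin (mtop quot) U \<and> b \<in> U \<and> openin (mtop euclid) (qmu ` U) \<and>
      diffeo (open_sub quot U) (open_sub euclid (qmu ` U)) qmu"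
    using tube_open[OF s(1)] s(2) oV im by (intro exI[of _ ?U]) auto
qed

text \<open>The fibre coordinate of the trivialisation determined by \<open>s\<close>; by freeness
  only one group element qualifies.\<close>

definition angle :: "(real^3 \<Rightarrow> 'm) \<Rightarrow> 'm \<Rightarrow> complex" where
  "angle s m = (SOME z. z \<in> points circle \<and> m = \<rho> z (s (\<mu> m)))"

context
  fixes V s assumes sec: "is_section V s"
begin

lemma angle_flow:
  assumes "v \<in> V"
  shows "angle s (flow s (t, v)) = cis t"
  unfolding angle_def \<mu>_flow[OF sec assms]
proof (rule some_equality)
  show "cis t \<in> points circle \<and> flow s (t, v) = \<rho> (cis t) (s v)" by (simp add: flow_def)
  show "z = cis t" if "z \<in> points circle \<and> flow s (t, v) = \<rho> z (s v)" for z
    using that act_cancel[OF section_points[OF sec assms], of z "cis t"] by (simp add: flow_def)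
qed

lemma totalE:
  assumes "m \<in> total V s"
  obtains t where "\<mu> m \<in> V" "m = flow s (t, \<mu> m)" "angle s m = cis t"
proof -
  obtain t v where tv: "v \<in> V" "m = flow s (t, v)" using assms by (auto simp: total_def)
  then have "\<mu> m = v" using \<mu>_flow[OF sec] by simp
  then show ?thesis using that[of t] tv angle_flow[of v t] by simp
qed

text \<open>Provides a real branch \<open>\<theta>\<close> of the angle near \<open>m\<close>. It is
  what allows the connection to be written as \<open>d \<theta>\<close> plus a form from the
  base.\<close>

lemma flow_coordinates:
  assumes m: "m \<in> total V s"
  obtains W \<theta> where "openin (mtop M) W" "m \<in> W" "W \<subseteq> total V s" "smooth_map (open_sub M W) euclid \<theta>"
    "\<And>x. x \<in> W \<Longrightarrow> x = flow s (\<theta> x, \<mu> x)"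
proof -
  obtain t where t: "\<mu> m \<in> V" "m = flow s (t, \<mu> m)" using totalE[OF m] by metis
  \<comment> \<open>The interval begins at \<open>t - 1\<close> so that \<open>t\<close> lies
    strictly inside it.\<close>
  define T where "T = {t - 1<..<t - 1 + 2 * pi} \<times> V"
  define W where "W = flow s ` T"
  note i = flow_inverse[OF sec, of "t - 1", folded T_def, folded W_def]
  define \<theta> where "\<theta> = (\<lambda>x. fst (inv_into T (flow s) x))"
  have "(t, \<mu> m) \<in> T" using t pi_ge_two by (simp add: T_def)
  then have "m \<in> W" using t(2) by (auto simp: W_def)
  moreover have "W \<subseteq> total V s" by (auto simp: W_def T_def total_def)
  moreover have "smooth_map (open_sub M W) euclid \<theta>"
    unfolding \<theta>_def
    by (rule smooth_map_compose[OF premanifold_open_sub[OF M i(1)] premanifold_euclid premanifold_euclid i(2)])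
      (rule smooth_map_euclid[OF open_UNIV, unfolded open_sub_points[OF premanifold_euclid, unfolded points_euclid],
          THEN iffD2, OF smooth_on_fst[OF open_UNIV]])
  moreover have "x = flow s (\<theta> x, \<mu> x)" if x: "x \<in> W" for x
  proof -
    have k: "inv_into T (flow s) x \<in> T" "flow s (inv_into T (flow s) x) = x"
      using x by (auto simp: W_def inv_into_into f_inv_into_f)
    obtain c v where cv: "inv_into T (flow s) x = (c, v)" by fastforce
    then have "v \<in> V" using k by (simp add: T_def)
    then have "\<mu> x = v" using \<mu>_flow[OF sec, of v c] k cv by simp
    then show ?thesis using k cv by (simp add: \<theta>_def)
  qed
  ultimately show ?thesis using that i(1) by blast
qed

lemma angle_smooth: "smooth_map (open_sub M (total V s)) circle (angle s)"
proof (rule smooth_map_local[OF premanifold_open_sub[OF M total_open[OF sec]] premanifold_circle])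
  fix m assume "m \<in> points (open_sub M (total V s))"
  then have "m \<in> total V s" by (simp add: points_open_sub)
  then obtain W \<theta> where W: "openin (mtop M) W" "m \<in> W" "W \<subseteq> total V s" and \<theta>: "smooth_map (open_sub M W) euclid \<theta>"
    "\<And>x. x \<in> W \<Longrightarrow> x = flow s (\<theta> x, \<mu> x)" using flow_coordinates by metis
  have MW: "premanifold (open_sub M W)" by (rule premanifold_open_sub[OF M W(1)])
  have "smooth_map (open_sub M W) circle (\<lambda>x. cis (\<theta> x))"
    by (rule smooth_map_compose[OF MW premanifold_euclid premanifold_circle \<theta>(1) smooth_map_cis])
  then have "smooth_map (open_sub M W) circle (angle s)"
  proof (rule smooth_map_cong[OF MW premanifold_circle])
    fix x assume "x \<in> points (open_sub M W)"
    then have x: "x \<in> W" by (simp add: points_open_sub)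
    then have "\<mu> x \<in> V" using W(3) totalE by blast
    then show "cis (\<theta> x) = angle s x" using angle_flow[of "\<mu> x" "\<theta> x"] \<theta>(2)[OF x] by simp
  qed
  then show "\<exists>U. openin (mtop (open_sub M (total V s))) U \<and> m \<in> U \<and> smooth_map (open_sub (open_sub M (total V s)) U) circle (angle s)"
    using W by (intro exI[of _ W]) (auto simp: openin_open_subtopology[OF total_open[OF sec]] open_sub_open_sub inf_absorb2)
qed

text \<open>The inverse \<open>G\<close> starts at the point where the section meets the orbit
  \<open>b\<close> and moves it by \<open>z\<close>; both directions are composites of the action,
  the section, \<open>orb\<close> and the angle.\<close>

lemma trivialization:
  "diffeo (open_sub M (total V s)) (prod_manifold (open_sub quot (tube V s)) circle) (\<lambda>m. (orb m, angle s m))"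
proof -
  let ?P = "total V s" and ?U = "tube V s" and ?f = "\<lambda>m. (orb m, angle s m)"
  define G where "G = (\<lambda>q. \<rho> (snd q) (s (qmu (fst q))))"
  note oP = total_open[OF sec] and PU = premanifold_tube[OF sec]
  note MP = premanifold_open_sub[OF M oP] and PR = premanifold_prod[OF PU premanifold_circle]
  have pP: "points (open_sub M ?P) = ?P" by (rule points_open_sub_openin[OF oP])
  have pU: "points (open_sub quot ?U) = ?U" by (rule points_open_sub_openin[OF tube_open[OF sec]])
  have f: "?f m \<in> ?U \<times> points circle" "G (?f m) = m" if m: "m \<in> ?P" for m
  proof -
    obtain t where t: "\<mu> m \<in> V" "m = flow s (t, \<mu> m)" "angle s m = cis t" using totalE[OF m] .
    have "m \<in> points M" "orb m \<in> ?U" using total_iff[OF sec] m by auto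
    then show "?f m \<in> ?U \<times> points circle" "G (?f m) = m" using t by (auto simp: G_def flow_def)
  qed
  have g: "G q \<in> ?P" "?f (G q) = q" if q: "q \<in> ?U \<times> points circle" for q
  proof -
    obtain b z where bz: "q = (b, z)" "b \<in> ?U" "z \<in> points circle" using q by blast
    note t = tubeD[OF sec bz(2)]
    obtain c where c: "z = cis c" using circle_cis[OF bz(3)] .
    have G: "G q = flow s (c, qmu b)" by (simp add: G_def bz c flow_def)
    show "G q \<in> ?P" unfolding G using t by (auto simp: total_def)
    show "?f (G q) = q" unfolding G using t orb_flow[OF sec] angle_flow by (simp add: bz c)
  qed
  have b: "bij_betw ?f ?P (?U \<times> points circle)"
    by (rule bij_betw_byWitness[where f' = G]) (use f g in auto)
  have invf: "inv_into ?P ?f q = G q" if "q \<in> ?U \<times> points circle" for q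
    by (rule inv_into_f_eq) (use b g[OF that] in \<open>auto simp: bij_betw_def\<close>)
  have "smooth_map (open_sub M ?P) quot orb" by (rule smooth_map_restrict[OF M premanifold_quot orb_smooth oP])
  then have "smooth_map (open_sub M ?P) (open_sub quot ?U) orb"
    by (rule smooth_map_into_open_sub[OF MP premanifold_quot]) (use f(1) pP in auto)
  then have 1: "smooth_map (open_sub M ?P) (prod_manifold (open_sub quot ?U) circle) ?f"
    by (rule smooth_map_Pair[OF MP PU premanifold_circle _ angle_smooth])
  have "smooth_map (prod_manifold (open_sub quot ?U) circle) M (\<lambda>q. s (qmu (fst q)))"
    by (rule smooth_map_compose[OF PR PU M smooth_map_fst[OF PU premanifold_circle] section_smooth[OF sec]])
  then have "smooth_map (prod_manifold (open_sub quot ?U) circle) (prod_manifold circle M) (\<lambda>q. (snd q, s (qmu (fst q))))"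
    by (rule smooth_map_Pair[OF PR premanifold_circle M smooth_map_snd[OF PU premanifold_circle]])
  moreover have "smooth_map (prod_manifold circle M) M (\<lambda>(z, x). \<rho> z x)" using act by (simp add: circle_action_def)
  ultimately have "smooth_map (prod_manifold (open_sub quot ?U) circle) M (\<lambda>q. (\<lambda>(z, x). \<rho> z x) (snd q, s (qmu (fst q))))"
    by (rule smooth_map_compose[OF PR premanifold_prod[OF premanifold_circle M] M])
  then have sG: "smooth_map (prod_manifold (open_sub quot ?U) circle) M G" by (simp add: G_def case_prod_beta)
  have "smooth_map (prod_manifold (open_sub quot ?U) circle) (open_sub M ?P) G"
    by (rule smooth_map_into_open_sub[OF PR M sG]) (use g(1) in \<open>auto simp: points_prod pU\<close>)
  then have "smooth_map (prod_manifold (open_sub quot ?U) circle) (open_sub M ?P) (inv_into ?P ?f)"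
    by (rule smooth_map_cong[OF PR MP]) (use invf in \<open>auto simp: points_prod pU\<close>)
  then show ?thesis using b 1 by (simp add: diffeo_def pP points_prod pU)
qed

lemma angle_act:
  assumes m: "m \<in> total V s" and z: "z \<in> points circle"
  shows "orb (\<rho> z m) = orb m" "angle s (\<rho> z m) = z * angle s m"
proof -
  obtain t where t: "\<mu> m \<in> V" "m = flow s (t, \<mu> m)" "angle s m = cis t" using totalE[OF m] .
  obtain c where c: "z = cis c" using circle_cis[OF z] .
  have "m \<in> points M" using total_iff[OF sec] m by blast
  then show "orb (\<rho> z m) = orb m" by (rule orb_act[OF _ z])
  have "\<rho> z m = flow s (c + t, \<mu> m)"
    using act_mult[OF section_points[OF sec t(1)], of "cis c" "cis t"] t(2) by (simp add: c flow_def cis_mult)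
  then show "angle s (\<rho> z m) = z * angle s m" using angle_flow[OF t(1), of "c + t"] t(3) by (simp add: c cis_mult)
qed

end

lemma principal_bundle: "principal_circle_bundle quot M \<rho> orb"
  unfolding principal_circle_bundle_def
proof (intro conjI ballI smooth_quot smooth_M act orb_smooth)
  fix b assume "b \<in> points quot"
  then obtain V s where s: "is_section V s" "b \<in> tube V s" by (rule tube_exists)
  have P: "{m \<in> points M. orb m \<in> tube V s} = total V s" using total_iff[OF s(1)] by blast
  show "\<exists>U \<tau>. openin (mtop quot) U \<and> b \<in> U \<and> (let P = {m \<in> points M. orb m \<in> U} in
      diffeo (open_sub M P) (prod_manifold (open_sub quot U) circle) (\<lambda>m. (orb m, \<tau> m)) \<and>
      (\<forall>m\<in>P. \<forall>z\<in>points circle. orb (\<rho> z m) = orb m \<and> \<tau> (\<rho> z m) = z * \<tau> m))"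
    by (intro exI[of _ "tube V s"] exI[of _ "angle s"])
      (use s tube_open[OF s(1)] trivialization[OF s(1)] angle_act[OF s(1)] in \<open>simp add: P Let_def\<close>)
qed

lemma tan_qmu [simp]: "b \<in> points quot \<Longrightarrow> tan_map quot euclid qmu b v = v"
  using chart_at_frame(2)[OF premanifold_quot] chart_at_atlas[OF premanifold_quot] atlas_quot by (metis prod.collapse)

text \<open>Every chart of the orbit space is \<open>qmu\<close>, so tangent vectors are vectors of
  \<real>^3, and the section followed by \<open>orb\<close> has the identity as
  differential.\<close>

lemma fun_d_quot:
  fixes f :: "'m set \<Rightarrow> real"
  assumes s: "is_section V s" and v: "v \<in> V" and f: "smooth_near quot euclid f (orb (s v))"
  shows "fun_d quot f (orb (s v)) [w] = frechet_derivative (\<lambda>v. f (orb (s v))) (at v) w"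
proof -
  let ?h = "\<lambda>v. orb (s v)"
  have oV: "open V" by (rule section_facts(1)[OF s])
  have h: "smooth_near euclid quot ?h v"
    by (rule smooth_near_compose[OF premanifold_euclid M premanifold_quot section_near[OF s v]
          smooth_map_near[OF M orb_smooth section_points[OF s v]]])
  have hp: "?h v \<in> points quot" using section_points[OF s v] orb_points by blast
  have "tan_map quot euclid qmu (?h v) (tan_map euclid quot ?h v w) = tan_map euclid euclid (\<lambda>v. qmu (?h v)) v w"
    by (rule tan_map_compose[OF premanifold_euclid premanifold_quot premanifold_euclid h smooth_map_near[OF premanifold_quot qmu_smooth hp], symmetric])
  also have "\<dots> = tan_map euclid euclid (\<lambda>v. v) v w"
    by (rule fun_cong[OF tan_map_cong[of _ V]]) (use oV v qmu_section[OF s] in auto)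
  finally have "tan_map euclid quot ?h v w = w" using hp by (simp add: tan_map_id)
  then show ?thesis
    using tan_map_compose[OF premanifold_euclid premanifold_quot premanifold_euclid h f, of w]
    by (simp add: fun_d_tan_map tan_map_euclid)
qed

lemma mu_partial_quot:
  assumes s: "is_section V s" and v: "v \<in> V" and f: "smooth_near quot euclid f (orb (s v))"
  shows "mu_partial quot qmu i f (orb (s v)) = frechet_derivative (\<lambda>v. f (orb (s v))) (at v) (axis i 1)"
proof -
  have "tan_map quot euclid qmu (orb (s v)) = id"
    using tan_qmu[OF orb_points[OF section_points[OF s v]]] by (simp add: fun_eq_iff)
  then show ?thesis by (simp add: mu_partial_def fun_d_quot[OF assms])
qed

end

subsection \<open>Connection forms in local sections\<close>

text \<open>In a chart of \<open>M\<close> these values are smooth components of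
  \<open>\<alpha>\<close> applied to derivatives of the section, the case treated by
  \<open>smooth_on_linear_apply\<close>.\<close>

lemma smooth_pullback_section:
  fixes M :: "('m, 'e::euclidean_space) manifold" and s :: "'b::euclidean_space \<Rightarrow> 'm"
    and \<alpha> :: "('m, 'e, real) tensor"
  assumes M: "premanifold M" and V: "open V" and s: "smooth_map (open_sub euclid V) M s"
    and \<alpha>: "smooth_tensor_on M (points M) 1 \<alpha>"
  shows "smooth_on V (\<lambda>v. \<alpha> (s v) [tan_map euclid M s v w])"
proof (rule smooth_on_local)
  fix v0 assume v0: "v0 \<in> V"
  have sp: "s v \<in> points M" if "v \<in> V" for v using smooth_map_points[OF s] that by (simp add: points_open_sub)
  obtain U \<phi> where U: "(U, \<phi>) \<in> atlas M" "s v0 \<in> U" using chart_exists[OF M sp[OF v0]] .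
  define T where "T = {v \<in> V. s v \<in> U}"
  have oT: "open T"
    using smooth_map_vimage[OF s chart_openin[OF M U(1)]] V by (simp add: points_open_sub T_def openin_open_subtopology)
  have ET: "premanifold (open_sub euclid T)" by (rule premanifold_open_sub) (use oT in auto)
  have UM: "U \<inter> points M = U" using chart_subset[OF M U(1)] by blast
  have sT: "smooth_map (open_sub euclid T) M s"
    by (rule smooth_map_smaller[OF premanifold_euclid M _ _ _ s]) (use V oT in \<open>auto simp: T_def\<close>)
  have sTU: "smooth_map (open_sub euclid T) (open_sub M U) s"
    by (rule smooth_map_into_open_sub[OF ET M sT]) (auto simp: points_open_sub T_def)
  have "smooth_map (open_sub euclid T) euclid (\<lambda>v. \<phi> (s v))"
    by (rule smooth_map_compose[OF ET premanifold_open_sub[OF M chart_openin[OF M U(1)]] premanifold_euclid sTU smooth_map_chart_map[OF M U(1)]])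
  then have c: "smooth_on T (\<lambda>v. \<phi> (s v))" using smooth_map_euclid[OF oT] by blast
  let ?A = "\<lambda>v u. \<alpha> (inv_into U \<phi> (\<phi> (s v))) [tan_map euclid M (inv_into U \<phi>) (\<phi> (s v)) u]"
  have A: "smooth_on T (\<lambda>v. ?A v u)" for u
    by (rule smooth_on_compose[OF oT chart_homeomorphic(2)[OF M U(1)] _ c smooth_one_form_chart[OF \<alpha> U(1), unfolded UM]])
      (auto simp: T_def)
  have lA: "linear (?A v)" if v: "v \<in> T" for v
  proof -
    have sv: "s v \<in> U" "s v \<in> points M" using v sp by (auto simp: T_def)
    have "linear (tan_map euclid M (inv_into U \<phi>) (\<phi> (s v)))"
      by (rule tan_map_linear[OF premanifold_euclid M smooth_near_chart_inv[OF M U(1)]]) (use sv in auto)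
    from linear_compose[OF this one_form_linear[OF \<alpha> sv(2)]]
    show ?thesis by (simp add: o_def chart_inv[OF M U(1) sv(1)])
  qed
  have "smooth_on T (\<lambda>v. ?A v (frechet_derivative (\<lambda>v. \<phi> (s v)) (at v) w))"
    by (rule smooth_on_linear_apply[OF oT smooth_on_derivative[OF c] A lA])
  then have "smooth_on T (\<lambda>v. \<alpha> (s v) [tan_map euclid M s v w])"
  proof (rule smooth_on_cong[OF oT, rotated])
    fix v assume v: "v \<in> T"
    then have sv: "s v \<in> U" by (simp add: T_def)
    have n: "smooth_near euclid M s v" by (rule smooth_nearI[of _ T]) (use oT v sT in auto)
    have "frechet_derivative (\<lambda>v. \<phi> (s v)) (at v) w = tan_map M euclid \<phi> (s v) (tan_map euclid M s v w)"
      using tan_map_compose[OF premanifold_euclid M premanifold_euclid n smooth_near_chart_map[OF M U(1) sv], of w]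
      by (simp add: tan_map_euclid)
    then show "?A v (frechet_derivative (\<lambda>v. \<phi> (s v)) (at v) w) = \<alpha> (s v) [tan_map euclid M s v w]"
      by (simp add: chart_frame(2)[OF M U(1) sv] chart_inv[OF M U(1) sv])
  qed
  then show "\<exists>T. open T \<and> v0 \<in> T \<and> smooth_on T (\<lambda>v. \<alpha> (s v) [tan_map euclid M s v w])"
    using oT v0 U(2) by (auto simp: T_def)
qed

abbreviation partial :: "3 \<Rightarrow> (real^3 \<Rightarrow> real) \<Rightarrow> real^3 \<Rightarrow> real" where
  "partial i f v \<equiv> frechet_derivative f (at v) (axis i 1)"

lemma fun_d_compose:
  fixes K :: "('k, 'e::euclidean_space) manifold" and m :: "'k \<Rightarrow> real^3"
  assumes K: "premanifold K" and m: "smooth_near K euclid m x" and V: "open V" "m x \<in> V" and f: "smooth_on V f"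
  shows "fun_d K (\<lambda>x. f (m x)) x [u] = partial 1 f (m x) * fun_d K (\<lambda>x. m x $ 1) x [u]
    + partial 2 f (m x) * fun_d K (\<lambda>x. m x $ 2) x [u] + partial 3 f (m x) * fun_d K (\<lambda>x. m x $ 3) x [u]"
proof -
  have n: "smooth_near euclid euclid f (m x)" by (rule smooth_near_euclid[OF V f])
  have l: "linear (frechet_derivative f (at (m x)))" by (rule smooth_on_linear_derivative[OF f V(2)])
  have r: "w = (w $ 1) *\<^sub>R axis 1 1 + (w $ 2) *\<^sub>R axis 2 1 + (w $ 3) *\<^sub>R axis 3 1" for w :: "real^3"
    using exhaust_3 by (auto simp: vec_eq_iff axis_def)
  have "fun_d K (\<lambda>x. f (m x)) x [u] = frechet_derivative f (at (m x)) (tan_map K euclid m x u)"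
    using tan_map_compose[OF K premanifold_euclid premanifold_euclid m n, of u] by (simp add: fun_d_tan_map tan_map_euclid)
  also have "\<dots> = tan_map K euclid m x u $ 1 * partial 1 f (m x) + tan_map K euclid m x u $ 2 * partial 2 f (m x)
      + tan_map K euclid m x u $ 3 * partial 3 f (m x)"
    by (subst r[of "tan_map K euclid m x u"]) (simp only: linear_add[OF l] linear_scale[OF l] real_scaleR_def)
  finally show ?thesis by (simp add: fun_d_vec_nth[OF K m] mult.commute)
qed

text \<open>The pullback under \<open>m\<close> of a 1-form with coefficients \<open>a\<close> on
  part of \<real>^3. It is used on the total space with \<open>\<mu>\<close> and on the orbit space
  with \<open>qmu\<close>, which keeps the two computations parallel.\<close>

definition pulled_form ::
  "('k, 'e::euclidean_space) manifold \<Rightarrow> ('k \<Rightarrow> real^3) \<Rightarrow> (3 \<Rightarrow> real^3 \<Rightarrow> real) \<Rightarrow> ('k, 'e, real) tensor" where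
  "pulled_form K m a x vs = a 1 (m x) * fun_d K (\<lambda>x. m x $ 1) x vs
     + (a 2 (m x) * fun_d K (\<lambda>x. m x $ 2) x vs + a 3 (m x) * fun_d K (\<lambda>x. m x $ 3) x vs)"

text \<open>The exterior derivative of \<open>pulled_form\<close>; the coefficients are, up to sign,
  the components of the curl of \<open>a\<close>.\<close>

definition curl_form ::
  "('k, 'e::euclidean_space) manifold \<Rightarrow> ('k \<Rightarrow> real^3) \<Rightarrow> (3 \<Rightarrow> real^3 \<Rightarrow> real) \<Rightarrow> ('k, 'e, real) tensor" where
  "curl_form K m a x vs =
     (partial 1 (a 2) (m x) - partial 2 (a 1) (m x)) * wedge (fun_d K (\<lambda>x. m x $ 1)) (fun_d K (\<lambda>x. m x $ 2)) x vs
   + (partial 1 (a 3) (m x) - partial 3 (a 1) (m x)) * wedge (fun_d K (\<lambda>x. m x $ 1)) (fun_d K (\<lambda>x. m x $ 3)) x vs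
   + (partial 2 (a 3) (m x) - partial 3 (a 2) (m x)) * wedge (fun_d K (\<lambda>x. m x $ 2)) (fun_d K (\<lambda>x. m x $ 3)) x vs"

lemma pulled_form:
  fixes K :: "('k, 'e::euclidean_space) manifold"
  assumes K: "premanifold K" and U: "openin (mtop K) U" and m: "smooth_map (open_sub K U) euclid m"
    and V: "open V" "m ` U \<subseteq> V" and a: "\<And>i. smooth_on V (a i)"
  shows "smooth_tensor_on K U 1 (pulled_form K m a)"
    and "x \<in> U \<Longrightarrow> ext_d K (pulled_form K m a) x [u, w] = curl_form K m a x [u, w]"
proof -
  note KU = premanifold_open_sub[OF K U]
  have EV: "premanifold (open_sub euclid V)" by (rule premanifold_open_sub) (use V in auto)
  have mi: "smooth_map (open_sub K U) euclid (\<lambda>x. m x $ i)" for i by (rule smooth_map_vec_nth[OF KU m])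
  have "smooth_map (open_sub K U) (open_sub euclid V) m"
    by (rule smooth_map_into_open_sub[OF KU premanifold_euclid m]) (use V in \<open>auto simp: points_open_sub\<close>)
  then have am: "smooth_map (open_sub K U) euclid (\<lambda>x. a i (m x))" for i
    by (rule smooth_map_compose[OF KU EV premanifold_euclid]) (use smooth_map_euclid[OF V(1)] a in blast)
  note d = smooth_fun_d[OF K U mi]
  note s = smooth_tensor_on_mult[OF K U am d]
  note s23 = smooth_tensor_on_add[OF K U s[of 2 2] s[of 3 3]]
  show "smooth_tensor_on K U 1 (pulled_form K m a)"
    unfolding pulled_form_def[abs_def] by (rule smooth_tensor_on_add[OF K U s s23])
  assume x: "x \<in> U"
  have l: "length [u, w] = Suc 1" by simp
  have mn: "smooth_near K euclid m x" by (rule smooth_nearI[OF U x m])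
  have mV: "m x \<in> V" using V x by blast
  have e: "ext_d K (\<lambda>x vs. a i (m x) * fun_d K (\<lambda>x. m x $ i) x vs) x [u, w] =
      fun_d K (\<lambda>x. a i (m x)) x [u] * fun_d K (\<lambda>x. m x $ i) x [w] - fun_d K (\<lambda>x. a i (m x)) x [w] * fun_d K (\<lambda>x. m x $ i) x [u]" for i
    unfolding ext_d_mult_one[OF K U x am d] ext_d_fun_d(2)[OF K U x mi] by simp
  show "ext_d K (pulled_form K m a) x [u, w] = curl_form K m a x [u, w]"
    unfolding pulled_form_def[abs_def] ext_d_add[OF K U x s s23 l] ext_d_add[OF K U x s s l] e
      fun_d_compose[OF K mn V(1) mV a] curl_form_def wedge_def by (simp add: algebra_simps)
qed

locale circle_connection = circle_submersion +
  fixes \<eta> :: "('a, real^4, real) tensor"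
  assumes conn: "connection_form M \<rho> \<eta>"
begin

lemma \<eta>_smooth: "smooth_tensor_on M (points M) 1 \<eta>"
  using conn by (simp add: connection_form_def smooth_form_on_def)

lemma \<eta>_generator: "x \<in> points M \<Longrightarrow> \<eta> x [X x] = 1"
  using conn by (simp add: connection_form_def)

lemma \<eta>_invariant:
  assumes x: "x \<in> points M" and z: "z \<in> points circle"
  shows "\<eta> (\<rho> z x) [tan_map M M (\<rho> z) x v] = \<eta> x [v]"
proof -
  have "pullback M M (\<rho> z) \<eta> x [v] = \<eta> x [v]"
    using conn x z by (simp add: connection_form_def preserves_tensor_def tensor_eq_on_def)
  then show ?thesis by (simp add: pullback_def)
qed

text \<open>The local gauge potential: the components of the connection form pulled back by the
  section.\<close>

definition potential :: "(real^3 \<Rightarrow> 'a) \<Rightarrow> 3 \<Rightarrow> real^3 \<Rightarrow> real" where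
  "potential s i v = \<eta> (s v) [tan_map euclid M s v (axis i 1)]"

context
  fixes V s assumes sec: "is_section V s"
begin

lemma potential_smooth: "smooth_on V (potential s i)"
  unfolding potential_def[abs_def]
  by (rule smooth_pullback_section[OF M section_facts(1,3)[OF sec] \<eta>_smooth])

lemma \<eta>_section:
  assumes v: "v \<in> V"
  shows "\<eta> (s v) [tan_map euclid M s v w] = w $ 1 * potential s 1 v + w $ 2 * potential s 2 v + w $ 3 * potential s 3 v"
proof -
  have l: "linear (\<lambda>w. \<eta> (s v) [tan_map euclid M s v w])"
    using linear_compose[OF tan_map_linear[OF premanifold_euclid M section_near[OF sec v]] one_form_linear[OF \<eta>_smooth section_points[OF sec v]]]
    by (simp add: o_def)
  have r: "w = (w $ 1) *\<^sub>R axis 1 1 + (w $ 2) *\<^sub>R axis 2 1 + (w $ 3) *\<^sub>R axis 3 1"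
    using exhaust_3 by (auto simp: vec_eq_iff axis_def)
  show ?thesis
    by (subst r) (simp only: linear_add[OF l] linear_scale[OF l] real_scaleR_def potential_def)
qed

text \<open>Invariance moves the evaluation to the section, and the angular part contributes
  \<open>c\<close> because \<open>\<eta>\<close> is 1 on the generator. In the coordinates of
  \<open>flow\<close> the connection is the differential of the angle plus the potential.\<close>

lemma \<eta>_flow:
  assumes v: "v \<in> V"
  shows "\<eta> (flow s (t, v)) [tan_map euclid M (flow s) (t, v) (c, w)] =
    c + (w $ 1 * potential s 1 v + w $ 2 * potential s 2 v + w $ 3 * potential s 3 v)"
proof -
  note l = one_form_linear[OF \<eta>_smooth flow_points[OF sec v, of t]]
  have "\<eta> (flow s (t, v)) [tan_map M M (\<rho> (cis t)) (s v) (tan_map euclid M s v w)] = \<eta> (s v) [tan_map euclid M s v w]"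
    using \<eta>_invariant[OF section_points[OF sec v], of "cis t"] by (simp add: flow_def)
  then show ?thesis
    unfolding flow_derivative(1)[OF sec v] linear_add[OF l] linear_scale[OF l]
    by (simp add: \<eta>_generator[OF flow_points[OF sec v]] \<eta>_section[OF v])
qed

text \<open>Over a section, \<open>\<eta>\<close> is locally \<open>d\<theta>\<close> plus the pull-back of a form on the base.\<close>

lemma d\<eta>_total:
  assumes m: "m \<in> total V s"
  shows "ext_d M \<eta> m [u, w] = curl_form M \<mu> (potential s) m [u, w]"
proof -
  obtain W \<theta> where W: "openin (mtop M) W" "m \<in> W" "W \<subseteq> total V s" and \<theta>: "smooth_map (open_sub M W) euclid \<theta>"
    and fl: "\<And>x. x \<in> W \<Longrightarrow> x = flow s (\<theta> x, \<mu> x)" using flow_coordinates[OF sec m] by blast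
  note MW = premanifold_open_sub[OF M W(1)]
  have \<mu>W: "\<mu> ` W \<subseteq> V" using W(3) totalE[OF sec] by blast
  have s\<mu>: "smooth_map (open_sub M W) euclid \<mu>" by (rule smooth_map_restrict[OF M premanifold_euclid \<mu> W(1)])
  note pf = pulled_form[OF M W(1) s\<mu> section_facts(1)[OF sec] \<mu>W potential_smooth]
  note s\<theta> = smooth_fun_d[OF M W(1) \<theta>]
  \<comment> \<open>The identity \<open>x = flow s (\<theta> x, \<mu> x)\<close> is differentiated,
    so that \<open>v\<close> becomes the image of its angle and base components and
    \<open>\<eta>_flow\<close> applies.\<close>
  have eq: "\<eta> x [v] = fun_d M \<theta> x [v] + pulled_form M \<mu> (potential s) x [v]" if x: "x \<in> W" for x v
  proof -
    have xM: "x \<in> points M" and \<mu>x: "\<mu> x \<in> V" using x W points_openin \<mu>W by blast+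
    have n\<theta>: "smooth_near M euclid \<theta> x" by (rule smooth_nearI[OF W(1) x \<theta>])
    have n: "smooth_near M euclid (\<lambda>x. (\<theta> x, \<mu> x)) x"
    proof (rule smooth_nearI[OF W(1) x])
      show "smooth_map (open_sub M W) euclid (\<lambda>x. (\<theta> x, \<mu> x))"
        using smooth_map_Pair[OF MW premanifold_euclid premanifold_euclid \<theta> s\<mu>] by (simp add: prod_manifold_euclid)
    qed
    let ?q = "tan_map M euclid (\<lambda>x. (\<theta> x, \<mu> x)) x v"
    have "tan_map M M (\<lambda>x. flow s (\<theta> x, \<mu> x)) x v = tan_map M M (\<lambda>x. x) x v"
      by (rule fun_cong[OF tan_map_cong[OF M W(1) x]]) (use fl in auto)
    then have fq: "tan_map euclid M (flow s) (\<theta> x, \<mu> x) ?q = v"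
      using tan_map_compose[OF M premanifold_euclid M n flow_near[OF sec \<mu>x]] tan_map_id[OF M xM] by simp
    have q: "?q = (fun_d M \<theta> x [v], tan_map M euclid \<mu> x v)"
      using tan_map_compose[OF M premanifold_euclid premanifold_euclid n smooth_near_linear(1)[OF bounded_linear_fst], of v]
        tan_map_compose[OF M premanifold_euclid premanifold_euclid n smooth_near_linear(1)[OF bounded_linear_snd], of v]
      by (simp add: smooth_near_linear(2)[OF bounded_linear_fst] smooth_near_linear(2)[OF bounded_linear_snd] fun_d_tan_map prod_eq_iff)
    have "\<eta> x [v] = \<eta> (flow s (\<theta> x, \<mu> x)) [tan_map euclid M (flow s) (\<theta> x, \<mu> x) ?q]" unfolding fq fl[OF x, symmetric] ..
    then show ?thesis
      unfolding q \<eta>_flow[OF \<mu>x] by (simp add: pulled_form_def fun_d_vec_nth[OF M \<mu>_near[OF xM]] algebra_simps)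
  qed
  have "ext_d M \<eta> m [u, w] = ext_d M (\<lambda>x vs. fun_d M \<theta> x vs + pulled_form M \<mu> (potential s) x vs) m [u, w]"
  proof (rule ext_d_cong[OF M W(1,2), where k = 1])
    fix x :: 'a and vs :: "(real^4) list" assume "x \<in> W" "length vs = 1"
    then show "\<eta> x vs = fun_d M \<theta> x vs + pulled_form M \<mu> (potential s) x vs" using eq length_one by metis
  qed simp
  also have "\<dots> = ext_d M (fun_d M \<theta>) m [u, w] + ext_d M (pulled_form M \<mu> (potential s)) m [u, w]"
    by (rule ext_d_add[OF M W(1,2) s\<theta> pf(1)]) simp
  finally show ?thesis by (simp add: ext_d_fun_d(2)[OF M W(1,2) \<theta>] pf(2)[OF W(2)])
qed

lemma tube_form:
  shows "smooth_form_on quot (tube V s) 1 (pulled_form quot qmu (potential s))"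
    and "b \<in> tube V s \<Longrightarrow> ext_d quot (pulled_form quot qmu (potential s)) b [u, w] = curl_form quot qmu (potential s) b [u, w]"
proof -
  have s: "smooth_map (open_sub quot (tube V s)) euclid qmu"
    by (rule smooth_map_restrict[OF premanifold_quot premanifold_euclid qmu_smooth tube_open[OF sec]])
  have i: "qmu ` tube V s \<subseteq> V" using qmu_tube[OF sec] by simp
  note pf = pulled_form[OF premanifold_quot tube_open[OF sec] s section_facts(1)[OF sec] i potential_smooth]
  show "smooth_form_on quot (tube V s) 1 (pulled_form quot qmu (potential s))"
    unfolding smooth_form_on_one by (rule pf(1))
  show "b \<in> tube V s \<Longrightarrow> ext_d quot (pulled_form quot qmu (potential s)) b [u, w] = curl_form quot qmu (potential s) b [u, w]"
    by (rule pf(2))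
qed

end

text \<open>The set where two sections meet the same orbits is open and closed in the convex intersection of
  their domains, so it is contractible and the transition function has a single-valued angle \<open>f\<close>.\<close>

lemma transition_exists:
  assumes 1: "is_section V1 s1" and 2: "is_section V2 s2"
  obtains f where "smooth_map (open_sub quot (tube V1 s1 \<inter> tube V2 s2)) euclid f"
    "\<And>b. b \<in> tube V1 s1 \<inter> tube V2 s2 \<Longrightarrow> s2 (qmu b) = \<rho> (cis (f b)) (s1 (qmu b))"
    "\<And>b u. b \<in> tube V1 s1 \<inter> tube V2 s2 \<Longrightarrow> fun_d quot f b [u] =
       pulled_form quot qmu (potential s2) b [u] - pulled_form quot qmu (potential s1) b [u]"
proof -
  let ?U = "tube V1 s1 \<inter> tube V2 s2"
  define C where "C = qmu ` ?U"
  have oU: "openin (mtop quot) ?U" using tube_open[OF 1] tube_open[OF 2] by blast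
  have QU: "premanifold (open_sub quot ?U)" by (rule premanifold_open_sub[OF premanifold_quot oU])
  have oC: "open C" unfolding C_def by (rule qmu_open[OF oU])
  have oV: "open (V1 \<inter> V2)" using section_facts(1)[OF 1] section_facts(1)[OF 2] by blast
  have Ceq: "C = {v \<in> V1 \<inter> V2. orb (s1 v) = orb (s2 v)}"
  proof (intro equalityI subsetI)
    fix v assume "v \<in> C"
    then obtain b where "b \<in> ?U" "v = qmu b" by (auto simp: C_def)
    then show "v \<in> {v \<in> V1 \<inter> V2. orb (s1 v) = orb (s2 v)}" using tubeD[OF 1, of b] tubeD[OF 2, of b] by simp
  next
    fix v assume v: "v \<in> {v \<in> V1 \<inter> V2. orb (s1 v) = orb (s2 v)}"
    then have "orb (s1 v) \<in> ?U" by (auto simp: tube_def)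
    then show "v \<in> C" using qmu_section[OF 1, of v] v by (auto simp: C_def intro!: image_eqI[of _ _ "orb (s1 v)"])
  qed
  have co: "continuous_map (top_of_set (V1 \<inter> V2)) (mtop quot) (\<lambda>v. orb (s v))"
    if "is_section V s" "V1 \<inter> V2 \<subseteq> V" for V s
  proof -
    have "continuous_map (top_of_set V) (mtop quot) (\<lambda>v. orb (s v))"
      using continuous_map_compose[OF smooth_map_continuous[OF section_facts(3)[OF that(1)]] orb_continuous]
      by (simp add: o_def)
    from continuous_map_from_subtopology_mono[OF this that(2)] show ?thesis .
  qed
  have "closedin (top_of_set (V1 \<inter> V2)) {v \<in> topspace (top_of_set (V1 \<inter> V2)). orb (s1 v) = orb (s2 v)}"
    by (rule closedin_continuous_maps_eq[OF quot_Hausdorff co[OF 1] co[OF 2]]) auto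
  then have "closedin (top_of_set (V1 \<inter> V2)) C" by (simp add: Ceq)
  moreover have "openin (top_of_set (V1 \<inter> V2)) C" using oC Ceq by (auto intro: open_subset)
  moreover have cv: "convex (V1 \<inter> V2)" by (intro convex_Int section_facts(2)[OF 1] section_facts(2)[OF 2])
  ultimately have "C = {} \<or> C = V1 \<inter> V2" using convex_connected[OF cv] connected_clopen by blast
  then have cC: "convex C" using cv by auto
  have CV: "C \<subseteq> V1" "C \<subseteq> V2" using Ceq by auto
  have EC: "premanifold (open_sub euclid C)" by (rule premanifold_open_sub) (use oC in auto)
  define h where "h = (\<lambda>v. angle s1 (s2 v))"
  have tot: "s2 v \<in> total V1 s1" if "v \<in> C" for v
    using that Ceq section_points[OF 2] by (auto simp: total_iff[OF 1] tube_def)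
  have sC: "smooth_map (open_sub euclid C) M s2"
    by (rule smooth_map_smaller[OF premanifold_euclid M _ _ CV(2) section_facts(3)[OF 2]]) (use section_facts(1)[OF 2] oC in auto)
  have "smooth_map (open_sub euclid C) (open_sub M (total V1 s1)) s2"
    by (rule smooth_map_into_open_sub[OF EC M sC]) (use tot in \<open>auto simp: points_open_sub\<close>)
  then have sh: "smooth_map (open_sub euclid C) circle h" unfolding h_def
    by (rule smooth_map_compose[OF EC premanifold_open_sub[OF M total_open[OF 1]] premanifold_circle _ angle_smooth[OF 1]])
  have s2h: "s2 v = \<rho> (h v) (s1 v)" if "v \<in> C" for v
    using totalE[OF 1 tot[OF that]] section_facts(4)[OF 2] CV that by (metis h_def flow_def fst_conv snd_conv subsetD)
  have ch: "continuous_on C h" and h1: "v \<in> C \<Longrightarrow> cmod (h v) = 1" for v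
    using smooth_map_continuous[OF sh] smooth_map_points[OF sh]
    by (auto simp: mtop_circle continuous_map_in_subtopology points_open_sub points_circle)
  obtain g where g: "continuous_on C g" "\<And>v. v \<in> C \<Longrightarrow> h v = exp (g v)"
    using continuous_logarithm_on_contractible[OF ch convex_imp_contractible[OF cC]] h1 by (metis norm_zero zero_neq_one)
  define k where "k = (\<lambda>v. Im (g v))"
  have ck: "continuous_on C k" unfolding k_def by (intro continuous_intros g)
  have hk: "h v = cis (k v)" if "v \<in> C" for v
  proof -
    have "exp (Re (g v)) = 1" using h1[OF that] g(2)[OF that] by (simp add: norm_exp_eq_Re)
    then show ?thesis using g(2)[OF that] by (simp add: k_def exp_eq_polar)
  qed
  have sk: "smooth_on C k"
  proof (rule smooth_on_local)
    fix v0 assume v0: "v0 \<in> C"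
    \<comment> \<open>Centres the chart of the circle at \<open>h v0\<close>; near \<open>v0\<close>
      the merely continuous angle \<open>k\<close> then equals the smooth chart coordinate of
      \<open>h\<close>.\<close>
    define a where "a = k v0 - pi"
    define T where "T = C \<inter> k -` {a<..<a + 2 * pi}"
    have oT: "open T" unfolding T_def using continuous_open_preimage[OF ck oC] by auto
    have ET: "premanifold (open_sub euclid T)" by (rule premanifold_open_sub) (use oT in auto)
    have at: "(cis ` {a<..<a + 2 * pi}, inv_into {a<..<a + 2 * pi} cis) \<in> atlas circle" by (auto simp: atlas_circle)
    have "smooth_map (open_sub euclid T) circle h"
      by (rule smooth_map_smaller[OF premanifold_euclid premanifold_circle _ _ _ sh]) (use oC oT in \<open>auto simp: T_def\<close>)
    then have "smooth_map (open_sub euclid T) (open_sub circle (cis ` {a<..<a + 2 * pi})) h"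
      by (rule smooth_map_into_open_sub[OF ET premanifold_circle]) (auto simp: points_open_sub T_def hk)
    from smooth_map_compose[OF ET premanifold_open_sub[OF premanifold_circle chart_openin[OF premanifold_circle at]] premanifold_euclid
        this smooth_map_chart_map[OF premanifold_circle at]]
    have "smooth_on T (\<lambda>v. inv_into {a<..<a + 2 * pi} cis (h v))" using smooth_map_euclid[OF oT] by blast
    then have "smooth_on T k"
      by (rule smooth_on_cong[OF oT, rotated]) (auto simp: T_def hk inj_on_cis)
    moreover have "v0 \<in> T" using v0 by (simp add: T_def a_def)
    ultimately show "\<exists>T. open T \<and> v0 \<in> T \<and> smooth_on T k" using oT by blast
  qed
  \<comment> \<open>Differentiating \<open>s2 v = flow s1 (k v, v)\<close> shows that the two
    potentials differ by \<open>d k\<close>, a change of gauge.\<close>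
  have dk: "potential s2 i v = partial i k v + potential s1 i v" if v: "v \<in> C" for v i
  proof -
    have v1: "v \<in> V1" using v CV by blast
    have n: "smooth_near euclid euclid (\<lambda>v. (k v, v)) v"
      by (rule smooth_near_euclid[OF oC v]) (intro smooth_on_Pair oC sk smooth_on_id)
    have d: "((\<lambda>v. (k v, v)) has_derivative (\<lambda>w. (frechet_derivative k (at v) w, w))) (at v)"
      by (intro has_derivative_Pair smooth_on_has_derivative[OF sk v] has_derivative_ident)
    have "tan_map euclid M s2 v w = tan_map euclid M (\<lambda>v. flow s1 (k v, v)) v w" for w
      by (rule fun_cong[OF tan_map_cong[of _ C]]) (use oC v s2h hk in \<open>auto simp: flow_def\<close>)
    also have "\<dots> w = tan_map euclid M (flow s1) (k v, v) (frechet_derivative k (at v) w, w)" for w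
      using tan_map_compose[OF premanifold_euclid premanifold_euclid M n flow_near[OF 1 v1], of w]
      by (simp add: tan_map_euclid frechet_derivative_at[OF d, symmetric])
    finally have "potential s2 i v = \<eta> (flow s1 (k v, v)) [tan_map euclid M (flow s1) (k v, v) (partial i k v, axis i 1)]"
      using s2h[OF v] hk[OF v] by (simp add: potential_def flow_def)
    then show ?thesis unfolding \<eta>_flow[OF 1 v1] using exhaust_3[of i] by (auto simp: axis_def)
  qed
  have Uq: "qmu b \<in> C" if "b \<in> ?U" for b using that by (auto simp: C_def)
  have qU: "smooth_map (open_sub quot ?U) euclid qmu"
    by (rule smooth_map_restrict[OF premanifold_quot premanifold_euclid qmu_smooth oU])
  show ?thesis
  proof (rule that[of "\<lambda>b. k (qmu b)"])
    have "smooth_map (open_sub quot ?U) (open_sub euclid C) qmu"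
      by (rule smooth_map_into_open_sub[OF QU premanifold_euclid qU]) (use Uq in \<open>auto simp: points_open_sub\<close>)
    then show "smooth_map (open_sub quot ?U) euclid (\<lambda>b. k (qmu b))"
      by (rule smooth_map_compose[OF QU EC premanifold_euclid]) (use smooth_map_euclid[OF oC] sk in blast)
    fix b assume b: "b \<in> ?U"
    show "s2 (qmu b) = \<rho> (cis (k (qmu b))) (s1 (qmu b))" using s2h[OF Uq[OF b]] hk[OF Uq[OF b]] by simp
    fix u
    have "smooth_near quot euclid qmu b" by (rule smooth_nearI[OF oU b qU])
    from fun_d_compose[OF premanifold_quot this oC Uq[OF b] sk, of u]
    show "fun_d quot (\<lambda>b. k (qmu b)) b [u] =
       pulled_form quot qmu (potential s2) b [u] - pulled_form quot qmu (potential s1) b [u]"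
      by (simp add: pulled_form_def dk[OF Uq[OF b]] algebra_simps)
  qed
qed

text \<open>The cover consists of tubes, the primitives are the potentials and the functions are the
  transition angles. On a triple overlap both ways around carry the same point to the same point, so
  freeness makes the angles agree modulo \<open>2 * pi\<close>.\<close>

lemma curvature_class:
  assumes \<beta>: "\<And>V s. is_section V s \<Longrightarrow> tensor_eq_on (tube V s) 2 (curl_form quot qmu (potential s)) \<beta>"
  shows "represents_2pi_int_class quot \<beta>"
proof -
  define \<U> where "\<U> = {tube V s | V s. is_section V s}"
  \<comment> \<open>The Cech data are indexed by sets, so a section has to be chosen for every
    tube.\<close>
  define VS where "VS = (\<lambda>U. SOME c. is_section (fst c) (snd c) \<and> tube (fst c) (snd c) = U)"
  have VS: "is_section (fst (VS U)) (snd (VS U)) \<and> tube (fst (VS U)) (snd (VS U)) = U" if "U \<in> \<U>" for U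
    unfolding VS_def by (rule someI_ex) (use that in \<open>auto simp: \<U>_def\<close>)
  define sg where "sg = (\<lambda>U. snd (VS U))"
  define A where "A = (\<lambda>U. pulled_form quot qmu (potential (sg U)))"
  define Q where "Q = (\<lambda>U V f. smooth_map (open_sub quot (U \<inter> V)) euclid f \<and>
    (\<forall>b\<in>U \<inter> V. sg V (qmu b) = \<rho> (cis (f b)) (sg U (qmu b)) \<and> (\<forall>u. fun_d quot f b [u] = A V b [u] - A U b [u])))"
  have "\<exists>f. Q U V f" if "U \<in> \<U>" "V \<in> \<U>" for U V
    unfolding Q_def A_def sg_def
    using VS[OF that(1)] VS[OF that(2)] transition_exists[of "fst (VS U)" "snd (VS U)" "fst (VS V)" "snd (VS V)"] by metis
  then obtain f where f: "\<And>U V. U \<in> \<U> \<Longrightarrow> V \<in> \<U> \<Longrightarrow> Q U V (f U V)" by metis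
  show ?thesis unfolding represents_2pi_int_class_def
  proof (intro exI[of _ \<U>] exI[of _ A] exI[of _ f] conjI ballI)
    show "openin (mtop quot) U" if "U \<in> \<U>" for U using that tube_open by (auto simp: \<U>_def)
    show "\<Union> \<U> = points quot"
    proof (intro equalityI subsetI)
      fix b assume "b \<in> \<Union> \<U>"
      then obtain V s where "is_section V s" "b \<in> tube V s" by (auto simp: \<U>_def)
      then show "b \<in> points quot" using points_openin[OF tube_open] by blast
    next
      fix b assume "b \<in> points quot"
      then obtain V s where "is_section V s" "b \<in> tube V s" by (rule tube_exists)
      then show "b \<in> \<Union> \<U>" by (auto simp: \<U>_def)
    qed
    show "smooth_form_on quot U 1 (A U)" if "U \<in> \<U>" for U
      using tube_form(1)[of "fst (VS U)" "snd (VS U)"] VS[OF that] by (simp add: A_def sg_def)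
    show "tensor_eq_on U 2 (ext_d quot (A U)) \<beta>" if U: "U \<in> \<U>" for U
      unfolding tensor_eq_on_def
    proof (intro ballI allI impI)
      fix b and vs :: "(real^3) list" assume b: "b \<in> U" and lv: "length vs = 2"
      obtain u w where vs: "vs = [u, w]" using lv length_two_cases by blast
      have "ext_d quot (A U) b vs = curl_form quot qmu (potential (sg U)) b vs"
        using tube_form(2)[of "fst (VS U)" "snd (VS U)" b u w] VS[OF U] b by (simp add: A_def sg_def vs)
      also have "\<dots> = \<beta> b vs" using \<beta>[of "fst (VS U)" "snd (VS U)"] VS[OF U] b lv by (simp add: tensor_eq_on_def sg_def)
      finally show "ext_d quot (A U) b vs = \<beta> b vs" .
    qed
    show "smooth_map (open_sub quot (U \<inter> V)) euclid (f U V)" if "U \<in> \<U>" "V \<in> \<U>" for U V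
      using f[OF that] by (simp add: Q_def)
    show "tensor_eq_on (U \<inter> V) 1 (fun_d quot (f U V)) (\<lambda>x vs. A V x vs - A U x vs)" if "U \<in> \<U>" "V \<in> \<U>" for U V
      unfolding tensor_eq_on_def
    proof (intro ballI allI impI)
      fix b and vs :: "(real^3) list" assume b: "b \<in> U \<inter> V" and lv: "length vs = 1"
      obtain u where vs: "vs = [u]" using length_one[OF lv] by blast
      show "fun_d quot (f U V) b vs = A V b vs - A U b vs" using f[OF that] b by (simp add: Q_def vs)
    qed
    fix U V W b assume U: "U \<in> \<U>" and V: "V \<in> \<U>" and W: "W \<in> \<U>" and b: "b \<in> U \<inter> V \<inter> W"
    have p: "sg U (qmu b) \<in> points M"
      using VS[OF U] b section_points tubeD by (metis IntD1 sg_def)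
    have 1: "sg V (qmu b) = \<rho> (cis (f U V b)) (sg U (qmu b))" using f[OF U V] b by (simp add: Q_def)
    have 2: "sg W (qmu b) = \<rho> (cis (f V W b)) (sg V (qmu b))" using f[OF V W] b by (simp add: Q_def)
    have 3: "sg W (qmu b) = \<rho> (cis (f U W b)) (sg U (qmu b))" using f[OF U W] b by (simp add: Q_def)
    have "\<rho> (cis (f V W b + f U V b)) (sg U (qmu b)) = \<rho> (cis (f U W b)) (sg U (qmu b))"
      using act_mult[OF p, of "cis (f V W b)" "cis (f U V b)"] 1 2 3 by (simp add: cis_mult)
    then have "cis (f V W b + f U V b) = cis (f U W b)" by (rule act_cancel[OF p cis_in_circle cis_in_circle])
    then obtain n :: int where n: "f V W b + f U V b = f U W b + 2 * pi * n" using cis_eq_cis by blast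
    show "let c = f V W b - f U W b + f U V b in \<exists>n::int. c = 2 * pi * of_int n"
      unfolding Let_def by (rule exI[of _ n]) (use n in simp)
  qed
qed

end

section \<open>Generalized Kaehler linear algebra\<close>

text \<open>One tangent space of a nondegenerate structure, with \<open>X\<close> the value of the
  generator.\<close>

locale compatible_pair =
  fixes G :: "real^4 \<Rightarrow> real^4 \<Rightarrow> real" and I J :: "real^4 \<Rightarrow> real^4" and X :: "real^4"
  assumes linG: "linear (\<lambda>u. G u v)" and symG: "G u v = G v u" and posG: "v \<noteq> 0 \<Longrightarrow> G v v > 0"
    and linI: "linear I" and II: "I (I v) = - v" and compI: "G (I u) (I v) = G u v"
    and linJ: "linear J" and JJ: "J (J v) = - v" and compJ: "G (J u) (J v) = G u v"
    and injA: "inj (\<lambda>v. (1 / 2) *\<^sub>R (I (J v) - J (I v)))" and X: "X \<noteq> 0"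
begin

definition "A v = (1 / 2) *\<^sub>R (I (J v) - J (I v))"

text \<open>Normalised so that \<open>I J + J I = - 2 P\<close> once the left side is known to be a
  multiple of the identity: pairing with \<open>X\<close> reads off the factor.\<close>

definition "P = - G (I (J X) + J (I X)) X / (2 * G X X)"

text \<open>The half-commutator \<open>A\<close> satisfies \<open>A\<^sup>2 = - Q\<close>, which is
  why the formulas for its inverse divide by \<open>Q\<close>.\<close>

definition "Q = 1 - P\<^sup>2"

lemmas G1 = linear_add[OF linG] linear_scale[OF linG, unfolded real_scaleR_def] linear_neg[OF linG] linear_diff[OF linG] linear_0[OF linG]

lemma G2: "G u (v + w) = G u v + G u w" "G u (c *\<^sub>R v) = c * G u v" "G u (- v) = - G u v" "G u (v - w) = G u v - G u w"
  unfolding symG[of u] G1 by auto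

lemmas I_rules = linear_add[OF linI] linear_scale[OF linI] linear_neg[OF linI] linear_diff[OF linI] II
lemmas J_rules = linear_add[OF linJ] linear_scale[OF linJ] linear_neg[OF linJ] linear_diff[OF linJ] JJ

lemma skew: "G u (I v) = - G (I u) v" "G u (J v) = - G (J u) v"
  using compI[of u "I v"] compJ[of u "J v"] by (simp_all add: I_rules J_rules G2)

lemma A_nonzero: "A X \<noteq> 0"
proof
  assume "A X = 0"
  moreover have "A 0 = 0" by (simp add: A_def linear_0[OF linI] linear_0[OF linJ])
  ultimately have "A X = A 0" by simp
  then show False using injD[OF injA, of X 0] X by (simp add: A_def)
qed

lemma orthogonal [simp]:
  "G (I X) X = 0" "G (J X) X = 0" "G (A X) X = 0" "G (A X) (I X) = 0" "G (A X) (J X) = 0"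
proof -
  show 1: "G (I X) X = 0" "G (J X) X = 0" using skew[of X X] symG[of X] by auto
  have c: "G (I (J X)) X = G (J (I X)) X" using skew(1)[of X "J X"] skew(2)[of "I X" X] symG by (metis skew)
  show "G (A X) X = 0" by (simp add: A_def G1 c)
  show "G (A X) (I X) = 0" using compI[of "J X" X] skew(2)[of "I X" "I X"] symG[of "I X" "J (I X)"] 1 by (simp add: A_def G1)
  show "G (A X) (J X) = 0" using compJ[of "I X" X] skew(1)[of "J X" "J X"] symG[of "J X" "I (J X)"] 1 by (simp add: A_def G1)
qed

text \<open>The four vectors form a basis. \<open>X\<close> and \<open>A X\<close> are orthogonal to
  the rest; a relation between \<open>I X\<close> and \<open>J X\<close> is excluded by applying
  \<open>I\<close> or \<open>J\<close> and pairing with \<open>A X\<close>, against which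
  \<open>I J X\<close> and \<open>J I X\<close> have opposite nonzero products.\<close>

lemma frame_determines:
  assumes "G X u = 0" "G (I X) u = 0" "G (J X) u = 0" "G (A X) u = 0"
  shows "u = 0"
proof (rule ccontr)
  assume u: "u \<noteq> 0"
  define T :: "real^4 \<Rightarrow> real^4" where
    "T = (\<lambda>c. (c $ 1) *\<^sub>R X + (c $ 2) *\<^sub>R I X + (c $ 3) *\<^sub>R J X + (c $ 4) *\<^sub>R A X)"
  have lT: "linear T" by (rule linearI) (simp_all add: T_def scaleR_add_left scaleR_add_right add_divide_distrib)
  have "inj T" unfolding linear_injective_0[OF lT]
  proof (intro allI impI)
    fix c assume T0: "T c = 0"
    have pX: "G X X > 0" "G (A X) (A X) > 0" using posG X A_nonzero by auto
    have c1: "c $ 1 = 0"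
    proof -
      have "G (T c) X = c $ 1 * G X X" unfolding T_def G1(1,2) orthogonal by simp
      then show ?thesis using T0 pX by (simp add: G1)
    qed
    have c4: "c $ 4 = 0"
    proof -
      have "G (A X) (T c) = c $ 4 * G (A X) (A X)" unfolding T_def G2(1,2) orthogonal by simp
      then show ?thesis using T0 pX symG[of "A X" 0] by (simp add: G1)
    qed
    have s: "(c $ 2) *\<^sub>R I X + (c $ 3) *\<^sub>R J X = 0" using T0 by (simp add: T_def c1 c4)
    have "G (A X) (I ((c $ 2) *\<^sub>R I X + (c $ 3) *\<^sub>R J X)) = c $ 3 * G (A X) (I (J X))"
      unfolding I_rules G2(1,2,3) orthogonal by simp
    then have 3: "c $ 3 * G (A X) (I (J X)) = 0" unfolding s linear_0[OF linI] using G2(2)[of "A X" 0 0] by simp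
    have "G (A X) (J ((c $ 2) *\<^sub>R I X + (c $ 3) *\<^sub>R J X)) = c $ 2 * G (A X) (J (I X))"
      unfolding J_rules G2(1,2,3) orthogonal by simp
    then have 2: "c $ 2 * G (A X) (J (I X)) = 0" unfolding s linear_0[OF linJ] using G2(2)[of "A X" 0 0] by simp
    have e: "G (I (J X)) (I (J X)) = G X X" "G (J (I X)) (J (I X)) = G X X" by (simp_all add: compI compJ)
    \<comment> \<open>\<open>I J X\<close> and \<open>J I X\<close> have equal length, so their sum
      is orthogonal to their difference, which is twice \<open>A X\<close>.\<close>
    have "G (A X) (I (J X)) = - G (A X) (J (I X))"
      by (simp add: A_def G1 e symG[of "I (J X)" "J (I X)"] field_simps)
    moreover have "G (A X) (A X) = (G (A X) (I (J X)) - G (A X) (J (I X))) / 2"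
      by (subst (2) A_def) (simp add: G2)
    ultimately have "G (A X) (I (J X)) \<noteq> 0" "G (A X) (J (I X)) \<noteq> 0" using pX by auto
    then have "c $ 2 = 0" "c $ 3 = 0" using 2 3 by auto
    then show "c = 0" using c1 c4 by (simp add: vec_eq_iff forall_4)
  qed
  then have "surj T" using linear_injective_imp_surjective[OF lT] by blast
  then obtain c where "u = T c" by (rule surjE)
  have "G (T c) u = 0" unfolding T_def G1(1,2) assms by simp
  then have "G u u = 0" using \<open>u = T c\<close> by simp
  then show False using posG[OF u] by simp
qed

text \<open>The vector \<open>(I J + J I) X\<close> is orthogonal to \<open>I X\<close>, \<open>J X\<close> and \<open>A X\<close>, hence a multiple of \<open>X\<close>; as
  \<open>I J + J I\<close> commutes with \<open>I\<close>, \<open>J\<close> and \<open>A\<close>, it is a multiple of the identity.\<close>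

lemma anticommutator_X: "J (I X) = - (2 * P) *\<^sub>R X - I (J X)"
proof -
  let ?z = "I (J X) + J (I X) + (2 * P) *\<^sub>R X"
  have e: "G (I (J X)) (I (J X)) = G X X" "G (J (I X)) (J (I X)) = G X X" by (simp_all add: compI compJ)
  have "?z = 0"
  proof (rule frame_determines)
    have "G X X \<noteq> 0" using posG[OF X] by simp
    then have "2 * P * G X X = - G (I (J X) + J (I X)) X" unfolding P_def by simp
    then show "G X ?z = 0" using symG[of X ?z] by (simp add: G1)
    show "G (I X) ?z = 0" using compI[of X "J X"] skew(2)[of "I X" "I X"] symG[of "I X" "J (I X)"] symG[of X "J X"] by (simp add: G2)
    show "G (J X) ?z = 0" using compJ[of X "I X"] skew(1)[of "J X" "J X"] symG[of "J X" "I (J X)"] symG[of X "I X"] by (simp add: G2)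
    show "G (A X) ?z = 0" unfolding G2(1,2) orthogonal by (simp add: A_def G1 G2 e symG[of "I (J X)" "J (I X)"] field_simps)
  qed
  moreover have "J (I X) = ?z - (2 * P) *\<^sub>R X - I (J X)" by simp
  ultimately show ?thesis by (metis diff_0 scaleR_minus_left)
qed

lemma anticommutator: "J (I v) = - (2 * P) *\<^sub>R v - I (J v)"
proof -
  define B where "B v = I (J v) + J (I v) + (2 * P) *\<^sub>R v" for v
  have lB: "linear B" by (rule linearI) (simp_all add: B_def I_rules J_rules scaleR_add_right mult.commute)
  have BI: "B (I v) = I (B v)" and BJ: "B (J v) = J (B v)" for v by (simp_all add: B_def I_rules J_rules)
  have BX: "B X = 0" by (simp add: B_def anticommutator_X)
  have skewB: "G (B u) v = G u (B v)" for u v by (simp add: B_def G1 G2 skew)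
  have "B v = 0"
  proof (rule frame_determines)
    \<comment> \<open>\<open>B\<close> is symmetric and commutes with \<open>I\<close>,
      \<open>J\<close> and \<open>A\<close>, so pairing \<open>B v\<close> with any basis vector
      reduces to \<open>B X = 0\<close>.\<close>
    have "B (A X) = A (B X)" by (simp add: A_def linear_diff[OF lB] linear_scale[OF lB] BI BJ)
    then show "G (A X) (B v) = 0" by (simp add: BX skewB[symmetric] A_def linear_0[OF linI] linear_0[OF linJ] G1)
  qed (simp_all add: BX BI BJ skewB[symmetric] linear_0[OF linI] linear_0[OF linJ] G1)
  moreover have "J (I v) = B v - (2 * P) *\<^sub>R v - I (J v)" by (simp add: B_def)
  ultimately show ?thesis by (metis diff_0 scaleR_minus_left)
qed

lemma A_eq: "A v = I (J v) + P *\<^sub>R v"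
  by (simp add: A_def anticommutator scaleR_add_right scaleR_diff_right)

lemma AA: "A (A v) = - Q *\<^sub>R v"
proof -
  have "I (J (I (J v))) = - (2 * P) *\<^sub>R I (J v) - v"
    by (simp add: I_rules J_rules anticommutator)
  moreover have "A (A v) = I (J (I (J v))) + (2 * P) *\<^sub>R I (J v) + (P * P) *\<^sub>R v"
    unfolding A_eq I_rules J_rules by (simp add: vec_eq_iff algebra_simps)
  ultimately show ?thesis by (simp add: Q_def power2_eq_square scaleR_diff_left)
qed

lemma G_A: "G (A u) (A v) = Q * G u v"
proof -
  have sA: "G (A a) b = - G a (A b)" for a b by (simp add: A_def G1 G2 skew field_simps)
  show ?thesis by (simp add: sA AA G2)
qed

text \<open>\<open>A X\<close> is nonzero, and its squared length is \<open>Q\<close> times that of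
  \<open>X\<close>.\<close>

lemma Q_pos: "0 < Q"
  using posG[OF A_nonzero] posG[OF X] by (simp add: G_A zero_less_mult_iff)

lemma P_bounds: "-1 < P" "P < 1"
  using Q_pos abs_square_less_1[of P] by (auto simp: Q_def abs_less_iff)

lemma inv_A: "inv (\<lambda>v. (1 / 2) *\<^sub>R (I (J v) - J (I v))) v = - (1 / Q) *\<^sub>R A v"
proof (rule inv_f_eq[OF injA])
  have "A (c *\<^sub>R u) = c *\<^sub>R A u" for c u by (simp add: A_def I_rules J_rules scaleR_diff_right)
  from this[of "- (1 / Q)" "A v"] have "A (- (1 / Q) *\<^sub>R A v) = - (1 / Q) *\<^sub>R A (A v)" .
  then show "(1 / 2) *\<^sub>R (I (J (- (1 / Q) *\<^sub>R A v)) - J (I (- (1 / Q) *\<^sub>R A v))) = v"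
    using Q_pos by (simp add: AA flip: A_def)
qed

definition "W = 1 / G X X"
definition "e v = W * G X v"
text \<open>As the inverse of \<open>A\<close> is \<open>- A / Q\<close>, the functionals
  \<open>m1\<close>, \<open>m2\<close>, \<open>m3\<close> are the contractions of the symplectic
  form with \<open>X\<close>, \<open>I X\<close>, \<open>J X\<close>; for a tri-Hamiltonian action
  they are the differentials of the three components of \<open>\<mu>\<close>.\<close>

definition "m1 v = - G (A X) v / Q"
definition "m2 v = - G (A (I X)) v / Q"
definition "m3 v = - G (A (J X)) v / Q"

lemma W_pos: "0 < W"
  using posG[OF X] by (simp add: W_def)

text \<open>\<open>A (I X) = J X - P I X\<close> and \<open>A (J X) = - I X + P J X\<close> relate
  \<open>m2\<close>, \<open>m3\<close> to the pairings with \<open>I X\<close>, \<open>J X\<close>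
  by a 2 by 2 system of determinant \<open>Q\<close>, which is inverted here.\<close>

lemma coframe_expand:
  "G X v = e v / W"
  "G (I X) v = m3 v - P * m2 v" "G (J X) v = P * m3 v - m2 v" "G (A X) v = - Q * m1 v"
proof -
  show "G X v = e v / W" using W_pos by (simp add: e_def)
  show "G (A X) v = - Q * m1 v" using Q_pos by (simp add: m1_def)
  have a: "A (I X) = J X - P *\<^sub>R I X" "A (J X) = - I X + P *\<^sub>R J X"
    by (simp_all add: A_eq anticommutator I_rules J_rules vec_eq_iff algebra_simps)
  have m: "Q * m2 v = P * G (I X) v - G (J X) v" "Q * m3 v = G (I X) v - P * G (J X) v"
    using Q_pos by (simp_all add: m2_def m3_def a G1)
  have "Q * (m3 v - P * m2 v) = Q * m3 v - P * (Q * m2 v)" by (simp add: algebra_simps)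
  also have "\<dots> = Q * G (I X) v" unfolding m by (simp add: Q_def power2_eq_square algebra_simps)
  finally show "G (I X) v = m3 v - P * m2 v" using Q_pos by simp
  have "Q * (P * m3 v - m2 v) = P * (Q * m3 v) - Q * m2 v" by (simp add: algebra_simps)
  also have "\<dots> = Q * G (J X) v" unfolding m by (simp add: Q_def power2_eq_square algebra_simps)
  finally show "G (J X) v = P * m3 v - m2 v" using Q_pos by simp
qed

lemma coframe_linear: "linear m1" "linear m2" "linear m3" "linear e"
  by (auto intro!: linearI simp: m1_def[abs_def] m2_def[abs_def] m3_def[abs_def] e_def[abs_def] G2 add_divide_distrib diff_divide_distrib algebra_simps)

text \<open>Skewness moves \<open>I\<close> to the fixed slot, where the anticommutator rule brings
  the vectors back to the basis. The result is the defining set of equations of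
  \<open>gk_coframe.adapted\<close>.\<close>

lemma I_coframe:
  "m1 (I v) = m2 v" "m2 (I v) = - m1 v" "m3 (I v) = - P * m1 v + e v / W" "e (I v) = - W * (m3 v - P * m2 v)"
proof -
  have a: "A (I X) = J X - P *\<^sub>R I X" "A (J X) = - I X + P *\<^sub>R J X" "A X = I (J X) + P *\<^sub>R X"
    by (simp_all add: A_eq anticommutator I_rules J_rules vec_eq_iff algebra_simps)
  show "m1 (I v) = m2 v" by (simp add: m1_def m2_def a G1 G2 skew I_rules)
  show "m2 (I v) = - m1 v" using Q_pos by (simp add: m1_def m2_def a G1 G2 skew I_rules field_simps)
  show "e (I v) = - W * (m3 v - P * m2 v)" by (simp add: e_def skew coframe_expand algebra_simps)
  have "Q * m3 (I v) = G X v + P * G (I (J X)) v" using Q_pos by (simp add: m3_def a G1 G2 skew I_rules)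
  moreover have "G (I (J X)) v = - Q * m1 v - P * G X v" using coframe_expand(4)[of v] unfolding a(3) G1 by simp
  ultimately have "Q * m3 (I v) = Q * (- P * m1 v + e v / W)"
    by (simp add: coframe_expand(1) Q_def power2_eq_square algebra_simps)
  then show "m3 (I v) = - P * m1 v + e v / W" using Q_pos by (metis less_irrefl mult_cancel_left)
qed

lemma J_coframe:
  "m1 (J v) = m3 v" "m3 (J v) = - m1 v" "m2 (J v) = - P * m1 v - e v / W" "e (J v) = W * (m2 v - P * m3 v)"
proof -
  have a: "A (I X) = J X - P *\<^sub>R I X" "A (J X) = - I X + P *\<^sub>R J X" "A X = I (J X) + P *\<^sub>R X"
    by (simp_all add: A_eq anticommutator I_rules J_rules vec_eq_iff algebra_simps)
  note r = G1 G2 skew I_rules J_rules anticommutator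
  show "m1 (J v) = m3 v" unfolding m1_def m3_def a by (simp add: r)
  show "m3 (J v) = - m1 v" unfolding m1_def m3_def a using Q_pos by (simp add: r field_simps)
  show "e (J v) = W * (m2 v - P * m3 v)" by (simp add: e_def skew coframe_expand algebra_simps)
  have "Q * m2 (J v) = - G X v + P * G (I (J X)) v + 2 * P\<^sup>2 * G X v"
    using Q_pos unfolding m2_def a by (simp add: r power2_eq_square field_simps)
  moreover have "G (I (J X)) v = - Q * m1 v - P * G X v" using coframe_expand(4)[of v] unfolding a(3) G1 by simp
  ultimately have "Q * m2 (J v) = Q * (- P * m1 v - e v / W)"
    by (simp add: coframe_expand(1) Q_def power2_eq_square algebra_simps)
  then show "m2 (J v) = - P * m1 v - e v / W" using Q_pos by (metis less_irrefl mult_cancel_left)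
qed

lemma coframe_X: "m1 X = 0" "m2 X = 0" "m3 X = 0" "e X = 1"
proof -
  have 1: "m1 X = 0" by (simp add: m1_def)
  then show "m1 X = 0" .
  have "P * m3 X - m2 X = 0" "m3 X - P * m2 X = 0" using coframe_expand(2,3)[of X] by simp_all
  then have "Q * m2 X = 0" "Q * m3 X = 0" by (auto simp: Q_def power2_eq_square algebra_simps)
  then show "m2 X = 0" "m3 X = 0" using Q_pos by auto
  show "e X = 1" using posG[OF X] by (simp add: e_def W_def)
qed

text \<open>Both sides are paired with the basis vectors of \<open>frame_determines\<close>;
  \<open>n\<close>, \<open>c\<close> and \<open>o\<close> list the Gram matrix.\<close>

lemma expand: "u = e u *\<^sub>R X + (W * m3 u) *\<^sub>R I X - (W * m2 u) *\<^sub>R J X - (W * m1 u) *\<^sub>R A X" (is "u = ?R")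
proof -
  have n: "G X X = 1 / W" "G (I X) (I X) = 1 / W" "G (J X) (J X) = 1 / W" "G (A X) (A X) = Q / W"
    by (simp_all add: compI compJ G_A W_def)
  have "G (I X) (J X) = P / W"
    using coframe_expand(2)[of "J X"] by (simp add: J_coframe coframe_X)
  then have c: "G (I X) (J X) = P / W" "G (J X) (I X) = P / W" using symG by auto
  have o: "G X (I X) = 0" "G X (J X) = 0" "G X (A X) = 0" "G (I X) (A X) = 0" "G (J X) (A X) = 0"
    using orthogonal symG by metis+
  have "u - ?R = 0"
  proof (rule frame_determines)
    show "G X (u - ?R) = 0" unfolding G2 orthogonal o n c coframe_expand[of u] by simp
    show "G (I X) (u - ?R) = 0" unfolding G2 orthogonal o n c coframe_expand[of u] using W_pos by simp
    show "G (J X) (u - ?R) = 0" unfolding G2 orthogonal o n c coframe_expand[of u] using W_pos by simp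
    show "G (A X) (u - ?R) = 0" unfolding G2 orthogonal o n c coframe_expand[of u] using W_pos by simp
  qed
  then show ?thesis by simp
qed

lemma metric: "G u v = W * ((1 - P\<^sup>2) * (m1 u * m1 v) + m2 u * m2 v + m3 u * m3 v - P * (m2 u * m3 v + m3 u * m2 v))
    + inverse W * (e u * e v)"
  by (subst expand[of u]) (simp only: G1 coframe_expand[of v] Q_def, simp add: field_simps)

lemma coframe_inj: "m1 u = 0 \<Longrightarrow> m2 u = 0 \<Longrightarrow> m3 u = 0 \<Longrightarrow> e u = 0 \<Longrightarrow> u = 0"
  using expand[of u] by simp

lemma coframe_surj:
  obtains u where "m1 u = x" "m2 u = y" "m3 u = z"
proof -
  let ?u = "(W * z) *\<^sub>R I X - (W * y) *\<^sub>R J X - (W * x) *\<^sub>R A X"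
  note l = coframe_linear[THEN linear_diff] coframe_linear[THEN linear_scale]
  have A: "A X = I (J X) + P *\<^sub>R X" by (rule A_eq)
  show ?thesis
    by (rule that[of ?u]) (use W_pos in \<open>simp_all add: l A coframe_linear[THEN linear_add] I_coframe J_coframe coframe_X\<close>)
qed

end

section \<open>Tri-Hamiltonian actions\<close>

text \<open>The value \<open>Y x\<close> consists of components in the preferred chart at
  \<open>x\<close>, which may jump from point to point, so smoothness has to be asked after
  conversion to a fixed chart.\<close>

definition smooth_field :: "('a, 'e::euclidean_space) manifold \<Rightarrow> ('a \<Rightarrow> 'e) \<Rightarrow> bool" where
  "smooth_field M Y \<longleftrightarrow> (\<forall>(U, \<phi>)\<in>atlas M.
     smooth_on (\<phi> ` U) (\<lambda>y. tan_map M euclid \<phi> (inv_into U \<phi> y) (Y (inv_into U \<phi> y))))"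

lemma smooth_fieldD:
  "smooth_field M Y \<Longrightarrow> (U, \<phi>) \<in> atlas M \<Longrightarrow>
    smooth_on (\<phi> ` U) (\<lambda>y. tan_map M euclid \<phi> (inv_into U \<phi> y) (Y (inv_into U \<phi> y)))"
  by (auto simp: smooth_field_def)

lemma smooth_field_endo:
  assumes M: "premanifold M" and I: "almost_complex_structure M I" and Y: "smooth_field M Y"
  shows "smooth_field M (\<lambda>x. I x (Y x))"
  unfolding smooth_field_def
proof (safe)
  fix U \<phi> assume U: "(U, \<phi>) \<in> atlas M"
  let ?Q = "inv_into U \<phi>" and ?A = "coord_endo M (U, \<phi>) I"
  have o: "open (\<phi> ` U)" by (rule chart_homeomorphic(2)[OF M U])
  have sA: "smooth_on (\<phi> ` U) (\<lambda>z. ?A z w)" for w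
    using I U by (auto simp: almost_complex_structure_def)
  have l: "linear (?A y)" if y: "y \<in> \<phi> ` U" for y
  proof -
    have Q: "?Q y \<in> U" "\<phi> (?Q y) = y" using y chart_inv[OF M U] by auto
    have "linear (I (?Q y))" using I Q chart_subset[OF M U] by (auto simp: almost_complex_structure_def)
    from linear_compose[OF linear_compose[OF tan_map_linear[OF premanifold_euclid M smooth_near_chart_inv[OF M U y]] this]
        tan_map_linear[OF M premanifold_euclid smooth_near_chart_map[OF M U Q(1)]]]
    show ?thesis by (simp add: coord_endo_def[abs_def] Let_def o_def)
  qed
  show "smooth_on (\<phi> ` U) (\<lambda>y. tan_map M euclid \<phi> (?Q y) (I (?Q y) (Y (?Q y))))"
  proof (rule smooth_on_cong[OF o _ smooth_on_linear_apply[OF o smooth_fieldD[OF Y U] sA l]])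
    fix y assume y: "y \<in> \<phi> ` U"
    have Q: "?Q y \<in> U" "\<phi> (?Q y) = y" using y chart_inv[OF M U] by auto
    show "?A y (tan_map M euclid \<phi> (?Q y) (Y (?Q y))) = tan_map M euclid \<phi> (?Q y) (I (?Q y) (Y (?Q y)))"
      using chart_frame(2)[OF M U Q(1)] by (simp add: coord_endo_def Let_def Q(2))
  qed assumption
qed

lemma smooth_one_form_field:
  fixes \<alpha> :: "('a, 'e::euclidean_space, real) tensor"
  assumes M: "premanifold M" and \<alpha>: "smooth_tensor_on M (points M) 1 \<alpha>" and Y: "smooth_field M Y"
  shows "smooth_map M euclid (\<lambda>x. \<alpha> x [Y x])"
proof (rule smooth_map_realI[OF M])
  fix U \<phi> assume U: "(U, \<phi>) \<in> atlas M"
  let ?Q = "inv_into U \<phi>" and ?E = "\<lambda>y. tan_map euclid M (inv_into U \<phi>) y"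
  have o: "open (\<phi> ` U)" by (rule chart_homeomorphic(2)[OF M U])
  have UM: "U \<inter> points M = U" using chart_subset[OF M U] by blast
  have s: "smooth_on (\<phi> ` U) (\<lambda>y. \<alpha> (?Q y) [?E y v])" for v
    using smooth_one_form_chart[OF \<alpha> U] by (simp add: UM)
  have l: "linear (\<lambda>v. \<alpha> (?Q y) [?E y v])" if y: "y \<in> \<phi> ` U" for y
  proof -
    have "?Q y \<in> points M" using y chart_inv[OF M U] chart_subset[OF M U] by auto
    from linear_compose[OF tan_map_linear[OF premanifold_euclid M smooth_near_chart_inv[OF M U y]] one_form_linear[OF \<alpha> this]]
    show ?thesis by (simp add: o_def)
  qed
  show "smooth_on (\<phi> ` U) (\<lambda>y. \<alpha> (?Q y) [Y (?Q y)])"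
  proof (rule smooth_on_cong[OF o _ smooth_on_linear_apply[OF o smooth_fieldD[OF Y U] s l]])
    fix y assume y: "y \<in> \<phi> ` U"
    have Q: "?Q y \<in> U" "\<phi> (?Q y) = y" using y chart_inv[OF M U] by auto
    show "\<alpha> (?Q y) [?E y (tan_map M euclid \<phi> (?Q y) (Y (?Q y)))] = \<alpha> (?Q y) [Y (?Q y)]"
      using chart_frame(2)[OF M U Q(1)] by (simp add: Q(2))
  qed assumption
qed

lemma smooth_contraction:
  fixes g :: "('a, 'e::euclidean_space, real) tensor"
  assumes M: "premanifold M" and g: "smooth_tensor_on M (points M) 2 g" and Y: "smooth_field M Y"
  shows "smooth_tensor_on M (points M) 1 (\<lambda>x vs. g x [Y x, vs ! 0])"
proof (rule smooth_one_formI)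
  fix x assume x: "x \<in> points M"
  show "linear (\<lambda>v. g x [Y x, [v] ! 0])" using smooth_tensor_on_linear[OF g x, of "[Y x, 0]" 1] by simp
next
  fix U \<phi> v assume U: "(U, \<phi>) \<in> atlas M"
  let ?Q = "inv_into U \<phi>" and ?E = "\<lambda>y. tan_map euclid M (inv_into U \<phi>) y"
  have o: "open (\<phi> ` U)" by (rule chart_homeomorphic(2)[OF M U])
  have UM: "U \<inter> points M = U" using chart_subset[OF M U] by blast
  have s: "smooth_on (\<phi> ` U) (\<lambda>y. g (?Q y) [?E y u, ?E y v])" for u
    using smooth_tensor_on_chart[OF g U, of "[u, v]"] by (simp add: UM coord_rep_chart)
  have l: "linear (\<lambda>u. g (?Q y) [?E y u, ?E y v])" if y: "y \<in> \<phi> ` U" for y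
  proof -
    have Q: "?Q y \<in> points M" using y chart_inv[OF M U] chart_subset[OF M U] by auto
    have "linear (\<lambda>u. g (?Q y) [u, ?E y v])" using smooth_tensor_on_linear[OF g Q, of "[0, ?E y v]" 0] by simp
    from linear_compose[OF tan_map_linear[OF premanifold_euclid M smooth_near_chart_inv[OF M U y]] this]
    show ?thesis by (simp add: o_def)
  qed
  have "smooth_on (\<phi> ` U) (\<lambda>y. coord_rep M (U, \<phi>) (\<lambda>x vs. g x [Y x, vs ! 0]) y [v])"
  proof (rule smooth_on_cong[OF o _ smooth_on_linear_apply[OF o smooth_fieldD[OF Y U] s l]])
    fix y assume y: "y \<in> \<phi> ` U"
    have Q: "?Q y \<in> U" "\<phi> (?Q y) = y" using y chart_inv[OF M U] by auto
    show "g (?Q y) [?E y (tan_map M euclid \<phi> (?Q y) (Y (?Q y))), ?E y v] =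
        coord_rep M (U, \<phi>) (\<lambda>x vs. g x [Y x, vs ! 0]) y [v]"
      using chart_frame(2)[OF M U Q(1)] by (simp add: Q(2) coord_rep_chart)
  qed assumption
  then show "smooth_on (\<phi> ` (U \<inter> points M)) (\<lambda>y. coord_rep M (U, \<phi>) (\<lambda>x vs. g x [Y x, vs ! 0]) y [v])"
    unfolding UM .
qed

context free_circle_action
begin

text \<open>In a chart the generator is the derivative at angle 0 of a map that is jointly smooth in
  the angle and the chart coordinates.\<close>

lemma generator_smooth: "smooth_field M X"
  unfolding smooth_field_def
proof safe
  fix U \<phi> assume U: "(U, \<phi>) \<in> atlas M"
  let ?Q = "inv_into U \<phi>" and ?S = "UNIV \<times> \<phi> ` U :: (real \<times> 'e) set"
  let ?E = "open_sub euclid ?S :: (real \<times> 'e, real \<times> 'e) manifold"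
  have o: "open (\<phi> ` U)" by (rule chart_homeomorphic(2)[OF M U])
  then have oS: "open ?S" by (simp add: open_Times)
  have E: "premanifold ?E" by (rule premanifold_open_sub) (use oS in auto)
  have EU: "premanifold (open_sub euclid (\<phi> ` U))" by (rule premanifold_open_sub) (use o in auto)
  define F where "F q = \<rho> (cis (fst q)) (?Q (snd q))" for q
  have f: "smooth_map ?E euclid fst" "smooth_map ?E euclid snd"
    using smooth_map_euclid[OF oS] smooth_on_fst[OF oS] smooth_on_snd[OF oS] by blast+
  have 1: "smooth_map ?E circle (\<lambda>q. cis (fst q))"
    by (rule smooth_map_compose[OF E premanifold_euclid premanifold_circle f(1) smooth_map_cis])
  have "smooth_map ?E (open_sub euclid (\<phi> ` U)) snd"
    by (rule smooth_map_into_open_sub[OF E premanifold_euclid f(2)]) (auto simp: points_open_sub)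
  then have 2: "smooth_map ?E M (\<lambda>q. ?Q (snd q))"
    by (rule smooth_map_compose[OF E EU M _ smooth_map_chart_inv[OF M U]])
  have r: "smooth_map (prod_manifold circle M) M (\<lambda>(z, x). \<rho> z x)" using act by (simp add: circle_action_def)
  from smooth_map_compose[OF E premanifold_prod[OF premanifold_circle M] M smooth_map_Pair[OF E premanifold_circle M 1 2] r]
  have sF: "smooth_map ?E M F" by (simp add: F_def[abs_def])
  define T where "T = {q \<in> ?S. F q \<in> U}"
  have oT: "open T"
    using smooth_map_vimage[OF sF chart_openin[OF M U]] oS by (simp add: points_open_sub T_def openin_open_subtopology)
  have ET: "premanifold (open_sub euclid T)" by (rule premanifold_open_sub) (use oT in auto)
  have "smooth_map (open_sub euclid T) M F"
    by (rule smooth_map_smaller[OF premanifold_euclid M _ _ _ sF]) (use oS oT in \<open>auto simp: T_def\<close>)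
  then have "smooth_map (open_sub euclid T) (open_sub M U) F"
    by (rule smooth_map_into_open_sub[OF ET M]) (auto simp: points_open_sub T_def)
  from smooth_map_compose[OF ET premanifold_open_sub[OF M chart_openin[OF M U]] premanifold_euclid this smooth_map_chart_map[OF M U]]
  have h: "smooth_on T (\<lambda>q. \<phi> (F q))" using smooth_map_euclid[OF oT] by blast
  have T0: "(0, y) \<in> T" if "y \<in> \<phi> ` U" for y
    using that chart_inv[OF M U] chart_subset[OF M U] by (auto simp: T_def F_def)
  have "smooth_on (\<phi> ` U) (\<lambda>y. frechet_derivative (\<lambda>q. \<phi> (F q)) (at (0, y)) (1, 0))"
    by (rule smooth_on_compose[OF o oT T0 _ smooth_on_derivative[OF h]])
      (auto intro!: smooth_on_Pair smooth_on_const smooth_on_id o)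
  then show "smooth_on (\<phi> ` U) (\<lambda>y. tan_map M euclid \<phi> (?Q y) (X (?Q y)))"
  proof (rule smooth_on_cong[OF o, rotated])
    fix y assume y: "y \<in> \<phi> ` U"
    have Q: "?Q y \<in> U" "?Q y \<in> points M" using y chart_inv[OF M U] chart_subset[OF M U] by auto
    have nphi: "smooth_near M euclid \<phi> (\<rho> (cis 0) (?Q y))" using smooth_near_chart_map[OF M U Q(1)] Q(2) by simp
    have d: "((\<lambda>t. (t, y)) has_derivative (\<lambda>t. (t, 0))) (at 0)" by (auto intro!: derivative_eq_intros)
    have "((\<lambda>t. \<phi> (F (t, y))) has_derivative (\<lambda>t. frechet_derivative (\<lambda>q. \<phi> (F q)) (at (0, y)) (t, 0))) (at 0)"
      using diff_chain_at[OF d smooth_on_has_derivative[OF h T0[OF y]]] by (simp add: o_def)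
    from frechet_derivative_at[OF this]
    have "tan_map euclid euclid (\<lambda>t. \<phi> (\<rho> (cis t) (?Q y))) 0 1 = frechet_derivative (\<lambda>q. \<phi> (F q)) (at (0, y)) (1, 0)"
      by (simp add: tan_map_euclid F_def fun_eq_iff)
    then show "frechet_derivative (\<lambda>q. \<phi> (F q)) (at (0, y)) (1, 0) = tan_map M euclid \<phi> (?Q y) (X (?Q y))"
      using tan_map_compose[OF premanifold_euclid M premanifold_euclid curve_near[OF Q(2)] nphi, of 1] Q(2)
      by (simp add: generator_def)
  qed
qed

end

section \<open>The structure on each tangent space and its invariance\<close>

locale hamiltonian_gk = free_circle_action M \<rho>
  for M :: "('m, real^4) manifold" and \<rho> :: "complex \<Rightarrow> 'm \<Rightarrow> 'm" +
  fixes g :: "('m, real^4, real) tensor" and I J :: "('m, real^4) endo" and \<mu> :: "'m \<Rightarrow> real^3"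
  assumes gk: "nondegenerate_gk M g I J"
    and g_inv: "preserves_tensor M \<rho> 2 g" and I_inv: "preserves_endo M \<rho> I" and J_inv: "preserves_endo M \<rho> J"
    and ham: "tri_hamiltonian M g I J \<rho> \<mu>"
begin

lemma gk_facts:
  "riemannian_metric M g" "smooth_tensor_on M (points M) 2 g"
  "almost_complex_structure M I" "almost_complex_structure M J" "compatible_acs M g I" "compatible_acs M g J"
  using gk by (auto simp: nondegenerate_gk_def generalized_kaehler_def integrable_acs_def riemannian_metric_def)

text \<open>The metric turns a kernel vector \<open>w\<close> into a covector that the Poisson
  tensor sends to 0; nondegeneracy makes this covector, and then \<open>w\<close>, vanish.\<close>

lemma half_commutator_inj:
  assumes x: "x \<in> points M"
  shows "inj (half_commutator I J x)"
proof -
  have li: "linear (I x)" "linear (J x)" using gk_facts(3,4) x by (auto simp: almost_complex_structure_def)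
  have l: "linear (half_commutator I J x)"
    by (rule linearI) (simp_all add: half_commutator_def linear_add[OF li(1)] linear_add[OF li(2)]
      linear_scale[OF li(1)] linear_scale[OF li(2)] algebra_simps)
  show ?thesis unfolding linear_injective_0[OF l]
  proof (intro allI impI)
    fix w assume w: "half_commutator I J x w = 0"
    have l2: "linear (\<lambda>v. g x [w, v])" using smooth_tensor_on_linear[OF gk_facts(2) x, of "[w, 0]" 1] by simp
    have l1: "linear (\<lambda>v. g x [v, u])" for u using smooth_tensor_on_linear[OF gk_facts(2) x, of "[0, u]" 0] by simp
    let ?s = "sharp g x (\<lambda>v. g x [w, v])"
    have pos: "v \<noteq> 0 \<Longrightarrow> 0 < g x [v, v]" for v using gk_facts(1) x by (auto simp: riemannian_metric_def)
    have "g x [?s - w, ?s - w] = 0"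
      using linear_diff[OF l1, of ?s w] sharp_works[OF gk_facts(1) x l2] by simp
    then have "?s = w" using pos[of "?s - w"] by auto
    then have "poisson g I J x (\<lambda>v. g x [w, v]) = 0" by (simp add: poisson_def w)
    then have "(\<lambda>v. g x [w, v]) = (\<lambda>_. 0)"
      using gk x l2 linear_0 unfolding nondegenerate_gk_def by metis
    then have "g x [w, w] = 0" by metis
    then show "w = 0" using pos[of w] by auto
  qed
qed

lemma pair:
  assumes x: "x \<in> points M"
  shows "compatible_pair (\<lambda>u v. g x [u, v]) (I x) (J x) (X x)"
proof (rule compatible_pair.intro)
  show "linear (\<lambda>u. g x [u, v])" for v using smooth_tensor_on_linear[OF gk_facts(2) x, of "[0, v]" 0] by simp
  show "g x [u, v] = g x [v, u]" for u v using gk_facts(1) x by (simp add: riemannian_metric_def)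
  show "0 < g x [v, v]" if "v \<noteq> 0" for v using gk_facts(1) x that by (simp add: riemannian_metric_def)
  show "inj (\<lambda>v. (1 / 2) *\<^sub>R (I x (J x v) - J x (I x v)))"
    using half_commutator_inj[OF x] by (simp add: half_commutator_def[abs_def])
qed (use x gk_facts(3-6) generator_nonzero[OF x] in \<open>auto simp: almost_complex_structure_def compatible_acs_def\<close>)

definition "W x = inverse (g x [X x, X x])"
text \<open>Skewness gives \<open>2 g (I X, J X) = - g (X, (I J + J I) X)\<close>, so this is the
  number \<open>P\<close> of \<open>compatible_pair\<close>, in a form whose smoothness and
  invariance are immediate.\<close>

definition "p x = W x * g x [I x (X x), J x (X x)]"
definition \<eta> :: "('m, real^4, real) tensor" where "\<eta> x vs = W x * g x [X x, vs ! 0]"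

lemma inv_half_commutator: "inv (half_commutator I J x) = inv (\<lambda>v. (1 / 2) *\<^sub>R (I x (J x v) - J x (I x v)))"
  by (simp add: half_commutator_def[abs_def])

text \<open>Transfers \<open>compatible_pair\<close> to the tangent space at \<open>x\<close>: the
  explicit inverse of the half-commutator and the moment equations identify the differentials of the
  components of \<open>\<mu>\<close> with \<open>m1\<close>, \<open>m2\<close>,
  \<open>m3\<close>.\<close>

lemma
  assumes x: "x \<in> points M"
  shows bounds: "-1 < p x" "p x < 1" "0 < W x"
    and d\<mu>_I: "fun_d M (\<lambda>x. \<mu> x $ 1) x [I x v] = fun_d M (\<lambda>x. \<mu> x $ 2) x [v]"
      "fun_d M (\<lambda>x. \<mu> x $ 2) x [I x v] = - fun_d M (\<lambda>x. \<mu> x $ 1) x [v]"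
      "fun_d M (\<lambda>x. \<mu> x $ 3) x [I x v] = - p x * fun_d M (\<lambda>x. \<mu> x $ 1) x [v] + \<eta> x [v] / W x"
      "\<eta> x [I x v] = - W x * (fun_d M (\<lambda>x. \<mu> x $ 3) x [v] - p x * fun_d M (\<lambda>x. \<mu> x $ 2) x [v])"
    and d\<mu>_J: "fun_d M (\<lambda>x. \<mu> x $ 1) x [J x v] = fun_d M (\<lambda>x. \<mu> x $ 3) x [v]"
      "fun_d M (\<lambda>x. \<mu> x $ 3) x [J x v] = - fun_d M (\<lambda>x. \<mu> x $ 1) x [v]"
      "fun_d M (\<lambda>x. \<mu> x $ 2) x [J x v] = - p x * fun_d M (\<lambda>x. \<mu> x $ 1) x [v] - \<eta> x [v] / W x"
      "\<eta> x [J x v] = W x * (fun_d M (\<lambda>x. \<mu> x $ 2) x [v] - p x * fun_d M (\<lambda>x. \<mu> x $ 3) x [v])"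
    and d\<mu>_X: "fun_d M (\<lambda>x. \<mu> x $ i) x [X x] = 0" "\<eta> x [X x] = 1"
    and metric_eq: "g x [u, v] = constructed_metric M \<mu> p W \<eta> x [u, v]"
    and d\<mu>_inj: "fun_d M (\<lambda>x. \<mu> x $ 1) x [v] = 0 \<Longrightarrow> fun_d M (\<lambda>x. \<mu> x $ 2) x [v] = 0 \<Longrightarrow>
      fun_d M (\<lambda>x. \<mu> x $ 3) x [v] = 0 \<Longrightarrow> \<eta> x [v] = 0 \<Longrightarrow> v = 0"
    and d\<mu>_surj: "\<exists>v. fun_d M (\<lambda>x. \<mu> x $ 1) x [v] = a \<and> fun_d M (\<lambda>x. \<mu> x $ 2) x [v] = b \<and> fun_d M (\<lambda>x. \<mu> x $ 3) x [v] = c"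
proof -
  interpret C: compatible_pair "\<lambda>u v. g x [u, v]" "I x" "J x" "X x" by (rule pair[OF x])
  have W: "W x = C.W" by (simp add: W_def C.W_def divide_inverse)
  have p: "p x = C.P"
    using C.coframe_expand(2)[of "J x (X x)"] C.W_pos by (simp add: p_def W C.J_coframe C.coframe_X)
  have e: "\<eta> x [v] = C.e v" for v by (simp add: \<eta>_def C.e_def W)
  have K: "gk_Omega g I J x [u, v] = - g x [C.A u, v] / C.Q" for u v
    unfolding gk_Omega_def inv_half_commutator nth_Cons_0 C.inv_A C.G1 by simp
  have m: "fun_d M (\<lambda>x. \<mu> x $ 1) x [v] = C.m1 v" "fun_d M (\<lambda>x. \<mu> x $ 2) x [v] = C.m2 v" "fun_d M (\<lambda>x. \<mu> x $ 3) x [v] = C.m3 v" for v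
    using ham x by (auto simp: tri_hamiltonian_def K C.m1_def C.m2_def C.m3_def)
  note r = W p e m
  show "-1 < p x" "p x < 1" "0 < W x" by (simp_all add: r C.P_bounds C.W_pos)
  show "fun_d M (\<lambda>x. \<mu> x $ 1) x [I x v] = fun_d M (\<lambda>x. \<mu> x $ 2) x [v]"
      "fun_d M (\<lambda>x. \<mu> x $ 2) x [I x v] = - fun_d M (\<lambda>x. \<mu> x $ 1) x [v]"
      "fun_d M (\<lambda>x. \<mu> x $ 3) x [I x v] = - p x * fun_d M (\<lambda>x. \<mu> x $ 1) x [v] + \<eta> x [v] / W x"
      "\<eta> x [I x v] = - W x * (fun_d M (\<lambda>x. \<mu> x $ 3) x [v] - p x * fun_d M (\<lambda>x. \<mu> x $ 2) x [v])"
    unfolding r by (rule C.I_coframe)+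
  show "fun_d M (\<lambda>x. \<mu> x $ 1) x [J x v] = fun_d M (\<lambda>x. \<mu> x $ 3) x [v]"
      "fun_d M (\<lambda>x. \<mu> x $ 3) x [J x v] = - fun_d M (\<lambda>x. \<mu> x $ 1) x [v]"
      "fun_d M (\<lambda>x. \<mu> x $ 2) x [J x v] = - p x * fun_d M (\<lambda>x. \<mu> x $ 1) x [v] - \<eta> x [v] / W x"
      "\<eta> x [J x v] = W x * (fun_d M (\<lambda>x. \<mu> x $ 2) x [v] - p x * fun_d M (\<lambda>x. \<mu> x $ 3) x [v])"
    unfolding r by (rule C.J_coframe)+
  show "fun_d M (\<lambda>x. \<mu> x $ i) x [X x] = 0" using exhaust_3[of i] C.coframe_X by (auto simp: r)
  show "\<eta> x [X x] = 1" unfolding r by (rule C.coframe_X)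
  show "g x [u, v] = constructed_metric M \<mu> p W \<eta> x [u, v]"
    unfolding constructed_metric_def Let_def nth_Cons_0 using C.metric[of u v] by (simp add: r)
  show "fun_d M (\<lambda>x. \<mu> x $ 1) x [v] = 0 \<Longrightarrow> fun_d M (\<lambda>x. \<mu> x $ 2) x [v] = 0 \<Longrightarrow>
      fun_d M (\<lambda>x. \<mu> x $ 3) x [v] = 0 \<Longrightarrow> \<eta> x [v] = 0 \<Longrightarrow> v = 0"
    unfolding r by (rule C.coframe_inj)
  show "\<exists>v. fun_d M (\<lambda>x. \<mu> x $ 1) x [v] = a \<and> fun_d M (\<lambda>x. \<mu> x $ 2) x [v] = b \<and> fun_d M (\<lambda>x. \<mu> x $ 3) x [v] = c"
    unfolding r using C.coframe_surj[of a b c] by metis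
qed

lemma \<mu>_smooth: "smooth_map M euclid \<mu>"
  using ham by (simp add: tri_hamiltonian_def)

lemma circle_cis_obtain:
  assumes "z \<in> points circle" obtains t where "z = cis t"
  using assms complex_norm_eq_1_exp_eq by (metis cis_conv_exp points_circle mem_sphere_0)

text \<open>The differential of \<open>\<mu>\<close> kills the generator, so \<open>\<mu>\<close>
  has zero derivative along each orbit curve.\<close>

lemma \<mu>_invariant:
  assumes x: "x \<in> points M" and z: "z \<in> points circle"
  shows "\<mu> (\<rho> z x) = \<mu> x"
proof -
  obtain t where t: "z = cis t" using circle_cis_obtain[OF z] .
  have n: "smooth_near M euclid \<mu> y" if "y \<in> points M" for y by (rule smooth_map_near[OF M \<mu>_smooth that])
  have "((\<lambda>t. \<mu> (\<rho> (cis t) x)) has_derivative (\<lambda>_. 0)) (at t)" for t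
  proof -
    let ?y = "\<rho> (cis t) x"
    have y: "?y \<in> points M" using x by simp
    have nn: "smooth_near euclid euclid (\<lambda>t. \<mu> (\<rho> (cis t) x)) t"
      by (rule smooth_near_compose[OF premanifold_euclid M premanifold_euclid curve_near[OF x] n[OF y]])
    have "tan_map M euclid \<mu> ?y (X ?y) = 0"
      using d\<mu>_X(1)[OF y] fun_d_vec_nth[OF M n[OF y]] by (simp add: vec_eq_iff)
    then have "tan_map euclid euclid (\<lambda>t. \<mu> (\<rho> (cis t) x)) t 1 = 0"
      using tan_map_compose[OF premanifold_euclid M premanifold_euclid curve_near[OF x] n[OF y], of 1] curve_velocity[OF x, of t] by simp
    moreover have lin: "linear (tan_map euclid euclid (\<lambda>t. \<mu> (\<rho> (cis t) x)) t)"
      by (rule tan_map_linear[OF premanifold_euclid premanifold_euclid nn])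
    ultimately have "tan_map euclid euclid (\<lambda>t. \<mu> (\<rho> (cis t) x)) t = (\<lambda>_. 0)"
      using linear_scale[OF lin, of _ 1] by (auto simp: fun_eq_iff)
    then show ?thesis
      using tan_map_has_derivative[OF premanifold_euclid premanifold_euclid nn, of UNIV id UNIV id] by simp
  qed
  then have "\<exists>k. \<forall>s\<in>UNIV. \<mu> (\<rho> (cis s) x) = k"
    by (intro has_derivative_zero_constant) auto
  then obtain k where "\<And>s. \<mu> (\<rho> (cis s) x) = k" by blast
  from this[of t] this[of 0] show ?thesis using x t by simp
qed

lemma \<mu>_submersion:
  assumes x: "x \<in> points M"
  shows "surj (tan_map M euclid \<mu> x)"
proof (rule surj_def[THEN iffD2], rule allI)
  fix w :: "real^3"
  obtain v where "fun_d M (\<lambda>x. \<mu> x $ 1) x [v] = w $ 1 \<and> fun_d M (\<lambda>x. \<mu> x $ 2) x [v] = w $ 2 \<and> fun_d M (\<lambda>x. \<mu> x $ 3) x [v] = w $ 3"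
    using d\<mu>_surj[OF x] by blast
  then have "w = tan_map M euclid \<mu> x v"
    using fun_d_vec_nth[OF M smooth_map_near[OF M \<mu>_smooth x]] by (simp add: vec_eq_iff forall_3)
  then show "\<exists>v. w = tan_map M euclid \<mu> x v" by blast
qed

lemma W_smooth: "smooth_map M euclid W"
proof -
  have "smooth_map M euclid (\<lambda>x. g x [X x, X x])"
    using smooth_one_form_field[OF M smooth_contraction[OF M gk_facts(2) generator_smooth] generator_smooth] by simp
  then show ?thesis unfolding W_def[abs_def]
    by (rule smooth_map_inverse[OF M]) (use generator_nonzero gk_facts(1) in \<open>auto simp: riemannian_metric_def less_imp_neq[symmetric]\<close>)
qed

lemma p_smooth: "smooth_map M euclid p"
proof -
  note Y = smooth_field_endo[OF M gk_facts(3) generator_smooth] smooth_field_endo[OF M gk_facts(4) generator_smooth]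
  have "smooth_map M euclid (\<lambda>x. g x [I x (X x), J x (X x)])"
    using smooth_one_form_field[OF M smooth_contraction[OF M gk_facts(2) Y(1)] Y(2)] by simp
  then show ?thesis unfolding p_def[abs_def] by (rule smooth_map_mult[OF M W_smooth])
qed

lemma generator_equivariant:
  assumes x: "x \<in> points M" and z: "z \<in> points circle"
  shows "X (\<rho> z x) = tan_map M M (\<rho> z) x (X x)"
    and "I (\<rho> z x) (X (\<rho> z x)) = tan_map M M (\<rho> z) x (I x (X x))"
    and "J (\<rho> z x) (X (\<rho> z x)) = tan_map M M (\<rho> z) x (J x (X x))"
  using generator_translate[OF x z] I_inv J_inv x z by (simp_all add: preserves_endo_def)

lemma g_equivariant:
  assumes x: "x \<in> points M" and z: "z \<in> points circle"
  shows "g (\<rho> z x) [tan_map M M (\<rho> z) x u, tan_map M M (\<rho> z) x v] = g x [u, v]"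
proof -
  have "pullback M M (\<rho> z) g x [u, v] = g x [u, v]"
    using g_inv x z by (simp add: preserves_tensor_def tensor_eq_on_def)
  then show ?thesis by (simp add: pullback_def)
qed

lemma invariant:
  assumes x: "x \<in> points M" and z: "z \<in> points circle"
  shows "W (\<rho> z x) = W x" "p (\<rho> z x) = p x" "\<eta> (\<rho> z x) [tan_map M M (\<rho> z) x v] = \<eta> x [v]"
proof -
  show W: "W (\<rho> z x) = W x" unfolding W_def generator_equivariant(1)[OF x z] g_equivariant[OF x z] ..
  show "p (\<rho> z x) = p x" unfolding p_def generator_equivariant(2,3)[OF x z] g_equivariant[OF x z] W ..
  show "\<eta> (\<rho> z x) [tan_map M M (\<rho> z) x v] = \<eta> x [v]"
    unfolding \<eta>_def nth_Cons_0 generator_equivariant(1)[OF x z] g_equivariant[OF x z] W ..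
qed

sublocale circle_connection M \<rho> \<mu> \<eta>
proof unfold_locales
  show "connection_form M \<rho> \<eta>" unfolding connection_form_def smooth_form_on_one preserves_tensor_def tensor_eq_on_def
  proof (intro conjI ballI allI impI)
    show "smooth_tensor_on M (points M) 1 \<eta>" unfolding \<eta>_def[abs_def]
      by (rule smooth_tensor_on_mult[OF M openin_points _ smooth_contraction[OF M gk_facts(2) generator_smooth]])
        (simp add: open_sub_points[OF M] W_smooth)
    fix z x vs assume z: "z \<in> points circle" and x: "x \<in> points M" and l: "length (vs :: (real^4) list) = 1"
    obtain v where vs: "vs = [v]" using length_one[OF l] by blast
    show "pullback M M (\<rho> z) \<eta> x vs = \<eta> x vs" using invariant(3)[OF x z] by (simp add: pullback_def vs)
  qed (rule d\<mu>_X)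
qed (use \<mu>_smooth \<mu>_invariant \<mu>_submersion in auto)

end

section \<open>Partial derivatives on the base, computed along sections\<close>

context circle_submersion
begin

text \<open>Only the values of \<open>f\<close> along the section are prescribed, and smoothness on
  the tube comes from \<open>h\<close>. In this form the lemma can be iterated for second
  derivatives.\<close>

lemma quot_partial:
  assumes s: "is_section V s" and h: "smooth_on V h" and f: "\<And>v. v \<in> V \<Longrightarrow> f (orb (s v)) = h v" and v: "v \<in> V"
  shows "mu_partial quot qmu i f (orb (s v)) = partial i h v"
proof -
  have oV: "open V" by (rule section_facts(1)[OF s])
  note to = tube_open[OF s]
  have QT: "premanifold (open_sub quot (tube V s))" by (rule premanifold_tube[OF s])
  have EV: "premanifold (open_sub euclid V)" by (rule premanifold_open_sub) (use oV in auto)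
  have q: "smooth_map (open_sub quot (tube V s)) euclid qmu"
    by (rule smooth_map_restrict[OF premanifold_quot premanifold_euclid qmu_smooth to])
  have "smooth_map (open_sub quot (tube V s)) (open_sub euclid V) qmu"
    by (rule smooth_map_into_open_sub[OF QT premanifold_euclid q]) (use tubeD[OF s] in \<open>auto simp: points_open_sub\<close>)
  then have "smooth_map (open_sub quot (tube V s)) euclid (\<lambda>b. h (qmu b))"
    by (rule smooth_map_compose[OF QT EV premanifold_euclid]) (use smooth_map_euclid[OF oV] h in blast)
  then have "smooth_map (open_sub quot (tube V s)) euclid f"
  proof (rule smooth_map_cong[OF QT premanifold_euclid])
    fix b assume "b \<in> points (open_sub quot (tube V s))"
    then have "b \<in> tube V s" by (simp add: points_open_sub)
    then show "h (qmu b) = f b" using tubeD[OF s, of b] f by metis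
  qed
  then have "smooth_near quot euclid f (orb (s v))"
    by (rule smooth_nearI[OF to, rotated]) (use v in \<open>auto simp: tube_def\<close>)
  from mu_partial_quot[OF s v this] show ?thesis
    using frechet_derivative_cong_open[OF oV v, of "\<lambda>v. f (orb (s v))" h] f by simp
qed

end

lemma curl_form_X:
  assumes "\<And>i. fun_d K (\<lambda>x. m x $ i) x [X] = 0"
  shows "curl_form K m a x [X, v] = 0"
  by (simp add: curl_form_def wedge_def assms)

lemma partial_rules:
  assumes "open V" "v \<in> V" "smooth_on V f" "smooth_on V h"
  shows "partial i (\<lambda>v. f v + h v) v = partial i f v + partial i h v"
    "partial i (\<lambda>v. f v - h v) v = partial i f v - partial i h v"
    "partial i (\<lambda>v. - f v) v = - partial i f v"
proof -
  note d = smooth_on_has_derivative[OF assms(3,2)] smooth_on_has_derivative[OF assms(4,2)]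
  show "partial i (\<lambda>v. f v + h v) v = partial i f v + partial i h v"
    by (simp add: frechet_derivative_at[OF has_derivative_add[OF d], symmetric])
  show "partial i (\<lambda>v. f v - h v) v = partial i f v - partial i h v"
    by (simp add: frechet_derivative_at[OF has_derivative_diff[OF d], symmetric])
  show "partial i (\<lambda>v. - f v) v = - partial i f v"
    by (simp add: frechet_derivative_at[OF has_derivative_minus[OF d(1)], symmetric])
qed

section \<open>The curvature extracted from integrability\<close>

context hamiltonian_gk
begin

text \<open>\<open>xi 3 2\<close> is the form \<open>\<xi>\<close> of \<open>gk_coframe\<close>
  belonging to \<open>I\<close>, and \<open>xi 2 3\<close> is its counterpart for
  \<open>J\<close>.\<close>

definition xi :: "3 \<Rightarrow> 3 \<Rightarrow> ('m, real^4, real) tensor" where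
  "xi j k x vs = W x * fun_d M (\<lambda>x. \<mu> x $ j) x vs + - (p x * W x) * fun_d M (\<lambda>x. \<mu> x $ k) x vs"

lemma xi_smooth: "smooth_tensor_on M (points M) 1 (xi j k)"
proof -
  have d: "smooth_tensor_on M (points M) 1 (fun_d M (\<lambda>x. \<mu> x $ i))" for i
    by (rule smooth_fun_d[OF M openin_points]) (simp add: open_sub_points[OF M] smooth_map_vec_nth[OF M \<mu>])
  have "smooth_map M euclid (\<lambda>x. - (p x * W x))"
    by (intro smooth_fun_intros M p_smooth W_smooth)
  then show ?thesis unfolding xi_def[abs_def]
    by (intro smooth_tensor_on_add[OF M openin_points] smooth_tensor_on_mult[OF M openin_points _ d])
      (simp_all add: open_sub_points[OF M] W_smooth)
qed

text \<open>\<open>\<eta> + \<i> xi 3 2\<close> is of type (1,0) for \<open>I\<close> and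
  \<open>xi 2 3 + \<i> \<eta>\<close> for \<open>J\<close>, so the vanishing Nijenhuis tensors give
  relations between exterior derivatives. Starting the second pair with \<open>xi 2 3\<close>
  accounts for the opposite sign in \<open>J\<close>.\<close>

lemma nijenhuis_equations:
  assumes x: "x \<in> points M"
  shows "ext_d M \<eta> x [u, v] - ext_d M \<eta> x [I x u, I x v] - ext_d M (xi 3 2) x [I x u, v] - ext_d M (xi 3 2) x [u, I x v] = 0"
    and "ext_d M (xi 2 3) x [u, v] - ext_d M (xi 2 3) x [J x u, J x v] - ext_d M \<eta> x [J x u, v] - ext_d M \<eta> x [u, J x v] = 0"
proof -
  have N: "nijenhuis M I x u v = 0" "nijenhuis M J x u v = 0"
    using gk x by (auto simp: nondegenerate_gk_def generalized_kaehler_def integrable_acs_def)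
  have W0: "W z \<noteq> 0" if "z \<in> points M" for z using bounds(3)[OF that] by simp
  have "\<eta> x [nijenhuis M I x u v] =
    ext_d M \<eta> x [u, v] - ext_d M \<eta> x [I x u, I x v] - ext_d M (xi 3 2) x [I x u, v] - ext_d M (xi 3 2) x [u, I x v]"
    by (rule nijenhuis_one_form[OF M gk_facts(3) x \<eta>_smooth xi_smooth])
      (use W0 in \<open>simp_all add: d\<mu>_I xi_def algebra_simps\<close>)
  then show "ext_d M \<eta> x [u, v] - ext_d M \<eta> x [I x u, I x v] - ext_d M (xi 3 2) x [I x u, v] - ext_d M (xi 3 2) x [u, I x v] = 0"
    using N linear_0[OF one_form_linear[OF \<eta>_smooth x]] by simp
  have "xi 2 3 x [nijenhuis M J x u v] =
    ext_d M (xi 2 3) x [u, v] - ext_d M (xi 2 3) x [J x u, J x v] - ext_d M \<eta> x [J x u, v] - ext_d M \<eta> x [u, J x v]"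
    by (rule nijenhuis_one_form[OF M gk_facts(4) x xi_smooth \<eta>_smooth])
      (use W0 in \<open>simp_all add: d\<mu>_J xi_def algebra_simps\<close>)
  then show "ext_d M (xi 2 3) x [u, v] - ext_d M (xi 2 3) x [J x u, J x v] - ext_d M \<eta> x [J x u, v] - ext_d M \<eta> x [u, J x v] = 0"
    using N linear_0[OF one_form_linear[OF xi_smooth x]] by simp
qed

context
  fixes V s assumes sec: "is_section V s"
begin

abbreviation "Wv \<equiv> \<lambda>v. W (s v)"
abbreviation "pWv \<equiv> \<lambda>v. p (s v) * W (s v)"

lemma section_function_smooth: "smooth_on V Wv" "smooth_on V pWv"
proof -
  have oV: "open V" by (rule section_facts(1)[OF sec])
  have EV: "premanifold (open_sub euclid V)" by (rule premanifold_open_sub) (use oV in auto)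
  have s: "smooth_on V (\<lambda>v. f (s v))" if "smooth_map M euclid f" for f :: "'m \<Rightarrow> real"
    using smooth_map_compose[OF EV M premanifold_euclid section_facts(3)[OF sec] that] smooth_map_euclid[OF oV] by blast
  show "smooth_on V Wv" "smooth_on V pWv"
    using s[OF W_smooth] s[OF smooth_map_mult[OF M p_smooth W_smooth]] by auto
qed

lemma total_invariant:
  assumes m: "m \<in> total V s"
  shows "W m = Wv (\<mu> m)" "p m = p (s (\<mu> m))"
proof -
  obtain t where t: "\<mu> m \<in> V" "m = flow s (t, \<mu> m)" using totalE[OF sec m] by metis
  then have "m = \<rho> (cis t) (s (\<mu> m))" by (simp add: flow_def)
  then show "W m = Wv (\<mu> m)" "p m = p (s (\<mu> m))"
    using invariant(1,2)[OF section_points[OF sec t(1)], of "cis t"] by auto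
qed

text \<open>The coefficients of \<open>xi j k\<close> along the section, as functions on \<real>^3.
  Since \<open>p\<close> and \<open>W\<close> are invariant, pulling them back by
  \<open>\<mu>\<close> gives \<open>xi j k\<close> on all of \<open>total V s\<close>.\<close>

definition xi_coeff :: "3 \<Rightarrow> 3 \<Rightarrow> 3 \<Rightarrow> real^3 \<Rightarrow> real" where
  "xi_coeff j k i = (if i = j then Wv else if i = k then (\<lambda>v. - pWv v) else (\<lambda>_. 0))"

lemma dxi_total:
  assumes jk: "j = 3 \<and> k = 2 \<or> j = 2 \<and> k = 3" and m: "m \<in> total V s"
  shows "ext_d M (xi j k) m [u, w] = curl_form M \<mu> (xi_coeff j k) m [u, w]"
proof -
  note to = total_open[OF sec]
  have oV: "open V" by (rule section_facts(1)[OF sec])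
  have "\<mu> ` total V s \<subseteq> V" using totalE[OF sec] by blast
  note pf = pulled_form(2)[OF M to smooth_map_restrict[OF M premanifold_euclid \<mu> to] oV this]
  have s: "smooth_on V (xi_coeff j k i)" for i
    unfolding xi_coeff_def using section_function_smooth by (auto intro: smooth_on_const smooth_on_uminus oV)
  have "ext_d M (xi j k) m [u, w] = ext_d M (pulled_form M \<mu> (xi_coeff j k)) m [u, w]"
    by (rule ext_d_cong[OF M to m, where k = 1])
      (use jk in \<open>auto simp: xi_def pulled_form_def xi_coeff_def total_invariant\<close>)
  then show ?thesis using pf[OF s m] by simp
qed

text \<open>Inserting \<open>X\<close> into the integrability equations leaves linear equations for the components of \<open>d\<eta>\<close>.\<close>

lemma curl_relations:
  assumes v: "v \<in> V"
  shows "partial 2 (potential s 3) v - partial 3 (potential s 2) v = partial 1 Wv v"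
    and "partial 1 (potential s 3) v - partial 3 (potential s 1) v = - (partial 2 Wv v + partial 3 pWv v)"
    and "partial 1 (potential s 2) v - partial 2 (potential s 1) v = partial 3 Wv v + partial 2 pWv v"
proof -
  let ?x = "s v"
  have x: "?x \<in> points M" by (rule section_points[OF sec v])
  have m: "?x \<in> total V s" unfolding total_iff[OF sec] using x v by (auto simp: tube_def)
  have \<mu>x: "\<mu> ?x = v" by (rule section_facts(4)[OF sec v])
  have oV: "open V" by (rule section_facts(1)[OF sec])
  note W0 = bounds(3)[OF x]
  have pm: "partial i (\<lambda>v. - pWv v) v = - partial i pWv v" for i
    by (rule partial_rules(3)[OF oV v section_function_smooth(2) section_function_smooth(2)])
  note d = d\<eta>_total[OF sec m] dxi_total[OF _ m]
  have c: "curl_form M \<mu> a ?x [X ?x, w] = 0" for a w by (rule curl_form_X[OF d\<mu>_X(1)[OF x]])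
  \<comment> \<open>Of the four terms of the integrability equation, the two with \<open>X\<close>
    itself in a slot vanish by \<open>c\<close>.\<close>
  have eI: "curl_form M \<mu> (potential s) ?x [I ?x (X ?x), I ?x w] = - curl_form M \<mu> (xi_coeff 3 2) ?x [I ?x (X ?x), w]" for w
    using nijenhuis_equations(1)[OF x, of "X ?x" w] by (simp add: d c)
  have eJ: "curl_form M \<mu> (potential s) ?x [J ?x (X ?x), w] = - curl_form M \<mu> (xi_coeff 2 3) ?x [J ?x (X ?x), J ?x w]" for w
    using nijenhuis_equations(2)[OF x, of "X ?x" w] by (simp add: d c)
  \<comment> \<open>Among the three differentials, \<open>I X\<close> is seen only by the third and
    \<open>J X\<close> only by the second. With these test vectors each equation therefore isolates
    one curvature coefficient.\<close>
  obtain w1 where w1: "fun_d M (\<lambda>x. \<mu> x $ 1) ?x [w1] = 1" "fun_d M (\<lambda>x. \<mu> x $ 2) ?x [w1] = 0" "fun_d M (\<lambda>x. \<mu> x $ 3) ?x [w1] = 0"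
    using d\<mu>_surj[OF x, of 1 0 0] by blast
  obtain w2 where w2: "fun_d M (\<lambda>x. \<mu> x $ 1) ?x [w2] = 0" "fun_d M (\<lambda>x. \<mu> x $ 2) ?x [w2] = 1" "fun_d M (\<lambda>x. \<mu> x $ 3) ?x [w2] = 0"
    using d\<mu>_surj[OF x, of 0 1 0] by blast
  note r = curl_form_def wedge_def d\<mu>_X[OF x] d\<mu>_I[OF x] d\<mu>_J[OF x] \<mu>x xi_coeff_def pm frechet_derivative_const
  show "partial 2 (potential s 3) v - partial 3 (potential s 2) v = partial 1 Wv v"
    using eI[of w1] W0 by (simp add: r w1)
  have q: "b = c" if "y = b / w" "z = - (c / w)" "y = - z" "0 < w" for y z b c w :: real
    using that by (metis add.inverse_inverse divide_cancel_right less_irrefl)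
  have "curl_form M \<mu> (potential s) ?x [I ?x (X ?x), I ?x w2] =
      - (partial 1 (potential s 3) v - partial 3 (potential s 1) v) / Wv v" by (simp add: r w2 diff_divide_distrib)
  moreover have "curl_form M \<mu> (xi_coeff 3 2) ?x [I ?x (X ?x), w2] = - ((partial 2 Wv v + partial 3 pWv v) / Wv v)"
    by (simp add: r w2)
  ultimately have "- (partial 1 (potential s 3) v - partial 3 (potential s 1) v) = partial 2 Wv v + partial 3 pWv v"
    by (rule q[OF _ _ eI W0])
  then show "partial 1 (potential s 3) v - partial 3 (potential s 1) v = - (partial 2 Wv v + partial 3 pWv v)"
    by (rule minus_equation_iff[THEN iffD1, symmetric])
  have "curl_form M \<mu> (potential s) ?x [J ?x (X ?x), w1] =
      (partial 1 (potential s 2) v - partial 2 (potential s 1) v) / Wv v" by (simp add: r w1)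
  moreover have "curl_form M \<mu> (xi_coeff 2 3) ?x [J ?x (X ?x), J ?x w1] = - ((partial 3 Wv v + partial 2 pWv v) / Wv v)"
    by (simp add: r w1 add_divide_distrib diff_divide_distrib)
  ultimately show "partial 1 (potential s 2) v - partial 2 (potential s 1) v = partial 3 Wv v + partial 2 pWv v"
    by (rule q[OF _ _ eJ W0])
qed

end

section \<open>Descent to the base and identification with the construction\<close>

definition "pq = descend p"
definition "Wq = descend W"

lemma quot_functions:
  assumes x: "x \<in> points M"
  shows "pq (orb x) = p x" "Wq (orb x) = W x"
  unfolding pq_def Wq_def using descend_orb[OF x] invariant(1,2)[OF x] by auto

lemma quot_partials:
  assumes s: "is_section V s" and v: "v \<in> V"
  shows "mu_partial quot qmu i Wq (orb (s v)) = partial i (Wv s) v"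
    "mu_partial quot qmu i (\<lambda>b. pq b * Wq b) (orb (s v)) = partial i (pWv s) v"
    "mu_partial quot qmu j (mu_partial quot qmu i Wq) (orb (s v)) = partial j (partial i (Wv s)) v"
    "mu_partial quot qmu j (mu_partial quot qmu i (\<lambda>b. pq b * Wq b)) (orb (s v)) = partial j (partial i (pWv s)) v"
proof -
  note sm = section_function_smooth[OF s] and q = quot_functions[OF section_points[OF s]]
  have 1: "mu_partial quot qmu i Wq (orb (s v)) = partial i (Wv s) v" if "v \<in> V" for v i
    by (rule quot_partial[OF s sm(1) _ that]) (simp add: q)
  have 2: "mu_partial quot qmu i (\<lambda>b. pq b * Wq b) (orb (s v)) = partial i (pWv s) v" if "v \<in> V" for v i
    by (rule quot_partial[OF s sm(2) _ that]) (simp add: q)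
  show "mu_partial quot qmu i Wq (orb (s v)) = partial i (Wv s) v"
    "mu_partial quot qmu i (\<lambda>b. pq b * Wq b) (orb (s v)) = partial i (pWv s) v"
    using 1[OF v] 2[OF v] by auto
  show "mu_partial quot qmu j (mu_partial quot qmu i Wq) (orb (s v)) = partial j (partial i (Wv s)) v"
    by (rule quot_partial[OF s smooth_on_derivative[OF sm(1)] 1 v])
  show "mu_partial quot qmu j (mu_partial quot qmu i (\<lambda>b. pq b * Wq b)) (orb (s v)) = partial j (partial i (pWv s)) v"
    by (rule quot_partial[OF s smooth_on_derivative[OF sm(2)] 2 v])
qed

lemma curvature_tube:
  assumes s: "is_section V s" and v: "v \<in> V"
  shows "curl_form quot qmu (potential s) (orb (s v)) vs = curvature_beta quot qmu pq Wq (orb (s v)) vs"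
  unfolding curvature_beta_def Let_def quot_partials[OF s v] curl_form_def qmu_section[OF s v] curl_relations[OF s v]
  by (simp add: algebra_simps)

text \<open>The divergence of a curl vanishes: each curl relation is differentiated in the missing
  coordinate and the mixed derivatives of the potential cancel. The factor 2 collects the two mixed
  derivatives of \<open>pq * Wq\<close>.\<close>

lemma quot_equation:
  assumes b: "b \<in> points quot"
  shows "let D = mu_partial quot qmu in
    D 1 (D 1 Wq) b + D 2 (D 2 Wq) b + D 3 (D 3 Wq) b + 2 * D 3 (D 2 (\<lambda>y. pq y * Wq y)) b = 0"
proof -
  obtain V s where s: "is_section V s" "b \<in> tube V s" using tube_exists[OF b] .
  then obtain v where v: "v \<in> V" "b = orb (s v)" by (auto simp: tube_def)
  have oV: "open V" by (rule section_facts(1)[OF s(1)])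
  note sm = section_function_smooth[OF s(1)]
  note sd = smooth_on_derivative[OF sm(1)] smooth_on_derivative[OF sm(2)] smooth_on_derivative[OF potential_smooth[OF s(1)]]
  have cg: "partial i f v = partial i h v" if "\<And>v. v \<in> V \<Longrightarrow> f v = h v" for i f h
    by (rule fun_cong[OF frechet_derivative_cong_open[OF oV v(1) that]])
  let ?a = "potential s"
  note rel = curl_relations[OF s(1)]
  note pr = partial_rules[OF oV v(1)]
  have d: "partial k (\<lambda>v. partial i (?a j) v - partial j (?a i) v) v = partial k (partial i (?a j)) v - partial k (partial j (?a i)) v" for i j k
    by (rule pr(2)[OF sd(3) sd(3)])
  have e: "partial k (\<lambda>v. partial i (Wv s) v + partial j (pWv s) v) v = partial k (partial i (Wv s)) v + partial k (partial j (pWv s)) v" for i j k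
    by (rule pr(1)[OF sd(1) sd(2)])
  have 1: "partial 1 (\<lambda>v. partial 2 (?a 3) v - partial 3 (?a 2) v) v = partial 1 (partial 1 (Wv s)) v"
    by (rule cg) (rule rel(1))
  have "partial 2 (\<lambda>v. partial 1 (?a 3) v - partial 3 (?a 1) v) v = partial 2 (\<lambda>v. - (partial 2 (Wv s) v + partial 3 (pWv s) v)) v"
    by (rule cg) (rule rel(2))
  also have "\<dots> = - partial 2 (\<lambda>v. partial 2 (Wv s) v + partial 3 (pWv s) v) v"
    by (rule pr(3)[OF smooth_on_add[OF oV sd(1,2)] sd(1)])
  finally have 2: "partial 2 (\<lambda>v. partial 1 (?a 3) v - partial 3 (?a 1) v) v = - partial 2 (\<lambda>v. partial 2 (Wv s) v + partial 3 (pWv s) v) v" .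
  have 3: "partial 3 (\<lambda>v. partial 1 (?a 2) v - partial 2 (?a 1) v) v = partial 3 (\<lambda>v. partial 3 (Wv s) v + partial 2 (pWv s) v) v"
    by (rule cg) (rule rel(3))
  have sym: "partial i (partial j f) v = partial j (partial i f) v" if "smooth_on V f" for i j f
    by (rule second_derivative_symmetric[OF oV that v(1)])
  note pa = potential_smooth[OF s(1)]
  show ?thesis unfolding Let_def v(2) quot_partials[OF s(1) v(1)]
    using 1[unfolded d] 2[unfolded d e] 3[unfolded d e] sym[where f = "pWv s" and i = 2 and j = 3, OF sm(2)] sym[where f = "?a 3" and i = 1 and j = 2, OF pa]
      sym[where f = "?a 2" and i = 1 and j = 3, OF pa] sym[where f = "?a 1" and i = 2 and j = 3, OF pa] by linarith
qed

lemma construction: "construction_data quot qmu pq Wq M \<rho> orb \<eta>"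
  unfolding construction_data_def
proof (intro conjI ballI smooth_quot qmu_local_diffeo quot_equation principal_bundle conn)
  show "open_map (mtop quot) euclidean qmu" unfolding open_map_def using qmu_open by simp
  show "smooth_map quot euclid pq" "smooth_map quot euclid Wq"
    unfolding pq_def Wq_def by (auto intro!: descend_smooth p_smooth W_smooth simp: invariant)
  fix b assume "b \<in> points quot"
  then obtain x where x: "x \<in> points M" "b = orb x" by (auto simp: points_quot)
  show "-1 < pq b" "pq b < 1" "0 < Wq b" using bounds[OF x(1)] by (simp_all add: x(2) quot_functions[OF x(1)])
next
  show "represents_2pi_int_class quot (curvature_beta quot qmu pq Wq)"
    by (rule curvature_class) (auto simp: tensor_eq_on_def tube_def curvature_tube)
  show "tensor_eq_on (points M) 2 (ext_d M \<eta>) (pullback M quot orb (curvature_beta quot qmu pq Wq))"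
    unfolding tensor_eq_on_def
  proof (intro ballI allI impI)
    fix x and vs :: "(real^4) list" assume x: "x \<in> points M" and "length vs = 2"
    then obtain u w where vs: "vs = [u, w]" using length_two_cases by blast
    have "orb x \<in> points quot" using x by (simp add: points_quot)
    then obtain V s where s: "is_section V s" "orb x \<in> tube V s" by (rule tube_exists)
    then have m: "x \<in> total V s" using x total_iff by blast
    obtain v where v: "v \<in> V" "orb x = orb (s v)" using s(2) by (auto simp: tube_def)
    have qn: "smooth_near quot euclid (\<lambda>b. qmu b $ i) (orb x)" for i
      by (rule smooth_map_near[OF premanifold_quot smooth_map_vec_nth[OF premanifold_quot qmu_smooth]]) (simp add: points_quot x)
    have f: "fun_d quot (\<lambda>b. qmu b $ i) (orb x) [tan_map M quot orb x u] = fun_d M (\<lambda>x. \<mu> x $ i) x [u]" for i u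
    proof -
      have "fun_d quot (\<lambda>b. qmu b $ i) (orb x) [tan_map M quot orb x u] = fun_d M (\<lambda>x. qmu (orb x) $ i) x [u]"
        by (rule tan_map_fun_d[OF M premanifold_quot smooth_map_near[OF M orb_smooth x] qn])
      also have "\<dots> = fun_d M (\<lambda>x. \<mu> x $ i) x [u]"
        unfolding fun_d_tan_map by (rule fun_cong[OF tan_map_cong[OF M openin_points x]]) simp
      finally show ?thesis .
    qed
    have "ext_d M \<eta> x vs = curl_form M \<mu> (potential s) x [u, w]" unfolding vs by (rule d\<eta>_total[OF s(1) m])
    also have "\<dots> = curl_form quot qmu (potential s) (orb x) [tan_map M quot orb x u, tan_map M quot orb x w]"
      by (simp add: curl_form_def wedge_def f x)
    also have "\<dots> = pullback M quot orb (curvature_beta quot qmu pq Wq) x vs"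
      unfolding v(2) curvature_tube[OF s(1) v(1)] by (simp add: pullback_def vs v(2))
    finally show "ext_d M \<eta> x vs = pullback M quot orb (curvature_beta quot qmu pq Wq) x vs" .
  qed
qed

text \<open>By \<open>d\<mu>_I\<close> and \<open>d\<mu>_J\<close> the given \<open>I\<close> and
  \<open>J\<close> are adapted to the coframe of the data just obtained and to its exchange, so the
  uniqueness proved for the construction identifies them.\<close>

lemma constructed: "constructed_structure qmu pq Wq M orb \<eta> g I J"
proof -
  note cf = construction_coframe[OF construction]
  note cf' = gk_coframe_swap[OF cf]
  interpret A: gk_coframe M "\<lambda>x. (qmu \<circ> orb) x $ 1" "\<lambda>x. (qmu \<circ> orb) x $ 2" "\<lambda>x. (qmu \<circ> orb) x $ 3" "pq \<circ> orb" "Wq \<circ> orb"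
    "mu_partial quot qmu 1 pq \<circ> orb" "mu_partial quot qmu 2 pq \<circ> orb" "mu_partial quot qmu 3 pq \<circ> orb"
    "mu_partial quot qmu 1 Wq \<circ> orb" "mu_partial quot qmu 2 Wq \<circ> orb" "mu_partial quot qmu 3 Wq \<circ> orb" \<eta>
    by (rule cf)
  interpret B: gk_coframe M "\<lambda>x. (qmu \<circ> orb) x $ 1" "\<lambda>x. (qmu \<circ> orb) x $ 3" "\<lambda>x. (qmu \<circ> orb) x $ 2" "pq \<circ> orb" "Wq \<circ> orb"
    "mu_partial quot qmu 1 pq \<circ> orb" "mu_partial quot qmu 3 pq \<circ> orb" "mu_partial quot qmu 2 pq \<circ> orb"
    "mu_partial quot qmu 1 Wq \<circ> orb" "mu_partial quot qmu 3 Wq \<circ> orb" "mu_partial quot qmu 2 Wq \<circ> orb" "\<lambda>x vs. - \<eta> x vs"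
    by (rule cf')
  have f: "fun_d M (\<lambda>x. (qmu \<circ> orb) x $ i) x [v] = fun_d M (\<lambda>x. \<mu> x $ i) x [v]" if "x \<in> points M" for i x v
    unfolding fun_d_tan_map by (rule fun_cong[OF tan_map_cong[OF M openin_points that]]) simp
  have I: "A.adapted I" unfolding A.adapted_def by (auto simp: f[unfolded comp_apply] quot_functions d\<mu>_I)
  have J: "B.adapted J" unfolding B.adapted_def by (auto simp: f[unfolded comp_apply] quot_functions d\<mu>_J algebra_simps)
  have "tensor_eq_on (points M) 2 g (constructed_metric M (qmu \<circ> orb) (pq \<circ> orb) (Wq \<circ> orb) \<eta>)"
    unfolding tensor_eq_on_def
  proof (intro ballI allI impI)
    fix x and vs :: "(real^4) list" assume x: "x \<in> points M" and "length vs = 2"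
    then obtain u w where vs: "vs = [u, w]" using length_two_cases by blast
    show "g x vs = constructed_metric M (qmu \<circ> orb) (pq \<circ> orb) (Wq \<circ> orb) \<eta> x vs"
      unfolding vs metric_eq[OF x] constructed_metric_def Let_def
      unfolding f[OF x] unfolding comp_apply quot_functions[OF x] ..
  qed
  then show ?thesis
    unfolding constructed_structure_def constructed_Omega_I_eq[OF cf] constructed_Omega_J_eq[OF cf']
    using A.adapted_determined[OF gk_facts(3) I, of 1] B.adapted_determined[OF gk_facts(4) J, of "-1"] by simp
qed

end

text \<open>Points of the base in the converse are orbits, that is subsets of \<open>M\<close>,
  which explains its type \<open>'k set\<close>.\<close>

theorem theorem1p1:
  shows
    "(\<forall>(N :: ('n, real^3) manifold) \<iota> p W (M :: ('m, real^4) manifold) \<rho> \<pi> \<eta>.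
        construction_data N \<iota> p W M \<rho> \<pi> \<eta> \<longrightarrow>
        (\<exists>g I J. nondegenerate_gk M g I J \<and> constructed_structure \<iota> p W M \<pi> \<eta> g I J))
     \<and>
     (\<forall>(M :: ('k, real^4) manifold) g I J \<rho> \<mu>.
        nondegenerate_gk M g I J \<and>
        circle_action M \<rho> \<and> free_action M \<rho> \<and>
        preserves_tensor M \<rho> 2 g \<and> preserves_endo M \<rho> I \<and> preserves_endo M \<rho> J \<and>
        tri_hamiltonian M g I J \<rho> \<mu> \<longrightarrow>
        (\<exists>(N :: ('k set, real^3) manifold) \<iota> p W \<pi> \<eta>.
           construction_data N \<iota> p W M \<rho> \<pi> \<eta> \<and>
           (\<forall>x\<in>points M. \<iota> (\<pi> x) = \<mu> x) \<and>
           constructed_structure \<iota> p W M \<pi> \<eta> g I J))"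
proof (intro conjI allI impI)
  fix N :: "('n, real^3) manifold" and \<iota> p W and M :: "('m, real^4) manifold" and \<rho> \<pi> \<eta>
  assume "construction_data N \<iota> p W M \<rho> \<pi> \<eta>"
  then show "\<exists>g I J. nondegenerate_gk M g I J \<and> constructed_structure \<iota> p W M \<pi> \<eta> g I J"
    by (rule construction_forward)
next
  fix M :: "('k, real^4) manifold" and g I J \<rho> \<mu>
  assume "nondegenerate_gk M g I J \<and> circle_action M \<rho> \<and> free_action M \<rho> \<and>
    preserves_tensor M \<rho> 2 g \<and> preserves_endo M \<rho> I \<and> preserves_endo M \<rho> J \<and> tri_hamiltonian M g I J \<rho> \<mu>"
  then interpret H: hamiltonian_gk M \<rho> g I J \<mu>
    by unfold_locales (auto simp: nondegenerate_gk_def generalized_kaehler_def)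
  show "\<exists>(N :: ('k set, real^3) manifold) \<iota> p W \<pi> \<eta>. construction_data N \<iota> p W M \<rho> \<pi> \<eta> \<and>
      (\<forall>x\<in>points M. \<iota> (\<pi> x) = \<mu> x) \<and> constructed_structure \<iota> p W M \<pi> \<eta> g I J"
    using H.construction H.constructed H.qmu_orb by blast
qed

end
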